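(* Let $n\ge4$, $N=\frac{n(n-1)}{2}$, and let $g\ge2$ be an integer such that $K:=\mathbb{Q}(\zeta_{2N})\subsetneq L:=\mathbb{Q}(\zeta_{2N},g^{1/N})$. Set $$\delta_g:=\frac{1}{[K:\mathbb{Q}]}-\frac{1}{[L:\mathbb{Q}]}>0.$$ For $X\ge2$ let $\mathcal{A}_g(X)$ be the set of integers $m$ with $|m|\le X$ such that $m$ is square-free, $X^n-m$ (as a polynomial in an indeterminate) is irreducible over $\mathbb{Q}$, $g(m)=g$, and $K_m$ is fixed-sign locally solvable for monogenicity. Then $$\#\mathcal{A}_g(X)\ll_{n,g}\frac{X}{(\log X)^{\delta_g}}\qquad(X\to\infty).$$ Moreover, $$\delta_g=\frac{[L:K]-1}{[L:K]\,[K:\mathbb{Q}]}\ \ge\ \frac{1}{2\varphi(2N)},$$ so the uniform exponent $\frac{1}{2\varphi(2N)}$ works (in place of $\delta_g$) for all such $g$.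
   Context: $\zeta_{2N}$ is a primitive $2N$-th root of unity, $\varphi$ is Euler's function. For square-free $m$ with the polynomial $T^n-m$ irreducible over $\mathbb{Q}$, $K_m=\mathbb{Q}(\alpha)$ with $\alpha^n=m$, $\mathcal{O}_{K_m}$ is its ring of integers, and $g(m)=[\mathcal{O}_{K_m}:\mathbb{Z}[\alpha]]$. Index form: for a number field $F$ of degree $n$ with ring of integers $\mathcal{O}_F$, an orientation is a generator $\omega$ of $\bigwedge^n_{\mathbb{Z}}\mathcal{O}_F\cong\mathbb{Z}$, and $f_{F,\omega}:\mathcal{O}_F\to\mathbb{Z}$ is defined by $1\wedge\beta\wedge\cdots\wedge\beta^{n-1}=f_{F,\omega}(\beta)\,\omega$; it extends by the same formula to $\mathcal{O}_F\otimes_{\mathbb{Z}}\mathbb{Z}_\ell\to\mathbb{Z}_\ell$. $F$ is fixed-sign locally solvable for monogenicity if there exist an orientation $\omega$ of $\mathcal{O}_F$ and $\varepsilon\in\{\pm1\}$ such that for every rational prime $\ell$ the equation $f_{F,\omega}(x)=\varepsilon$ has a solution in $\mathcal{O}_F\otimes_{\mathbb{Z}}\mathbb{Z}_\ell$. *)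

theory Defs
  imports
    Complex_Main
    "HOL-Algebra.Algebra"
    "HOL-Algebra.Algebraic_Closure_Type"
    "HOL-Number_Theory.Number_Theory"
    "HOL-Computational_Algebra.Squarefree"
    "HOL-Library.Landau_Symbols"
begin

section \<open>Number fields inside the complex numbers\<close>

abbreviation complex_ring :: "complex ring" where
  "complex_ring \<equiv> ring_of_type_algebra"

text \<open>The field \<open>\<rat>(S)\<close>; a subfield of \<open>\<complex>\<close> contains \<open>\<rat>\<close> automatically.\<close>

definition adjoin :: "complex set \<Rightarrow> complex set" where
  "adjoin S = generate_field complex_ring S"

definition ext_degree :: "complex set \<Rightarrow> complex set \<Rightarrow> nat" where
  "ext_degree K L = ring.dim complex_ring K L"

definition integer_algebra :: "complex set \<Rightarrow> (int, complex) module" where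
  "integer_algebra F =
     \<lparr>carrier = {x \<in> F. algebraic_int x}, monoid.mult = (*), one = 1, ring.zero = 0, ring.add = (+),
      module.smult = (\<lambda>k x. of_int k * x)\<rparr>"

definition power_order_index :: "complex \<Rightarrow> nat" where
  "power_order_index \<alpha> =
     card (a_rcosets\<^bsub>integer_algebra (adjoin {\<alpha>})\<^esub> (generate_ring complex_ring {\<alpha>}))"

section \<open>The \<open>\<ell>\<close>-adic integers\<close>

text \<open>The inverse limit of the rings \<open>\<int>/\<ell>\<^sup>k\<close>, the \<open>k\<close>-th component being given by its
  representative in \<open>{0..<\<ell>\<^sup>k}\<close>.\<close>

definition padic_int_ring :: "nat \<Rightarrow> (nat \<Rightarrow> int) ring" where
  "padic_int_ring l =
     \<lparr>carrier = {x. \<forall>k. x k \<in> {0..<int l ^ k} \<and> x (Suc k) mod int l ^ k = x k},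
      monoid.mult = (\<lambda>x y k. (x k * y k) mod int l ^ k),
      one = (\<lambda>k. 1 mod int l ^ k),
      ring.zero = (\<lambda>k. 0),
      ring.add = (\<lambda>x y k. (x k + y k) mod int l ^ k)\<rparr>"

section \<open>Tensor products of commutative rings over the integers\<close>

text \<open>The free abelian group on \<open>A \<times> B\<close>, with \<open>(a, b) (a', b') = (a a', b b')\<close>
  extended bilinearly. The biadditivity relations are stable under multiplication by
  the basis elements, so the ideal they generate is also the additive subgroup they
  generate, and the quotient is the usual \<open>A \<otimes>\<^sub>\<int> B\<close>.\<close>

definition pair_ring :: "('a, 'c) ring_scheme \<Rightarrow> ('b, 'd) ring_scheme \<Rightarrow> ('a \<times> 'b \<Rightarrow>\<^sub>0 int) ring" where
  "pair_ring A B =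
     \<lparr>carrier = {c. Poly_Mapping.keys c \<subseteq> carrier A \<times> carrier B},
      monoid.mult = (\<lambda>c d. frag_extend (\<lambda>(a, b). frag_extend (\<lambda>(a', b').
                 frag_of (a \<otimes>\<^bsub>A\<^esub> a', b \<otimes>\<^bsub>B\<^esub> b')) d) c),
      one = frag_of (\<one>\<^bsub>A\<^esub>, \<one>\<^bsub>B\<^esub>),
      ring.zero = 0,
      ring.add = (+)\<rparr>"

definition tensor_relations ::
    "('a, 'c) ring_scheme \<Rightarrow> ('b, 'd) ring_scheme \<Rightarrow> ('a \<times> 'b \<Rightarrow>\<^sub>0 int) set" where
  "tensor_relations A B =
     {frag_of (a \<oplus>\<^bsub>A\<^esub> a', b) - frag_of (a, b) - frag_of (a', b) | a a' b.
        a \<in> carrier A \<and> a' \<in> carrier A \<and> b \<in> carrier B} \<union>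
     {frag_of (a, b \<oplus>\<^bsub>B\<^esub> b') - frag_of (a, b) - frag_of (a, b') | a b b'.
        a \<in> carrier A \<and> b \<in> carrier B \<and> b' \<in> carrier B}"

definition tensor_ideal ::
    "('a, 'c) ring_scheme \<Rightarrow> ('b, 'd) ring_scheme \<Rightarrow> ('a \<times> 'b \<Rightarrow>\<^sub>0 int) set" where
  "tensor_ideal A B = Idl\<^bsub>pair_ring A B\<^esub> (tensor_relations A B)"

definition pure_tensor ::
    "('a, 'c) ring_scheme \<Rightarrow> ('b, 'd) ring_scheme \<Rightarrow> 'a \<Rightarrow> 'b \<Rightarrow> ('a \<times> 'b \<Rightarrow>\<^sub>0 int) set" where
  "pure_tensor A B a b = tensor_ideal A B +>\<^bsub>pair_ring A B\<^esub> frag_of (a, b)"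

text \<open>\<open>A \<otimes>\<^sub>\<int> B\<close> as a \<open>B\<close>-algebra.\<close>

definition base_change ::
    "('a, 'c) ring_scheme \<Rightarrow> ('b, 'd) ring_scheme \<Rightarrow> ('b, ('a \<times> 'b \<Rightarrow>\<^sub>0 int) set) module" where
  "base_change A B =
     (let T = pair_ring A B Quot tensor_ideal A B in
      \<lparr>carrier = carrier T, monoid.mult = monoid.mult T, one = \<one>\<^bsub>T\<^esub>, ring.zero = \<zero>\<^bsub>T\<^esub>, ring.add = ring.add T,
       module.smult = (\<lambda>b t. pure_tensor A B \<one>\<^bsub>A\<^esub> b \<otimes>\<^bsub>T\<^esub> t)\<rparr>)"

section \<open>Exterior powers\<close>

text \<open>For \<open>n > 0\<close>, the \<open>n\<close>-th exterior power of an \<open>R\<close>-module \<open>M\<close> is the quotient of the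
  free abelian group on \<open>M\<^sup>n\<close> by the following relations: additivity in each argument,
  scalars move between arguments, and tuples with a repeated entry vanish.  The scalar action
  is the one on the first argument.\<close>

definition tuples :: "nat \<Rightarrow> ('r, 'm, 'c) module_scheme \<Rightarrow> 'm list set" where
  "tuples n M = {xs. length xs = n \<and> set xs \<subseteq> carrier M}"

definition exterior_relations ::
    "nat \<Rightarrow> ('r, 'd) ring_scheme \<Rightarrow> ('r, 'm, 'c) module_scheme \<Rightarrow> ('m list \<Rightarrow>\<^sub>0 int) set" where
  "exterior_relations n R M =
     {frag_of (xs[i := x \<oplus>\<^bsub>M\<^esub> y]) - frag_of (xs[i := x]) - frag_of (xs[i := y]) | xs i x y.
        xs \<in> tuples n M \<and> i < n \<and> x \<in> carrier M \<and> y \<in> carrier M} \<union>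
     {frag_of (xs[i := c \<odot>\<^bsub>M\<^esub> xs ! i]) - frag_of (xs[j := c \<odot>\<^bsub>M\<^esub> xs ! j]) | xs i j c.
        xs \<in> tuples n M \<and> i < n \<and> j < n \<and> c \<in> carrier R} \<union>
     {frag_of xs | xs. xs \<in> tuples n M \<and> (\<exists>i j. i < j \<and> j < n \<and> xs ! i = xs ! j)}"

definition exterior_null ::
    "nat \<Rightarrow> ('r, 'd) ring_scheme \<Rightarrow> ('r, 'm, 'c) module_scheme \<Rightarrow> ('m list \<Rightarrow>\<^sub>0 int) set" where
  "exterior_null n R M =
     generate (free_Abelian_group (tuples n M)) (exterior_relations n R M)"

definition exterior_power ::
    "nat \<Rightarrow> ('r, 'd) ring_scheme \<Rightarrow> ('r, 'm, 'c) module_scheme \<Rightarrow> ('m list \<Rightarrow>\<^sub>0 int) set monoid" where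
  "exterior_power n R M = free_Abelian_group (tuples n M) Mod exterior_null n R M"

definition wedge ::
    "('r, 'd) ring_scheme \<Rightarrow> ('r, 'm, 'c) module_scheme \<Rightarrow> 'm list \<Rightarrow> ('m list \<Rightarrow>\<^sub>0 int) set" where
  "wedge R M xs =
     exterior_null (length xs) R M #>\<^bsub>free_Abelian_group (tuples (length xs) M)\<^esub> frag_of xs"

text \<open>If \<open>f\<close> maps the null subgroup of the source into that of the target, then \<open>f ` W\<close> lies
  in one coset for every coset \<open>W\<close>, and the sum of sets below is precisely that coset.\<close>

definition exterior_lift ::
    "nat \<Rightarrow> ('r, 'd) ring_scheme \<Rightarrow> ('r, 'm, 'c) module_scheme \<Rightarrow>
     ('a list \<Rightarrow> 'm list) \<Rightarrow> ('a list \<Rightarrow>\<^sub>0 int) set \<Rightarrow> ('m list \<Rightarrow>\<^sub>0 int) set" where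
  "exterior_lift n R M f W =
     exterior_null n R M <#>\<^bsub>free_Abelian_group (tuples n M)\<^esub>
       (frag_extend (\<lambda>xs. frag_of (f xs)) ` W)"

definition exterior_smult ::
    "nat \<Rightarrow> ('r, 'd) ring_scheme \<Rightarrow> ('r, 'm, 'c) module_scheme \<Rightarrow>
     'r \<Rightarrow> ('m list \<Rightarrow>\<^sub>0 int) set \<Rightarrow> ('m list \<Rightarrow>\<^sub>0 int) set" where
  "exterior_smult n R M c = exterior_lift n R M (\<lambda>xs. xs[0 := c \<odot>\<^bsub>M\<^esub> xs ! 0])"

section \<open>Index forms and local solvability\<close>

text \<open>The scalar \<open>c\<close> with \<open>1 \<and> x \<and> \<dots> \<and> x\<^sup>n\<^sup>-\<^sup>1 = c \<omega>\<close>. It is unique when \<open>\<omega>\<close> is a basis of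
  the \<open>n\<close>-th exterior power of the \<open>R\<close>-algebra \<open>A\<close>.\<close>

definition index_form ::
    "nat \<Rightarrow> ('r, 'd) ring_scheme \<Rightarrow> ('r, 'a, 'c) module_scheme \<Rightarrow>
     ('a list \<Rightarrow>\<^sub>0 int) set \<Rightarrow> 'a \<Rightarrow> 'r" where
  "index_form n R A \<omega> x =
     (THE c. c \<in> carrier R \<and>
        wedge R A (map (\<lambda>i. x [^]\<^bsub>A\<^esub> i) [0..<n]) = exterior_smult n R A c \<omega>)"

definition orientation :: "complex set \<Rightarrow> (complex list \<Rightarrow>\<^sub>0 int) set \<Rightarrow> bool" where
  "orientation F \<omega> \<longleftrightarrow>
     (let E = exterior_power (ext_degree \<rat> F) \<Z> (integer_algebra F)
      in \<omega> \<in> carrier E \<and> generate E {\<omega>} = carrier E)"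

definition local_algebra ::
    "complex set \<Rightarrow> nat \<Rightarrow> (nat \<Rightarrow> int, (complex \<times> (nat \<Rightarrow> int) \<Rightarrow>\<^sub>0 int) set) module" where
  "local_algebra F l = base_change (integer_algebra F) (padic_int_ring l)"

text \<open>The image of \<open>\<omega>\<close> under the base change map induced by \<open>x \<mapsto> x \<otimes> 1\<close>.\<close>

definition local_orientation ::
    "complex set \<Rightarrow> nat \<Rightarrow> (complex list \<Rightarrow>\<^sub>0 int) set \<Rightarrow>
     ((complex \<times> (nat \<Rightarrow> int) \<Rightarrow>\<^sub>0 int) set list \<Rightarrow>\<^sub>0 int) set" where
  "local_orientation F l =
     exterior_lift (ext_degree \<rat> F) (padic_int_ring l) (local_algebra F l)
       (map (\<lambda>x. pure_tensor (integer_algebra F) (padic_int_ring l) x \<one>\<^bsub>padic_int_ring l\<^esub>))"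

definition local_index_form ::
    "complex set \<Rightarrow> nat \<Rightarrow> (complex list \<Rightarrow>\<^sub>0 int) set \<Rightarrow>
     (complex \<times> (nat \<Rightarrow> int) \<Rightarrow>\<^sub>0 int) set \<Rightarrow> (nat \<Rightarrow> int)" where
  "local_index_form F l \<omega> =
     index_form (ext_degree \<rat> F) (padic_int_ring l) (local_algebra F l) (local_orientation F l \<omega>)"

definition fixed_sign_locally_solvable :: "complex set \<Rightarrow> bool" where
  "fixed_sign_locally_solvable F \<longleftrightarrow>
     (\<exists>\<omega>. orientation F \<omega> \<and>
       (\<exists>\<epsilon> \<in> {1, -1 :: int}. \<forall>l :: nat. Factorial_Ring.prime l \<longrightarrow>
          (\<exists>x \<in> carrier (local_algebra F l).
             local_index_form F l \<omega> x = [\<epsilon>] \<cdot>\<^bsub>padic_int_ring l\<^esub> \<one>\<^bsub>padic_int_ring l\<^esub>)))"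

section \<open>The counting problem\<close>

text \<open>The choice of the root \<open>\<alpha>\<close> is immaterial: all roots of an irreducible polynomial are
  conjugate.\<close>

definition pure_field_params :: "nat \<Rightarrow> nat \<Rightarrow> real \<Rightarrow> int set" where
  "pure_field_params n g x =
     {m. \<bar>real_of_int m\<bar> \<le> x \<and> squarefree m \<and>
         Factorial_Ring.irreducible (Polynomial.monom 1 n - [:of_int m:] :: rat poly) \<and>
         (\<exists>\<alpha> :: complex. \<alpha> ^ n = of_int m \<and> power_order_index \<alpha> = g \<and>
            fixed_sign_locally_solvable (adjoin {\<alpha>}))}"

end

theory Submission
  imports Defs "Jordan_Normal_Form.Char_Poly"
begin

text \<open>
  Let \<open>q = 2 N\<close>.  The proof combines a condition at the primes dividing \<open>m\<close> with the density of the primes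
  that violate this condition.

  The local condition.  Let \<open>l\<close> be an odd prime with \<open>l dvd m\<close> that does not divide \<open>g\<close>.  As the index of
  \<open>\<int>[\<alpha>]\<close> is prime to \<open>l\<close>, the ring of integers modulo \<open>l\<close> is \<open>\<int>[X] / (l, X\<^sup>n)\<close>.  Let
  \<open>x = x\<^sub>0 + x\<^sub>1 \<alpha> + \<dots>\<close>; as \<open>x - x\<^sub>0\<close> has the same index form, let \<open>x\<^sub>0 = 0\<close>.  Then the coordinates of
  \<open>1, x, \<dots>, x\<^sup>n\<^sup>-\<^sup>1\<close> form a triangular matrix modulo \<open>l\<close>, with diagonal
  \<open>1, x\<^sub>1, x\<^sub>1\<^sup>2, \<dots>\<close> and determinant \<open>x\<^sub>1\<^sup>N\<close>.  Since \<open>1 \<and> \<alpha> \<and> \<dots> \<and> \<alpha>\<^sup>n\<^sup>-\<^sup>1\<close> is \<open>\<plusminus>g\<close> times an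
  orientation, a local solution at \<open>l\<close> makes \<open>g a\<^sup>N\<close> congruent to \<open>\<plusminus>1\<close> for some \<open>a\<close>
  (\<open>index_form_power_residue\<close>).  If \<open>l\<close> is congruent to 1 modulo \<open>2 N\<close>, then \<open>-1\<close> is an \<open>N\<close>-th power modulo
  \<open>l\<close>, and so \<open>g\<close> is one as well.  Thus \<open>m\<close> has no prime factor in the set \<open>P\<close> of primes \<open>l\<close> congruent to 1
  modulo \<open>2 N\<close>, prime to \<open>g\<close>, for which \<open>g\<close> is not an \<open>N\<close>-th power modulo \<open>l\<close> (\<open>obstructing_primes\<close>).

  The density of \<open>P\<close>.  The sum of \<open>ln p / p\<close> over the primes of \<open>P\<close> up to \<open>y\<close> is at least
  \<open>\<delta> ln y - O(1)\<close>.  Up to the finitely many primes dividing \<open>g\<close>, it is the sum over all primes congruent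
  to 1 modulo \<open>2 N\<close>, minus the sum over those modulo which \<open>g\<close> is an \<open>N\<close>-th power.
  So it suffices to have a lower bound for the former and an upper bound for the latter.  The lower bound, with constant \<open>1 / \<phi>(2 N)\<close>, is Dirichlet's theorem in Mertens' form
  (\<open>primes_cong_1_lower\<close>).  The upper bound rests on a congruence: for such \<open>p\<close>, a generator \<open>\<theta>\<close> of \<open>L\<close>
  satisfies \<open>\<theta>\<^sup>p = \<theta>\<close> modulo \<open>p\<close>, so that its minimal polynomial divides \<open>X\<^sup>p - X\<close> modulo \<open>p\<close> and has
  \<open>[L : \<rat>]\<close> roots there.  The primes with this many roots are bounded by counting coincidences in a box
  (\<open>totally_split_primes_upper\<close>).  The same bound for \<open>K\<close>, compared with Dirichlet's theorem, gives
  \<open>[K : \<rat>] \<le> \<phi>(2 N)\<close>; the other inequality is the irreducibility of the cyclotomic polynomial.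

  The count.  Square-free integers up to \<open>x\<close> without prime factors in a set of density \<open>\<delta>\<close> number
  \<open>O(x / (ln x)\<^sup>\<delta>)\<close> (\<open>card_sqfree_over_upper_bound\<close>).  The identities and the inequality for \<open>\<delta>\<close> follow from
  \<open>[L : \<rat>] = [L : K] [K : \<rat>]\<close> and \<open>[L : K] \<ge> 2\<close>.
\<close>

hide_const (open) Divisibility.prime Divisibility.irreducible

section \<open>Square-free integers with restricted prime factors\<close>

lemma prod_primes_dvd:
  fixes n :: nat
  assumes "finite A" "\<And>p. p \<in> A \<Longrightarrow> prime p \<and> p dvd n"
  shows "\<Prod>A dvd n"
  using assms
proof (induction A rule: finite_induct)
  case (insert p A)
  have "coprime p (\<Prod>A)"
    using insert by (intro prod_coprime_right) (auto intro: primes_coprime)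
  with insert show ?case by (simp add: divides_mult)
qed simp

text \<open>
  Chebyshev's argument: the primes in \<open>(m, 2 m]\<close> all divide the binomial coefficient \<open>2 m\<close> over \<open>m\<close>,
  which is at most \<open>4\<^sup>m\<close>; halving repeatedly sums a geometric series.
\<close>
lemma chebyshev_theta_upper:
  "(\<Sum>p | prime p \<and> p \<le> n. ln (real p)) \<le> 3 * ln 4 * real n"
proof (induction n rule: less_induct)
  case (less n)
  show ?case
  proof (cases "n \<le> 1")
    case True
    then have *: "{p. prime p \<and> p \<le> n} = {}" using prime_gt_1_nat by (metis (mono_tags, lifting) Collect_empty_eq leD order.strict_trans2)
    show ?thesis unfolding * by simp
  next
    case False
    define m where "m = (n + 1) div 2"
    have m: "m < n" "n \<le> 2 * m" "m > 0" "2 * real m \<le> real n + 1" using False by (auto simp: m_def)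
    let ?S = "\<lambda>n. {p::nat. prime p \<and> p \<le> n}"
    have fin: "finite (?S k)" for k by (rule finite_subset[of _ "{..k}"]) auto
    let ?Q = "{p::nat. prime p \<and> m < p \<and> p \<le> 2 * m}"
    have finQ: "finite ?Q" by (rule finite_subset[of _ "{..2*m}"]) auto
    have "(\<Sum>p\<in>?S n. ln (real p)) \<le> (\<Sum>p\<in>?S m \<union> ?Q. ln (real p))"
      using m(2) by (intro sum_mono2) (auto simp: fin finQ dest: prime_gt_0_nat intro!: ln_ge_zero)
    also have "\<dots> = (\<Sum>p\<in>?S m. ln (real p)) + (\<Sum>p\<in>?Q. ln (real p))"
      by (intro sum.union_disjoint fin finQ) auto
    also have "(\<Sum>p\<in>?Q. ln (real p)) = ln (real (\<Prod>?Q))"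
      unfolding of_nat_prod by (rule ln_prod[symmetric]) (auto simp: finQ dest: prime_gt_0_nat)
    also have "\<Prod>?Q dvd (2 * m) choose m"
    proof (rule prod_primes_dvd[OF finQ])
      show "prime p \<and> p dvd (2 * m) choose m" if p: "p \<in> ?Q" for p
      proof -
        have "fact (2 * m) = fact m * fact m * ((2 * m) choose m)"
          using binomial_fact_lemma[of m "2*m"] by (simp add: mult_ac)
        moreover have "p dvd fact (2 * m)" using p by (simp add: prime_dvd_fact_iff)
        moreover have "\<not> p dvd fact m" using p by (simp add: prime_dvd_fact_iff)
        ultimately show ?thesis using p by (auto simp: prime_dvd_mult_iff)
      qed
    qed
    then have "\<Prod>?Q \<le> (2 * m) choose m" by (rule dvd_imp_le) simp
    then have "\<Prod>?Q \<le> 4 ^ m"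
      using binomial_le_pow2[of "2*m" m] by (simp add: power_mult)
    then have "ln (real (\<Prod>?Q)) \<le> real m * ln 4"
    proof -
      have "\<Prod>?Q > 0" using finQ by (intro prod_pos) (auto dest: prime_gt_0_nat)
      then have "ln (real (\<Prod>?Q)) \<le> ln (real (4 ^ m))" using \<open>\<Prod>?Q \<le> 4 ^ m\<close>
        by (subst ln_le_cancel_iff) (auto simp del: of_nat_prod of_nat_power)
      also have "\<dots> = real m * ln 4" by (simp add: ln_realpow)
      finally show ?thesis .
    qed
    also have "(\<Sum>p\<in>?S m. ln (real p)) \<le> 3 * ln 4 * real m" using less[OF m(1)] .
    finally have "(\<Sum>p\<in>?S n. ln (real p)) \<le> ln 4 * (4 * real m)" by (simp add: algebra_simps)
    also have "\<dots> \<le> ln 4 * (3 * real n)" 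
      using m False by (intro mult_left_mono) auto
    finally show ?thesis by (simp add: algebra_simps)
  qed
qed

text \<open>
  Partial summation against \<open>1 / ln\<close>.  The increments of \<open>ln (ln n)\<close> dominate \<open>ln n (1 / ln n - 1 / ln (n + 1))\<close>,
  which turns a bound \<open>\<kappa> ln n\<close> into \<open>\<kappa> ln (ln n)\<close>.
\<close>
lemma abel_summation_over_log:
  fixes a :: "nat \<Rightarrow> real"
  assumes \<kappa>: "\<kappa> \<ge> 0" and C: "C \<ge> 0"
    and le: "\<And>n. n \<ge> 2 \<Longrightarrow> (\<Sum>k=2..n. a k) \<le> \<kappa> * ln (real n) + C"
  shows "n \<ge> 2 \<Longrightarrow> (\<Sum>k=2..n. a k / ln (real k)) \<le> \<kappa> * ln (ln (real n)) + (\<kappa> - \<kappa> * ln (ln 2) + C / ln 2)"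
proof -
  assume n: "n \<ge> 2"
  define A where "A n = (\<Sum>k=2..n. a k)" for n
  have "(\<Sum>k=2..n. a k / ln (real k)) - A n / ln (real n)
        \<le> \<kappa> * (ln (ln (real n)) - ln (ln 2)) + C * (1 / ln 2 - 1 / ln (real n))"
    using n
  proof (induction n rule: dec_induct)
    case base
    then show ?case by (simp add: A_def)
  next
    case (step n)
    define x y where "x = ln (real n)" and "y = ln (real (Suc n))"
    have xy: "0 < x" "x \<le> y" "0 < y" using step(1) by (auto simp: x_def y_def)
    have "A n * (1 / x - 1 / y) \<le> (\<kappa> * x + C) * (1 / x - 1 / y)"
      using le[OF step(1)] xy by (intro mult_right_mono) (auto simp: A_def x_def field_simps)
    also have "\<dots> = \<kappa> * (1 - x / y) + C * (1 / x - 1 / y)" using xy by (simp add: field_simps)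
    also have "1 - x / y \<le> ln y - ln x"
      using ln_le_minus_one[of "x / y"] xy by (simp add: ln_div)
    finally have *: "A n * (1 / x - 1 / y) \<le> \<kappa> * (ln y - ln x) + C * (1 / x - 1 / y)"
      using \<kappa> by (simp add: mult_left_mono)
    have eq: "(\<Sum>k=2..Suc n. a k / ln (real k)) - A (Suc n) / y = (\<Sum>k=2..n. a k / ln (real k)) - A n / x + A n * (1 / x - 1 / y)"
    proof -
      have "A (Suc n) = A n + a (Suc n)" "(\<Sum>k=2..Suc n. a k / ln (real k)) = (\<Sum>k=2..n. a k / ln (real k)) + a (Suc n) / y"
        using step(1) by (auto simp: A_def y_def)
      then show ?thesis by (simp add: add_divide_distrib right_diff_distrib)
    qed
    have "(\<Sum>k=2..n. a k / ln (real k)) - A n / x \<le> \<kappa> * (ln x - ln (ln 2)) + C * (1 / ln 2 - 1 / x)"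
      using step(3) unfolding x_def .
    with eq * have "(\<Sum>k=2..Suc n. a k / ln (real k)) - A (Suc n) / y
        \<le> \<kappa> * (ln x - ln (ln 2)) + C * (1 / ln 2 - 1 / x) + (\<kappa> * (ln y - ln x) + C * (1 / x - 1 / y))" by linarith
    also have "\<dots> = \<kappa> * (ln y - ln (ln 2)) + C * (1 / ln 2 - 1 / y)" by (simp only: algebra_simps)
    finally show ?case unfolding y_def .
  qed
  moreover have "A n / ln (real n) \<le> \<kappa> + C / ln (real n)"
  proof -
    have L: "ln (real n) > 0" using n by simp
    have "A n / ln (real n) \<le> (\<kappa> * ln (real n) + C) / ln (real n)"
      using le[OF n] L unfolding A_def by (intro divide_right_mono) auto
    also have "\<dots> = \<kappa> + C / ln (real n)" using L by (simp add: add_divide_distrib)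
    finally show ?thesis .
  qed
  moreover have "\<kappa> * (ln (ln (real n)) - ln (ln 2)) + C * (1 / ln 2 - 1 / ln (real n)) + (\<kappa> + C / ln (real n))
      = \<kappa> * ln (ln (real n)) + (\<kappa> - \<kappa> * ln (ln 2) + C / ln 2)" by (simp add: right_diff_distrib)
  ultimately show ?thesis by linarith
qed

lemma sum_primes_conv_interval:
  fixes f :: "nat \<Rightarrow> real"
  shows "(\<Sum>p | prime p \<and> Q p \<and> p \<le> n. f p) = (\<Sum>k=2..n. if prime k \<and> Q k then f k else 0)"
proof -
  have "(\<Sum>k=2..n. if prime k \<and> Q k then f k else 0) = (\<Sum>k | k \<in> {2..n} \<and> (prime k \<and> Q k). f k)"
    by (subst sum.inter_filter) auto
  also have "{k \<in> {2..n}. (prime k \<and> Q k)} = {p. prime p \<and> Q p \<and> p \<le> n}"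
    by (auto dest: prime_ge_2_nat)
  finally show ?thesis ..
qed

lemma sum_inverse_primes_le:
  fixes Q :: "nat \<Rightarrow> bool"
  assumes \<kappa>: "\<kappa> \<ge> 0" and C: "C \<ge> 0"
    and le: "\<And>n. n \<ge> 2 \<Longrightarrow> (\<Sum>p | prime p \<and> Q p \<and> p \<le> n. ln (real p) / real p) \<le> \<kappa> * ln (real n) + C"
    and n: "n \<ge> 2"
  shows "(\<Sum>p | prime p \<and> Q p \<and> p \<le> n. 1 / real p)
           \<le> \<kappa> * ln (ln (real n)) + (\<kappa> - \<kappa> * ln (ln 2) + C / ln 2)"
proof -
  define a where "a k = (if prime k \<and> Q k then ln (real k) / real k else 0)" for k
  have "(\<Sum>k=2..n. a k / ln (real k)) \<le> \<kappa> * ln (ln (real n)) + (\<kappa> - \<kappa> * ln (ln 2) + C / ln 2)"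
    by (rule abel_summation_over_log[OF \<kappa> C _ n]) (use le in \<open>simp add: sum_primes_conv_interval a_def\<close>)
  also have "(\<Sum>k=2..n. a k / ln (real k)) = (\<Sum>p | prime p \<and> Q p \<and> p \<le> n. 1 / real p)"
    unfolding sum_primes_conv_interval by (intro sum.cong) (auto simp: a_def)
  finally show ?thesis .
qed

definition sqfree_over :: "nat set \<Rightarrow> nat \<Rightarrow> nat set" where
  "sqfree_over Q n = {k. 0 < k \<and> k \<le> n \<and> squarefree k \<and> prime_factors k \<subseteq> Q}"

lemma finite_sqfree_over [simp]: "finite (sqfree_over Q n)"
  by (rule finite_subset[of _ "{..n}"]) (auto simp: sqfree_over_def)

lemma squarefree_eq_prod_prime_factors:
  fixes k :: nat
  assumes "squarefree k"
  shows "k = prod id (prime_factors k)"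
proof -
  have "k \<noteq> 0" using assms by (metis not_squarefree_0)
  then have mult: "\<forall>p\<in>prime_factors k. multiplicity p k = 1"
    using assms squarefree_factorial_semiring' by blast
  have "k = (\<Prod>p\<in>prime_factors k. p ^ multiplicity p k)"
    using prod_prime_factors[OF \<open>k \<noteq> 0\<close>] by (metis normalize_nat_def id_apply)
  also have "\<dots> = prod id (prime_factors k)"
    using mult by (intro prod.cong refl) (metis id_apply power_one_right)
  finally show ?thesis .
qed

text \<open>
  Expanding the product over the primes yields each square-free integer composed of them exactly once.
\<close>
lemma sum_inverse_sqfree_over_le:
  "(\<Sum>k\<in>sqfree_over Q n. 1 / real k) \<le> (\<Prod>p | prime p \<and> p \<in> Q \<and> p \<le> n. 1 + 1 / real p)"
proof -
  let ?S = "{p. prime p \<and> p \<in> Q \<and> p \<le> n}"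
  have fin: "finite ?S" by (rule finite_subset[of _ "{..n}"]) auto
  have "(\<Prod>p\<in>?S. 1 + 1 / real p) = (\<Prod>p\<in>?S. 1 / real p + 1)" by (simp add: add.commute)
  also have "\<dots> = (\<Sum>Y\<in>Pow ?S. (\<Prod>p\<in>Y. 1 / real p) * (\<Prod>p\<in>?S - Y. 1))"
    by (rule prod_add[OF fin])
  also have "\<dots> = (\<Sum>Y\<in>Pow ?S. 1 / real (prod id Y))"
    by (simp add: prod_dividef)
  finally have 1: "(\<Prod>p\<in>?S. 1 + 1 / real p) = (\<Sum>Y\<in>Pow ?S. 1 / real (prod id Y))" .
  have "(\<Sum>Y\<in>prime_factors ` sqfree_over Q n. 1 / real (prod id Y)) \<le> (\<Sum>Y\<in>Pow ?S. 1 / real (prod id Y))"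
  proof (rule sum_mono2)
    show "prime_factors ` sqfree_over Q n \<subseteq> Pow ?S"
      by (auto simp: sqfree_over_def in_prime_factors_iff dest!: dvd_imp_le)
  qed (use fin in \<open>auto intro!: prod_nonneg\<close>)
  moreover have "(\<Sum>Y\<in>prime_factors ` sqfree_over Q n. 1 / real (prod id Y)) = (\<Sum>k\<in>sqfree_over Q n. 1 / real k)"
  proof (subst sum.reindex)
    show "inj_on prime_factors (sqfree_over Q n)"
      by (rule inj_on_inverseI[of _ "prod id"]) (metis (mono_tags, lifting) mem_Collect_eq sqfree_over_def squarefree_eq_prod_prime_factors)
    show "sum ((\<lambda>Y. 1 / real (prod id Y)) \<circ> prime_factors) (sqfree_over Q n) = (\<Sum>k\<in>sqfree_over Q n. 1 / real k)"
    proof (intro sum.cong refl)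
      fix k assume "k \<in> sqfree_over Q n"
      then have "k = prod id (prime_factors k)" by (intro squarefree_eq_prod_prime_factors) (auto simp: sqfree_over_def)
      then show "((\<lambda>Y. 1 / real (prod id Y)) \<circ> prime_factors) k = 1 / real k" by (metis comp_apply)
    qed
  qed
  ultimately show ?thesis using 1 by simp
qed

text \<open>
  The weight \<open>ln n\<close> is split as \<open>ln k + ln (n / k)\<close>.  The second part is at most \<open>n / k\<close>.  The first is the
  sum of \<open>ln p\<close> over the primes \<open>p\<close> dividing \<open>k\<close>; exchanging the sums leaves Chebyshev's function at
  \<open>n / r\<close> for the cofactors \<open>r\<close>, which lie again in the set.
\<close>
lemma card_sqfree_over_ln_le:
  assumes "n > 0"
  shows "real (card (sqfree_over Q n)) * ln (real n) \<le> (1 + 3 * ln 4) * real n * (\<Sum>k\<in>sqfree_over Q n. 1 / real k)"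
proof -
  let ?S = "sqfree_over Q n"
  have pos: "k > 0" "k \<le> n" if "k \<in> ?S" for k using that by (auto simp: sqfree_over_def)
  have "real (card ?S) * ln (real n) = (\<Sum>k\<in>?S. ln (real n))" by simp
  also have "\<dots> = (\<Sum>k\<in>?S. ln (real k) + ln (real n / real k))"
    using pos assms by (intro sum.cong) (auto simp: ln_div)
  also have "\<dots> = (\<Sum>k\<in>?S. ln (real k)) + (\<Sum>k\<in>?S. ln (real n / real k))" by (simp add: sum.distrib)
  also have "(\<Sum>k\<in>?S. ln (real n / real k)) \<le> (\<Sum>k\<in>?S. real n * (1 / real k))"
    using pos assms by (intro sum_mono) (auto intro!: order.trans[OF ln_bound])
  also have "\<dots> = real n * (\<Sum>k\<in>?S. 1 / real k)" by (simp add: sum_distrib_left)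
  also have "(\<Sum>k\<in>?S. ln (real k)) = (\<Sum>k\<in>?S. \<Sum>p\<in>prime_factors k. ln (real p))"
  proof (intro sum.cong refl)
    fix k assume k: "k \<in> ?S"
    then have "k = prod id (prime_factors k)" by (intro squarefree_eq_prod_prime_factors) (auto simp: sqfree_over_def)
    then have "ln (real k) = ln (real (prod id (prime_factors k)))" by simp
    also have "\<dots> = (\<Sum>p\<in>prime_factors k. ln (real p))"
      unfolding of_nat_prod id_apply by (rule ln_prod) (auto simp: in_prime_factors_iff prime_gt_0_nat)
    finally show "ln (real k) = (\<Sum>p\<in>prime_factors k. ln (real p))" .
  qed
  also have "\<dots> = (\<Sum>(k,p)\<in>Sigma ?S prime_factors. ln (real p))"
    by (subst sum.Sigma) auto
  also have "\<dots> = (\<Sum>(r,p)\<in>(\<lambda>(k,p). (k div p, p)) ` Sigma ?S prime_factors. ln (real p))"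
  proof (subst sum.reindex)
    show "inj_on (\<lambda>(k, p). (k div p, p)) (Sigma ?S prime_factors)"
      by (auto simp: inj_on_def in_prime_factors_iff) (metis dvd_mult_div_cancel)
  qed (auto intro!: sum.cong)
  also have "\<dots> \<le> (\<Sum>(r,p)\<in>Sigma ?S (\<lambda>r. {p. prime p \<and> p \<le> n div r}). ln (real p))"
  proof (rule sum_mono2)
    show "finite (Sigma ?S (\<lambda>r. {p. prime p \<and> p \<le> n div r}))"
      by (intro finite_SigmaI finite_sqfree_over) (rule finite_subset[of _ "{..n}"], auto intro: order.trans[OF _ div_le_dividend])
    show "(\<lambda>(k, p). (k div p, p)) ` Sigma ?S prime_factors \<subseteq> Sigma ?S (\<lambda>r. {p. prime p \<and> p \<le> n div r})"
    proof (clarsimp simp: in_prime_factors_iff)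
      fix k p assume k: "k \<in> ?S" and p: "prime p" "p dvd k" 
      then obtain r where r: "k = p * r" by auto
      have "p > 0" using p prime_gt_0_nat by auto
      have sq: "squarefree r" using k r by (auto simp: sqfree_over_def intro: squarefree_multD)
      have "r > 0" using k r by (auto simp: sqfree_over_def intro!: Nat.gr0I)
      have "k div p = r" using r \<open>p > 0\<close> by simp
      moreover have "r \<in> ?S" using k sq \<open>r > 0\<close> r \<open>p > 0\<close>
        by (auto simp: sqfree_over_def in_prime_factors_iff intro: order.trans[of r "p * r"])
      moreover have "p \<le> n div r" using k r \<open>r > 0\<close> by (auto simp: sqfree_over_def less_eq_div_iff_mult_less_eq)
      ultimately show "k div p \<in> ?S \<and> p \<le> n div (k div p)" by simp
    qed
  qed (auto dest: prime_gt_0_nat intro!: ln_ge_zero)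
  also have "\<dots> = (\<Sum>r\<in>?S. \<Sum>p | prime p \<and> p \<le> n div r. ln (real p))"
    by (subst sum.Sigma) (auto intro: finite_subset[of _ "{..n}"] order.trans[OF _ div_le_dividend])
  also have "\<dots> \<le> (\<Sum>r\<in>?S. 3 * ln 4 * (real n * (1 / real r)))"
  proof (intro sum_mono)
    fix r assume "r \<in> ?S"
    have "(\<Sum>p | prime p \<and> p \<le> n div r. ln (real p)) \<le> 3 * ln 4 * real (n div r)"
      by (rule chebyshev_theta_upper)
    also have "\<dots> \<le> 3 * ln 4 * (real n * (1 / real r))"
      by (intro mult_left_mono) (auto simp: of_nat_div_le_of_nat)
    finally show "(\<Sum>p | prime p \<and> p \<le> n div r. ln (real p)) \<le> 3 * ln 4 * (real n * (1 / real r))" .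
  qed
  also have "\<dots> = 3 * ln 4 * (real n * (\<Sum>k\<in>?S. 1 / real k))" by (simp add: sum_distrib_left)
  finally show ?thesis by (simp add: algebra_simps)
qed

text \<open>
  A prime set whose logarithmic density is at most \<open>\<kappa>\<close> makes the Euler product at most a multiple of
  \<open>(ln n)\<^sup>\<kappa>\<close>; dividing by the weight \<open>ln n\<close> gives the exponent \<open>\<kappa> - 1\<close>.
\<close>
theorem card_sqfree_over_upper_bound:
  assumes \<kappa>: "\<kappa> \<ge> 0"
    and le: "\<And>n. n \<ge> 2 \<Longrightarrow> (\<Sum>p | prime p \<and> p \<in> Q \<and> p \<le> n. ln (real p) / real p) \<le> \<kappa> * ln (real n) + C"
  shows "\<exists>B. \<forall>n\<ge>2. real (card (sqfree_over Q n)) \<le> B * real n * ln (real n) powr (\<kappa> - 1)"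
proof -
  define D where "D = \<kappa> - \<kappa> * ln (ln 2) + max C 0 / ln 2"
  have "real (card (sqfree_over Q n)) \<le> (1 + 3 * ln 4) * exp D * real n * ln (real n) powr (\<kappa> - 1)"
    if n: "n \<ge> 2" for n
  proof -
    let ?S = "sqfree_over Q n" and ?P = "{p. prime p \<and> p \<in> Q \<and> p \<le> n}"
    have L: "ln (real n) > 0" using n by simp
    have "(\<Sum>k\<in>?S. 1 / real k) \<le> (\<Prod>p\<in>?P. 1 + 1 / real p)" by (rule sum_inverse_sqfree_over_le)
    also have "\<dots> \<le> (\<Prod>p\<in>?P. exp (1 / real p))" by (intro prod_mono) (auto simp: exp_ge_add_one_self)
    also have "\<dots> = exp (\<Sum>p\<in>?P. 1 / real p)"
      by (rule exp_sum[symmetric]) (rule finite_subset[of _ "{..n}"], auto)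
    also have "(\<Sum>p\<in>?P. 1 / real p) \<le> \<kappa> * ln (ln (real n)) + D"
      unfolding D_def 
    proof (rule sum_inverse_primes_le[OF \<kappa> _ _ n])
      show "(\<Sum>p | prime p \<and> p \<in> Q \<and> p \<le> n. ln (real p) / real p) \<le> \<kappa> * ln (real n) + max C 0"
        if "n \<ge> 2" for n using le[OF that] by (auto simp: max_def)
    qed simp
    also have "exp (\<kappa> * ln (ln (real n)) + D) = exp D * ln (real n) powr \<kappa>"
      using L by (simp add: exp_add powr_def)
    finally have *: "(\<Sum>k\<in>?S. 1 / real k) \<le> exp D * ln (real n) powr \<kappa>" by simp
    have "real (card ?S) * ln (real n) \<le> (1 + 3 * ln 4) * real n * (\<Sum>k\<in>?S. 1 / real k)"
      by (rule card_sqfree_over_ln_le) (use n in auto)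
    also have "\<dots> \<le> (1 + 3 * ln 4) * real n * (exp D * ln (real n) powr \<kappa>)"
      by (intro mult_left_mono *) auto
    finally show ?thesis using L n by (simp add: powr_diff field_simps)
  qed
  then show ?thesis by blast
qed

section \<open>Integer polynomials and algebraic integers\<close>

abbreviation ipoly :: "int poly \<Rightarrow> complex \<Rightarrow> complex" where
  "ipoly f z \<equiv> poly (map_poly of_int f) z"

lemma ipoly_simps [simp]:
  "ipoly (f + g) z = ipoly f z + ipoly g z"
  "ipoly (f - g) z = ipoly f z - ipoly g z"
  "ipoly (- f) z = - ipoly f z"
  "ipoly (f * g) z = ipoly f z * ipoly g z"
  "ipoly (f ^ n) z = ipoly f z ^ n"
  "ipoly (smult c f) z = of_int c * ipoly f z"
  "ipoly (sum h A) z = (\<Sum>a\<in>A. ipoly (h a) z)"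
  "ipoly (prod h A) z = (\<Prod>a\<in>A. ipoly (h a) z)"
  by (simp_all add: of_int_poly_hom.hom_add of_int_poly_hom.hom_minus of_int_poly_hom.hom_uminus of_int_poly_hom.hom_mult of_int_poly_hom.hom_power
      of_int_poly_hom.hom_sum of_int_poly_hom.hom_prod poly_sum poly_prod of_int_hom.map_poly_hom_smult)

lemma ipoly_pcompose [simp]: "ipoly (f \<circ>\<^sub>p g) z = ipoly f (ipoly g z)"
  by (simp add: of_int_hom.map_poly_pcompose poly_pcompose)

lemma ipoly_monom [simp]: "ipoly (Polynomial.monom c n) z = of_int c * z ^ n"
  by (simp add: map_poly_monom poly_monom)

lemma ipoly_of_int [simp]: "ipoly [:c:] z = of_int c" by (simp add: of_int_hom.map_poly_pCons_hom)

lemma ipoly_altdef: "degree f < n \<Longrightarrow> ipoly f z = (\<Sum>i<n. of_int (coeff f i) * z ^ i)"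
proof -
  assume "degree f < n"
  then have "degree (map_poly of_int f :: complex poly) < n" using degree_map_poly_le order.strict_trans1 by blast
  then show ?thesis
    using poly_as_sum_of_monoms'[of "map_poly of_int f :: complex poly" "n - 1"]
    by (subst poly_altdef, intro sum.mono_neutral_cong_left) (auto simp: coeff_eq_0 degree_map_poly_le)
qed

lemma monic_int_division:
  fixes f H :: "int poly"
  assumes "lead_coeff H = 1"
  obtains q r where "f = H * q + r" "r = 0 \<or> degree r < degree H"
proof -
  have "H \<noteq> 0" using assms by auto
  obtain q r where qr: "pseudo_divmod f H = (q, r)" by (metis surj_pair)
  from pseudo_divmod[OF \<open>H \<noteq> 0\<close> qr] assms show ?thesis using that by simp
qed

lemma monic_root_degree_pos:
  assumes "ipoly P x = 0" "lead_coeff P = 1"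
  shows "degree P > 0"
proof (rule ccontr)
  assume "\<not> degree P > 0"
  then obtain c where "P = [:c:]" using degree_eq_zeroE by blast
  then show False using assms by simp
qed

text \<open>
  The determinant trick: \<open>z\<close> is an eigenvalue of an integer matrix, hence a root of its monic characteristic
  polynomial.
\<close>
lemma algebraic_int_of_finite_span:
  fixes z :: complex and v :: "'a \<Rightarrow> complex"
  assumes fin: "finite I" and i0: "i0 \<in> I" "v i0 \<noteq> 0"
    and span: "\<And>i. i \<in> I \<Longrightarrow> \<exists>r::'a \<Rightarrow> int. z * v i = (\<Sum>j\<in>I. of_int (r j) * v j)"
  shows "algebraic_int z"
proof -
  obtain h n where h: "bij_betw h {..<n::nat} I"
    using fin ex_bij_betw_nat_finite[of I] by (auto simp: atLeast0LessThan)
  from span obtain r where r: "\<And>i. i \<in> I \<Longrightarrow> z * v i = (\<Sum>j\<in>I. of_int (r i j :: int) * v j)" by metis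
  define M where "M = mat n n (\<lambda>(i,j). r (h i) (h j))"
  define w where "w = vec n (\<lambda>i. v (h i))"
  have M: "M \<in> carrier_mat n n" by (simp add: M_def)
  have hI: "h i \<in> I" if "i < n" for i using h that by (auto simp: bij_betw_def)
  have "of_int_hom.mat_hom M *\<^sub>v w = z \<cdot>\<^sub>v w"
  proof (rule eq_vecI)
    fix i assume "i < dim_vec (z \<cdot>\<^sub>v w)"
    then have i: "i < n" by (simp add: w_def)
    have "(of_int_hom.mat_hom M *\<^sub>v w) $ i = (\<Sum>j<n. of_int (r (h i) (h j)) * v (h j))"
      using i by (simp add: M_def w_def scalar_prod_def atLeast0LessThan)
    also have "\<dots> = (\<Sum>j\<in>I. of_int (r (h i) j) * v j)" by (rule sum.reindex_bij_betw[OF h])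
    also have "\<dots> = z * v (h i)" using r[OF hI[OF i]] by simp
    finally show "(of_int_hom.mat_hom M *\<^sub>v w) $ i = (z \<cdot>\<^sub>v w) $ i" using i by (simp add: w_def)
  qed (simp add: M_def w_def)
  moreover have "w \<noteq> 0\<^sub>v n"
  proof
    assume w0: "w = 0\<^sub>v n"
    from h i0 obtain k where k: "k < n" "h k = i0" by (auto simp: bij_betw_def)
    from w0 have "w $ k = 0" using k by simp
    then show False using k i0 by (simp add: w_def)
  qed
  ultimately have "eigenvalue (of_int_hom.mat_hom M) z"
    unfolding eigenvalue_def eigenvector_def by (intro exI[of _ w]) (simp add: M_def w_def)
  moreover have "of_int_hom.mat_hom M \<in> carrier_mat n n" using M by simp
  ultimately have "poly (char_poly (of_int_hom.mat_hom M)) z = 0"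
    using eigenvalue_root_char_poly by blast
  then have "ipoly (char_poly M) z = 0" by (simp add: of_int_hom.char_poly_hom[OF M])
  moreover have "lead_coeff (char_poly M) = 1" using degree_monic_char_poly[OF M] by simp
  ultimately show ?thesis unfolding algebraic_int_altdef_ipoly by blast
qed

lemma algebraic_int_plus_times:
  fixes x y :: complex
  assumes "algebraic_int x" "algebraic_int y"
  shows "algebraic_int (x + y)" "algebraic_int (x * y)"
proof -
  from assms obtain P Q where P: "ipoly P x = 0" "lead_coeff P = 1" and Q: "ipoly Q y = 0" "lead_coeff Q = 1"
    by (auto simp: algebraic_int_altdef_ipoly)
  have degP: "degree P > 0" using monic_root_degree_pos[OF P] .
  have degQ: "degree Q > 0" using monic_root_degree_pos[OF Q] .
  define I where "I = {..<degree P} \<times> {..<degree Q}"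
  define v where "v = (\<lambda>(i,j). x ^ i * y ^ j)"
  have fin: "finite I" by (simp add: I_def)
  have red: "\<exists>c::nat \<Rightarrow> int. x ^ k = (\<Sum>i<degree P. of_int (c i) * x ^ i)" if P: "ipoly P x = 0" "lead_coeff P = 1" "degree P > 0" for P k x
  proof -
    obtain q r where qr: "Polynomial.monom 1 k = P * q + r" "r = 0 \<or> degree r < degree P"
      using monic_int_division[OF P(2)] by metis
    have "ipoly (Polynomial.monom 1 k) x = ipoly r x" unfolding qr(1) using P by simp
    also have "\<dots> = (\<Sum>i<degree P. of_int (coeff r i) * x ^ i)" using qr(2) P(3) by (intro ipoly_altdef) auto
    finally show ?thesis by (auto simp: poly_monom)
  qed
  have span: "\<exists>r. x ^ k * y ^ l = (\<Sum>j\<in>I. of_int (r j :: int) * v j)" for k l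
  proof -
    from red[OF P degP] obtain c where c: "x ^ k = (\<Sum>i<degree P. of_int (c i :: int) * x ^ i)" by metis
    from red[OF Q degQ] obtain d where d: "y ^ l = (\<Sum>i<degree Q. of_int (d i :: int) * y ^ i)" by metis
    have "x ^ k * y ^ l = (\<Sum>(i,j)\<in>I. (of_int (c i) * x ^ i) * (of_int (d j) * y ^ j))"
      unfolding c d sum_product I_def by (simp add: sum.cartesian_product)
    also have "\<dots> = (\<Sum>j\<in>I. of_int (c (fst j) * d (snd j)) * v j)"
      by (intro sum.cong) (auto simp: v_def mult_ac)
    finally show ?thesis by (intro exI)
  qed
  have i0: "(0,0) \<in> I" "v (0,0) \<noteq> 0" using degP degQ by (auto simp: I_def v_def)
  show "algebraic_int (x + y)"
  proof (rule algebraic_int_of_finite_span[where I = I and v = v, OF fin i0(1) i0(2)])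
    fix i assume "i \<in> I"
    obtain a b where i: "i = (a, b)" by (cases i)
    obtain r s where r: "x ^ Suc a * y ^ b = (\<Sum>j\<in>I. of_int (r j :: int) * v j)" and
       s: "x ^ a * y ^ Suc b = (\<Sum>j\<in>I. of_int (s j :: int) * v j)" using span by metis
    have "(x + y) * v i = x ^ Suc a * y ^ b + x ^ a * y ^ Suc b" by (simp add: i v_def algebra_simps)
    also have "\<dots> = (\<Sum>j\<in>I. of_int (r j + s j) * v j)" unfolding r s by (simp add: algebra_simps sum.distrib)
    finally show "\<exists>r. (x + y) * v i = (\<Sum>j\<in>I. of_int (r j :: int) * v j)" by (intro exI)
  qed
  show "algebraic_int (x * y)"
  proof (rule algebraic_int_of_finite_span[where I = I and v = v, OF fin i0(1) i0(2)])
    fix i assume "i \<in> I"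
    obtain a b where i: "i = (a, b)" by (cases i)
    have *: "(x * y) * v i = x ^ Suc a * y ^ Suc b" by (simp add: i v_def algebra_simps)
    show "\<exists>r. (x * y) * v i = (\<Sum>j\<in>I. of_int (r j :: int) * v j)" unfolding * by (rule span)
  qed
qed

lemma algebraic_int_ipoly:
  assumes "algebraic_int (x::complex)"
  shows "algebraic_int (ipoly f x)"
proof (induction f)
  case (pCons a f)
  then show ?case by (simp add: algebraic_int_plus_times assms of_int_hom.map_poly_pCons_hom int_imp_algebraic_int)
qed simp

definition min_int_poly_of :: "int poly \<Rightarrow> complex \<Rightarrow> bool" where
  "min_int_poly_of H x \<longleftrightarrow> lead_coeff H = 1 \<and> ipoly H x = 0 \<and> (\<forall>f. ipoly f x = 0 \<longrightarrow> H dvd f)"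

text \<open>
  An integer polynomial of least degree vanishing at \<open>x\<close>, taken primitive, divides every other one by Gauss' lemma;
  as it divides a monic polynomial, its leading coefficient is a unit.
\<close>
lemma min_int_poly_of_exists:
  assumes "algebraic_int x"
  shows "\<exists>H. min_int_poly_of H x"
proof -
  from assms obtain P where P: "ipoly P x = 0" "lead_coeff P = 1"
    by (auto simp: algebraic_int_altdef_ipoly)
  define good where "good f \<longleftrightarrow> f \<noteq> 0 \<and> ipoly f x = 0" for f
  have "good P" using P by (auto simp: good_def)
  then obtain G0 where G0: "good G0" "\<And>f. good f \<Longrightarrow> degree G0 \<le> degree f"
    using ex_has_least_nat[of good P degree] by blast
  define G where "G = primitive_part G0"
  have "G0 \<noteq> 0" using G0 by (auto simp: good_def)
  have G0_eq: "G0 = smult (content G0) G" by (simp add: G_def)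
  have "content G0 \<noteq> 0" using \<open>G0 \<noteq> 0\<close> by simp
  then have G: "good G" "degree G = degree G0" 
  proof -
    have "ipoly G0 x = of_int (content G0) * ipoly G x" by (subst G0_eq) simp
    then show "good G" using G0(1) \<open>content G0 \<noteq> 0\<close> \<open>G0 \<noteq> 0\<close> by (auto simp: good_def G_def)
    show "degree G = degree G0" by (simp add: G_def)
  qed
  have cG: "content G = 1" using \<open>G0 \<noteq> 0\<close> by (simp add: G_def)
  have dvd: "G dvd f" if f: "ipoly f x = 0" for f
  proof -
    have "G \<noteq> 0" using G by (simp add: good_def)
    obtain q r where qr: "pseudo_divmod f G = (q, r)" by (metis surj_pair)
    define c where "c = coeff G (degree G) ^ (Suc (degree f) - degree G)"
    have eq: "smult c f = G * q + r" and r: "r = 0 \<or> degree r < degree G"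
      using pseudo_divmod[OF \<open>G \<noteq> 0\<close> qr] by (auto simp: c_def)
    have "ipoly r x = 0" using arg_cong[OF eq, of "\<lambda>f. ipoly f x"] f G(1) by (simp add: good_def)
    then have "r = 0" using r G0(2)[of r] G(2) by (metis good_def not_le)
    then have eq: "smult c f = G * q" using eq by simp
    have "c \<noteq> 0" using \<open>G \<noteq> 0\<close> by (simp add: c_def)
    have "content q = normalize c * content f" using arg_cong[OF eq, of content] by (simp add: content_mult cG content_smult)
    then have "c dvd content q" by (metis dvd_triv_left normalize_dvd_iff)
    then have "[:c:] dvd q" by (simp add: const_poly_dvd_iff_dvd_content)
    then obtain q' where "q = smult c q'" by (elim dvdE) simp
    then have "smult c f = smult c (G * q')" using eq by simp
    then have "f = G * q'" using \<open>c \<noteq> 0\<close> by (metis smult_cancel)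
    then show ?thesis by simp
  qed
  have "G dvd P" using dvd P by simp
  then have "lead_coeff G dvd 1" using P by (metis lead_coeff_mult dvd_def)
  then have lc: "lead_coeff G = 1 \<or> lead_coeff G = -1" by auto
  show ?thesis
  proof (cases "lead_coeff G = 1")
    case True
    then show ?thesis using dvd G by (intro exI[of _ G]) (auto simp: min_int_poly_of_def good_def)
  next
    case False
    then show ?thesis using dvd G lc by (intro exI[of _ "- G"]) (auto simp: min_int_poly_of_def good_def)
  qed
qed

context
  fixes H :: "int poly" and x :: complex
  assumes H: "min_int_poly_of H x"
begin

lemma min_int_poly_of_monic: "lead_coeff H = 1" and min_int_poly_of_root: "ipoly H x = 0"
  and min_int_poly_of_dvd: "ipoly f x = 0 \<Longrightarrow> H dvd f"
  using H by (auto simp: min_int_poly_of_def)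

lemma min_int_poly_of_degree_pos: "degree H > 0"
proof (rule ccontr)
  assume "\<not> degree H > 0"
  then obtain c where "H = [:c:]" using degree_eq_zeroE by blast
  then show False using min_int_poly_of_monic min_int_poly_of_root by simp
qed

lemma min_int_poly_of_algebraic_int: "algebraic_int x"
  unfolding algebraic_int_altdef_ipoly using min_int_poly_of_monic min_int_poly_of_root by blast

lemma min_int_poly_of_eq_0:
  assumes "ipoly f x = 0" "degree f < degree H"
  shows "f = 0"
  using min_int_poly_of_dvd[OF assms(1)] assms(2) by (metis dvd_imp_degree_le not_le)

lemma min_int_poly_of_reduce:
  obtains r where "degree r < degree H" "ipoly f x = ipoly r x" "H dvd f - r"
proof -
  obtain q r where qr: "f = H * q + r" "r = 0 \<or> degree r < degree H"
    using monic_int_division[OF min_int_poly_of_monic] by metis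
  show ?thesis
    by (rule that[of r]) (use qr min_int_poly_of_root min_int_poly_of_degree_pos in auto)
qed

lemma min_int_poly_of_irreducible_mult:
  assumes "H dvd f * g" shows "H dvd f \<or> H dvd g"
proof -
  from assms have "ipoly (f * g) x = 0" using min_int_poly_of_root by (metis dvdE ipoly_simps(4) mult_zero_left)
  then show ?thesis using min_int_poly_of_dvd by auto
qed

end

text \<open>
  The constant coefficient of the minimal polynomial is a multiple of \<open>x\<close> in \<open>\<int>[x]\<close>; up to sign it is the norm of \<open>x\<close>.
\<close>
lemma algebraic_int_inverse_multiple:
  assumes "algebraic_int x" "x \<noteq> 0"
  obtains S :: "int poly" and c :: int where "c \<noteq> 0" "x * ipoly S x = of_int c"
proof -
  from min_int_poly_of_exists[OF assms(1)] obtain G where G: "min_int_poly_of G x" by blast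
  obtain c S where cS: "G = pCons c S" by (cases G)
  have "S \<noteq> 0" using min_int_poly_of_degree_pos[OF G] by (auto simp: cS)
  then have "degree S < degree G" by (simp add: cS)
  have root: "of_int c + x * ipoly S x = 0"
    using min_int_poly_of_root[OF G] by (simp add: cS of_int_hom.map_poly_pCons_hom)
  have "c \<noteq> 0"
  proof
    assume "c = 0"
    then have "ipoly S x = 0" using root assms(2) by simp
    then show False using min_int_poly_of_eq_0[OF G _ \<open>degree S < degree G\<close>] \<open>S \<noteq> 0\<close> by blast
  qed
  show ?thesis
    by (rule that[of "- c" S]) (use \<open>c \<noteq> 0\<close> root in \<open>auto simp: eq_neg_iff_add_eq_0 add.commute\<close>)
qed

section \<open>Number fields generated by one algebraic integer\<close>

declare poly_monom [simp]

lemma complex_ring_simps [simp]: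
  "carrier complex_ring = UNIV" "x \<otimes>\<^bsub>complex_ring\<^esub> y = x * y" "x \<oplus>\<^bsub>complex_ring\<^esub> y = x + y"
  "\<one>\<^bsub>complex_ring\<^esub> = 1" "\<zero>\<^bsub>complex_ring\<^esub> = 0"
  by (simp_all add: ring_of_type_algebra_def)

lemma field_complex_ring: "Ring.field complex_ring" by (rule field_from_type_algebra)

interpretation cx: cring complex_ring by (rule cring_from_type_algebra)

lemma complex_ring_a_inv [simp]: "\<ominus>\<^bsub>complex_ring\<^esub> x = - x"
  by (rule cx.minus_equality) auto

lemma complex_ring_m_inv [simp]: "x \<noteq> 0 \<Longrightarrow> inv\<^bsub>complex_ring\<^esub> x = inverse x"
  by (rule cx.comm_inv_char) auto

lemma adjoin_closed:
  shows "1 \<in> adjoin S" "0 \<in> adjoin S" "s \<in> S \<Longrightarrow> s \<in> adjoin S"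
    "x \<in> adjoin S \<Longrightarrow> y \<in> adjoin S \<Longrightarrow> x + y \<in> adjoin S"
    "x \<in> adjoin S \<Longrightarrow> y \<in> adjoin S \<Longrightarrow> x * y \<in> adjoin S"
    "x \<in> adjoin S \<Longrightarrow> - x \<in> adjoin S"
    "x \<in> adjoin S \<Longrightarrow> inverse x \<in> adjoin S"
proof -
  note gen = generate_field.intros[where R = complex_ring and H = S, simplified, folded adjoin_def]
  show 0: "0 \<in> adjoin S" using field.zero_in_generate[OF field_complex_ring, of S] by (simp add: adjoin_def)
  show "1 \<in> adjoin S" "s \<in> S \<Longrightarrow> s \<in> adjoin S"
    "x \<in> adjoin S \<Longrightarrow> y \<in> adjoin S \<Longrightarrow> x + y \<in> adjoin S"
    "x \<in> adjoin S \<Longrightarrow> y \<in> adjoin S \<Longrightarrow> x * y \<in> adjoin S"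
    "x \<in> adjoin S \<Longrightarrow> - x \<in> adjoin S" by (auto intro: gen)
  show "x \<in> adjoin S \<Longrightarrow> inverse x \<in> adjoin S" using gen(4)[of x] 0 by (cases "x = 0") auto
qed

lemma adjoin_subset:
  assumes "S \<subseteq> F" "1 \<in> F" "\<And>x y. x \<in> F \<Longrightarrow> y \<in> F \<Longrightarrow> x + y \<in> F" "\<And>x y. x \<in> F \<Longrightarrow> y \<in> F \<Longrightarrow> x * y \<in> F"
    "\<And>x. x \<in> F \<Longrightarrow> - x \<in> F" "\<And>x. x \<in> F \<Longrightarrow> x \<noteq> 0 \<Longrightarrow> inverse x \<in> F"
  shows "adjoin S \<subseteq> F"
proof
  fix x assume "x \<in> adjoin S"
  then have "x \<in> generate_field complex_ring S" by (simp add: adjoin_def)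
  then show "x \<in> F" by induction (use assms in auto)
qed

lemma adjoin_least: "S \<subseteq> adjoin T \<Longrightarrow> adjoin S \<subseteq> adjoin T"
  by (rule adjoin_subset) (auto intro: adjoin_closed)

lemma adjoin_of_nat: "of_nat n \<in> adjoin S"
  by (induction n) (auto intro: adjoin_closed)

lemma adjoin_of_int: "of_int k \<in> adjoin S"
  by (cases k rule: int_cases2) (auto intro: adjoin_closed adjoin_of_nat)

lemma adjoin_divide: "x \<in> adjoin S \<Longrightarrow> y \<in> adjoin S \<Longrightarrow> x / y \<in> adjoin S"
  by (simp add: divide_inverse adjoin_closed)

lemma adjoin_ipoly: "x \<in> adjoin S \<Longrightarrow> ipoly f x \<in> adjoin S"
  by (induction f) (auto simp: of_int_hom.map_poly_pCons_hom intro: adjoin_closed adjoin_of_int)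

lemma adjoin_subfield: "subfield (adjoin S) complex_ring"
  unfolding adjoin_def by (rule field.generate_field_is_subfield[OF field_complex_ring]) simp

lemma Rats_eq_adjoin: "\<rat> = adjoin {}"
proof
  show "adjoin {} \<subseteq> (\<rat> :: complex set)" by (rule adjoin_subset) auto
  show "(\<rat> :: complex set) \<subseteq> adjoin {}"
  proof
    fix x :: complex assume "x \<in> \<rat>"
    then obtain a b where "x = of_int a / of_int b" by (auto elim: Rats_cases')
    then show "x \<in> adjoin {}" by (auto intro: adjoin_divide adjoin_of_int)
  qed
qed

lemma Rats_subfield: "subfield (\<rat> :: complex set) complex_ring"
  unfolding Rats_eq_adjoin by (rule adjoin_subfield)

text \<open>
  Inverses of polynomial expressions in \<open>x\<close> are again of this form up to an integer denominator, since every
  non-zero algebraic integer has a non-zero integer multiple in the ring that it generates.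
\<close>
lemma adjoin_singleton_iff:
  assumes H: "min_int_poly_of H x"
  shows "y \<in> adjoin {x} \<longleftrightarrow> (\<exists>f D. D \<noteq> 0 \<and> degree f < degree H \<and> of_int D * y = ipoly f x)"
proof
  assume "\<exists>f D. D \<noteq> 0 \<and> degree f < degree H \<and> of_int D * y = ipoly f x"
  then obtain f and D :: int where "D \<noteq> 0" "of_int D * y = ipoly f x" by blast
  then have "y = ipoly f x / of_int D" by (simp add: field_simps)
  then show "y \<in> adjoin {x}" by (auto intro: adjoin_divide adjoin_of_int adjoin_ipoly adjoin_closed)
next
  define F where "F = {y. \<exists>f D. D \<noteq> 0 \<and> of_int D * y = ipoly f x}"
  have FI: "y \<in> F" if "D \<noteq> 0" "of_int D * y = ipoly f x" for y D f using that by (auto simp: F_def)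
  have "adjoin {x} \<subseteq> F"
  proof (rule adjoin_subset)
    show "{x} \<subseteq> F" by (auto intro: FI[of 1 _ "[:0,1:]"])
    show "1 \<in> F" by (auto intro: FI[of 1 _ "1"])
    show "- y \<in> F" if "y \<in> F" for y
    proof -
      from that obtain f D where "D \<noteq> 0" "of_int D * y = ipoly f x" by (auto simp: F_def)
      then show ?thesis by (intro FI[of D _ "- f"]) auto
    qed
    fix y z assume "y \<in> F" "z \<in> F"
    then obtain f D g E where *: "D \<noteq> 0" "of_int D * y = ipoly f x" "E \<noteq> 0" "of_int E * z = ipoly g x"
      by (auto simp: F_def)
    have "of_int (D * E) * (y + z) = of_int E * (of_int D * y) + of_int D * (of_int E * z)" by (simp add: algebra_simps)
    also have "\<dots> = ipoly (smult E f + smult D g) x" using * by simp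
    finally show "y + z \<in> F" by (rule FI[rotated]) (use * in auto)
    have "of_int (D * E) * (y * z) = (of_int D * y) * (of_int E * z)" by (simp add: algebra_simps)
    also have "\<dots> = ipoly (f * g) x" using * by simp
    finally show "y * z \<in> F" by (rule FI[rotated]) (use * in auto)
  next
    fix y assume "y \<in> F" "y \<noteq> 0"
    then obtain f D where *: "D \<noteq> 0" "of_int D * y = ipoly f x" by (auto simp: F_def)
    have "algebraic_int (ipoly f x)" by (intro algebraic_int_ipoly min_int_poly_of_algebraic_int[OF H])
    moreover have "ipoly f x \<noteq> 0" using * \<open>y \<noteq> 0\<close> by (metis mult_eq_0_iff of_int_eq_0_iff)
    ultimately obtain S :: "int poly" and c where S: "c \<noteq> 0" "ipoly f x * ipoly S (ipoly f x) = of_int c"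
      by (rule algebraic_int_inverse_multiple)
    have "of_int c * inverse y = of_int D * y * ipoly S (ipoly f x) * inverse y" using S * by simp
    also have "\<dots> = of_int D * ipoly S (ipoly f x)" using \<open>y \<noteq> 0\<close> by simp
    also have "\<dots> = ipoly (smult D (S \<circ>\<^sub>p f)) x" by simp
    finally show "inverse y \<in> F" by (rule FI[OF S(1)])
  qed
  moreover assume "y \<in> adjoin {x}"
  ultimately obtain f D where fD: "D \<noteq> 0" "of_int D * y = ipoly f x" by (auto simp: F_def)
  from min_int_poly_of_reduce[OF H, of f] obtain r where "degree r < degree H" "ipoly f x = ipoly r x" by metis
  with fD show "\<exists>f D. D \<noteq> 0 \<and> degree f < degree H \<and> of_int D * y = ipoly f x" by auto
qed

lemma dimension_power_span:
  assumes H: "min_int_poly_of H x" and "k \<le> degree H"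
  shows "cx.dimension k \<rat> {y. \<exists>f D. D \<noteq> 0 \<and> (\<forall>i\<ge>k. coeff f i = 0) \<and> of_int D * y = ipoly f x}"
  using assms(2)
proof (induction k)
  case 0
  have "{y. \<exists>f D. D \<noteq> 0 \<and> (\<forall>i\<ge>0. coeff f i = 0) \<and> of_int D * y = ipoly f x} = {0}" (is "?A = _")
  proof -
    have "f = 0" if "\<forall>i. coeff f i = (0::int)" for f using that by (simp add: poly_eq_iff)
    then have y0: "y = 0" if "y \<in> ?A" for y using that by force
    have z0: "0 \<in> ?A" by (auto intro!: exI[of _ "0::int poly"] exI[of _ "1::int"])
    show ?thesis
    proof (rule Set.set_eqI, rule iffI)
      fix y assume "y \<in> ?A"
      from y0[OF this] show "y \<in> {0}" by simp
    next
      fix y :: complex assume "y \<in> {0}"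
      then have "y = 0" by simp
      then show "y \<in> ?A" using z0 by (simp only:)
    qed
  qed
  then show ?case using cx.zero_dim by simp
next
  case (Suc k)
  let ?E = "\<lambda>k. {y. \<exists>f D. D \<noteq> 0 \<and> (\<forall>i\<ge>k. coeff f i = 0) \<and> of_int D * y = ipoly f x}"
  have "x ^ k \<notin> ?E k"
  proof
    assume "x ^ k \<in> ?E k"
    then obtain f D where f: "D \<noteq> 0" "\<forall>i\<ge>k. coeff f i = 0" "of_int D * x ^ k = ipoly f x" by blast
    define g where "g = Polynomial.monom D k - f"
    have "ipoly g x = 0" using f by (simp add: g_def)
    moreover have "coeff g i = 0" if "i > k" for i using that f(2) by (simp add: g_def)
    then have "degree g \<le> k" by (intro degree_le) auto
    ultimately have "g = 0" using min_int_poly_of_eq_0[OF H, of g] Suc.prems by simp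
    moreover have "coeff g k = D" using f(2) by (simp add: g_def)
    ultimately show False using f(1) by simp
  qed
  moreover have "cx.line_extension \<rat> (x ^ k) (?E k) = ?E (Suc k)"
  proof (rule Set.set_eqI)
    fix y
    have "y \<in> cx.line_extension \<rat> (x ^ k) (?E k) \<longleftrightarrow> (\<exists>q\<in>\<rat>. \<exists>v\<in>?E k. y = q * x ^ k + v)"
      by (subst cx.line_extension_mem_iff) auto
    also have "\<dots> \<longleftrightarrow> y \<in> ?E (Suc k)"
    proof
      assume "\<exists>q\<in>\<rat>. \<exists>v\<in>?E k. y = q * x ^ k + v"
      then obtain q v f D where q: "q \<in> \<rat>" and v: "y = q * x ^ k + v" "D \<noteq> 0" "\<forall>i\<ge>k. coeff f i = 0" "of_int D * v = ipoly f x"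
        by blast
      from q obtain a b where ab: "b > 0" "q = of_int a / of_int b" by (auto elim: Rats_cases')
      have "of_int (D * b) * y = ipoly (Polynomial.monom (D * a) k + smult b f) x"
        using v(4)[symmetric] ab by (simp add: v(1) field_simps)
      moreover have "\<forall>i\<ge>Suc k. coeff (Polynomial.monom (D * a) k + smult b f) i = 0" using v(3) by simp
      ultimately show "y \<in> ?E (Suc k)" using v(2) ab(1) by (intro CollectI exI[of _ "Polynomial.monom (D * a) k + smult b f"] exI[of _ "D * b"]) auto
    next
      assume "y \<in> ?E (Suc k)"
      then obtain f D where f: "D \<noteq> 0" "\<forall>i\<ge>Suc k. coeff f i = 0" "of_int D * y = ipoly f x" by blast
      define g where "g = f - Polynomial.monom (coeff f k) k"
      have g: "\<forall>i\<ge>k. coeff g i = 0"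
      proof (intro allI impI)
        fix i assume "i \<ge> k"
        then show "coeff g i = 0" using f(2)[rule_format, of i] by (cases "i = k") (auto simp: g_def)
      qed
      have fg: "ipoly f x = of_int (coeff f k) * x ^ k + ipoly g x" by (simp add: g_def)
      have "y - of_int (coeff f k) / of_int D * x ^ k \<in> ?E k"
        using f fg g by (intro CollectI exI[of _ g] exI[of _ D]) (auto simp: field_simps)
      moreover have "y = of_int (coeff f k) / of_int D * x ^ k + (y - of_int (coeff f k) / of_int D * x ^ k)" by simp
      moreover have "(of_int (coeff f k) / of_int D :: complex) \<in> \<rat>" by simp
      ultimately show "\<exists>q\<in>\<rat>. \<exists>v\<in>?E k. y = q * x ^ k + v" by blast
    qed
    finally show "y \<in> cx.line_extension \<rat> (x ^ k) (?E k) \<longleftrightarrow> y \<in> ?E (Suc k)" .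
  qed
  ultimately show ?case using cx.Suc_dim[of "x ^ k" "?E k" k \<rat>] Suc by simp
qed

lemma dimension_adjoin:
  assumes H: "min_int_poly_of H x"
  shows "cx.dimension (degree H) \<rat> (adjoin {x})"
proof -
  have deg: "degree f < degree H \<longleftrightarrow> (\<forall>i\<ge>degree H. coeff f i = 0)" for f :: "int poly"
  proof
    assume "\<forall>i\<ge>degree H. coeff f i = 0"
    then have "degree f \<le> degree H - 1" by (intro degree_le) auto
    then show "degree f < degree H" using min_int_poly_of_degree_pos[OF H] by linarith
  qed (auto simp: coeff_eq_0)
  have "adjoin {x} = {y. \<exists>f D. D \<noteq> 0 \<and> (\<forall>i\<ge>degree H. coeff f i = 0) \<and> of_int D * y = ipoly f x}"
    by (simp only: set_eq_iff mem_Collect_eq adjoin_singleton_iff[OF H] deg simp_thms)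
  then show ?thesis using dimension_power_span[OF H order.refl] by simp
qed

lemma ext_degree_adjoin:
  assumes "min_int_poly_of H x"
  shows "ext_degree \<rat> (adjoin {x}) = degree H"
  unfolding ext_degree_def using cx.dimI[OF Rats_subfield dimension_adjoin[OF assms]]
  by (simp add: over_def)

text \<open>
  The multiplicativity of degrees applies once \<open>L\<close> is known to be finite over \<open>K\<close>; a proper extension has degree at
  least 2 because degree 1 forces equality.
\<close>
lemma ext_degree_tower:
  assumes fin: "cx.dimension d \<rat> (adjoin T)" "cx.dimension e \<rat> (adjoin S)" and sub: "adjoin S \<subset> adjoin T"
  shows "ext_degree \<rat> (adjoin T) = ext_degree \<rat> (adjoin S) * ext_degree (adjoin S) (adjoin T)"
    and "ext_degree (adjoin S) (adjoin T) \<ge> 2"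
proof -
  let ?K = "adjoin S" and ?L = "adjoin T"
  have smult: "k \<otimes>\<^bsub>complex_ring\<^esub> v \<in> ?L" if "k \<in> ?K" "v \<in> ?L" for k v
    using that sub adjoin_closed(5)[of k T v] by auto
  have alg: "subalgebra ?K ?L complex_ring"
    using subring.axioms(1)[OF subfieldE(1)[OF adjoin_subfield]] smult
    by (auto simp: subalgebra_def subalgebra_axioms_def)
  obtain Us where Us: "cx.Span \<rat> Us = ?L"
    using cx.exists_base[OF Rats_subfield fin(1)] by blast
  have "set Us \<subseteq> ?L" using cx.Span_base_incl[OF Rats_subfield, of Us] Us by simp
  have "subalgebra ?K (cx.Span ?K Us) complex_ring"
    by (rule cx.Span_is_subalgebra[OF adjoin_subfield]) simp
  then have "subalgebra \<rat> (cx.Span ?K Us) complex_ring"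
    unfolding subalgebra_def subalgebra_axioms_def Rats_eq_adjoin using adjoin_least[of "{}" S] by blast
  then have "?L \<subseteq> cx.Span ?K Us"
    using cx.subalgebra_Span_incl[OF Rats_subfield _ cx.Span_base_incl[OF adjoin_subfield, of Us S]] Us by simp
  moreover have "cx.Span ?K Us \<subseteq> ?L"
    by (rule cx.subalgebra_Span_incl[OF adjoin_subfield alg \<open>set Us \<subseteq> ?L\<close>])
  ultimately have "?L = cx.Span ?K Us" by blast
  then have finKL: "cx.finite_dimension ?K ?L"
    using cx.Span_finite_dimension[OF adjoin_subfield, of Us S] by simp
  show "ext_degree \<rat> ?L = ext_degree \<rat> ?K * ext_degree ?K ?L"
    using cx.telescopic_base_dim(2)[OF Rats_subfield adjoin_subfield cx.finite_dimensionI[OF fin(2)] finKL]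
    by (simp add: ext_degree_def over_def)
  have dim: "cx.dimension (ext_degree ?K ?L) ?K ?L"
    using cx.finite_dimensionE[OF adjoin_subfield finKL] by (simp add: ext_degree_def over_def)
  show "ext_degree ?K ?L \<ge> 2"
  proof (rule ccontr)
    assume "\<not> ?thesis"
    then consider "ext_degree ?K ?L = 0" | "ext_degree ?K ?L = 1" by linarith
    then show False
    proof cases
      case 1
      then have "?L = {0}" using dim cx.dimension_zero[OF adjoin_subfield] by fastforce
      then show False using adjoin_closed(1)[of T] by simp
    next
      case 2
      then have d1: "cx.dimension 1 ?K ?L" using dim by simp
      obtain Vs where Vs: "length Vs = 1" "cx.Span ?K Vs = ?L"
        using cx.exists_base[OF adjoin_subfield d1] by blast
      have li: "cx.independent ?K [1]"
        by (auto intro!: cx.li_Cons)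
      have "cx.Span ?K [1] = ?K"
        by (auto simp: cx.line_extension_mem_iff)
      moreover have "cx.Span ?K [1] = ?L"
        using cx.independent_length_eq_dimension[OF adjoin_subfield d1 li] adjoin_closed(1)[of T] by simp
      ultimately show False using sub by simp
    qed
  qed
qed

section \<open>Primes modulo which a polynomial splits completely\<close>

declare int.le_trans [trans del] int.trans [trans del]

definition mod_monic :: "int poly \<Rightarrow> int poly \<Rightarrow> int poly" where
  "mod_monic H f = snd (pseudo_divmod f H)"

context
  fixes H :: "int poly" and x :: complex
  assumes H: "min_int_poly_of H x"
begin

lemma mod_monic: "degree (mod_monic H f) < degree H" "H dvd f - mod_monic H f" "ipoly (mod_monic H f) x = ipoly f x"
proof -
  have "H \<noteq> 0" using min_int_poly_of_monic[OF H] by auto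
  from pseudo_divmod[OF this, of f] min_int_poly_of_monic[OF H]
  have *: "f = H * fst (pseudo_divmod f H) + mod_monic H f" "mod_monic H f = 0 \<or> degree (mod_monic H f) < degree H"
    by (auto simp: mod_monic_def prod_eq_iff)
  show "degree (mod_monic H f) < degree H" using *(2) min_int_poly_of_degree_pos[OF H] by auto
  show "H dvd f - mod_monic H f" using *(1) by (metis add_diff_cancel_right' dvd_triv_left)
  have "ipoly f x = ipoly (H * fst (pseudo_divmod f H) + mod_monic H f) x" using *(1) by simp
  then show "ipoly (mod_monic H f) x = ipoly f x" using min_int_poly_of_root[OF H] by simp
qed

lemma mod_monic_eqI:
  assumes "degree r < degree H" "ipoly f x = ipoly r x"
  shows "mod_monic H f = r"
proof -
  have "degree (mod_monic H f - r) < degree H" using mod_monic(1) assms(1) by (rule degree_diff_less)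
  then have "mod_monic H f - r = 0" using assms(2) mod_monic(3) by (intro min_int_poly_of_eq_0[OF H]) simp_all
  then show ?thesis by simp
qed

lemma mod_monic_sum_smult:
  "mod_monic H (\<Sum>a\<in>A. smult (c a) (f a)) = (\<Sum>a\<in>A. smult (c a) (mod_monic H (f a)))"
proof (rule mod_monic_eqI)
  show "degree (\<Sum>a\<in>A. smult (c a) (mod_monic H (f a))) < degree H"
    using mod_monic(1) min_int_poly_of_degree_pos[OF H]
    by (induction A rule: infinite_finite_induct) (auto intro!: degree_add_less intro: order.strict_trans1[OF degree_smult_le])
qed (simp add: mod_monic(3))

lemma mod_monic_eq_0_iff: "mod_monic H f = 0 \<longleftrightarrow> H dvd f"
proof
  assume "H dvd f"
  then have "ipoly f x = 0" using min_int_poly_of_root[OF H] by (auto elim!: dvdE)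
  then show "mod_monic H f = 0" using min_int_poly_of_degree_pos[OF H] by (intro mod_monic_eqI) auto
qed (use mod_monic(2)[of f] in simp)

text \<open>
  The matrix of multiplication by \<open>z\<close> on \<open>\<int>[x]\<close> with respect to the powers of \<open>x\<close>.
\<close>
definition mult_mat :: "int poly \<Rightarrow> int mat" where
  "mult_mat z = mat (degree H) (degree H) (\<lambda>(i,k). coeff (mod_monic H (Polynomial.monom 1 k * z)) i)"

lemma mult_mat_carrier: "mult_mat z \<in> carrier_mat (degree H) (degree H)"
  by (simp add: mult_mat_def)

text \<open>
  A kernel vector would be a non-zero polynomial of small degree whose product with \<open>z\<close> vanishes at \<open>x\<close>.
\<close>
lemma det_mult_mat_nonzero:
  assumes z: "z \<noteq> 0" "degree z < degree H"
  shows "det (mult_mat z) \<noteq> 0"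
proof
  let ?d = "degree H"
  assume "det (mult_mat z) = 0"
  then obtain v where v: "v \<in> carrier_vec ?d" "v \<noteq> 0\<^sub>v ?d" "mult_mat z *\<^sub>v v = 0\<^sub>v ?d"
    using det_0_iff_vec_prod_zero[OF mult_mat_carrier] by blast
  define f where "f = (\<Sum>k<?d. Polynomial.monom (v $ k) k)"
  have cf: "coeff f k = v $ k" if "k < ?d" for k
    using that by (simp add: f_def coeff_sum)
  have degf: "degree f < ?d"
    unfolding f_def using min_int_poly_of_degree_pos[OF H]
    by (intro degree_sum_less) (auto intro: order.strict_trans1[OF degree_monom_le])
  have "coeff (mod_monic H (f * z)) i = 0" for i
  proof (cases "i < ?d")
    case True
    have "f * z = (\<Sum>k<?d. smult (v $ k) (Polynomial.monom 1 k * z))"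
      by (simp add: f_def sum_distrib_right smult_monom flip: mult_smult_left)
    then have "coeff (mod_monic H (f * z)) i = (\<Sum>k<?d. v $ k * coeff (mod_monic H (Polynomial.monom 1 k * z)) i)"
      by (simp add: mod_monic_sum_smult coeff_sum)
    also have "\<dots> = (mult_mat z *\<^sub>v v) $ i"
      using True v(1) by (simp add: mult_mat_def scalar_prod_def atLeast0LessThan mult.commute)
    finally show ?thesis using v(3) True by simp
  next
    case False
    then show ?thesis using mod_monic(1)[of "f * z"] by (intro coeff_eq_0) linarith
  qed
  then have "mod_monic H (f * z) = 0" by (simp add: poly_eq_iff)
  then have "H dvd f * z" by (simp add: mod_monic_eq_0_iff)
  then have "H dvd f \<or> H dvd z" by (rule min_int_poly_of_irreducible_mult[OF H])
  then have "f = 0"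
    using z degf by (metis dvd_imp_degree_le not_le)
  then have "v $ k = 0" if "k < ?d" for k using cf[OF that] by simp
  then show False using v(1,2) by (metis eq_vecI carrier_vecD index_zero_vec)
qed

text \<open>
  This determinant is the norm of the element \<open>z\<close> of \<open>\<int>[x]\<close>; its matrix has entries linear in the coefficients of \<open>z\<close>.
\<close>
lemma det_mult_mat_bound:
  "\<exists>C>0. \<forall>z A. degree z < degree H \<longrightarrow> A \<ge> 0 \<longrightarrow> (\<forall>i. \<bar>coeff z i\<bar> \<le> A) \<longrightarrow> \<bar>det (mult_mat z)\<bar> \<le> C * A ^ degree H"
proof -
  let ?d = "degree H"
  define K where "K = (\<Sum>m<2 * ?d. \<Sum>i<?d. \<bar>coeff (mod_monic H (Polynomial.monom 1 m)) i\<bar>)"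
  have K: "\<bar>coeff (mod_monic H (Polynomial.monom 1 m)) i\<bar> \<le> K" if "m < 2 * ?d" "i < ?d" for m i
  proof -
    have "\<bar>coeff (mod_monic H (Polynomial.monom 1 m)) i\<bar> \<le> (\<Sum>i<?d. \<bar>coeff (mod_monic H (Polynomial.monom 1 m)) i\<bar>)"
      using that(2) by (intro member_le_sum[of i]) auto
    also have "\<dots> \<le> K" unfolding K_def using that(1) by (intro member_le_sum[of m]) (auto intro: sum_nonneg)
    finally show ?thesis .
  qed
  have K0: "K \<ge> 0" unfolding K_def by (intro sum_nonneg) auto
  have bound: "\<bar>det (mult_mat z)\<bar> \<le> (fact ?d * (int ?d * K) ^ ?d + 1) * A ^ ?d"
    if z: "degree z < ?d" and A: "A \<ge> 0" "\<And>i. \<bar>coeff z i\<bar> \<le> A" for z A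
  proof -
    have entry: "\<bar>mult_mat z $$ (i, k)\<bar> \<le> int ?d * K * A" if ik: "i < ?d" "k < ?d" for i k
    proof -
      have "z = (\<Sum>j<?d. smult (coeff z j) (Polynomial.monom 1 j))"
        using poly_as_sum_of_monoms'[of z "?d - 1"] z by (simp add: smult_monom lessThan_Suc_atMost[symmetric] Suc_diff_1 del: lessThan_Suc_atMost) 
      then have "Polynomial.monom 1 k * z = (\<Sum>j<?d. smult (coeff z j) (Polynomial.monom 1 (k + j)))"
        by (metis (no_types, lifting) mult_monom mult_smult_right sum.cong sum_distrib_left mult_1)
      then have "mult_mat z $$ (i, k) = (\<Sum>j<?d. coeff z j * coeff (mod_monic H (Polynomial.monom 1 (k + j))) i)"
        using ik by (simp add: mult_mat_def mod_monic_sum_smult coeff_sum)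
      also have "\<bar>\<dots>\<bar> \<le> (\<Sum>j<?d. A * K)"
        using ik A K K0 by (intro order.trans[OF sum_abs] sum_mono) (auto simp: abs_mult intro!: mult_mono)
      finally show ?thesis by (simp add: mult_ac)
    qed
    have "\<bar>det (mult_mat z)\<bar> \<le> (\<Sum>p | p permutes {0..<?d}. \<bar>signof p * (\<Prod>i = 0..<?d. mult_mat z $$ (i, p i))\<bar>)"
      unfolding det_def'[OF mult_mat_carrier] by (rule sum_abs)
    also have "\<dots> \<le> (\<Sum>p | p permutes {0..<?d}. (int ?d * K * A) ^ ?d)"
    proof (intro sum_mono)
      fix p assume p: "p \<in> {p. p permutes {0..<?d}}"
      have "\<bar>signof p * (\<Prod>i = 0..<?d. mult_mat z $$ (i, p i))\<bar> = (\<Prod>i = 0..<?d. \<bar>mult_mat z $$ (i, p i)\<bar>)"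
        by (simp add: abs_mult abs_prod sign_def)
      also have "\<dots> \<le> (\<Prod>i = 0..<?d. int ?d * K * A)"
        using p permutes_in_image[of p "{0..<?d}"] by (intro prod_mono) (auto intro!: entry)
      finally show "\<bar>signof p * (\<Prod>i = 0..<?d. mult_mat z $$ (i, p i))\<bar> \<le> (int ?d * K * A) ^ ?d" by simp
    qed
    also have "\<dots> = fact ?d * (int ?d * K) ^ ?d * A ^ ?d"
      by (simp add: card_permutations power_mult_distrib)
    also have "\<dots> \<le> (fact ?d * (int ?d * K) ^ ?d + 1) * A ^ ?d"
      using A by (intro mult_right_mono) auto
    finally show ?thesis .
  qed
  have "fact ?d * (int ?d * K) ^ ?d + 1 > 0"
    using K0 by (intro add_nonneg_pos mult_nonneg_nonneg) auto
  then show ?thesis using bound by (intro exI[of _ "fact ?d * (int ?d * K) ^ ?d + 1"]) auto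
qed

text \<open>
  When \<open>H\<close> has all its roots \<open>c\<close> modulo \<open>p\<close>, multiplication by \<open>z\<close> is diagonalized modulo \<open>p\<close> by evaluation at these
  roots, so each root of \<open>z\<close> among them contributes a factor \<open>p\<close> to the norm.  The Vandermonde matrix \<open>V\<close> has
  determinant prime to \<open>p\<close>, which replaces working over the residue field.
\<close>
lemma det_mult_mat_dvd:
  assumes p: "prime (p::nat)" and R: "finite R" "card R = degree H" "R \<subseteq> {0..<int p}" "\<And>c. c \<in> R \<Longrightarrow> int p dvd poly H c"
  shows "int p ^ card {c\<in>R. int p dvd poly z c} dvd det (mult_mat z)"
proof -
  let ?d = "degree H"
  obtain r where r: "bij_betw r {..<?d} R" using ex_bij_betw_nat_finite[OF R(1)] R(2) by (auto simp: atLeast0LessThan)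
  have rR: "r i \<in> R" if "i < ?d" for i using r that by (auto simp: bij_betw_def)
  define V where "V = mat ?d ?d (\<lambda>(c,i). r c ^ i)"
  define w where "w c' = (\<Prod>c\<in>{..<?d} - {c'}. [:- r c, 1:])" for c'
  define W where "W = mat ?d ?d (\<lambda>(i,c'). coeff (w c') i)"
  have V: "V \<in> carrier_mat ?d ?d" and W: "W \<in> carrier_mat ?d ?d" by (simp_all add: V_def W_def)
  have Vrow: "(\<Sum>i<?d. r c ^ i * coeff f i) = poly f (r c)" if "degree f < ?d" for f c
  proof -
    have "poly f (r c) = (\<Sum>i\<le>degree f. coeff f i * r c ^ i)" by (rule poly_altdef)
    also have "\<dots> = (\<Sum>i<?d. coeff f i * r c ^ i)" using that by (intro sum.mono_neutral_left) (auto simp: coeff_eq_0)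
    finally show ?thesis by (simp add: mult.commute)
  qed
  have degw: "degree (w c) < ?d" if "c < ?d" for c
  proof -
    have "degree (w c) \<le> (\<Sum>c\<in>{..<?d} - {c}. 1)" unfolding w_def
      by (rule order.trans[OF degree_prod_sum_le]) auto
    also have "\<dots> < ?d" using that by simp
    finally show ?thesis .
  qed
  have "V * W = mat ?d ?d (\<lambda>(c,c'). poly (w c') (r c))"
  proof (rule eq_matI)
    fix c c' assume "c < dim_row (mat ?d ?d (\<lambda>(c,c'). poly (w c') (r c)))" "c' < dim_col (mat ?d ?d (\<lambda>(c,c'). poly (w c') (r c)))"
    then show "(V * W) $$ (c, c') = mat ?d ?d (\<lambda>(c,c'). poly (w c') (r c)) $$ (c, c')"
      using Vrow[OF degw, of c' c] by (simp add: V_def W_def scalar_prod_def atLeast0LessThan)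
  qed (simp_all add: V_def W_def)
  then have "det V * det W = det (mat ?d ?d (\<lambda>(c,c'). poly (w c') (r c)))"
    using det_mult[OF V W] by simp
  also have "\<dots> = prod_list (diag_mat (mat ?d ?d (\<lambda>(c,c'). poly (w c') (r c))))"
  proof (rule det_upper_triangular[of _ ?d])
    have "poly (w c') (r c) = 0" if "c < ?d" "c \<noteq> c'" for c c'
      unfolding w_def poly_prod using that by (intro prod_zero bexI[of _ c]) auto
    then show "upper_triangular (mat ?d ?d (\<lambda>(c,c'). poly (w c') (r c)))" by (auto simp: upper_triangular_def)
  qed simp
  also have "\<dots> = (\<Prod>c<?d. poly (w c) (r c))" by (simp add: prod_list_diag_prod atLeast0LessThan)
  finally have VW: "det V * det W = (\<Prod>c<?d. poly (w c) (r c))" .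
  have pp: "prime (int p)" using p by simp
  have "\<not> int p dvd det V"
  proof
    assume "int p dvd det V"
    then have "int p dvd (\<Prod>c<?d. poly (w c) (r c))" unfolding VW[symmetric] by simp
    then obtain c where c: "c < ?d" "int p dvd poly (w c) (r c)" by (auto simp: prime_dvd_prod_iff[OF _ pp])
    then have "int p dvd (\<Prod>c'\<in>{..<?d} - {c}. r c - r c')" by (simp add: w_def poly_prod)
    then obtain c' where c': "c' < ?d" "c' \<noteq> c" "int p dvd r c - r c'" by (auto simp: prime_dvd_prod_iff[OF _ pp])
    have "r c \<in> {0..<int p}" "r c' \<in> {0..<int p}" using rR c(1) c'(1) R(3) by blast+
    then have "r c = r c'" using c'(3) by (metis atLeastLessThan_iff mod_eq_dvd_iff mod_pos_pos_trivial)
    then show False using r c(1) c' by (auto simp: bij_betw_def inj_on_def)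
  qed
  then have cop: "coprime (int p ^ k) (det V)" for k using pp by (simp add: prime_imp_coprime)
  define Good where "Good = {c. c < ?d \<and> int p dvd poly z (r c)}"
  have cardG: "card Good = card {c\<in>R. int p dvd poly z c}"
  proof (rule bij_betw_same_card[of r])
    show "bij_betw r Good {c\<in>R. int p dvd poly z c}"
      using r unfolding Good_def bij_betw_def inj_on_def by auto
  qed
  have VM: "V * mult_mat z = mat ?d ?d (\<lambda>(c,k). poly (mod_monic H (Polynomial.monom 1 k * z)) (r c))"
  proof (rule eq_matI)
    fix c k assume "c < dim_row (mat ?d ?d (\<lambda>(c,k). poly (mod_monic H (Polynomial.monom 1 k * z)) (r c)))"
      "k < dim_col (mat ?d ?d (\<lambda>(c,k). poly (mod_monic H (Polynomial.monom 1 k * z)) (r c)))"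
    then show "(V * mult_mat z) $$ (c, k) = mat ?d ?d (\<lambda>(c,k). poly (mod_monic H (Polynomial.monom 1 k * z)) (r c)) $$ (c, k)"
      using Vrow[OF mod_monic(1), of c] by (simp add: V_def mult_mat_def scalar_prod_def atLeast0LessThan)
  qed (simp_all add: V_def mult_mat_def)
  have row: "int p dvd poly (mod_monic H (Polynomial.monom 1 k * z)) (r c)" if "c \<in> Good" for c k
  proof -
    have c: "c < ?d" "int p dvd poly z (r c)" using that by (auto simp: Good_def)
    obtain q where "Polynomial.monom 1 k * z - mod_monic H (Polynomial.monom 1 k * z) = H * q" using mod_monic(2) by blast
    then have "mod_monic H (Polynomial.monom 1 k * z) = Polynomial.monom 1 k * z - H * q" by (simp add: algebra_simps)
    then show ?thesis using c(2) R(4)[OF rR[OF c(1)]] by (simp add: dvd_diff)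
  qed
  have "int p ^ card Good dvd det (V * mult_mat z)"
    unfolding VM det_def'[OF mat_carrier]
  proof (intro dvd_sum dvd_mult)
    fix q assume q: "q \<in> {q. q permutes {0..<?d}}"
    let ?t = "\<lambda>c. poly (mod_monic H (Polynomial.monom 1 (q c) * z)) (r c)"
    have "(\<Prod>c = 0..<?d. mat ?d ?d (\<lambda>(c,k). poly (mod_monic H (Polynomial.monom 1 k * z)) (r c)) $$ (c, q c)) = (\<Prod>c = 0..<?d. ?t c)"
      using q permutes_in_image[of q "{0..<?d}"] by (intro prod.cong) auto
    also have "\<dots> = (\<Prod>c\<in>Good. ?t c) * (\<Prod>c\<in>{0..<?d} - Good. ?t c)"
      by (subst prod.subset_diff[of Good]) (auto simp: Good_def)
    finally have e: "(\<Prod>c = 0..<?d. mat ?d ?d (\<lambda>(c,k). poly (mod_monic H (Polynomial.monom 1 k * z)) (r c)) $$ (c, q c))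
        = (\<Prod>c\<in>Good. ?t c) * (\<Prod>c\<in>{0..<?d} - Good. ?t c)" .
    have "(\<Prod>c\<in>Good. int p) dvd (\<Prod>c\<in>Good. ?t c)" by (intro prod_dvd_prod row)
    then show "int p ^ card Good dvd (\<Prod>c = 0..<?d. mat ?d ?d (\<lambda>(c,k). poly (mod_monic H (Polynomial.monom 1 k * z)) (r c)) $$ (c, q c))"
      unfolding e by simp
  qed
  then have "int p ^ card Good dvd det V * det (mult_mat z)" using det_mult[OF V mult_mat_carrier] by simp
  then show ?thesis unfolding cardG[symmetric] using cop by (simp add: coprime_dvd_mult_right_iff)
qed

end


lemma sum_of_squares_ge:
  fixes f :: "'a \<Rightarrow> real"
  assumes "finite I" "I \<noteq> {}"
  shows "(\<Sum>i\<in>I. f i)\<^sup>2 / card I \<le> (\<Sum>i\<in>I. (f i)\<^sup>2)"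
proof -
  define m where "m = (\<Sum>i\<in>I. f i) / card I"
  have c: "real (card I) > 0" using assms by (simp add: card_gt_0_iff)
  have "0 \<le> (\<Sum>i\<in>I. (f i - m)\<^sup>2)" by (intro sum_nonneg) auto
  also have "\<dots> = (\<Sum>i\<in>I. (f i)\<^sup>2 - (2 * m) * f i + m\<^sup>2)" by (intro sum.cong) (simp_all add: power2_diff)
  also have "\<dots> = (\<Sum>i\<in>I. (f i)\<^sup>2) - 2 * m * (\<Sum>i\<in>I. f i) + card I * m\<^sup>2"
    unfolding sum.distrib sum_subtractf sum_distrib_left[symmetric] by simp
  also have "\<dots> = (\<Sum>i\<in>I. (f i)\<^sup>2) - (\<Sum>i\<in>I. f i)\<^sup>2 / card I"
    using c by (simp add: m_def power2_eq_square field_simps)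
  finally show ?thesis by simp
qed

text \<open>
  By the Cauchy-Schwarz inequality, the number of coincidences is least when the fibres have equal size.
\<close>
lemma card_collisions_ge:
  assumes "finite B" "finite I" "I \<noteq> {}" "h ` B \<subseteq> I"
  shows "(real (card B))\<^sup>2 / card I \<le> card {(a,b)\<in>B \<times> B. h a = h b}"
proof -
  have "{(a,b)\<in>B \<times> B. h a = h b} = (\<Union>r\<in>I. {a\<in>B. h a = r} \<times> {a\<in>B. h a = r})"
    using assms(4) by auto
  also have "card \<dots> = (\<Sum>r\<in>I. card ({a\<in>B. h a = r} \<times> {a\<in>B. h a = r}))"
    using assms by (intro card_UN_disjoint) auto
  finally have 1: "real (card {(a,b)\<in>B \<times> B. h a = h b}) = (\<Sum>r\<in>I. (real (card {a\<in>B. h a = r}))\<^sup>2)"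
    by (simp add: card_cartesian_product power2_eq_square)
  have "B = (\<Union>r\<in>I. {a\<in>B. h a = r})" using assms(4) by auto
  then have "card B = card (\<Union>r\<in>I. {a\<in>B. h a = r})" by simp
  also have "\<dots> = (\<Sum>r\<in>I. card {a\<in>B. h a = r})"
    using assms by (intro card_UN_disjoint) auto
  finally have "real (card B) = (\<Sum>r\<in>I. real (card {a\<in>B. h a = r}))" by simp
  then show ?thesis unfolding 1 using sum_of_squares_ge[OF assms(2,3)] by simp
qed

lemma prod_prime_powers_dvd:
  fixes D :: int
  assumes "finite T" "\<And>p. p \<in> T \<Longrightarrow> prime (p::nat)" "\<And>p. p \<in> T \<Longrightarrow> int p ^ k p dvd D"
  shows "(\<Prod>p\<in>T. int p ^ k p) dvd D"
  using assms
proof (induction T rule: finite_induct)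
  case (insert p T)
  have "coprime (int p ^ k p) (\<Prod>q\<in>T. int q ^ k q)"
    using insert by (intro prod_coprime_right) (auto intro!: primes_coprime)
  with insert show ?case by (simp add: divides_mult)
qed simp

definition box_poly :: "nat \<Rightarrow> (nat \<Rightarrow> int) \<Rightarrow> int poly" where
  "box_poly d a = (\<Sum>i<d. Polynomial.monom (a i) i)"

lemma coeff_box_poly: "coeff (box_poly d a) i = (if i < d then a i else 0)"
  by (simp add: box_poly_def coeff_sum)

lemma degree_box_poly: "d > 0 \<Longrightarrow> degree (box_poly d a) < d"
proof -
  assume "d > 0"
  moreover have "degree (box_poly d a) \<le> d - 1" by (rule degree_le) (auto simp: coeff_box_poly)
  ultimately show ?thesis by linarith
qed

lemma box_poly_inj: "inj_on (box_poly d) (PiE {..<d} A)"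
proof (rule inj_onI)
  fix a b assume ab: "a \<in> PiE {..<d} A" "b \<in> PiE {..<d} A" and e: "box_poly d a = box_poly d b"
  show "a = b"
  proof (rule PiE_ext[OF ab])
    fix i assume "i \<in> {..<d}"
    then show "a i = b i" using arg_cong[OF e, of "\<lambda>f. coeff f i"] by (simp add: coeff_box_poly)
  qed
qed

text \<open>
  Consider the polynomials of degree below \<open>d\<close> with coefficients in a box of side \<open>A\<close>, where \<open>A\<^sup>d\<close> is about \<open>y\<close>.
  For each root \<open>c\<close> modulo \<open>p\<close>, about \<open>A\<^sup>2\<^sup>d / p\<close> pairs agree at \<open>c\<close> modulo \<open>p\<close>.  Every such coincidence puts a
  factor \<open>p\<close> into the norm of the difference, and this norm is at most a constant times \<open>A\<^sup>d\<close>.  Comparing the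
  logarithms summed over all pairs bounds \<open>d\<close> times the sum of \<open>ln p / p\<close> by \<open>ln y + O(1)\<close>.
\<close>
theorem totally_split_primes_upper:
  fixes R :: "nat \<Rightarrow> int set"
  assumes H: "min_int_poly_of H x"
    and S: "\<And>p. p \<in> S \<Longrightarrow> prime p"
    and R: "\<And>p. p \<in> S \<Longrightarrow> finite (R p) \<and> card (R p) = degree H \<and> R p \<subseteq> {0..<int p} \<and> (\<forall>c\<in>R p. int p dvd poly H c)"
  shows "\<exists>C. \<forall>y\<ge>2. (\<Sum>p | p \<in> S \<and> p \<le> y. ln (real p) / real p) \<le> ln (real y) / real (degree H) + C"
proof -
  define d where "d = degree H"
  have d: "d > 0" using min_int_poly_of_degree_pos[OF H] by (simp add: d_def)
  obtain C where C: "C > 0" "\<And>z A. degree z < d \<Longrightarrow> A \<ge> 0 \<Longrightarrow> (\<And>i. \<bar>coeff z i\<bar> \<le> A) \<Longrightarrow> \<bar>det (mult_mat H z)\<bar> \<le> C * A ^ d"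
    using det_mult_mat_bound[OF H] unfolding d_def by blast
  have main: "(\<Sum>p | p \<in> S \<and> p \<le> y. ln (real p) / real p) \<le> ln (real A) + ln (real_of_int C) / d + 3 * ln 4"
    if A: "A > 0" and y: "y \<le> A ^ d" for A y
  proof -
    define B where "B = PiE {..<d} (\<lambda>_. {0..<int A})"
    define T where "T = {p. p \<in> S \<and> p \<le> y}"
    define N where "N p c = card {q\<in>B \<times> B. fst q \<noteq> snd q \<and> int p dvd poly (box_poly d (fst q) - box_poly d (snd q)) c}" for p :: nat and c
    have finT: "finite T" unfolding T_def by (rule finite_subset[of _ "{..y}"]) auto
    have finB: "finite B" by (simp add: B_def finite_PiE)
    have cardB: "card B = A ^ d" by (simp add: B_def card_PiE)
    have prT: "prime p" if "p \<in> T" for p using that S by (simp add: T_def)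
    have RT: "finite (R p)" "card (R p) = d" if "p \<in> T" for p using that R by (auto simp: T_def d_def)
    have lower: "(real (A ^ d))\<^sup>2 / p - real (A ^ d) \<le> N p c" if p: "p \<in> T" for p c
    proof -
      let ?h = "\<lambda>a. poly (box_poly d a) c mod int p"
      have p0: "p > 0" using prT[OF p] prime_gt_0_nat by blast
      have "(real (card B))\<^sup>2 / card {0..<int p} \<le> card {(a,b)\<in>B \<times> B. ?h a = ?h b}"
        by (rule card_collisions_ge[OF finB]) (use p0 in auto)
      also have "{(a,b)\<in>B \<times> B. ?h a = ?h b} \<subseteq> {q\<in>B \<times> B. fst q \<noteq> snd q \<and> int p dvd poly (box_poly d (fst q) - box_poly d (snd q)) c} \<union> (\<lambda>a. (a,a)) ` B"
        by (auto simp: mod_eq_dvd_iff)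
      then have "card {(a,b)\<in>B \<times> B. ?h a = ?h b} \<le> card ({q\<in>B \<times> B. fst q \<noteq> snd q \<and> int p dvd poly (box_poly d (fst q) - box_poly d (snd q)) c} \<union> (\<lambda>a. (a,a)) ` B)"
        using finB by (intro card_mono) (auto intro: finite_subset[of _ "B \<times> B"])
      also have "\<dots> \<le> N p c + card ((\<lambda>a. (a,a)) ` B)" unfolding N_def by (rule card_Un_le)
      also have "\<dots> \<le> N p c + card B" using card_image_le[OF finB] by simp
      finally show ?thesis by (simp add: cardB)
    qed
    have inner: "(\<Sum>p\<in>T. ln (real p) * card {c\<in>R p. int p dvd poly (box_poly d a - box_poly d b) c}) \<le> ln (real_of_int C) + d * ln (real A)"
      if ab: "a \<in> B" "b \<in> B" "a \<noteq> b" for a b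
    proof -
      define z where "z = box_poly d a - box_poly d b"
      define k where "k p = card {c\<in>R p. int p dvd poly z c}" for p
      have z: "degree z < d" unfolding z_def by (intro degree_diff_less degree_box_poly d)
      have "z \<noteq> 0" using ab inj_onD[OF box_poly_inj[of d "\<lambda>_. {0..<int A}"]] by (auto simp: z_def B_def)
      have "(\<Prod>p\<in>T. int p ^ k p) dvd det (mult_mat H z)"
      proof (rule prod_prime_powers_dvd[OF finT prT])
        fix p assume "p \<in> T"
        then show "int p ^ k p dvd det (mult_mat H z)" unfolding k_def
          using R S by (intro det_mult_mat_dvd[OF H]) (auto simp: T_def)
      qed
      moreover have "det (mult_mat H z) \<noteq> 0" using det_mult_mat_nonzero[OF H \<open>z \<noteq> 0\<close>] z by (simp add: d_def)
      ultimately have "(\<Prod>p\<in>T. int p ^ k p) \<le> \<bar>det (mult_mat H z)\<bar>"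
        by (intro zdvd_imp_le) auto
      also have "\<bar>det (mult_mat H z)\<bar> \<le> C * int A ^ d"
      proof (rule C(2)[OF z])
        fix i
        show "\<bar>coeff z i\<bar> \<le> int A"
        proof (cases "i < d")
          case True
          then have "a i \<in> {0..<int A}" "b i \<in> {0..<int A}"
            using PiE_mem[of a "{..<d}" _ i] PiE_mem[of b "{..<d}" _ i] ab(1,2) unfolding B_def by blast+
          then have "\<bar>a i - b i\<bar> \<le> int A" unfolding atLeastLessThan_iff by linarith
          then show ?thesis using True by (simp add: z_def coeff_box_poly)
        qed (simp add: z_def coeff_box_poly)
      qed simp
      finally have le: "(\<Prod>p\<in>T. int p ^ k p) \<le> C * int A ^ d" .
      have pos: "(\<Prod>p\<in>T. int p ^ k p) > 0" using prT prime_gt_0_nat by (intro prod_pos) auto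
      have "(\<Sum>p\<in>T. ln (real p) * k p) = ln (\<Prod>p\<in>T. real p ^ k p)"
        using prT finT by (subst ln_prod) (auto simp: ln_realpow prime_gt_0_nat mult.commute intro!: sum.cong)
      also have "(\<Prod>p\<in>T. real p ^ k p) = real_of_int (\<Prod>p\<in>T. int p ^ k p)" by simp
      also have "ln (real_of_int (\<Prod>p\<in>T. int p ^ k p)) \<le> ln (real_of_int (C * int A ^ d))"
        using le pos C(1) A by (subst ln_le_cancel_iff) (auto simp del: of_int_prod of_int_mult)
      also have "\<dots> = ln (real_of_int C) + d * ln (real A)" using C(1) A by (simp add: ln_mult ln_realpow)
      finally show ?thesis by (simp add: k_def z_def)
    qed
    define D where "D = {q\<in>B \<times> B. fst q \<noteq> snd q}"
    have finD: "finite D" unfolding D_def using finB by simp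
    have NP: "real (N p c) = (\<Sum>q\<in>D. if int p dvd poly (box_poly d (fst q) - box_poly d (snd q)) c then 1 else 0)" for p c
    proof -
      have "{q\<in>B \<times> B. fst q \<noteq> snd q \<and> int p dvd poly (box_poly d (fst q) - box_poly d (snd q)) c}
          = {q\<in>D. int p dvd poly (box_poly d (fst q) - box_poly d (snd q)) c}"
        unfolding D_def by (simp only: mem_Collect_eq conj_assoc)
      then have "real (N p c) = (\<Sum>q\<in>{q\<in>D. int p dvd poly (box_poly d (fst q) - box_poly d (snd q)) c}. 1)" by (simp add: N_def)
      also have "\<dots> = (\<Sum>q\<in>D. if int p dvd poly (box_poly d (fst q) - box_poly d (snd q)) c then 1 else 0)"
        by (rule sum.inter_filter[OF finD])
      finally show ?thesis .
    qed
    let ?Q = "(real (A ^ d))\<^sup>2"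
    have "(\<Sum>p\<in>T. d * (ln (real p) * (?Q / p - real (A ^ d)))) \<le> (\<Sum>p\<in>T. \<Sum>c\<in>R p. ln (real p) * N p c)"
    proof (intro sum_mono)
      fix p assume p: "p \<in> T"
      have lp: "ln (real p) \<ge> 0" using prT[OF p] prime_gt_0_nat[of p] by (intro ln_ge_zero) auto
      have "(\<Sum>c\<in>R p. ln (real p) * (?Q / p - real (A ^ d))) \<le> (\<Sum>c\<in>R p. ln (real p) * N p c)"
        by (intro sum_mono mult_left_mono lower p lp)
      then show "d * (ln (real p) * (?Q / p - real (A ^ d))) \<le> (\<Sum>c\<in>R p. ln (real p) * N p c)"
        using RT[OF p] by simp
    qed
    also have "\<dots> = (\<Sum>p\<in>T. \<Sum>c\<in>R p. \<Sum>q\<in>D. ln (real p) * (if int p dvd poly (box_poly d (fst q) - box_poly d (snd q)) c then 1 else 0))"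
      by (simp only: NP sum_distrib_left)
    also have "\<dots> = (\<Sum>p\<in>T. \<Sum>q\<in>D. \<Sum>c\<in>R p. ln (real p) * (if int p dvd poly (box_poly d (fst q) - box_poly d (snd q)) c then 1 else 0))"
      by (intro sum.cong refl sum.swap)
    also have "\<dots> = (\<Sum>q\<in>D. \<Sum>p\<in>T. \<Sum>c\<in>R p. ln (real p) * (if int p dvd poly (box_poly d (fst q) - box_poly d (snd q)) c then 1 else 0))"
      by (rule sum.swap)
    also have "\<dots> = (\<Sum>q\<in>D. \<Sum>p\<in>T. ln (real p) * card {c\<in>R p. int p dvd poly (box_poly d (fst q) - box_poly d (snd q)) c})"
    proof (intro sum.cong refl)
      fix q p assume "p \<in> T"
      then have "finite (R p)" by (rule RT)
      then show "(\<Sum>c\<in>R p. ln (real p) * (if int p dvd poly (box_poly d (fst q) - box_poly d (snd q)) c then 1 else 0))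
        = ln (real p) * card {c\<in>R p. int p dvd poly (box_poly d (fst q) - box_poly d (snd q)) c}"
        by (simp add: sum_distrib_left[symmetric] sum.inter_filter[symmetric])
    qed
    also have "\<dots> \<le> (\<Sum>q\<in>D. ln (real_of_int C) + d * ln (real A))"
      by (intro sum_mono inner) (simp_all add: D_def mem_Times_iff)
    also have "\<dots> = real (card D) * (ln (real_of_int C) + d * ln (real A))" by simp
    also have "\<dots> \<le> ?Q * (ln (real_of_int C) + d * ln (real A))"
    proof (intro mult_right_mono)
      have "card D \<le> card (B \<times> B)" using finB by (intro card_mono) (simp_all add: D_def subset_iff)
      then have "card D \<le> (A ^ d)\<^sup>2" by (simp add: cardB card_cartesian_product power2_eq_square)
      then show "real (card D) \<le> ?Q" by (metis of_nat_le_iff of_nat_power)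
      have "C \<ge> 1" using C(1) by simp
      then show "0 \<le> ln (real_of_int C) + d * ln (real A)" using A by (intro add_nonneg_nonneg ln_ge_zero mult_nonneg_nonneg) auto
    qed
    finally have fin: "(\<Sum>p\<in>T. d * (ln (real p) * (?Q / p - real (A ^ d)))) \<le> ?Q * (ln (real_of_int C) + d * ln (real A))" .
    define s where "s = (\<Sum>p\<in>T. ln (real p) / real p)"
    define t where "t = (\<Sum>p\<in>T. ln (real p))"
    have split: "(\<Sum>p\<in>T. d * (ln (real p) * (?Q / p - real (A ^ d)))) = d * (?Q * s) - d * (real (A ^ d) * t)"
      unfolding s_def t_def by (simp add: sum_distrib_left sum_subtractf right_diff_distrib mult_ac)
    have "t \<le> (\<Sum>p | prime p \<and> p \<le> y. ln (real p))"
      unfolding t_def T_def using S by (intro sum_mono2) (auto intro: finite_subset[of _ "{..y}"] dest: prime_gt_0_nat intro!: ln_ge_zero)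
    also have "\<dots> \<le> 3 * ln 4 * real y" by (rule chebyshev_theta_upper)
    also have "\<dots> \<le> 3 * ln 4 * real (A ^ d)" using y by (intro mult_left_mono) (auto simp del: of_nat_power)
    finally have t: "t \<le> 3 * ln 4 * real (A ^ d)" .
    have M: "real (A ^ d) > 0" using A by simp
    have "d * (?Q * s) \<le> ?Q * (ln (real_of_int C) + d * ln (real A)) + d * (real (A ^ d) * t)"
      using fin unfolding split by linarith
    also have "d * (real (A ^ d) * t) \<le> d * (real (A ^ d) * (3 * ln 4 * real (A ^ d)))"
      using t M by (intro mult_left_mono) auto
    finally have "?Q * (d * s) \<le> ?Q * (ln (real_of_int C) + d * ln (real A) + d * (3 * ln 4))"
      by (simp add: algebra_simps power2_eq_square)
    then have "d * s \<le> ln (real_of_int C) + d * ln (real A) + d * (3 * ln 4)"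
      using M by (subst (asm) mult_le_cancel_left_pos) auto
    then have "s \<le> (ln (real_of_int C) + d * ln (real A) + d * (3 * ln 4)) / d"
      using d by (subst pos_le_divide_eq) (simp_all add: mult.commute)
    also have "\<dots> = ln (real A) + ln (real_of_int C) / d + 3 * ln 4" using d by (simp add: add_divide_distrib)
    finally show ?thesis by (simp add: s_def T_def)
  qed
  show ?thesis
  proof (intro exI allI impI)
    fix y :: nat assume y: "y \<ge> 2"
    define A where "A = nat \<lceil>real y powr (1 / d)\<rceil>"
    have p1: "real y powr (1 / d) \<ge> 1" using y by (intro ge_one_powr_ge_zero) auto
    have A1: "real y powr (1 / d) \<le> real A" "real A \<le> 2 * real y powr (1 / d)"
      using p1 by (simp_all add: A_def) linarith+
    have "real A \<ge> 1" using A1(1) p1 by linarith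
    then have A0: "A > 0" by simp
    have "real y = (real y powr (1 / d)) ^ d"
      using y d by (simp add: powr_realpow[symmetric] powr_powr)
    also have "\<dots> \<le> real A ^ d" using A1(1) by (intro power_mono) auto
    finally have "real y \<le> real (A ^ d)" by simp
    then have yA: "y \<le> A ^ d" by (simp only: of_nat_le_iff)
    from main[OF A0 yA] have "(\<Sum>p | p \<in> S \<and> p \<le> y. ln (real p) / real p) \<le> ln (real A) + ln (real_of_int C) / d + 3 * ln 4" .
    also have "ln (real A) \<le> ln (2 * real y powr (1 / d))" using A1 A0 y by (subst ln_le_cancel_iff) auto
    also have "\<dots> = ln 2 + ln (real y) / d" using y by (simp add: ln_mult ln_powr)
    finally show "(\<Sum>p | p \<in> S \<and> p \<le> y. ln (real p) / real p) \<le> ln (real y) / real (degree H) + (ln 2 + ln (real_of_int C) / d + 3 * ln 4)"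
      by (simp add: d_def)
  qed
qed

section \<open>Irreducibility of cyclotomic polynomials\<close>

lemma fermat_little_int:
  fixes a :: int
  assumes p: "prime p"
  shows "[a ^ p = a] (mod int p)"
proof -
  have p0: "p > 0" by (rule prime_gt_0_nat[OF p])
  define b where "b = nat (a mod int p)"
  have ab: "[a = int b] (mod int p)" using p0 by (simp add: b_def Cong.cong_def)
  have "[b ^ p = b] (mod p)"
  proof (cases "p dvd b")
    case True
    then have "p dvd b ^ p" using p0 by (simp add: dvd_power_iff_le dvd_trans[OF True dvd_power])
    then have "[b ^ p = 0] (mod p)" "[b = 0] (mod p)" using True by (simp_all add: cong_0_iff)
    then show ?thesis using cong_trans cong_sym by blast
  next
    case False
    have "[b * b ^ (p - 1) = b * 1] (mod p)" by (rule cong_mult[OF cong_refl fermat_theorem[OF p False]])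
    moreover have "b * b ^ (p - 1) = b ^ p" using p0 by (simp add: power_eq_if)
    ultimately show ?thesis by simp
  qed
  then have "[int (b ^ p) = int b] (mod int p)" by (simp only: cong_int_iff)
  then have "[int b ^ p = int b] (mod int p)" by simp
  then show ?thesis using cong_trans[OF cong_pow[OF ab, of p]] cong_sym[OF ab] cong_trans by blast
qed

text \<open>
  Stated for an arbitrary subring \<open>A\<close> of \<open>\<complex>\<close>: it is applied both to all algebraic integers and to a localization of
  \<open>\<int>[\<theta>]\<close>, where the quotient \<open>s\<close> has to stay in the ring.
\<close>
lemma freshman_dream:
  fixes x y :: complex
  assumes add: "\<And>u v. u \<in> A \<Longrightarrow> v \<in> A \<Longrightarrow> u + v \<in> A" and mult: "\<And>u v. u \<in> A \<Longrightarrow> v \<in> A \<Longrightarrow> u * v \<in> A"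
    and int: "\<And>k. of_int k \<in> A" and x: "x \<in> A" and y: "y \<in> A" and p: "prime p"
  shows "\<exists>s\<in>A. (x + y) ^ p = x ^ p + y ^ p + of_nat p * s"
proof -
  have p1: "p > 1" by (rule prime_gt_1_nat[OF p])
  define s where "s = (\<Sum>k\<in>{0<..<p}. of_int (int ((p choose k) div p)) * x ^ k * y ^ (p - k))"
  have pow: "z ^ k \<in> A" if "z \<in> A" for z k using int[of 1] that by (induction k) (simp_all add: mult)
  have sum: "(\<And>i. i \<in> I \<Longrightarrow> f i \<in> A) \<Longrightarrow> sum f I \<in> A" for f :: "nat \<Rightarrow> complex" and I
    using int[of 0] by (induction I rule: infinite_finite_induct) (simp_all add: add)
  have s: "s \<in> A" unfolding s_def by (rule sum) (rule mult[OF mult[OF int pow[OF x]] pow[OF y]])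
  have "{..p} = insert 0 (insert p {0<..<p})" using p1 by auto
  then have "(x + y) ^ p = x ^ p + y ^ p + (\<Sum>k\<in>{0<..<p}. of_nat (p choose k) * x ^ k * y ^ (p - k))"
    using p1 by (simp add: binomial_ring)
  also have "(\<Sum>k\<in>{0<..<p}. of_nat (p choose k) * x ^ k * y ^ (p - k)) = of_nat p * s"
    unfolding s_def sum_distrib_left
  proof (rule sum.cong[OF refl])
    fix k assume "k \<in> {0<..<p}"
    then have "p dvd (p choose k)" using p by (intro dvd_choose_prime) auto
    then have "of_nat (p choose k) = (of_nat p * of_nat ((p choose k) div p) :: complex)"
      by (simp flip: of_nat_mult)
    then show "of_nat (p choose k) * x ^ k * y ^ (p - k) = of_nat p * (of_int (int ((p choose k) div p)) * x ^ k * y ^ (p - k) :: complex)"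
      by simp
  qed
  finally show ?thesis using s by blast
qed

lemma ipoly_frobenius:
  fixes z :: complex
  assumes z: "algebraic_int z" and p: "prime p"
  shows "\<exists>s. algebraic_int s \<and> ipoly f z ^ p = ipoly f (z ^ p) + of_nat p * s"
proof (induction f)
  case 0
  then show ?case using prime_gt_0_nat[OF p] by (intro exI[of _ 0]) simp
next
  case (pCons a f)
  then obtain s where s: "algebraic_int s" "ipoly f z ^ p = ipoly f (z ^ p) + of_nat p * s" by blast
  have zf: "algebraic_int (z * ipoly f z)" using algebraic_int_plus_times(2)[OF z algebraic_int_ipoly[OF z]] .
  obtain t where t: "algebraic_int t" "(of_int a + z * ipoly f z) ^ p = of_int a ^ p + (z * ipoly f z) ^ p + of_nat p * t"
    using freshman_dream[of "Collect algebraic_int" "of_int a" "z * ipoly f z" p] zf p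
    by (auto simp: algebraic_int_plus_times)
  have "int p dvd a ^ p - a" using fermat_little_int[OF p, of a] by (simp add: cong_iff_dvd_diff)
  then obtain k where "a ^ p - a = int p * k" by blast
  then have k: "a ^ p = a + int p * k" by simp
  have zp: "algebraic_int (z ^ p)" using algebraic_int_ipoly[OF z, of "Polynomial.monom 1 p"] by simp
  have "ipoly (pCons a f) z ^ p = of_int (a ^ p) + z ^ p * ipoly f z ^ p + of_nat p * t"
    using t(2) by (simp add: of_int_hom.map_poly_pCons_hom power_mult_distrib)
  also have "\<dots> = ipoly (pCons a f) (z ^ p) + of_nat p * (of_int k + z ^ p * s + t)"
    by (simp add: k s(2) of_int_hom.map_poly_pCons_hom algebra_simps)
  finally show ?case
    using algebraic_int_plus_times(1)[OF algebraic_int_plus_times(1)[OF _ algebraic_int_plus_times(2)[OF zp s(1)]] t(1), of "of_int k"]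
    by blast
qed

lemma algebraic_int_rat_divide:
  fixes a :: int and p :: nat
  assumes "algebraic_int (of_int a / of_nat p :: complex)" "p > 0"
  shows "int p dvd a"
proof -
  have "(of_int a / of_nat p :: complex) \<in> \<rat>" by simp
  then have "(of_int a / of_nat p :: complex) \<in> \<int>" using assms(1) rational_algebraic_int_is_int by blast
  then obtain k where "(of_int a / of_nat p :: complex) = of_int k" by (elim Ints_cases)
  then have "(of_int a :: complex) = of_int (k * int p)" using assms(2) by (simp add: field_simps)
  then have "a = k * int p" by (simp only: of_int_eq_iff)
  then show ?thesis by simp
qed

text \<open>
  Dedekind's argument without reducing polynomials modulo \<open>p\<close>.  Write \<open>X\<^sup>q - 1 = h k\<close>.  If \<open>y\<^sup>p\<close> is not a root of
  \<open>h\<close>, it is one of \<open>k\<close>, so \<open>k(y)\<^sup>p\<close> is \<open>p\<close> times an algebraic integer.  Differentiating gives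
  \<open>q y\<^sup>q\<^sup>-\<^sup>1 = h'(y) k(y)\<close>, hence \<open>p\<close> divides \<open>q\<^sup>p\<close>.
\<close>
lemma cyclotomic_root_prime_power:
  fixes h :: "int poly" and y :: complex
  assumes h: "h dvd Polynomial.monom 1 q - [:1:]" and hy: "ipoly h y = 0" and q: "q > 0"
    and p: "prime p" "\<not> p dvd q"
  shows "ipoly h (y ^ p) = 0"
proof (rule ccontr)
  assume ne: "ipoly h (y ^ p) \<noteq> 0"
  obtain k where hk: "Polynomial.monom 1 q - [:1:] = h * k" using h by blast
  have yq: "y ^ q = 1"
  proof -
    have "ipoly (Polynomial.monom 1 q - [:1:]) y = 0" unfolding hk using hy by simp
    then show ?thesis by simp
  qed
  have y: "algebraic_int y"
    unfolding algebraic_int_altdef_ipoly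
  proof (intro exI conjI)
    show "ipoly (Polynomial.monom 1 q - [:1:]) y = 0" unfolding hk using hy by simp
    show "lead_coeff (Polynomial.monom 1 q - [:1:] :: int poly) = 1"
    proof -
      have "degree (Polynomial.monom 1 q - [:1:] :: int poly) = q"
      proof -
        have eq: "Polynomial.monom (1::int) q - [:1:] = Polynomial.monom 1 q + [:-1:]" by simp
        show ?thesis unfolding eq using q by (subst degree_add_eq_left) (simp_all add: degree_monom_eq)
      qed
      then show ?thesis using q by (cases q) simp_all
    qed
  qed
  have "(y ^ p) ^ q = (y ^ q) ^ p" by (simp add: power_mult[symmetric] mult.commute)
  then have yqp: "(y ^ p) ^ q = 1" using yq by simp
  have "ipoly (h * k) (y ^ p) = 0" unfolding hk[symmetric] using yqp by simp
  then have "ipoly k (y ^ p) = 0" using ne by simp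
  then obtain s where s: "algebraic_int s" "ipoly k y ^ p = of_nat p * s"
    using ipoly_frobenius[OF y p(1), of k] by auto
  have "ipoly (pderiv (Polynomial.monom 1 q - [:1:])) y = ipoly (pderiv h) y * ipoly k y"
    unfolding hk using hy by (simp add: pderiv_mult)
  then have der: "of_nat q * y ^ (q - 1) = ipoly (pderiv h) y * ipoly k y"
    by (simp add: pderiv_diff pderiv_monom pderiv_pCons)
  have "y ^ (q - 1) * y = 1" using power_minus_mult[OF q, of y] yq by simp
  then have "(of_nat q :: complex) = of_nat q * y ^ (q - 1) * y" by (simp only: mult.assoc mult_1_right)
  then have "(of_nat q :: complex) ^ p = (ipoly (pderiv h) y * y) ^ p * ipoly k y ^ p"
    unfolding der by (simp only: power_mult_distrib[symmetric] mult_ac)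
  then have eq: "(of_nat q :: complex) ^ p = of_nat p * (ipoly ((pderiv h * [:0,1:]) ^ p) y * s)"
    by (simp add: s(2) power_mult_distrib of_int_hom.map_poly_pCons_hom)
  have "(of_int (int q ^ p) / of_nat p :: complex) = ipoly ((pderiv h * [:0,1:]) ^ p) y * s"
    using eq prime_gt_0_nat[OF p(1)] by simp
  then have "algebraic_int (of_int (int q ^ p) / of_nat p :: complex)"
    using algebraic_int_plus_times(2)[OF algebraic_int_ipoly[OF y] s(1)] by (simp only:)
  then have "int p dvd int q ^ p" by (rule algebraic_int_rat_divide) (rule prime_gt_0_nat[OF p(1)])
  then have "p dvd q" using p(1) by (metis int_dvd_int_iff of_nat_power prime_dvd_power)
  then show False using p(2) by simp
qed

lemma cyclotomic_roots:
  fixes h :: "int poly" and y :: complex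
  assumes h: "h dvd Polynomial.monom 1 q - [:1:]" and hy: "ipoly h y = 0" and q: "q > 0"
    and j: "coprime j q" "j > 0"
  shows "ipoly h (y ^ j) = 0"
  using j
proof (induction j rule: less_induct)
  case (less j)
  show ?case
  proof (cases "j = 1")
    case True
    then show ?thesis using hy by simp
  next
    case False
    then obtain p where p: "prime p" "p dvd j" using prime_factor_nat by blast
    then obtain i where i: "j = p * i" by blast
    have ip: "coprime i q" "coprime p q" using less.prems(1) by (simp_all add: i)
    have i0: "i > 0" using less.prems(2) by (simp add: i)
    then have "i < j" using prime_gt_1_nat[OF p(1)] by (simp add: i)
    then have "ipoly h (y ^ i) = 0" using less.IH ip(1) i0 by blast
    moreover have "\<not> p dvd q" using ip(2) p(1) coprime_common_divisor_nat[of p q p] prime_gt_1_nat[OF p(1)] by auto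
    ultimately have "ipoly h ((y ^ i) ^ p) = 0" by (intro cyclotomic_root_prime_power[OF h _ q p(1)])
    then show ?thesis by (simp add: i power_mult[symmetric] mult.commute)
  qed
qed

section \<open>Primes at which Frobenius fixes a generator\<close>

lemma card_roots_mod_prime_le:
  fixes W :: "int poly"
  assumes p: "prime p" and W: "lead_coeff W = 1"
  shows "card {a\<in>{0..<int p}. int p dvd poly W a} \<le> degree W"
  using W
proof (induction "degree W" arbitrary: W rule: less_induct)
  case (less W)
  let ?R = "\<lambda>W. {a\<in>{0..<int p}. int p dvd poly W a}"
  show ?case
  proof (cases "?R W = {}")
    case True
    then show ?thesis by (simp only: card.empty)
  next
    case False
    then obtain b where b: "b \<in> {0..<int p}" "int p dvd poly W b" by blast
    have deg: "degree W > 0"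
    proof (rule ccontr)
      assume "\<not> degree W > 0"
      then obtain c where "W = [:c:]" using degree_eq_zeroE by blast
      then have "int p dvd 1" using b(2) less.prems by simp
      then show False using prime_gt_1_nat[OF p] by simp
    qed
    define W1 where "W1 = W + [:- poly W b:]"
    have dW1: "degree W1 = degree W" unfolding W1_def using deg by (intro degree_add_eq_left) simp
    have lW1: "lead_coeff W1 = 1" unfolding dW1 using less.prems deg by (cases "degree W") (simp_all add: W1_def)
    have "poly W1 b = 0" by (simp add: W1_def)
    then obtain V where V: "W1 = [:- b, 1:] * V" using poly_eq_0_iff_dvd by blast
    have V0: "V \<noteq> 0" using lW1 V by auto
    have "degree W1 = 1 + degree V" unfolding V using V0 by (subst degree_mult_eq) auto
    then have dV: "degree W = Suc (degree V)" using dW1 by simp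
    have lV: "lead_coeff V = 1" using lW1 unfolding V lead_coeff_mult by simp
    have "?R W \<subseteq> insert b (?R V)"
    proof
      fix a assume "a \<in> ?R W"
      then have a: "a \<in> {0..<int p}" "int p dvd poly W a" by simp_all
      have "poly W a = poly W1 a + poly W b" by (simp add: W1_def)
      then have "int p dvd poly W1 a" using dvd_diff[OF a(2) b(2)] by simp
      then have "int p dvd (a - b) * poly V a" unfolding V by (simp add: algebra_simps)
      then have "int p dvd a - b \<or> int p dvd poly V a" using p by (simp add: prime_dvd_mult_iff)
      moreover have "a = b" if "int p dvd a - b"
      proof (rule ccontr)
        assume "a \<noteq> b"
        then have "int p \<le> \<bar>a - b\<bar>" using that by (intro zdvd_imp_le) (auto simp: dvd_abs_iff)
        then show False using a(1) b(1) by auto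
      qed
      ultimately show "a \<in> insert b (?R V)" using a(1) by auto
    qed
    moreover have fin: "finite (?R V)" by (rule finite_subset[of _ "{0..<int p}"]) auto
    ultimately have "card (?R W) \<le> card (insert b (?R V))" by (intro card_mono) auto
    also have "\<dots> \<le> Suc (card (?R V))" by (rule card_insert_le_m1) simp_all
    also have "card (?R V) \<le> degree V" by (rule less.hyps[OF _ lV]) (simp add: dV)
    finally show ?thesis by (simp add: dV)
  qed
qed

text \<open>
  Up to the denominator \<open>D\<close>, which is invertible modulo \<open>p\<close>, the hypothesis says that \<open>H\<close> divides \<open>X\<^sup>p - X\<close> modulo \<open>p\<close>.
  All \<open>p\<close> residues are roots of the product \<open>H W\<close>, and neither factor can have more roots than its degree.
\<close>
lemma card_roots_of_frobenius:
  assumes H: "min_int_poly_of H \<theta>" and p: "prime p" and pd: "p > degree H" and D: "\<not> int p dvd D"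
    and frob: "of_int D * (\<theta> ^ p - \<theta>) = of_nat p * ipoly f \<theta>"
  shows "card {a\<in>{0..<int p}. int p dvd poly H a} = degree H"
proof -
  note monic = min_int_poly_of_monic[OF H]
  define d where "d = degree H"
  have p1: "p > 1" by (rule prime_gt_1_nat[OF p])
  have "coprime (int p) D" using prime_imp_coprime[of "int p" D] p D by simp
  then have "coprime D (int p)" by (simp add: coprime_commute)
  then obtain u where u: "[D * u = 1] (mod int p)" using cong_solve_coprime_int by blast
  then have "int p dvd D * u - 1" by (simp add: cong_iff_dvd_diff)
  then obtain v where "D * u - 1 = int p * v" by blast
  then have uv: "D * u = 1 + int p * v" by simp
  define f1 where "f1 = smult u f - smult v (Polynomial.monom 1 p - [:0, 1:])"
  have "of_int (D * u) * (\<theta> ^ p - \<theta>) = of_int u * (of_int D * (\<theta> ^ p - \<theta>))" by simp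
  also have "\<dots> = of_int u * (of_nat p * ipoly f \<theta>)" unfolding frob ..
  finally have "\<theta> ^ p - \<theta> = of_nat p * (of_int u * ipoly f \<theta> - of_int v * (\<theta> ^ p - \<theta>))"
    unfolding uv by (simp add: algebra_simps)
  then have f1: "\<theta> ^ p - \<theta> = of_nat p * ipoly f1 \<theta>" by (simp add: f1_def of_int_hom.map_poly_pCons_hom)
  obtain r where r: "degree r < degree H" "ipoly f1 \<theta> = ipoly r \<theta>" using min_int_poly_of_reduce[OF H, of f1] by blast
  define P where "P = Polynomial.monom 1 p + (- [:0, 1:] - smult (int p) r)"
  have "degree (- [:0, 1:] - smult (int p) r) < p"
    using r(1) pd p1 by (intro degree_diff_less) (simp_all add: le_less_trans[OF degree_smult_le])
  then have degP: "degree P = p" unfolding P_def by (subst degree_add_eq_left) (simp_all add: degree_monom_eq)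
  have lP: "lead_coeff P = 1" unfolding degP using \<open>degree (- [:0, 1:] - smult (int p) r) < p\<close>
    by (simp add: P_def coeff_eq_0 del: coeff_diff)
  have "ipoly P \<theta> = 0" using f1 by (simp add: P_def r(2) of_int_hom.map_poly_pCons_hom algebra_simps)
  then obtain W where W: "P = H * W" using min_int_poly_of_dvd[OF H] by blast
  have lW: "lead_coeff W = 1" using lP monic unfolding W lead_coeff_mult by simp
  have "H \<noteq> 0" "W \<noteq> 0" using lW monic by auto
  then have dW: "p = d + degree W" using degP unfolding W d_def by (simp add: degree_mult_eq)
  let ?R = "\<lambda>W. {a\<in>{0..<int p}. int p dvd poly W a}"
  have fin: "finite (?R W)" for W by (rule finite_subset[of _ "{0..<int p}"]) auto
  have "{0..<int p} \<subseteq> ?R H \<union> ?R W"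
  proof
    fix a assume a: "a \<in> {0..<int p}"
    have "int p dvd a ^ p - a" using fermat_little_int[OF p, of a] by (simp add: cong_iff_dvd_diff)
    moreover have "poly P a = a ^ p - a - int p * poly r a" by (simp add: P_def poly_monom)
    ultimately have "int p dvd poly P a" by simp
    then have "int p dvd poly H a \<or> int p dvd poly W a" unfolding W using p by (simp add: prime_dvd_mult_iff)
    then show "a \<in> ?R H \<union> ?R W" using a by auto
  qed
  then have "card {0..<int p} \<le> card (?R H \<union> ?R W)" by (intro card_mono finite_UnI fin)
  also have "\<dots> \<le> card (?R H) + card (?R W)" by (rule card_Un_le)
  also have "card (?R W) \<le> degree W" by (rule card_roots_mod_prime_le[OF p lW])
  finally have "d \<le> card (?R H)" using dW by simp
  moreover have "card (?R H) \<le> d" unfolding d_def by (rule card_roots_mod_prime_le[OF p monic])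
  ultimately show ?thesis by (simp add: d_def)
qed

theorem frobenius_fixed_primes_upper:
  assumes H: "min_int_poly_of H \<theta>"
    and S: "\<And>p. p \<in> S \<Longrightarrow> prime p \<and> (p > B \<longrightarrow> (\<exists>D f. \<not> int p dvd D \<and> of_int D * (\<theta> ^ p - \<theta>) = of_nat p * ipoly f \<theta>))"
  shows "\<exists>C. \<forall>y\<ge>2. (\<Sum>p | p \<in> S \<and> p \<le> y. ln (real p) / real p) \<le> ln (real y) / real (degree H) + C"
proof -
  define B' where "B' = max B (degree H)"
  define S' where "S' = {p\<in>S. p > B'}"
  let ?R = "\<lambda>p. {a\<in>{0..<int p}. int p dvd poly H a}"
  have card: "card (?R p) = degree H" if "p \<in> S'" for p
  proof -
    have p: "p \<in> S" "p > B" "p > degree H" using that by (auto simp: S'_def B'_def)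
    then obtain D f where "\<not> int p dvd D" "of_int D * (\<theta> ^ p - \<theta>) = of_nat p * ipoly f \<theta>" using S by blast
    then show ?thesis using S[OF p(1)] p(3) by (intro card_roots_of_frobenius[OF H]) auto
  qed
  have fin: "finite (?R p)" for p by (rule finite_subset[of _ "{0..<int p}"]) auto
  have "\<exists>C. \<forall>y\<ge>2. (\<Sum>p | p \<in> S' \<and> p \<le> y. ln (real p) / real p) \<le> ln (real y) / real (degree H) + C"
  proof (rule totally_split_primes_upper[OF H, of S' ?R])
    fix p assume p: "p \<in> S'"
    show "prime p" using p S by (simp add: S'_def)
    show "finite (?R p) \<and> card (?R p) = degree H \<and> ?R p \<subseteq> {0..<int p} \<and> (\<forall>c\<in>?R p. int p dvd poly H c)"
      by (intro conjI fin card[OF p]) auto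
  qed
  then obtain C where C: "\<And>y. y \<ge> 2 \<Longrightarrow> (\<Sum>p | p \<in> S' \<and> p \<le> y. ln (real p) / real p) \<le> ln (real y) / real (degree H) + C" by blast
  define C' where "C' = (\<Sum>p\<in>{1..B'}. ln (real p) / real p)"
  show ?thesis
  proof (intro exI allI impI)
    fix y :: nat assume y: "y \<ge> 2"
    have fin1: "finite {p. p \<in> S' \<and> p \<le> y}" by (rule finite_subset[of _ "{..y}"]) auto
    have pos: "p \<ge> 1" if "p \<in> S" for p using S[OF that] prime_gt_0_nat[of p] by simp
    have "(\<Sum>p | p \<in> S \<and> p \<le> y. ln (real p) / real p) \<le> (\<Sum>p\<in>{p. p \<in> S' \<and> p \<le> y} \<union> {1..B'}. ln (real p) / real p)"
    proof (rule sum_mono2)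
      show "finite ({p. p \<in> S' \<and> p \<le> y} \<union> {1..B'})" using fin1 by simp
      show "{p. p \<in> S \<and> p \<le> y} \<subseteq> {p. p \<in> S' \<and> p \<le> y} \<union> {1..B'}" using pos by (auto simp: S'_def)
      show "0 \<le> ln (real b) / real b" for b :: nat by (cases "b = 0") simp_all
    qed
    also have "\<dots> = (\<Sum>p | p \<in> S' \<and> p \<le> y. ln (real p) / real p) + C'"
      unfolding C'_def using fin1 by (intro sum.union_disjoint) (auto simp: S'_def)
    finally show "(\<Sum>p | p \<in> S \<and> p \<le> y. ln (real p) / real p) \<le> ln (real y) / real (degree H) + (C + C')"
      using C[OF y] by simp
  qed
qed

definition polys_over :: "complex set \<Rightarrow> complex poly set" where
  "polys_over F = {P. \<forall>i. coeff P i \<in> F}"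

lemma polys_over_closed:
  shows "P \<in> polys_over (adjoin S) \<Longrightarrow> Q \<in> polys_over (adjoin S) \<Longrightarrow> P - Q \<in> polys_over (adjoin S)"
    and "P \<in> polys_over (adjoin S) \<Longrightarrow> Q \<in> polys_over (adjoin S) \<Longrightarrow> P * Q \<in> polys_over (adjoin S)"
    and "c \<in> adjoin S \<Longrightarrow> Polynomial.monom c n \<in> polys_over (adjoin S)"
    and "P \<in> polys_over (adjoin S) \<Longrightarrow> P ^ n \<in> polys_over (adjoin S)"
proof -
  have diff: "x - y \<in> adjoin S" if "x \<in> adjoin S" "y \<in> adjoin S" for x y
    using adjoin_closed(4)[OF that(1) adjoin_closed(6)[OF that(2)]] by simp
  have sum: "(\<And>i. i \<in> I \<Longrightarrow> f i \<in> adjoin S) \<Longrightarrow> sum f I \<in> adjoin S" for f :: "nat \<Rightarrow> complex" and I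
    by (induction I rule: infinite_finite_induct) (simp_all add: adjoin_closed)
  show 1: "P * Q \<in> polys_over (adjoin S)" if "P \<in> polys_over (adjoin S)" "Q \<in> polys_over (adjoin S)" for P Q
    using that unfolding polys_over_def mem_Collect_eq coeff_mult by (intro allI sum adjoin_closed(5)) auto
  show "P - Q \<in> polys_over (adjoin S)" if "P \<in> polys_over (adjoin S)" "Q \<in> polys_over (adjoin S)"
    using that diff by (simp add: polys_over_def)
  show "Polynomial.monom c n \<in> polys_over (adjoin S)" if "c \<in> adjoin S"
    using that by (simp add: polys_over_def adjoin_closed)
  show "P ^ n \<in> polys_over (adjoin S)" if "P \<in> polys_over (adjoin S)"
    using that by (induction n) (simp_all add: 1, simp add: polys_over_def coeff_1 adjoin_closed)
qed

lemma min_poly_over_adjoin: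
  assumes P: "P \<in> polys_over (adjoin S)" "P \<noteq> 0" "poly P z = 0"
  obtains f where "f \<in> polys_over (adjoin S)" "f \<noteq> 0" "poly f z = 0"
    "\<And>Q. Q \<in> polys_over (adjoin S) \<Longrightarrow> poly Q z = 0 \<Longrightarrow> f dvd Q"
proof -
  define good where "good f \<longleftrightarrow> f \<in> polys_over (adjoin S) \<and> f \<noteq> 0 \<and> poly f z = 0" for f
  define f where "f = (ARG_MIN degree f. good f)"
  have "good P" using P by (simp add: good_def)
  then have "good f \<and> (\<forall>g. good g \<longrightarrow> degree f \<le> degree g)" unfolding f_def by (rule arg_min_nat_lemma)
  then have f: "good f" and min: "\<And>g. good g \<Longrightarrow> degree f \<le> degree g" by blast+
  have "f dvd Q" if "Q \<in> polys_over (adjoin S)" "poly Q z = 0" for Q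
    using that
  proof (induction "degree Q" arbitrary: Q rule: less_induct)
    case (less Q)
    show ?case
    proof (cases "Q = 0")
      case False
      then have "good Q" using less.prems by (simp add: good_def)
      then have deg: "degree f \<le> degree Q" by (rule min)
      define c where "c = lead_coeff Q / lead_coeff f"
      define Q1 where "Q1 = Q - Polynomial.monom c (degree Q - degree f) * f"
      have f0: "f \<noteq> 0" "lead_coeff f \<noteq> 0" using f by (simp_all add: good_def)
      have c0: "c \<noteq> 0" using False f0 by (simp add: c_def)
      have cF: "c \<in> adjoin S" unfolding c_def using f less.prems by (intro adjoin_divide) (auto simp: good_def polys_over_def)
      have Q1: "Q1 \<in> polys_over (adjoin S)" unfolding Q1_def
        by (intro polys_over_closed less.prems(1) cF) (use f in \<open>simp add: good_def\<close>)
      have "poly Q1 z = 0" using less.prems f by (simp add: Q1_def good_def)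
      have "f dvd Q1"
      proof (cases "Q1 = 0")
        case False
        have dm: "degree (Polynomial.monom c (degree Q - degree f) * f) = degree Q"
          using c0 f0 deg by (simp add: degree_mult_eq degree_monom_eq)
        have lm: "coeff (Polynomial.monom c (degree Q - degree f) * f) (degree Q) = lead_coeff Q"
        proof -
          have "coeff (Polynomial.monom c (degree Q - degree f) * f) (degree Q) = lead_coeff (Polynomial.monom c (degree Q - degree f) * f)"
            by (simp only: dm)
          also have "\<dots> = c * lead_coeff f" unfolding lead_coeff_mult using c0 by (simp add: degree_monom_eq)
          also have "\<dots> = lead_coeff Q" using f0 by (simp add: c_def)
          finally show ?thesis .
        qed
        have "degree Q1 \<noteq> degree Q"
        proof
          assume eq: "degree Q1 = degree Q"
          have "coeff Q1 (degree Q) = 0" using lm by (simp add: Q1_def)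
          then show False using False eq by (metis leading_coeff_0_iff)
        qed
        moreover have "degree Q1 \<le> degree Q" unfolding Q1_def using dm by (intro degree_diff_le) auto
        ultimately have "degree Q1 < degree Q" by simp
        then show ?thesis using less.hyps Q1 \<open>poly Q1 z = 0\<close> by blast
      qed simp
      then have "f dvd Q1 + Polynomial.monom c (degree Q - degree f) * f" by (intro dvd_add dvd_triv_right)
      then show ?thesis by (simp add: Q1_def)
    qed simp
  qed
  then show ?thesis using that[of f] f by (simp add: good_def)
qed

text \<open>
  The polynomials \<open>X\<^sup>N - g\<close> and \<open>(\<theta> - c X)\<^sup>q - 1\<close> over \<open>\<rat>(\<theta>)\<close> have only the root \<open>\<gamma>\<close> in common, by the choice of \<open>c\<close>,
  and it is a simple root of the first.  So the minimal polynomial of \<open>\<gamma>\<close> over \<open>\<rat>(\<theta>)\<close> is linear.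
\<close>
lemma radical_in_adjoin_sum:
  fixes \<zeta> \<gamma> :: complex and c :: int
  assumes \<zeta>: "\<zeta> ^ q = 1" and \<gamma>: "\<gamma> ^ N = of_int g" "\<gamma> \<noteq> 0" and N: "N > 0" and q: "q > 0"
    and c: "\<And>\<zeta>' \<gamma>'. \<zeta>' ^ q = 1 \<Longrightarrow> \<gamma>' ^ N = of_int g \<Longrightarrow> \<zeta>' + of_int c * \<gamma>' = \<zeta> + of_int c * \<gamma> \<Longrightarrow> \<gamma>' = \<gamma>"
  shows "\<gamma> \<in> adjoin {\<zeta> + of_int c * \<gamma>}"
proof -
  define \<theta> where "\<theta> = \<zeta> + of_int c * \<gamma>"
  let ?F = "adjoin {\<theta>}"
  define A where "A = Polynomial.monom 1 N - Polynomial.monom (of_int g :: complex) 0"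
  define U where "U = (Polynomial.monom \<theta> 0 - Polynomial.monom (of_int c) 1) ^ q - Polynomial.monom 1 0"
  have \<theta>F: "\<theta> \<in> ?F" by (rule adjoin_closed(3)) simp
  have A: "A \<in> polys_over ?F" unfolding A_def by (intro polys_over_closed adjoin_closed(1) adjoin_of_int)
  have U: "U \<in> polys_over ?F" unfolding U_def by (intro polys_over_closed adjoin_closed(1) adjoin_of_int \<theta>F)
  have pA: "poly A x = x ^ N - of_int g" and pU: "poly U x = (\<theta> - of_int c * x) ^ q - 1" for x
    by (simp_all add: A_def U_def poly_monom)
  have A0: "A \<noteq> 0"
  proof
    assume "A = 0"
    then have "coeff A N = 0" by simp
    then show False using N by (simp add: A_def)
  qed
  obtain f where f: "f \<in> polys_over ?F" "f \<noteq> 0" "poly f \<gamma> = 0"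
      "\<And>Q. Q \<in> polys_over ?F \<Longrightarrow> poly Q \<gamma> = 0 \<Longrightarrow> f dvd Q"
    using min_poly_over_adjoin[OF A A0, of \<gamma>] \<gamma> by (auto simp: pA)
  have fA: "f dvd A" by (rule f(4)[OF A]) (simp add: pA \<gamma>)
  have fU: "f dvd U" by (rule f(4)[OF U]) (simp add: pU \<theta>_def \<zeta>)
  have root: "x = \<gamma>" if "poly f x = 0" for x
  proof -
    have "poly A x = 0" "poly U x = 0" using that fA fU by (auto elim!: dvdE)
    then have "x ^ N = of_int g" "(\<theta> - of_int c * x) ^ q = 1" by (simp_all add: pA pU)
    then show ?thesis by (intro c[of "\<theta> - of_int c * x"]) (simp_all add: \<theta>_def)
  qed
  obtain k where k: "f = [:- \<gamma>, 1:] * k" using f(3) poly_eq_0_iff_dvd by blast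
  have "k \<noteq> 0" using f(2) k by auto
  have "degree k = 0"
  proof (rule ccontr)
    assume "degree k \<noteq> 0"
    then have "\<not> constant (poly k)" by (simp add: constant_degree)
    then obtain x where x: "poly k x = 0" using fundamental_theorem_of_algebra by blast
    then have "x = \<gamma>" using root[of x] by (simp add: k)
    then obtain j where j: "k = [:- \<gamma>, 1:] * j" using x poly_eq_0_iff_dvd by blast
    obtain i where i: "A = f * i" using fA by blast
    define u where "u = [:- \<gamma>, 1:]"
    have "A = u * (u * (j * i))" by (simp only: i k j u_def mult_ac)
    moreover have "poly u \<gamma> = 0" by (simp add: u_def)
    ultimately have "poly (pderiv A) \<gamma> = 0" by (simp add: pderiv_mult)
    moreover have "poly (pderiv A) \<gamma> = of_nat N * \<gamma> ^ (N - 1)" by (simp add: A_def pderiv_diff pderiv_monom poly_monom)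
    ultimately show False using N \<gamma>(2) by simp
  qed
  then obtain e where e: "k = [:e:]" using degree_eq_zeroE by blast
  have "e \<noteq> 0" using \<open>k \<noteq> 0\<close> e by auto
  have "coeff f 0 \<in> ?F" "coeff f 1 \<in> ?F" using f(1) by (simp_all add: polys_over_def)
  then have "- (\<gamma> * e) \<in> ?F" "e \<in> ?F" by (simp_all add: k e mult.commute)
  then have "- (- (\<gamma> * e) / e) \<in> ?F" by (rule adjoin_closed(6)[OF adjoin_divide])
  moreover have "- (- (\<gamma> * e) / e) = \<gamma>" using \<open>e \<noteq> 0\<close> by simp
  ultimately show ?thesis by (simp only: \<theta>_def)
qed

lemma primitive_element_radical:
  fixes \<zeta> \<gamma> :: complex
  assumes \<zeta>: "\<zeta> ^ q = 1" and \<gamma>: "\<gamma> ^ N = of_int g" "\<gamma> \<noteq> 0" and N: "N > 0" and q: "q > 0"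
  obtains c :: int where "adjoin {\<zeta>, \<gamma>} = adjoin {\<zeta> + of_int c * \<gamma>}"
proof -
  define T where "T = (\<lambda>(\<zeta>', \<gamma>'). (\<zeta> - \<zeta>') / (\<gamma>' - \<gamma>)) ` ({z. z ^ q = 1} \<times> {z. z ^ N = of_int g})"
  have "finite T" unfolding T_def using N q by (intro finite_imageI finite_cartesian_product finite_nth_roots)
  then have "finite (of_int -` T :: int set)" by (rule finite_vimageI) (simp add: inj_def)
  then obtain c :: int where c: "c \<notin> of_int -` T" using ex_new_if_finite[OF infinite_UNIV_int] by blast
  have "\<gamma>' = \<gamma>" if "\<zeta>' ^ q = 1" "\<gamma>' ^ N = of_int g" "\<zeta>' + of_int c * \<gamma>' = \<zeta> + of_int c * \<gamma>" for \<zeta>' \<gamma>'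
  proof (rule ccontr)
    assume ne: "\<gamma>' \<noteq> \<gamma>"
    have "of_int c * (\<gamma>' - \<gamma>) = \<zeta> - \<zeta>'" using that(3) by (simp add: algebra_simps)
    then have eq: "of_int c = (\<zeta> - \<zeta>') / (\<gamma>' - \<gamma>)" using ne by (simp add: eq_divide_eq)
    have "(\<lambda>(\<zeta>', \<gamma>'). (\<zeta> - \<zeta>') / (\<gamma>' - \<gamma>)) (\<zeta>', \<gamma>') \<in> T" unfolding T_def by (rule imageI) (use that in simp)
    then show False using c eq by simp
  qed
  then have g: "\<gamma> \<in> adjoin {\<zeta> + of_int c * \<gamma>}" by (rule radical_in_adjoin_sum[OF \<zeta> \<gamma> N q])
  let ?\<theta> = "\<zeta> + of_int c * \<gamma>"
  have "?\<theta> \<in> adjoin {?\<theta>}" by (rule adjoin_closed(3)) simp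
  then have "?\<theta> + - (of_int c * \<gamma>) \<in> adjoin {?\<theta>}"
    by (rule adjoin_closed(4)[OF _ adjoin_closed(6)[OF adjoin_closed(5)[OF adjoin_of_int g]]])
  then have z: "\<zeta> \<in> adjoin {?\<theta>}" by simp
  have "adjoin {\<zeta>, \<gamma>} = adjoin {?\<theta>}"
  proof
    show "adjoin {\<zeta>, \<gamma>} \<subseteq> adjoin {?\<theta>}" by (rule adjoin_least) (use z g in simp)
    have "\<zeta> \<in> adjoin {\<zeta>, \<gamma>}" "\<gamma> \<in> adjoin {\<zeta>, \<gamma>}" by (simp_all add: adjoin_closed(3))
    then have "?\<theta> \<in> adjoin {\<zeta>, \<gamma>}" by (rule adjoin_closed(4)[OF _ adjoin_closed(5)[OF adjoin_of_int]])
    then show "adjoin {?\<theta>} \<subseteq> adjoin {\<zeta>, \<gamma>}" by (intro adjoin_least) simp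
  qed
  then show ?thesis by (rule that)
qed

text \<open>
  As \<open>p\<close> is congruent to 1 modulo \<open>q\<close>, the \<open>p\<close>-th power fixes \<open>\<zeta>\<close>.  It multiplies \<open>\<gamma>\<close> by
  \<open>g\<close> to the power \<open>(p - 1) / N\<close>, which is congruent to 1 because \<open>g\<close> is an \<open>N\<close>-th power modulo \<open>p\<close>.  The computation takes
  place in \<open>\<int>[\<theta>]\<close> with a fixed denominator \<open>E\<close> inverted, which suffices for all \<open>p > \<bar>E\<bar>\<close>.
\<close>
lemma frobenius_fixes_radical_sum:
  fixes \<zeta> \<gamma> :: complex
  assumes H: "min_int_poly_of H (\<zeta> + of_int c * \<gamma>)" and L: "adjoin {\<zeta>, \<gamma>} = adjoin {\<zeta> + of_int c * \<gamma>}"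
    and \<zeta>: "\<zeta> ^ q = 1" and \<gamma>: "\<gamma> ^ N = of_int g" and Nq: "N dvd q"
  shows "\<exists>B. \<forall>p r. prime p \<longrightarrow> p > B \<longrightarrow> [p = 1] (mod q) \<longrightarrow> \<not> int p dvd g \<longrightarrow> [r ^ N = g] (mod int p) \<longrightarrow>
    (\<exists>D f. \<not> int p dvd D \<and> of_int D * ((\<zeta> + of_int c * \<gamma>) ^ p - (\<zeta> + of_int c * \<gamma>)) = of_nat p * ipoly f (\<zeta> + of_int c * \<gamma>))"
proof -
  define \<theta> where "\<theta> = \<zeta> + of_int c * \<gamma>"
  have H': "min_int_poly_of H \<theta>" using H by (simp add: \<theta>_def)
  have "\<zeta> \<in> adjoin {\<theta>}" "\<gamma> \<in> adjoin {\<theta>}" using L adjoin_closed(3)[of _ "{\<zeta>, \<gamma>}"] by (simp_all add: \<theta>_def)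
  then obtain f1 D1 f2 D2 where 1: "D1 \<noteq> 0" "of_int D1 * \<zeta> = ipoly f1 \<theta>" and 2: "D2 \<noteq> 0" "of_int D2 * \<gamma> = ipoly f2 \<theta>"
    unfolding adjoin_singleton_iff[OF H'] by blast
  define E where "E = D1 * D2"
  have E0: "E \<noteq> 0" using 1(1) 2(1) by (simp add: E_def)
  define A where "A = {y. \<exists>k f. of_int (E ^ k) * y = ipoly f \<theta>}"
  have AI: "y \<in> A" if "of_int (E ^ k) * y = ipoly f \<theta>" for y k f using that unfolding A_def by blast
  have add: "x + y \<in> A" and mult: "x * y \<in> A" if "x \<in> A" "y \<in> A" for x y
  proof -
    from that obtain k f j h where kf: "of_int (E ^ k) * x = ipoly f \<theta>" "of_int (E ^ j) * y = ipoly h \<theta>" unfolding A_def by blast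
    have "of_int (E ^ (k + j)) * (x + y) = of_int (E ^ j) * (of_int (E ^ k) * x) + of_int (E ^ k) * (of_int (E ^ j) * y)"
      by (simp add: power_add algebra_simps)
    also have "\<dots> = ipoly (smult (E ^ j) f + smult (E ^ k) h) \<theta>" unfolding kf by simp
    finally show "x + y \<in> A" by (rule AI)
    have "of_int (E ^ (k + j)) * (x * y) = (of_int (E ^ k) * x) * (of_int (E ^ j) * y)"
      by (simp add: power_add algebra_simps)
    also have "\<dots> = ipoly (f * h) \<theta>" unfolding kf by simp
    finally show "x * y \<in> A" by (rule AI)
  qed
  have int: "of_int k \<in> A" for k by (rule AI[of 0 _ "[:k:]"]) simp
  have zA: "\<zeta> \<in> A"
  proof (rule AI[of 1 _ "smult D2 f1"])
    have "of_int (E ^ 1) * \<zeta> = of_int D2 * (of_int D1 * \<zeta>)" by (simp add: E_def)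
    then show "of_int (E ^ 1) * \<zeta> = ipoly (smult D2 f1) \<theta>" by (simp only: 1(2) ipoly_simps)
  qed
  have gA: "\<gamma> \<in> A"
  proof (rule AI[of 1 _ "smult D1 f2"])
    have "of_int (E ^ 1) * \<gamma> = of_int D1 * (of_int D2 * \<gamma>)" by (simp add: E_def)
    then show "of_int (E ^ 1) * \<gamma> = ipoly (smult D1 f2) \<theta>" by (simp only: 2(2) ipoly_simps)
  qed
  have main: "\<exists>D f. \<not> int p dvd D \<and> of_int D * (\<theta> ^ p - \<theta>) = of_nat p * ipoly f \<theta>"
    if p: "prime p" "p > nat \<bar>E\<bar>" "[p = 1] (mod q)" "\<not> int p dvd g" and r: "[r ^ N = g] (mod int p)" for p r
  proof -
    have p1: "p > 1" by (rule prime_gt_1_nat[OF p(1)])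
    have "q dvd p - 1" using p(3) p1 by (simp add: cong_altdef_nat cong_sym_eq)
    then have pz: "\<zeta> ^ (p - 1) = 1" using \<zeta> by (auto simp: power_mult elim!: dvdE)
    have "N dvd p - 1" using Nq \<open>q dvd p - 1\<close> by (rule dvd_trans)
    then obtain m where m: "p - 1 = N * m" by blast
    have "\<not> p dvd nat \<bar>r\<bar>"
    proof
      assume "p dvd nat \<bar>r\<bar>"
      then have "int p dvd r" by (simp add: int_dvd_int_iff[symmetric] dvd_abs_iff del: int_dvd_int_iff)
      moreover have "N > 0" using m p1 by (intro Nat.gr0I) auto
      ultimately have "int p dvd r ^ N" by (simp add: dvd_power_iff dvd_trans[OF _ dvd_power])
      then show False using cong_dvd_iff[OF r] p(4) by simp
    qed
    have "coprime r (int p)"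
      using p(1) \<open>\<not> p dvd nat \<bar>r\<bar>\<close> prime_imp_coprime[of "int p" r]
      by (simp add: coprime_commute int_dvd_int_iff[symmetric] dvd_abs_iff del: int_dvd_int_iff)
    have "[g ^ m = (r ^ N) ^ m] (mod int p)" by (rule cong_pow[OF cong_sym[OF r]])
    also have "(r ^ N) ^ m = r ^ (p - 1)" unfolding m by (simp only: power_mult)
    finally have "[g ^ m * r = r ^ (p - 1) * r] (mod int p)" by (rule cong_mult[OF _ cong_refl])
    also have "r ^ (p - 1) * r = r ^ p" using power_minus_mult[of p r] p1 by simp
    also have "[r ^ p = 1 * r] (mod int p)" using fermat_little_int[OF p(1), of r] by simp
    finally have "[g ^ m = 1] (mod int p)" using \<open>coprime r (int p)\<close> by (simp only: cong_mult_rcancel)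
    then have "int p dvd g ^ m - 1" by (simp add: cong_iff_dvd_diff)
    then obtain u where "g ^ m - 1 = int p * u" by blast
    then have u: "g ^ m = 1 + int p * u" by simp
    have "\<gamma> ^ p = \<gamma> ^ (N * m) * \<gamma>" unfolding m[symmetric] using power_minus_mult[of p \<gamma>] p1 by simp
    also have "\<gamma> ^ (N * m) = of_int (g ^ m)" by (simp add: power_mult \<gamma>)
    finally have gp: "\<gamma> ^ p = \<gamma> + of_nat p * (of_int u * \<gamma>)" unfolding u by (simp add: algebra_simps)
    have zp: "\<zeta> ^ p = \<zeta>" using power_minus_mult[of p \<zeta>] p1 pz by simp
    have "int p dvd c ^ p - c" using fermat_little_int[OF p(1), of c] by (simp add: cong_iff_dvd_diff)
    then obtain v where "c ^ p - c = int p * v" by blast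
    then have v: "c ^ p = c + int p * v" by simp
    obtain s where s: "s \<in> A" "(\<zeta> + of_int c * \<gamma>) ^ p = \<zeta> ^ p + (of_int c * \<gamma>) ^ p + of_nat p * s"
      using freshman_dream[OF add mult int zA mult[OF int gA] p(1)] by blast
    have "(of_int c * \<gamma>) ^ p = of_int (c ^ p) * \<gamma> ^ p" by (simp add: power_mult_distrib)
    also have "\<dots> = of_int c * \<gamma> + of_nat p * (of_int v * \<gamma> + of_int (c ^ p) * (of_int u * \<gamma>))"
      unfolding gp by (simp only: distrib_left v) (simp add: algebra_simps)
    finally have cg: "(of_int c * \<gamma>) ^ p = of_int c * \<gamma> + of_nat p * (of_int v * \<gamma> + of_int (c ^ p) * (of_int u * \<gamma>))" .
    define w where "w = of_int v * \<gamma> + of_int (c ^ p) * (of_int u * \<gamma>) + s"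
    have "w \<in> A" unfolding w_def by (intro add mult int gA s(1))
    then obtain k f where kf: "of_int (E ^ k) * w = ipoly f \<theta>" unfolding A_def by blast
    have "\<theta> ^ p - \<theta> = of_nat p * w" unfolding \<theta>_def s(2) cg zp w_def by (simp add: algebra_simps)
    then have "of_int (E ^ k) * (\<theta> ^ p - \<theta>) = of_nat p * (of_int (E ^ k) * w)" by (simp only: mult_ac)
    then have "of_int (E ^ k) * (\<theta> ^ p - \<theta>) = of_nat p * ipoly f \<theta>" unfolding kf .
    moreover have "\<not> int p dvd E ^ k"
    proof
      assume "int p dvd E ^ k"
      then have "int p dvd E" using p(1) by (meson prime_dvd_power prime_nat_int_transfer)
      then have "int p \<le> \<bar>E\<bar>" using E0 by (intro zdvd_imp_le) (auto simp: dvd_abs_iff)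
      then show False using p(2) by linarith
    qed
    ultimately show ?thesis by blast
  qed
  show ?thesis unfolding \<theta>_def[symmetric] using main by blast
qed

section \<open>Dirichlet characters\<close>

text \<open>
  A character on a subgroup of the units modulo \<open>q\<close>; the subgroup is given as the union \<open>H\<close> of its residue classes in \<open>\<nat>\<close>.
\<close>
definition partial_char :: "nat \<Rightarrow> nat set \<Rightarrow> (nat \<Rightarrow> complex) \<Rightarrow> bool" where
  "partial_char q H \<chi> \<longleftrightarrow> 1 \<in> H \<and> (\<forall>a\<in>H. coprime a q \<and> \<chi> a \<noteq> 0) \<and>
     (\<forall>a\<in>H. \<forall>b\<in>H. a * b \<in> H \<and> \<chi> (a * b) = \<chi> a * \<chi> b) \<and>
     (\<forall>a\<in>H. \<forall>b. [a = b] (mod q) \<longrightarrow> b \<in> H \<and> \<chi> b = \<chi> a)"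

lemma partial_charD:
  assumes "partial_char q H \<chi>"
  shows "1 \<in> H" "a \<in> H \<Longrightarrow> coprime a q" "a \<in> H \<Longrightarrow> \<chi> a \<noteq> 0"
    "a \<in> H \<Longrightarrow> b \<in> H \<Longrightarrow> a * b \<in> H" "a \<in> H \<Longrightarrow> b \<in> H \<Longrightarrow> \<chi> (a * b) = \<chi> a * \<chi> b"
    "a \<in> H \<Longrightarrow> [a = b] (mod q) \<Longrightarrow> b \<in> H" "a \<in> H \<Longrightarrow> [a = b] (mod q) \<Longrightarrow> \<chi> b = \<chi> a"
  using assms unfolding partial_char_def by blast+

lemma partial_char_one: assumes PC: "partial_char q H \<chi>" shows "\<chi> 1 = 1"
  using partial_charD(5)[OF PC partial_charD(1)[OF PC] partial_charD(1)[OF PC]]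
    partial_charD(3)[OF PC partial_charD(1)[OF PC]] by simp

lemma partial_char_power:
  assumes PC: "partial_char q H \<chi>" and a: "a \<in> H"
  shows "a ^ i \<in> H \<and> \<chi> (a ^ i) = \<chi> a ^ i"
proof (induction i)
  case 0
  then show ?case using partial_charD(1)[OF PC] partial_char_one[OF PC] by simp
next
  case (Suc i)
  then show ?case using partial_charD(4,5)[OF PC a, of "a ^ i"] by simp
qed

lemma partial_char_divide:
  assumes PC: "partial_char q H \<chi>" and q: "q > 0" and a: "a \<in> H" and ab: "a * b \<in> H"
  shows "b \<in> H"
proof -
  have cop: "coprime a q" by (rule partial_charD(2)[OF PC a])
  define a' where "a' = a ^ (totient q - 1)"
  have "a' \<in> H" using partial_char_power[OF PC a] by (simp add: a'_def)
  then have "a' * (a * b) \<in> H" by (rule partial_charD(4)[OF PC _ ab])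
  moreover have "a' * a = a ^ totient q" using q by (simp add: a'_def power_eq_if)
  then have "[a' * (a * b) = 1 * b] (mod q)"
    using cong_mult[OF euler_theorem[OF cop] cong_refl[of b q]] by (simp add: mult.assoc[symmetric])
  ultimately show ?thesis using partial_charD(6)[OF PC] by simp
qed

text \<open>
  The new values \<open>\<chi>(a) w\<^sup>i\<close> on \<open>a c\<^sup>i\<close> are well defined because \<open>W\<close> says that both prescriptions agree on the powers of
  \<open>c\<close> that already lie in \<open>H\<close>.
\<close>
lemma partial_char_extend:
  assumes PC: "partial_char q H \<chi>" and q: "q > 0" and c: "coprime c q" and w: "w \<noteq> 0"
    and W: "\<And>e. c ^ e \<in> H \<Longrightarrow> \<chi> (c ^ e) = w ^ e"
  shows "\<exists>H' \<chi>'. partial_char q H' \<chi>' \<and> H \<subseteq> H' \<and> c \<in> H' \<and> (\<forall>a\<in>H. \<chi>' a = \<chi> a) \<and> \<chi>' c = w"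
proof -
  note D = partial_charD[OF PC]
  have wd_le: "\<chi> a * w ^ i = \<chi> b * w ^ j"
    if a: "a \<in> H" and b: "b \<in> H" and cong: "[a * c ^ i = b * c ^ j] (mod q)" and ij: "i \<le> j" for a b i j
  proof -
    define e where "e = j - i"
    have j: "j = e + i" using ij by (simp add: e_def)
    have "[a * c ^ i = (b * c ^ e) * c ^ i] (mod q)" using cong by (simp add: j power_add mult.assoc)
    then have cong': "[a = b * c ^ e] (mod q)" using c by (subst (asm) cong_mult_rcancel_nat) auto
    have "b * c ^ e \<in> H" by (rule D(6)[OF a cong'])
    then have ce: "c ^ e \<in> H" by (rule partial_char_divide[OF PC q b])
    have "\<chi> a = \<chi> (b * c ^ e)" using D(7)[OF a cong'] by simp
    also have "\<dots> = \<chi> b * w ^ e" using D(5)[OF b ce] W[OF ce] by simp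
    finally show ?thesis by (simp add: j power_add)
  qed
  have wd: "\<chi> a * w ^ i = \<chi> b * w ^ j"
    if "a \<in> H" "b \<in> H" "[a * c ^ i = b * c ^ j] (mod q)" for a b i j
  proof (cases "i \<le> j")
    case True
    then show ?thesis using wd_le that by simp
  next
    case False
    then have "\<chi> b * w ^ j = \<chi> a * w ^ i" using that by (intro wd_le) (auto simp: cong_sym_eq)
    then show ?thesis by simp
  qed
  define H' where "H' = {x. \<exists>a i. a \<in> H \<and> [x = a * c ^ i] (mod q)}"
  define \<chi>' where "\<chi>' x = (THE z. \<exists>a i. a \<in> H \<and> [x = a * c ^ i] (mod q) \<and> z = \<chi> a * w ^ i)" for x
  have val: "\<chi>' x = \<chi> a * w ^ i" if "a \<in> H" "[x = a * c ^ i] (mod q)" for x a i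
    unfolding \<chi>'_def
  proof (rule the_equality)
    show "\<exists>b j. b \<in> H \<and> [x = b * c ^ j] (mod q) \<and> \<chi> a * w ^ i = \<chi> b * w ^ j" using that by blast
  next
    fix z assume "\<exists>b j. b \<in> H \<and> [x = b * c ^ j] (mod q) \<and> z = \<chi> b * w ^ j"
    then obtain b j where b: "b \<in> H" "[x = b * c ^ j] (mod q)" "z = \<chi> b * w ^ j" by blast
    have "[b * c ^ j = a * c ^ i] (mod q)" using b(2) that(2) cong_sym cong_trans by blast
    then show "z = \<chi> a * w ^ i" using wd[OF b(1) that(1)] b(3) by simp
  qed
  have I: "x \<in> H'" if "a \<in> H" "[x = a * c ^ i] (mod q)" for x a i using that unfolding H'_def by blast
  have inH: "[a = a * c ^ 0] (mod q)" for a by simp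
  have inc: "[c = 1 * c ^ 1] (mod q)" by simp
  have E: "\<exists>a i. a \<in> H \<and> [x = a * c ^ i] (mod q)" if "x \<in> H'" for x using that unfolding H'_def by blast
  have "partial_char q H' \<chi>'"
    unfolding partial_char_def
  proof (intro conjI ballI allI impI)
    show "1 \<in> H'" by (rule I[OF D(1), of 1 0]) simp
  next
    fix x assume "x \<in> H'"
    then obtain a i where a: "a \<in> H" "[x = a * c ^ i] (mod q)" using E by blast
    have "coprime (a * c ^ i) q" using D(2)[OF a(1)] c by simp
    then show "coprime x q" using a(2) cong_imp_coprime cong_sym by blast
    show "\<chi>' x \<noteq> 0" using val[OF a] D(3)[OF a(1)] w by simp
  next
    fix x y assume "x \<in> H'" "y \<in> H'"
    then obtain a i b j where a: "a \<in> H" "[x = a * c ^ i] (mod q)" and b: "b \<in> H" "[y = b * c ^ j] (mod q)"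
      using E by meson
    have ab: "a * b \<in> H" by (rule D(4)[OF a(1) b(1)])
    have "[x * y = (a * c ^ i) * (b * c ^ j)] (mod q)" by (rule cong_mult[OF a(2) b(2)])
    then have xy: "[x * y = (a * b) * c ^ (i + j)] (mod q)" by (simp add: power_add mult_ac)
    show "x * y \<in> H'" by (rule I[OF ab xy])
    show "\<chi>' (x * y) = \<chi>' x * \<chi>' y"
      using val[OF ab xy] val[OF a] val[OF b] D(5)[OF a(1) b(1)] by (simp add: power_add)
  next
    fix x y assume "x \<in> H'" and xy: "[x = y] (mod q)"
    then obtain a i where a: "a \<in> H" "[x = a * c ^ i] (mod q)" using E by blast
    have y: "[y = a * c ^ i] (mod q)" using cong_trans[OF cong_sym[OF xy] a(2)] .
    show "y \<in> H'" by (rule I[OF a(1) y])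
    show "\<chi>' y = \<chi>' x" using val[OF a] val[OF a(1) y] by simp
  qed
  moreover have "H \<subseteq> H'" using I[OF _ inH] by blast
  moreover have "c \<in> H'" by (rule I[OF D(1) inc])
  moreover have "\<forall>a\<in>H. \<chi>' a = \<chi> a" using val[OF _ inH] by simp
  moreover have "\<chi>' c = w" using val[OF D(1) inc] partial_char_one[OF PC] by simp
  ultimately show ?thesis by blast
qed

lemma complex_root_exists:
  assumes "k > 0" "z \<noteq> 0"
  shows "\<exists>w::complex. w ^ k = z"
proof -
  have "rcis (root k (cmod z)) (Arg z / real k) ^ k = z"
    using assms(1) by (simp add: DeMoivre2 rcis_cmod_Arg)
  then show ?thesis by blast
qed

text \<open>
  The powers of \<open>c\<close> lying in \<open>H\<close> are those with exponent divisible by the least positive such exponent \<open>k\<close>; any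
  \<open>k\<close>-th root of \<open>\<chi>(c\<^sup>k)\<close> can be taken as the value at \<open>c\<close>.
\<close>
lemma partial_char_extend_any:
  assumes PC: "partial_char q H \<chi>" and q: "q > 0" and c: "coprime c q"
  shows "\<exists>H' \<chi>'. partial_char q H' \<chi>' \<and> H \<subseteq> H' \<and> c \<in> H' \<and> (\<forall>a\<in>H. \<chi>' a = \<chi> a)"
proof -
  define k where "k = (LEAST k. k > 0 \<and> c ^ k \<in> H)"
  have "[1 = c ^ totient q] (mod q)" using euler_theorem[OF c] by (simp add: cong_sym_eq)
  then have "c ^ totient q \<in> H" by (rule partial_charD(6)[OF PC partial_charD(1)[OF PC]])
  then have ex: "\<exists>k. k > 0 \<and> c ^ k \<in> H" using q by (intro exI[of _ "totient q"]) simp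
  have k: "k > 0" "c ^ k \<in> H" using LeastI_ex[OF ex] by (auto simp: k_def)
  have least: "\<not> (j > 0 \<and> c ^ j \<in> H)" if "j < k" for j using not_less_Least[of j] that unfolding k_def by blast
  have ck0: "\<chi> (c ^ k) \<noteq> 0" by (rule partial_charD(3)[OF PC k(2)])
  obtain w where w: "w ^ k = \<chi> (c ^ k)" using complex_root_exists[OF k(1) ck0] by blast
  have "w \<noteq> 0" using w ck0 k(1) by (auto simp: power_0_left)
  have W: "\<chi> (c ^ e) = w ^ e" if ce: "c ^ e \<in> H" for e
  proof -
    define s r where "s = e div k" and "r = e mod k"
    have e: "e = k * s + r" by (simp add: s_def r_def)
    have cs: "(c ^ k) ^ s \<in> H" "\<chi> ((c ^ k) ^ s) = \<chi> (c ^ k) ^ s" using partial_char_power[OF PC k(2)] by blast+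
    have "(c ^ k) ^ s * c ^ r \<in> H" using ce by (simp add: e power_add power_mult)
    then have "c ^ r \<in> H" by (rule partial_char_divide[OF PC q cs(1)])
    then have "r = 0" using least[of r] k(1) by (auto simp: r_def)
    then show ?thesis using cs(2) by (simp add: e power_mult w)
  qed
  show ?thesis using partial_char_extend[OF PC q c \<open>w \<noteq> 0\<close> W] by blast
qed

definition dirichlet_char :: "nat \<Rightarrow> (nat \<Rightarrow> complex) \<Rightarrow> bool" where
  "dirichlet_char q \<chi> \<longleftrightarrow> (\<forall>a b. \<chi> (a * b) = \<chi> a * \<chi> b) \<and> (\<forall>a b. [a = b] (mod q) \<longrightarrow> \<chi> a = \<chi> b) \<and>
     (\<forall>a. \<chi> a = 0 \<longleftrightarrow> \<not> coprime a q)"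

lemma dirichlet_charD:
  assumes "dirichlet_char q \<chi>"
  shows "\<chi> (a * b) = \<chi> a * \<chi> b" "[a = b] (mod q) \<Longrightarrow> \<chi> a = \<chi> b" "\<chi> a = 0 \<longleftrightarrow> \<not> coprime a q"
  using assms unfolding dirichlet_char_def by blast+

lemma dirichlet_char_one: assumes \<chi>: "dirichlet_char q \<chi>" shows "\<chi> 1 = 1"
  using dirichlet_charD(1)[OF \<chi>, of 1 1] dirichlet_charD(3)[OF \<chi>, of 1] by simp

lemma partial_char_extends_to_dirichlet_char:
  assumes PC: "partial_char q H \<chi>" and q: "q > 0"
  shows "\<exists>\<psi>. dirichlet_char q \<psi> \<and> (\<forall>a\<in>H. \<psi> a = \<chi> a)"
proof -
  have "\<exists>H' \<chi>'. partial_char q H' \<chi>' \<and> H \<subseteq> H' \<and> {a. a < m \<and> coprime a q} \<subseteq> H' \<and> (\<forall>a\<in>H. \<chi>' a = \<chi> a)" for m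
  proof (induction m)
    case 0
    then show ?case using PC by (intro exI[of _ H] exI[of _ \<chi>]) simp
  next
    case (Suc m)
    then obtain H1 \<chi>1 where 1: "partial_char q H1 \<chi>1" "H \<subseteq> H1" "{a. a < m \<and> coprime a q} \<subseteq> H1" "\<forall>a\<in>H. \<chi>1 a = \<chi> a"
      by blast
    show ?case
    proof (cases "coprime m q")
      case True
      obtain H2 \<chi>2 where 2: "partial_char q H2 \<chi>2" "H1 \<subseteq> H2" "m \<in> H2" "\<forall>a\<in>H1. \<chi>2 a = \<chi>1 a"
        using partial_char_extend_any[OF 1(1) q True] by blast
      have "{a. a < Suc m \<and> coprime a q} \<subseteq> H2" using 1(3) 2(2,3) by (auto simp: less_Suc_eq)
      moreover have "\<forall>a\<in>H. \<chi>2 a = \<chi> a" using 1(2,4) 2(4) by (metis subsetD)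
      ultimately show ?thesis using 1(2) 2(1,2) by (intro exI[of _ H2] exI[of _ \<chi>2]) blast
    next
      case False
      have "{a. a < Suc m \<and> coprime a q} \<subseteq> H1" using 1(3) False by (auto simp: less_Suc_eq)
      then show ?thesis using 1 by blast
    qed
  qed
  from this[of q] obtain H' \<chi>' where 1: "partial_char q H' \<chi>'" "H \<subseteq> H'" "{a. a < q \<and> coprime a q} \<subseteq> H'" "\<forall>a\<in>H. \<chi>' a = \<chi> a"
    by blast
  have full: "a \<in> H' \<longleftrightarrow> coprime a q" for a
  proof
    assume "coprime a q"
    then have "a mod q \<in> H'" using 1(3) q by (auto simp: subset_iff)
    then show "a \<in> H'" by (rule partial_charD(6)[OF 1(1)]) (simp add: cong_def)
  qed (rule partial_charD(2)[OF 1(1)])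
  define \<psi> where "\<psi> a = (if coprime a q then \<chi>' a else 0)" for a
  have "dirichlet_char q \<psi>" unfolding dirichlet_char_def
  proof (intro conjI allI impI)
    fix a b
    show "\<psi> (a * b) = \<psi> a * \<psi> b" using partial_charD(5)[OF 1(1), of a b] by (auto simp: \<psi>_def full)
    show "\<psi> a = 0 \<longleftrightarrow> \<not> coprime a q" using partial_charD(3)[OF 1(1), of a] by (auto simp: \<psi>_def full)
    assume ab: "[a = b] (mod q)"
    show "\<psi> a = \<psi> b"
    proof (cases "coprime a q")
      case True
      then have "coprime b q" using ab cong_imp_coprime by blast
      then show ?thesis using True partial_charD(7)[OF 1(1) _ ab] by (simp add: \<psi>_def full)
    next
      case False
      then have "\<not> coprime b q" using cong_imp_coprime[OF cong_sym[OF ab]] by blast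
      then show ?thesis using False by (simp add: \<psi>_def)
    qed
  qed
  moreover have "\<forall>a\<in>H. \<psi> a = \<chi> a" using 1(2,4) full by (auto simp: \<psi>_def)
  ultimately show ?thesis by blast
qed

text \<open>
  On the subgroup generated by \<open>c\<close> a primitive root of unity of order \<open>ord q c > 1\<close> is chosen, then the character is
  extended to all residues.
\<close>
lemma dirichlet_char_separating:
  assumes q: "q > 0" and c: "coprime c q" "\<not> [c = 1] (mod q)"
  shows "\<exists>\<chi>. dirichlet_char q \<chi> \<and> \<chi> c \<noteq> 1"
proof -
  define H where "H = {b. [1 = b] (mod q)}"
  have PC: "partial_char q H (\<lambda>_. 1)" unfolding partial_char_def H_def
  proof (intro conjI ballI allI impI; unfold mem_Collect_eq)
    fix a b assume a: "[1 = a] (mod q)"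
    show "coprime a q" using cong_imp_coprime[OF a] by simp
    { assume b: "[1 = b] (mod q)"
      show "[1 = a * b] (mod q)" using cong_mult[OF a b] by simp }
    { assume "[a = b] (mod q)"
      with a show "[1 = b] (mod q)" by (rule cong_trans) }
  qed simp_all
  define k where "k = ord q c"
  have k0: "k > 0" using c(1) by (simp add: k_def ord_eq_0 coprime_commute)
  have "k \<noteq> 1" using ord_works[of c q] c(2) by (auto simp: k_def)
  with k0 have k: "k > 1" by simp
  define w where "w = cis (2 * pi / k)"
  have wk: "w ^ k = 1" using k0 by (simp add: w_def DeMoivre)
  have w1: "w \<noteq> 1"
  proof
    assume "w = 1"
    then have "cis (2 * pi * real 1 / real k) = cis (2 * pi * real 0 / real k)" by (simp add: w_def)
    then have "(1::nat) = 0"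
      using k by (intro inj_onD[OF bij_betw_imp_inj_on[OF bij_betw_roots_unity[OF k0]]]) auto
    then show False by simp
  qed
  have W: "(1::complex) = w ^ e" if "c ^ e \<in> H" for e
  proof -
    have "[c ^ e = 1] (mod q)" using that by (simp add: H_def cong_sym_eq)
    then have "k dvd e" unfolding k_def by (rule ord_divides[THEN iffD1])
    then show ?thesis using wk by (auto simp: power_mult)
  qed
  have "w \<noteq> 0" by (simp add: w_def)
  obtain H' \<chi>' where H': "partial_char q H' \<chi>'" "c \<in> H'" "\<chi>' c = w"
    using partial_char_extend[OF PC q c(1) \<open>w \<noteq> 0\<close> W] by blast
  then show ?thesis using partial_char_extends_to_dirichlet_char[OF H'(1) q] w1 by metis
qed

lemma dirichlet_char_power: assumes \<chi>: "dirichlet_char q \<chi>" shows "\<chi> (a ^ n) = \<chi> a ^ n"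
  using dirichlet_charD(1)[OF \<chi>] dirichlet_char_one[OF \<chi>] by (induction n) simp_all

lemma dirichlet_char_root_of_unity:
  assumes \<chi>: "dirichlet_char q \<chi>" and a: "coprime a q"
  shows "\<chi> a ^ totient q = 1"
proof -
  have "\<chi> a ^ totient q = \<chi> (a ^ totient q)" by (rule dirichlet_char_power[OF \<chi>, symmetric])
  also have "\<dots> = \<chi> 1" by (rule dirichlet_charD(2)[OF \<chi> euler_theorem[OF a]])
  finally show ?thesis using dirichlet_char_one[OF \<chi>] by simp
qed

lemma dirichlet_char_norm_eq_1:
  assumes \<chi>: "dirichlet_char q \<chi>" and q: "q > 0" and a: "coprime a q"
  shows "norm (\<chi> a) = 1"
proof -
  have "norm (\<chi> a) ^ totient q = 1 ^ totient q"
    using dirichlet_char_root_of_unity[OF \<chi> a] by (simp add: norm_power[symmetric])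
  then show ?thesis using q by (subst (asm) power_eq_iff_eq_base) auto
qed

lemma dirichlet_char_norm_le:
  assumes \<chi>: "dirichlet_char q \<chi>" and q: "q > 0"
  shows "norm (\<chi> a) \<le> 1"
  using dirichlet_char_norm_eq_1[OF \<chi> q, of a] dirichlet_charD(3)[OF \<chi>, of a] by (cases "coprime a q") auto

lemma finite_dirichlet_chars:
  assumes q: "q > 0"
  shows "finite {\<chi>. dirichlet_char q \<chi>}"
proof (rule finite_subset)
  define R where "R = insert 0 {z::complex. z ^ totient q = 1}"
  show "{\<chi>. dirichlet_char q \<chi>} \<subseteq> (\<lambda>f n. f (n mod q)) ` (PiE {..<q} (\<lambda>_. R))"
  proof
    fix \<chi> assume "\<chi> \<in> {\<chi>. dirichlet_char q \<chi>}"
    then have \<chi>: "dirichlet_char q \<chi>" by simp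
    have R: "\<chi> n \<in> R" for n
      using dirichlet_char_root_of_unity[OF \<chi>, of n] dirichlet_charD(3)[OF \<chi>, of n] by (auto simp: R_def)
    have "\<chi> = (\<lambda>n. restrict \<chi> {..<q} (n mod q))"
    proof
      fix n
      have "\<chi> (n mod q) = \<chi> n" by (rule dirichlet_charD(2)[OF \<chi>]) (simp add: cong_def)
      then show "\<chi> n = restrict \<chi> {..<q} (n mod q)" using q by simp
    qed
    moreover have "restrict \<chi> {..<q} \<in> PiE {..<q} (\<lambda>_. R)" using R by auto
    ultimately show "\<chi> \<in> (\<lambda>f n. f (n mod q)) ` (PiE {..<q} (\<lambda>_. R))" by (rule image_eqI)
  qed
  have "finite R" using q by (simp add: R_def finite_nth_roots)
  then show "finite ((\<lambda>f n. f (n mod q)) ` (PiE {..<q} (\<lambda>_. R)))" by (intro finite_imageI finite_PiE) auto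
qed

definition principal_char :: "nat \<Rightarrow> nat \<Rightarrow> complex" where
  "principal_char q n = (if coprime n q then 1 else 0)"

lemma dirichlet_char_principal: "dirichlet_char q (principal_char q)"
  unfolding dirichlet_char_def principal_char_def
  by (auto dest: cong_imp_coprime cong_imp_coprime[OF cong_sym])

lemma nonprincipal_witness:
  assumes \<chi>: "dirichlet_char q \<chi>" "\<chi> \<noteq> principal_char q"
  obtains a where "coprime a q" "\<chi> a \<noteq> 1"
proof -
  from \<chi>(2) obtain a where "\<chi> a \<noteq> principal_char q a" by blast
  then have "coprime a q \<and> \<chi> a \<noteq> 1" using dirichlet_charD(3)[OF \<chi>(1), of a] by (auto simp: principal_char_def split: if_splits)
  then show ?thesis using that by blast
qed

lemma sum_nonprincipal_char:
  assumes \<chi>: "dirichlet_char q \<chi>" "\<chi> \<noteq> principal_char q" and q: "q > 0"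
  shows "(\<Sum>n<q. \<chi> n) = 0"
proof -
  obtain a where a: "coprime a q" "\<chi> a \<noteq> 1" using nonprincipal_witness[OF \<chi>] .
  have inj: "inj_on (\<lambda>n. a * n mod q) {..<q}"
  proof (rule inj_onI)
    fix x y assume xy: "x \<in> {..<q}" "y \<in> {..<q}" and "a * x mod q = a * y mod q"
    then have "[a * x = a * y] (mod q)" by (simp add: Cong.cong_def)
    then have "[x = y] (mod q)" using a(1) by (subst (asm) cong_mult_lcancel_nat) auto
    then show "x = y" using xy by (simp add: Cong.cong_def)
  qed
  have sub: "(\<lambda>n. a * n mod q) ` {..<q} \<subseteq> {..<q}" using q by auto
  have "bij_betw (\<lambda>n. a * n mod q) {..<q} {..<q}"
    unfolding bij_betw_def using inj endo_inj_surj[OF _ sub inj] by simp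
  then have "(\<Sum>n<q. \<chi> n) = (\<Sum>n<q. \<chi> (a * n mod q))" by (rule sum.reindex_bij_betw[symmetric])
  also have "\<dots> = (\<Sum>n<q. \<chi> a * \<chi> n)"
  proof (rule sum.cong[OF refl])
    fix n
    have "\<chi> (a * n mod q) = \<chi> (a * n)" by (rule dirichlet_charD(2)[OF \<chi>(1)]) (simp add: cong_def)
    then show "\<chi> (a * n mod q) = \<chi> a * \<chi> n" by (simp add: dirichlet_charD(1)[OF \<chi>(1)])
  qed
  also have "\<dots> = \<chi> a * (\<Sum>n<q. \<chi> n)" by (simp add: sum_distrib_left)
  finally show ?thesis using a(2) by simp
qed

text \<open>
  Multiplication by a character \<open>\<psi>\<close> with \<open>\<psi>(n) \<noteq> 1\<close> permutes the characters and scales the sum by \<open>\<psi>(n)\<close>.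
\<close>
lemma sum_over_dirichlet_chars:
  assumes q: "q > 0"
  shows "(\<Sum>\<chi> | dirichlet_char q \<chi>. \<chi> n) = (if [n = 1] (mod q) then of_nat (card {\<chi>. dirichlet_char q \<chi>}) else 0)"
proof -
  consider "[n = 1] (mod q)" | "\<not> [n = 1] (mod q)" "\<not> coprime n q" | "\<not> [n = 1] (mod q)" "coprime n q" by blast
  then show ?thesis
  proof cases
    case 1
    have "\<chi> n = 1" if "dirichlet_char q \<chi>" for \<chi>
      using dirichlet_charD(2)[OF that 1] dirichlet_char_one[OF that] by simp
    then have "(\<Sum>\<chi> | dirichlet_char q \<chi>. \<chi> n) = (\<Sum>\<chi> | dirichlet_char q \<chi>. 1)"
      by (intro sum.cong) auto
    then show ?thesis using 1 by simp
  next
    case 2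
    have "(\<Sum>\<chi> | dirichlet_char q \<chi>. \<chi> n) = (\<Sum>\<chi> | dirichlet_char q \<chi>. 0)"
      using dirichlet_charD(3) 2(2) by (intro sum.cong) auto
    then show ?thesis using 2 by simp
  next
    case 3
    obtain \<psi> where \<psi>: "dirichlet_char q \<psi>" "\<psi> n \<noteq> 1" using dirichlet_char_separating[OF q 3(2,1)] by blast
    define F where "F \<chi> = (\<lambda>a. \<psi> a * \<chi> a)" for \<chi> :: "nat \<Rightarrow> complex"
    have inj: "inj_on F {\<chi>. dirichlet_char q \<chi>}"
    proof (rule inj_onI)
      fix \<chi> \<chi>' assume "\<chi> \<in> {\<chi>. dirichlet_char q \<chi>}" "\<chi>' \<in> {\<chi>. dirichlet_char q \<chi>}" and eq: "F \<chi> = F \<chi>'"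
      then have c: "dirichlet_char q \<chi>" "dirichlet_char q \<chi>'" by simp_all
      show "\<chi> = \<chi>'"
      proof
        fix a
        show "\<chi> a = \<chi>' a"
          using fun_cong[OF eq, of a] dirichlet_charD(3)[OF c(1), of a] dirichlet_charD(3)[OF c(2), of a]
            dirichlet_charD(3)[OF \<psi>(1), of a] by (cases "coprime a q") (simp_all add: F_def)
      qed
    qed
    have sub: "F ` {\<chi>. dirichlet_char q \<chi>} \<subseteq> {\<chi>. dirichlet_char q \<chi>}"
    proof (rule image_subsetI, rule CollectI)
      fix \<chi> assume "\<chi> \<in> {\<chi>. dirichlet_char q \<chi>}"
      then have c: "dirichlet_char q \<chi>" by simp
      show "dirichlet_char q (F \<chi>)" unfolding dirichlet_char_def F_def
        using dirichlet_charD(1)[OF c] dirichlet_charD(1)[OF \<psi>(1)] dirichlet_charD(2)[OF c] dirichlet_charD(2)[OF \<psi>(1)]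
          dirichlet_charD(3)[OF c] dirichlet_charD(3)[OF \<psi>(1)] by (simp add: mult_ac)
    qed
    have "bij_betw F {\<chi>. dirichlet_char q \<chi>} {\<chi>. dirichlet_char q \<chi>}"
      unfolding bij_betw_def using inj endo_inj_surj[OF finite_dirichlet_chars[OF q] sub inj] by simp
    then have "(\<Sum>\<chi> | dirichlet_char q \<chi>. \<chi> n) = (\<Sum>\<chi> | dirichlet_char q \<chi>. F \<chi> n)" by (rule sum.reindex_bij_betw[symmetric])
    also have "\<dots> = \<psi> n * (\<Sum>\<chi> | dirichlet_char q \<chi>. \<chi> n)" by (simp add: F_def sum_distrib_left)
    finally show ?thesis using \<psi>(2) 3(1) by simp
  qed
qed

text \<open>
  Both orthogonality relations evaluate the sum of all values of all characters.
\<close>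
lemma card_dirichlet_chars:
  assumes q: "q \<ge> 2"
  shows "card {\<chi>. dirichlet_char q \<chi>} = totient q"
proof -
  define D where "D = {\<chi>. dirichlet_char q \<chi>}"
  have q0: "q > 0" using q by simp
  have fin: "finite D" unfolding D_def by (rule finite_dirichlet_chars[OF q0])
  have one: "[n = 1] (mod q) \<longleftrightarrow> n = 1" if "n \<in> {..<q}" for n using that q by (simp add: Cong.cong_def)
  have "(\<Sum>n<q. \<Sum>\<chi>\<in>D. \<chi> n) = (\<Sum>n<q. if n = 1 then of_nat (card D) else 0)"
    using one by (intro sum.cong refl) (simp add: D_def sum_over_dirichlet_chars[OF q0])
  also have "\<dots> = of_nat (card D)" using q by (subst sum.delta) auto
  finally have 1: "(\<Sum>n<q. \<Sum>\<chi>\<in>D. \<chi> n) = of_nat (card D)" .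
  have "(\<Sum>n<q. \<Sum>\<chi>\<in>D. \<chi> n) = (\<Sum>\<chi>\<in>D. \<Sum>n<q. \<chi> n)" by (rule sum.swap)
  also have "\<dots> = (\<Sum>\<chi>\<in>D. if \<chi> = principal_char q then (\<Sum>n<q. principal_char q n) else 0)"
    using sum_nonprincipal_char q0 by (intro sum.cong refl) (simp add: D_def)
  also have "\<dots> = (\<Sum>n<q. principal_char q n)" using fin dirichlet_char_principal by (subst sum.delta) (auto simp: D_def)
  also have "\<dots> = of_nat (card {n\<in>{..<q}. coprime n q})"
    by (simp add: principal_char_def sum.inter_filter[symmetric])
  also have "{n\<in>{..<q}. coprime n q} = totatives q"
  proof (intro equalityI subsetI)
    fix n assume "n \<in> {n\<in>{..<q}. coprime n q}"
    then have n: "n < q" "coprime n q" by simp_all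
    have "n \<noteq> 0" using n(2) q by (intro notI) simp
    then show "n \<in> totatives q" using n by (simp add: totatives_def)
  next
    fix n assume "n \<in> totatives q"
    then have n: "0 < n" "n \<le> q" "coprime n q" by (simp_all add: totatives_def)
    have "n \<noteq> q" using n(3) q by (intro notI) simp
    then show "n \<in> {n\<in>{..<q}. coprime n q}" using n by simp
  qed
  finally have "of_nat (card D) = (of_nat (totient q) :: complex)" using 1 by (simp only: totient_def)
  then show ?thesis by (simp only: of_nat_eq_iff D_def)
qed

section \<open>Sums of the von Mangoldt function\<close>

text \<open>
  Partial summation: the differences of the decreasing weights telescope.
\<close>
lemma abel_bound:
  fixes c :: "nat \<Rightarrow> complex" and f :: "nat \<Rightarrow> real"
  assumes ps: "\<And>M. norm (\<Sum>n<M. c n) \<le> B"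
    and dec: "\<And>n. n \<ge> M \<Longrightarrow> f (Suc n) \<le> f n" and pos: "\<And>n. n \<ge> M \<Longrightarrow> f n \<ge> 0"
  shows "norm (\<Sum>n\<in>{M..<K}. of_real (f n) * c n) \<le> 2 * B * f M"
proof (cases "M \<le> K")
  case False
  have "0 \<le> B" using ps[of 0] by simp
  then show ?thesis using False pos[of M] by simp
next
  case True
  define P where "P n = (\<Sum>k<n. c k)" for n
  have "(\<Sum>n\<in>{M..<K}. of_real (f n) * c n) = of_real (f K) * P K - of_real (f M) * P M
      + (\<Sum>n\<in>{M..<K}. of_real (f n - f (Suc n)) * P (Suc n))"
    using True
  proof (induction K rule: dec_induct)
    case (step K)
    have "P (Suc K) = P K + c K" by (simp add: P_def)
    then show ?case using step by (simp add: algebra_simps)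
  qed simp
  also have "norm \<dots> \<le> f K * B + f M * B + (\<Sum>n\<in>{M..<K}. (f n - f (Suc n)) * B)"
  proof (intro order.trans[OF norm_triangle_ineq] add_mono order.trans[OF norm_triangle_ineq4] sum_norm_le)
    have fK: "f K \<ge> 0" "f M \<ge> 0" using pos True by auto
    show "norm (of_real (f K) * P K) \<le> f K * B" "norm (of_real (f M) * P M) \<le> f M * B"
      using fK ps[of K] ps[of M] by (simp_all add: norm_mult P_def mult_left_mono)
    fix n assume "n \<in> {M..<K}"
    then have "f n - f (Suc n) \<ge> 0" using dec[of n] by simp
    then show "norm (of_real (f n - f (Suc n)) * P (Suc n)) \<le> (f n - f (Suc n)) * B"
      using ps[of "Suc n"] by (simp add: norm_mult P_def mult_left_mono del: of_real_diff)
  qed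
  also have "(\<Sum>n\<in>{M..<K}. (f n - f (Suc n)) * B) = (f M - f K) * B"
  proof -
    have "(\<Sum>n\<in>{M..<K}. f n - f (Suc n)) = f M - f K"
      using True by (induction K rule: dec_induct) simp_all
    then show ?thesis by (simp add: sum_distrib_right[symmetric])
  qed
  finally show ?thesis by (simp add: algebra_simps)
qed

lemma sum_divisors_swap:
  fixes f :: "nat \<Rightarrow> nat \<Rightarrow> 'a :: comm_monoid_add"
  shows "(\<Sum>n\<in>{1..x}. \<Sum>d | d dvd n. f d (n div d)) = (\<Sum>d\<in>{1..x}. \<Sum>m\<in>{1..x div d}. f d m)"
proof -
  have "(\<Sum>n\<in>{1..x}. \<Sum>d | d dvd n. f d (n div d)) = (\<Sum>(n,d)\<in>Sigma {1..x} (\<lambda>n. {d. d dvd n}). f d (n div d))"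
    by (rule sum.Sigma) auto
  also have "\<dots> = (\<Sum>(d,m)\<in>Sigma {1..x} (\<lambda>d. {1..x div d}). f d m)"
  proof (rule sum.reindex_bij_witness[of _ "\<lambda>(d,m). (d * m, d)" "\<lambda>(n,d). (d, n div d)"])
    fix a assume "a \<in> Sigma {1..x} (\<lambda>n. {d. d dvd n})"
    then obtain n d where a: "a = (n, d)" "1 \<le> n" "n \<le> x" "d dvd n" by auto
    then obtain m where m: "n = d * m" by blast
    have d: "d > 0" "m > 0" using a(2) m by (auto intro!: Nat.gr0I)
    have "d \<le> n" using d by (simp add: m)
    then have "d \<le> x" using a(3) by (rule order.trans)
    moreover have "m \<le> x div d" using a(3) d(1) by (simp add: m less_eq_div_iff_mult_less_eq mult.commute)
    ultimately show "(case a of (n, d) \<Rightarrow> (d, n div d)) \<in> Sigma {1..x} (\<lambda>d. {1..x div d})"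
      using a(1) d by (simp add: m)
    show "(case (case a of (n, d) \<Rightarrow> (d, n div d)) of (d, m) \<Rightarrow> (d * m, d)) = a" using a by simp
    show "(case (case a of (n, d) \<Rightarrow> (d, n div d)) of (d, m) \<Rightarrow> f d m) = (case a of (n, d) \<Rightarrow> f d (n div d))" using a by simp
  next
    fix b assume "b \<in> Sigma {1..x} (\<lambda>d. {1..x div d})"
    then obtain d m where b: "b = (d, m)" "1 \<le> d" "d \<le> x" "1 \<le> m" "m \<le> x div d" by auto
    then have "d * m \<le> x" by (simp add: less_eq_div_iff_mult_less_eq mult.commute)
    moreover have "1 \<le> d * m" using b(2,4) by simp
    ultimately show "(case b of (d, m) \<Rightarrow> (d * m, d)) \<in> Sigma {1..x} (\<lambda>n. {d. d dvd n})" using b(1) by simp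
    show "(case (case b of (d, m) \<Rightarrow> (d * m, d)) of (n, d) \<Rightarrow> (d, n div d)) = b" using b(1,2) by simp
  qed
  also have "\<dots> = (\<Sum>d\<in>{1..x}. \<Sum>m\<in>{1..x div d}. f d m)" by (rule sum.Sigma[symmetric]) auto
  finally show ?thesis .
qed

lemma sum_ln_over_square_le: "(\<Sum>m\<in>{2..x}. ln (real m) / (real m)\<^sup>2) \<le> 4"
proof -
  have "(\<Sum>m\<in>{2..Suc y}. ln (real m) / (real m)\<^sup>2) \<le> 4 - 4 / sqrt (real (Suc y))" for y
  proof (induction y)
    case (Suc y)
    define a b where "a = sqrt (real (Suc y))" and "b = sqrt (real (Suc (Suc y)))"
    have ab: "0 < a" "a \<le> b" "b * b = a * a + 1" by (simp_all add: a_def b_def)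
    have mb: "real (Suc (Suc y)) = b * b" by (simp add: b_def)
    have "ln (real (Suc (Suc y))) = 2 * ln b" unfolding mb using ab(1,2) by (simp add: ln_mult)
    also have "\<dots> \<le> 2 * b" using ab ln_le_minus_one[of b] by simp
    finally have "ln (real (Suc (Suc y))) / (real (Suc (Suc y)))\<^sup>2 \<le> 2 * b / (b * b)\<^sup>2"
      unfolding mb by (intro divide_right_mono) simp_all
    also have "\<dots> = 2 / (b * b * b)" using ab(1,2) by (simp add: field_simps power2_eq_square)
    also have "\<dots> \<le> 4 * (b - a) / (a * b)"
    proof -
      have "(b - a) * (2 * b) \<ge> (b - a) * (a + b)" using ab by (intro mult_left_mono) auto
      then have 1: "(b - a) * (2 * b) \<ge> 1" using ab(3) by (simp add: algebra_simps)
      have "2 * (a * b) \<le> 2 * (b * b)" using ab(1,2) by simp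
      also have "\<dots> \<le> 2 * (b * b) * ((b - a) * (2 * b))" using mult_left_mono[OF 1, of "2 * (b * b)"] by simp
      finally have *: "2 * (a * b) \<le> 4 * (b - a) * (b * b * b)" by (simp add: mult_ac)
      have b0: "b > 0" using ab(1,2) by simp
      have "2 / (b * b * b) = 2 * (a * b) / ((a * b) * (b * b * b))" using ab(1) b0 by simp
      also have "\<dots> \<le> 4 * (b - a) * (b * b * b) / ((a * b) * (b * b * b))"
        by (rule divide_right_mono[OF *]) (use ab(1) b0 in simp)
      also have "\<dots> = 4 * (b - a) / (a * b)" using ab(1) b0 by simp
      finally show ?thesis .
    qed
    also have "\<dots> = 4 / a - 4 / b" using ab by (simp add: field_simps)
    finally have "ln (real (Suc (Suc y))) / (real (Suc (Suc y)))\<^sup>2 \<le> 4 / a - 4 / b" .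
    then show ?case using Suc by (simp add: a_def b_def)
  qed simp
  note * = this
  show ?thesis
  proof (cases x)
    case (Suc y)
    have "4 - 4 / sqrt (real (Suc y)) \<le> 4" by simp
    with *[of y] show ?thesis unfolding Suc by linarith
  qed simp
qed

text \<open>
  A proper prime power is \<open>m\<^sup>2\<close> or \<open>m\<^sup>2\<close> times the prime divisor of \<open>m\<close> for a smaller prime power \<open>m\<close>, so the sum is dominated by the
  convergent series of \<open>ln m / m\<^sup>2\<close>.
\<close>
lemma sum_mangoldt_nonprime_le: "(\<Sum>n | n \<in> {1..x} \<and> \<not> prime n. mangoldt n / real n) \<le> 20"
proof -
  define g where "g n = mangoldt n / real n" for n
  have g0: "g n \<ge> 0" for n by (simp add: g_def mangoldt_nonneg)
  define e1 e2 where "e1 m = m\<^sup>2" and "e2 m = m\<^sup>2 * aprimedivisor m" for m :: nat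
  have sub: "{n. n \<in> {1..x} \<and> \<not> prime n \<and> primepow n} \<subseteq> e1 ` {2..x} \<union> e2 ` {2..x}"
  proof
    fix n assume n: "n \<in> {n. n \<in> {1..x} \<and> \<not> prime n \<and> primepow n}"
    then obtain p k where pk: "prime p" "k > 0" "n = p ^ k" unfolding primepow_def by auto
    have "k \<noteq> 1" using n pk by auto
    define j where "j = k div 2"
    have j: "j > 0" using pk(2) \<open>k \<noteq> 1\<close> by (simp add: j_def)
    define m where "m = p ^ j"
    have "p ^ 1 \<le> p ^ j" using j prime_gt_0_nat[OF pk(1)] by (intro power_increasing) auto
    then have m2: "m \<ge> 2" using prime_ge_2_nat[OF pk(1)] by (simp add: m_def)
    have "p ^ j \<le> p ^ k" using prime_gt_0_nat[OF pk(1)] by (intro power_increasing) (auto simp: j_def)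
    then have mx: "m \<in> {2..x}" using m2 n by (simp add: m_def pk(3))
    consider "k = 2 * j" | "k = 2 * j + 1" unfolding j_def by linarith
    then show "n \<in> e1 ` {2..x} \<union> e2 ` {2..x}"
    proof cases
      case 1
      then have "n = e1 m" by (simp add: e1_def m_def pk(3) power_mult[symmetric] mult.commute)
      then show ?thesis using mx by blast
    next
      case 2
      have "aprimedivisor m = p" unfolding m_def by (rule aprimedivisor_prime_power[OF pk(1) j])
      then have "n = e2 m" using 2 by (simp add: e2_def m_def pk(3) power_mult[symmetric] mult.commute)
      then show ?thesis using mx by blast
    qed
  qed
  have g1: "g (e1 m) \<le> 2 * (ln (real m) / (real m)\<^sup>2)" if "m \<in> {2..x}" for m
  proof -
    have "mangoldt (m\<^sup>2) \<le> ln (real (m\<^sup>2))" using that by (intro mangoldt_le) simp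
    also have "\<dots> = 2 * ln (real m)" using that by (simp add: ln_realpow)
    finally show ?thesis using that by (simp add: g_def e1_def divide_simps)
  qed
  have g2: "g (e2 m) \<le> 3 * (ln (real m) / (real m)\<^sup>2)" if m: "m \<in> {2..x}" for m
  proof -
    define a where "a = aprimedivisor m"
    have "m > Suc 0" using m by simp
    then have "a > 0" "a \<le> m" unfolding a_def by (rule aprimedivisor_gt_0_nat, rule aprimedivisor_le_nat)
    then have a: "a \<ge> 1" "a \<le> m" by simp_all
    have pos: "m\<^sup>2 * a > 0" using m a by simp
    have "mangoldt (m\<^sup>2 * a) \<le> ln (real (m\<^sup>2 * a))" using pos by (intro mangoldt_le) simp
    also have "\<dots> \<le> ln (real m ^ 3)" using pos a m by (subst ln_le_cancel_iff) (auto simp: power2_eq_square power3_eq_cube intro!: mult_left_mono simp del: of_nat_mult of_nat_power simp flip: of_nat_mult of_nat_power)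
    also have "\<dots> = 3 * ln (real m)" using m by (simp add: ln_realpow)
    finally have "g (e2 m) \<le> 3 * ln (real m) / real (m\<^sup>2 * a)" unfolding g_def e2_def a_def by (intro divide_right_mono) simp_all
    also have "\<dots> \<le> 3 * ln (real m) / real (m\<^sup>2 * 1)" using m a by (intro divide_left_mono) auto
    finally show ?thesis by simp
  qed
  have fin: "finite (e1 ` {2..x})" "finite (e2 ` {2..x})" by simp_all
  have "(\<Sum>n | n \<in> {1..x} \<and> \<not> prime n. mangoldt n / real n) = (\<Sum>n | n \<in> {1..x} \<and> \<not> prime n \<and> primepow n. g n)"
    unfolding g_def by (rule sum.mono_neutral_right) (auto simp: mangoldt_def)
  also have "\<dots> \<le> (\<Sum>n\<in>e1 ` {2..x} \<union> e2 ` {2..x}. g n)" by (rule sum_mono2) (use sub g0 in simp_all)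
  also have "\<dots> \<le> (\<Sum>n\<in>e1 ` {2..x}. g n) + (\<Sum>n\<in>e2 ` {2..x}. g n)"
  proof -
    have "(\<Sum>n\<in>e1 ` {2..x} \<inter> e2 ` {2..x}. g n) \<ge> 0" using g0 by (intro sum_nonneg)
    then show ?thesis using sum.union_inter[OF fin, of g] by linarith
  qed
  also have "(\<Sum>n\<in>e1 ` {2..x}. g n) \<le> (\<Sum>m\<in>{2..x}. g (e1 m))" using g0 sum_image_le[of "{2..x}" g e1] by simp
  also have "\<dots> \<le> (\<Sum>m\<in>{2..x}. 2 * (ln (real m) / (real m)\<^sup>2))" by (rule sum_mono) (rule g1)
  also have "\<dots> = 2 * (\<Sum>m\<in>{2..x}. ln (real m) / (real m)\<^sup>2)" by (simp only: sum_distrib_left)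
  also have "(\<Sum>n\<in>e2 ` {2..x}. g n) \<le> (\<Sum>m\<in>{2..x}. g (e2 m))" using g0 sum_image_le[of "{2..x}" g e2] by simp
  also have "\<dots> \<le> (\<Sum>m\<in>{2..x}. 3 * (ln (real m) / (real m)\<^sup>2))" by (rule sum_mono) (rule g2)
  also have "\<dots> = 3 * (\<Sum>m\<in>{2..x}. ln (real m) / (real m)\<^sup>2)" by (simp only: sum_distrib_left)
  finally show ?thesis using sum_ln_over_square_le[of x] by linarith
qed

lemma sum_split_prime:
  fixes f :: "nat \<Rightarrow> real"
  shows "(\<Sum>n\<in>{1..x}. f n) = (\<Sum>p | prime p \<and> p \<le> x. f p) + (\<Sum>n | n \<in> {1..x} \<and> \<not> prime n. f n)"
proof -
  have "{1..x} = {p. prime p \<and> p \<le> x} \<union> {n. n \<in> {1..x} \<and> \<not> prime n}"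
    by (auto dest: prime_gt_0_nat simp: Suc_le_eq)
  moreover have "finite {p. prime p \<and> p \<le> x}" by (rule finite_subset[of _ "{..x}"]) auto
  ultimately show ?thesis by (metis (no_types, lifting) sum.union_disjoint[of "{p. prime p \<and> p \<le> x}" "{n. n \<in> {1..x} \<and> \<not> prime n}" f] finite_Collect_conjI finite_atLeastAtMost disjoint_iff mem_Collect_eq finite_Un)
qed

lemma chebyshev_psi_upper: "\<exists>C. \<forall>x. (\<Sum>n\<in>{1..x}. mangoldt n) \<le> C * real x"
proof (intro exI allI)
  fix x :: nat
  have "(\<Sum>n | n \<in> {1..x} \<and> \<not> prime n. mangoldt n) \<le> (\<Sum>n | n \<in> {1..x} \<and> \<not> prime n. real x * (mangoldt n / real n))"
  proof (rule sum_mono)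
    fix n assume "n \<in> {n. n \<in> {1..x} \<and> \<not> prime n}"
    then have "1 \<le> n" "n \<le> x" by auto
    then have "mangoldt n * real n \<le> mangoldt n * real x" by (intro mult_left_mono) (auto simp: mangoldt_nonneg)
    then show "mangoldt n \<le> real x * (mangoldt n / real n)" using \<open>1 \<le> n\<close> by (simp add: field_simps)
  qed
  also have "\<dots> = real x * (\<Sum>n | n \<in> {1..x} \<and> \<not> prime n. mangoldt n / real n)" by (simp only: sum_distrib_left)
  also have "\<dots> \<le> real x * 20" by (intro mult_left_mono sum_mangoldt_nonprime_le) simp
  finally have 1: "(\<Sum>n | n \<in> {1..x} \<and> \<not> prime n. mangoldt n) \<le> real x * 20" .
  have "(\<Sum>p | prime p \<and> p \<le> x. mangoldt p) = (\<Sum>p | prime p \<and> p \<le> x. ln (real p))" by (intro sum.cong) auto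
  then show "(\<Sum>n\<in>{1..x}. mangoldt n) \<le> (3 * ln 4 + 20) * real x"
    using 1 chebyshev_theta_upper[of x] sum_split_prime[of mangoldt x] by (simp add: algebra_simps)
qed

lemma mult_ln_Suc_le: "real x * (ln (real (Suc x)) - ln (real x)) \<le> 1"
proof (cases "x = 0")
  case False
  then have "ln (real (Suc x)) - ln (real x) = ln (real (Suc x) / real x)" by (simp add: ln_div)
  also have "real (Suc x) / real x = 1 + 1 / real x" using False by (simp add: field_simps)
  also have "ln (1 + 1 / real x) \<le> 1 / real x" by (rule ln_add_one_self_le_self) simp
  finally have "real x * (ln (real (Suc x)) - ln (real x)) \<le> real x * (1 / real x)" by (rule mult_left_mono) simp
  also have "\<dots> = 1" using False by simp
  finally show ?thesis .
qed simp

lemma sum_ln_ge: "(\<Sum>n\<in>{1..x}. ln (real n)) \<ge> real x * ln (real x) - real x"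
proof (induction x)
  case (Suc x)
  have "real (Suc x) * ln (real (Suc x)) - real (Suc x) = real x * ln (real x) - real x + ln (real (Suc x))
      + (real x * (ln (real (Suc x)) - ln (real x)) - 1)"
    by (simp add: algebra_simps)
  also have "\<dots> \<le> real x * ln (real x) - real x + ln (real (Suc x))" using mult_ln_Suc_le[of x] by linarith
  finally show ?case using Suc by simp
qed simp

text \<open>
  The logarithm of \<open>x!\<close> is the sum of \<open>mangoldt d\<close> times the integer part of \<open>x / d\<close>.
\<close>
lemma mertens_mangoldt_lower:
  assumes "x \<ge> 1"
  shows "(\<Sum>n\<in>{1..x}. mangoldt n / real n) \<ge> ln (real x) - 1"
proof -
  have "(\<Sum>n\<in>{1..x}. ln (real n)) = (\<Sum>n\<in>{1..x}. \<Sum>d | d dvd n. mangoldt d)"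
    by (intro sum.cong refl) (simp add: mangoldt_sum)
  also have "\<dots> = (\<Sum>d\<in>{1..x}. \<Sum>m\<in>{1..x div d}. mangoldt d)" by (rule sum_divisors_swap[of "\<lambda>d m. mangoldt d"])
  also have "\<dots> \<le> (\<Sum>d\<in>{1..x}. real x * (mangoldt d / real d))"
  proof (rule sum_mono)
    fix d assume "d \<in> {1..x}"
    have "real (x div d) * mangoldt d \<le> real x / real d * mangoldt d"
      by (intro mult_right_mono of_nat_div_le_of_nat mangoldt_nonneg)
    then show "(\<Sum>m\<in>{1..x div d}. mangoldt d) \<le> real x * (mangoldt d / real d)" by simp
  qed
  also have "\<dots> = real x * (\<Sum>d\<in>{1..x}. mangoldt d / real d)" by (simp only: sum_distrib_left)
  finally have "real x * (ln (real x) - 1) \<le> real x * (\<Sum>d\<in>{1..x}. mangoldt d / real d)"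
    using sum_ln_ge[of x] by (simp add: algebra_simps)
  moreover have "real x > 0" using assms by simp
  ultimately show ?thesis by (simp only: mult_le_cancel_left_pos)
qed

text \<open>
  This is the case of the linear polynomial \<open>X\<close>, which has a root modulo every prime.
\<close>
lemma mertens_prime_upper: "\<exists>C. \<forall>y\<ge>2. (\<Sum>p | prime p \<and> p \<le> y. ln (real p) / real p) \<le> ln (real y) + C"
proof -
  have H: "min_int_poly_of [:0, 1:] (0 :: complex)" unfolding min_int_poly_of_def
  proof (intro conjI allI impI)
    fix f :: "int poly" assume "ipoly f 0 = 0"
    then have "coeff f 0 = 0" by (simp add: poly_0_coeff_0)
    moreover obtain c g where f: "f = pCons c g" by (cases f)
    ultimately have "f = [:0, 1:] * g" by simp
    then show "[:0, 1:] dvd f" by (rule dvdI)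
  qed (simp_all add: of_int_hom.map_poly_pCons_hom)
  have "\<exists>C. \<forall>y\<ge>2. (\<Sum>p | p \<in> {p. prime p} \<and> p \<le> y. ln (real p) / real p) \<le> ln (real y) / real (degree [:0, 1 :: int:]) + C"
    by (rule totally_split_primes_upper[OF H, of "{p. prime p}" "\<lambda>p. {0}"]) (simp_all add: prime_gt_0_nat)
  then show ?thesis by simp
qed

definition moebius :: "nat \<Rightarrow> real" where
  "moebius n = (if squarefree n then (-1) ^ card (prime_factors n) else 0)"

lemma abs_moebius_le: "\<bar>moebius n\<bar> \<le> 1" by (simp add: moebius_def power_abs)

lemma moebius_prime_mult:
  assumes p: "prime p" and d: "\<not> p dvd d" and d0: "d > 0"
  shows "moebius (p * d) = - moebius d"
proof -
  have cop: "coprime p d" using p d by (simp add: prime_imp_coprime)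
  have sq: "squarefree (p * d) \<longleftrightarrow> squarefree d"
    using squarefree_mult_coprime[OF cop] squarefree_prime[OF p] squarefree_multD(2) by blast
  have "prime_factors (p * d) = insert p (prime_factors d)"
    using p d0 prime_gt_0_nat[OF p] by (simp add: prime_factorization_mult prime_factorization_prime)
  moreover have "p \<notin> prime_factors d" using d by auto
  ultimately show ?thesis by (simp add: moebius_def sq)
qed

text \<open>
  Multiplication by a fixed prime divisor of \<open>n\<close> pairs the square-free divisors with opposite signs.
\<close>
lemma sum_moebius_divisors:
  assumes n: "n > 0"
  shows "(\<Sum>d | d dvd n. moebius d) = (if n = 1 then 1 else 0)"
proof (cases "n = 1")
  case True
  then show ?thesis by (simp add: moebius_def)
next
  case False
  then obtain p where p: "prime p" "p dvd n" using prime_factor_nat by blast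
  define A B where "A = {d. d dvd n \<and> squarefree d \<and> \<not> p dvd d}" and "B = {d. d dvd n \<and> squarefree d \<and> p dvd d}"
  have p0: "p > 0" by (rule prime_gt_0_nat[OF p(1)])
  have fin: "finite A" "finite B" unfolding A_def B_def using n by (auto intro: finite_subset[OF _ finite_divisors_nat[OF n]])
  have "(\<Sum>d | d dvd n. moebius d) = (\<Sum>d\<in>A \<union> B. moebius d)"
    using n by (intro sum.mono_neutral_right) (auto simp: A_def B_def moebius_def)
  also have "\<dots> = (\<Sum>d\<in>A. moebius d) + (\<Sum>d\<in>B. moebius d)" using fin by (intro sum.union_disjoint) (auto simp: A_def B_def)
  also have "(\<Sum>d\<in>B. moebius d) = (\<Sum>d\<in>A. - moebius d)"
  proof (rule sum.reindex_bij_witness[of _ "\<lambda>d. p * d" "\<lambda>d. d div p"])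
    fix d assume "d \<in> B"
    then obtain e where e: "d = p * e" "d dvd n" "squarefree d" unfolding B_def by blast
    have "\<not> p dvd e"
    proof
      assume "p dvd e"
      then have "p ^ 2 dvd d" by (simp add: e(1) power2_eq_square)
      then have "is_unit p" using e(3) squarefreeD by blast
      then show False using p(1) by auto
    qed
    moreover have "e dvd n" using e(1,2) dvd_mult_right by blast
    moreover have "squarefree e" using e(1,3) squarefree_multD(2) by blast
    ultimately show "d div p \<in> A" "p * (d div p) = d" "- moebius (d div p) = moebius d"
      using e p0 n moebius_prime_mult[OF p(1), of e] by (auto simp: A_def dest: dvd_pos_nat)
  next
    fix d assume "d \<in> A"
    then have d: "d dvd n" "squarefree d" "\<not> p dvd d" by (simp_all add: A_def)
    have cop: "coprime p d" using p(1) d(3) by (simp add: prime_imp_coprime)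
    have "p * d dvd n" by (rule divides_mult[OF p(2) d(1) cop])
    moreover have "squarefree (p * d)" by (rule squarefree_mult_coprime[OF cop squarefree_prime[OF p(1)] d(2)])
    ultimately show "p * d \<in> B" by (simp add: B_def)
    show "p * d div p = d" using p0 by simp
  qed
  finally show ?thesis using False by (simp add: sum_negf)
qed

lemma sum_moebius_ln:
  assumes n: "n > 0"
  shows "(\<Sum>d | d dvd n. moebius d * ln (real (n div d))) = mangoldt n"
proof -
  let ?D = "{d. d dvd n}"
  have fin: "finite ?D" using n by simp
  have "(\<Sum>d\<in>?D. moebius d * ln (real (n div d))) = (\<Sum>d\<in>?D. \<Sum>e\<in>{e\<in>?D. d * e dvd n}. moebius d * mangoldt e)"
  proof (rule sum.cong[OF refl])
    fix d assume d: "d \<in> ?D"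
    then have "n div d > 0" using n by (auto simp: div_greater_zero_iff dvd_imp_le dvd_pos_nat)
    then have "ln (real (n div d)) = (\<Sum>e | e dvd n div d. mangoldt e)" using mangoldt_sum[of "n div d", where ?'a = real] by simp
    moreover have "{e. e dvd n div d} = {e\<in>?D. d * e dvd n}"
      using d n by (auto simp: dvd_div_iff_mult mult.commute dvd_pos_nat intro: dvd_mult_left dvd_mult_right)
    ultimately show "moebius d * ln (real (n div d)) = (\<Sum>e\<in>{e\<in>?D. d * e dvd n}. moebius d * mangoldt e)"
      by (simp add: sum_distrib_left)
  qed
  also have "\<dots> = (\<Sum>e\<in>?D. \<Sum>d\<in>{d\<in>?D. d * e dvd n}. moebius d * mangoldt e)"
    by (rule sum.swap_restrict[OF fin fin])
  also have "\<dots> = (\<Sum>e\<in>?D. if e = n then mangoldt n else 0)"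
  proof (rule sum.cong[OF refl])
    fix e assume e: "e \<in> ?D"
    then obtain k where k: "n = e * k" by blast
    have e0: "e > 0" "k > 0" using n k by (auto intro!: Nat.gr0I)
    have "{d\<in>?D. d * e dvd n} = {d. d dvd k}" using e0 by (auto simp: k mult.commute)
    then have "(\<Sum>d\<in>{d\<in>?D. d * e dvd n}. moebius d * mangoldt e) = (\<Sum>d | d dvd k. moebius d) * mangoldt e"
      by (simp add: sum_distrib_right)
    also have "\<dots> = (if e = n then mangoldt n else 0)" using e0 by (auto simp: k sum_moebius_divisors)
    finally show "(\<Sum>d\<in>{d\<in>?D. d * e dvd n}. moebius d * mangoldt e) = (if e = n then mangoldt n else 0)" .
  qed
  also have "\<dots> = mangoldt n" using fin by (subst sum.delta) auto
  finally show ?thesis .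
qed

section \<open>Logarithmic sums twisted by a character\<close>

locale oscillating_char =
  fixes \<chi> :: "nat \<Rightarrow> complex" and B :: real
  assumes mult: "\<chi> (a * b) = \<chi> a * \<chi> b" and one: "\<chi> 1 = 1"
    and norm_le: "norm (\<chi> n) \<le> 1" and partial: "norm (\<Sum>n<M. \<chi> n) \<le> B"
begin

definition harm where "harm x = (\<Sum>m\<in>{1..x}. \<chi> m / of_nat m)"
definition lam where "lam x = (\<Sum>n\<in>{1..x}. \<chi> n * of_real (mangoldt n / real n))"

lemma B0: "B \<ge> 0" using partial[of 0] by simp

lemma harm_diff: assumes "n \<le> k" shows "norm (harm k - harm n) \<le> 2 * B / real (n + 1)"
proof -
  have "harm k = harm n + (\<Sum>m\<in>{n+1..k}. \<chi> m / of_nat m)"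
  proof -
    have "{1..k} = {1..n} \<union> {n+1..k}" using assms by auto
    moreover have "(\<Sum>m\<in>{1..n} \<union> {n+1..k}. \<chi> m / of_nat m) = (\<Sum>m\<in>{1..n}. \<chi> m / of_nat m) + (\<Sum>m\<in>{n+1..k}. \<chi> m / of_nat m)"
      by (rule sum.union_disjoint) auto
    ultimately show ?thesis unfolding harm_def by simp
  qed
  then have "harm k - harm n = (\<Sum>m\<in>{n+1..<k+1}. of_real (1 / real m) * \<chi> m)"
    by (simp add: atLeastLessThanSuc_atLeastAtMost)
  also have "norm \<dots> \<le> 2 * B * (1 / real (n + 1))"
    by (rule abel_bound[OF partial]) (auto simp: field_simps)
  finally show ?thesis by simp
qed

lemma harm_limit: "\<exists>L. harm \<longlonglongrightarrow> L \<and> (\<forall>n. norm (harm n - L) \<le> 2 * B / real (n + 1))"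
proof -
  have "Cauchy harm"
  proof (rule CauchyI)
    fix e :: real assume e: "e > 0"
    obtain M where M: "4 * B / e < real M" using reals_Archimedean2 by blast
    have small: "norm (harm m - harm M) < e / 2" if "m \<ge> M" for m
    proof -
      have "norm (harm m - harm M) \<le> 2 * B / real (M + 1)" by (rule harm_diff[OF that])
      also have "\<dots> < e / 2" using M e by (simp add: field_simps)
      finally show ?thesis .
    qed
    have "norm (harm m - harm n) < e" if "m \<ge> M" "n \<ge> M" for m n
      using norm_triangle_ineq4[of "harm m - harm M" "harm n - harm M"] small[OF that(1)] small[OF that(2)] by simp
    then show "\<exists>M. \<forall>m\<ge>M. \<forall>n\<ge>M. norm (harm m - harm n) < e" by blast
  qed
  then obtain L where L: "harm \<longlonglongrightarrow> L" using Cauchy_convergent_iff convergent_def by blast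
  have "norm (harm n - L) \<le> 2 * B / real (n + 1)" for n
  proof -
    have "(\<lambda>k. norm (harm k - harm n)) \<longlonglongrightarrow> norm (L - harm n)" by (intro tendsto_intros L)
    then have "norm (L - harm n) \<le> 2 * B / real (n + 1)"
      by (rule LIMSEQ_le_const2) (use harm_diff in blast)
    then show ?thesis by (simp add: norm_minus_commute)
  qed
  with L show ?thesis by blast
qed

lemma ln_over_decreasing: assumes "n \<ge> 3" shows "ln (real (Suc n)) / real (Suc n) \<le> ln (real n) / real n"
proof -
  have "exp 1 \<le> real n" using exp_le assms by simp
  then have 1: "1 \<le> ln (real n)" using assms by (subst ln_ge_iff) auto
  have "real n * (ln (real (Suc n)) - ln (real n)) \<le> 1" by (rule mult_ln_Suc_le)
  with 1 have "real n * ln (real (Suc n)) \<le> real (Suc n) * ln (real n)" by (simp add: algebra_simps)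
  then show ?thesis using assms by (simp add: field_simps)
qed

lemma sum_ln_bounded: "\<exists>C. \<forall>x. norm (\<Sum>n\<in>{1..x}. \<chi> n * of_real (ln (real n) / real n)) \<le> C"
proof (intro exI allI)
  fix x :: nat
  let ?f = "\<lambda>n. ln (real n) / real n"
  define C where "C = (\<Sum>n\<in>{1..<3}. norm (\<chi> n * of_real (?f n))) + 2 * B * ?f 3"
  have C: "2 * B * ?f 3 \<ge> 0" using B0 by simp
  show "norm (\<Sum>n\<in>{1..x}. \<chi> n * of_real (?f n)) \<le> C"
  proof (cases "x < 3")
    case True
    have "norm (\<Sum>n\<in>{1..x}. \<chi> n * of_real (?f n)) \<le> (\<Sum>n\<in>{1..x}. norm (\<chi> n * of_real (?f n)))" by (rule norm_sum)
    also have "\<dots> \<le> (\<Sum>n\<in>{1..<3}. norm (\<chi> n * of_real (?f n)))" using True by (intro sum_mono2) auto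
    finally show ?thesis using C by (simp add: C_def)
  next
    case False
    have "{1..x} = {1..<3} \<union> {3..<x+1}" using False by auto
    then have "(\<Sum>n\<in>{1..x}. \<chi> n * of_real (?f n)) = (\<Sum>n\<in>{1..<3}. \<chi> n * of_real (?f n)) + (\<Sum>n\<in>{3..<x+1}. of_real (?f n) * \<chi> n)"
      by (simp add: sum.union_disjoint mult.commute del: of_real_divide)
    also have "norm \<dots> \<le> C" unfolding C_def
    proof (intro order.trans[OF norm_triangle_ineq] add_mono norm_sum)
      show "norm (\<Sum>n\<in>{3..<x+1}. of_real (?f n) * \<chi> n) \<le> 2 * B * ?f 3"
        by (rule abel_bound[OF partial]) (use ln_over_decreasing in auto)
    qed
    finally show ?thesis .
  qed
qed

lemma div_bound: assumes "d \<in> {1..x}" shows "2 * B / real (x div d + 1) \<le> 2 * B * real d / real x"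
proof -
  have "x < d * (x div d + 1)" using assms by (simp add: dividend_less_times_div)
  then have "real x \<le> real d * real (x div d + 1)" by (metis less_imp_le of_nat_le_iff of_nat_mult)
  then have "2 * B * real x \<le> 2 * B * (real d * real (x div d + 1))" using B0 by (intro mult_left_mono) auto
  then show ?thesis using assms by (simp add: divide_simps mult_ac)
qed

text \<open>
  Expanding \<open>ln n\<close> as the sum of \<open>mangoldt d\<close> over \<open>d dvd n\<close> turns the bounded sum of \<open>\<chi>(n) ln n / n\<close> into \<open>lam x\<close> times the limit of \<open>harm\<close>,
  up to an error controlled by Chebyshev's bound.
\<close>
lemma lam_bounded_of_nonzero:
  assumes "\<not> harm \<longlonglongrightarrow> 0"
  shows "\<exists>C. \<forall>x\<ge>1. norm (lam x) \<le> C"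
proof -
  obtain L where L: "harm \<longlonglongrightarrow> L" "\<And>n. norm (harm n - L) \<le> 2 * B / real (n + 1)" using harm_limit by blast
  have L0: "L \<noteq> 0" using L(1) assms by auto
  obtain C1 where C1: "\<And>x. norm (\<Sum>n\<in>{1..x}. \<chi> n * of_real (ln (real n) / real n)) \<le> C1" using sum_ln_bounded by blast
  obtain C2 where C2: "\<And>x. (\<Sum>n\<in>{1..x}. mangoldt n) \<le> C2 * real x" using chebyshev_psi_upper by blast
  have "norm (lam x) \<le> (C1 + 2 * B * C2) / norm L" if x: "x \<ge> 1" for x
  proof -
    define c where "c d = \<chi> d * of_real (mangoldt d / real d)" for d
    have "(\<Sum>n\<in>{1..x}. \<chi> n * of_real (ln (real n) / real n)) = (\<Sum>n\<in>{1..x}. \<Sum>d | d dvd n. c d * (\<chi> (n div d) / of_nat (n div d)))"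
    proof (rule sum.cong[OF refl])
      fix n assume n: "n \<in> {1..x}"
      then have "\<chi> n * of_real (ln (real n) / real n) = (\<chi> n / of_nat n) * of_real (ln (real n))" by simp
      also have "of_real (ln (real n)) = (\<Sum>d | d dvd n. mangoldt d :: complex)" using n by (simp add: mangoldt_sum)
      also have "(\<chi> n / of_nat n) * \<dots> = (\<Sum>d | d dvd n. c d * (\<chi> (n div d) / of_nat (n div d)))"
        unfolding sum_distrib_left
      proof (rule sum.cong[OF refl])
        fix d assume "d \<in> {d. d dvd n}"
        then obtain m where m: "n = d * m" by blast
        have "d > 0" "m > 0" using n m by (auto intro!: Nat.gr0I)
        then show "\<chi> n / of_nat n * mangoldt d = c d * (\<chi> (n div d) / of_nat (n div d))"
          by (simp add: m mult c_def field_simps)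
      qed
      finally show "\<chi> n * of_real (ln (real n) / real n) = (\<Sum>d | d dvd n. c d * (\<chi> (n div d) / of_nat (n div d)))" .
    qed
    also have "\<dots> = (\<Sum>d\<in>{1..x}. \<Sum>m\<in>{1..x div d}. c d * (\<chi> m / of_nat m))"
      by (rule sum_divisors_swap[of "\<lambda>d m. c d * (\<chi> m / of_nat m)"])
    also have "\<dots> = (\<Sum>d\<in>{1..x}. c d * harm (x div d))" by (simp add: harm_def sum_distrib_left)
    finally have eq: "(\<Sum>n\<in>{1..x}. \<chi> n * of_real (ln (real n) / real n)) = (\<Sum>d\<in>{1..x}. c d * harm (x div d))" .
    have "norm ((\<Sum>d\<in>{1..x}. c d * harm (x div d)) - (\<Sum>d\<in>{1..x}. c d * L)) = norm (\<Sum>d\<in>{1..x}. c d * (harm (x div d) - L))"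
      by (simp add: sum_subtractf right_diff_distrib)
    also have "\<dots> \<le> (\<Sum>d\<in>{1..x}. 2 * B / real x * mangoldt d)"
    proof (rule sum_norm_le)
      fix d assume d: "d \<in> {1..x}"
      have "norm (c d) = norm (\<chi> d) * (mangoldt d / real d)" unfolding c_def norm_mult norm_of_real
        by (simp add: mangoldt_nonneg)
      then have "norm (c d) \<le> mangoldt d / real d"
        using mult_right_mono[OF norm_le[of d], of "mangoldt d / real d"] by (simp add: mangoldt_nonneg)
      moreover have "norm (harm (x div d) - L) \<le> 2 * B * real d / real x" using L(2)[of "x div d"] div_bound[OF d] by linarith
      ultimately have "norm (c d) * norm (harm (x div d) - L) \<le> (mangoldt d / real d) * (2 * B * real d / real x)"
        by (intro mult_mono) (auto simp: mangoldt_nonneg)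
      moreover have "(mangoldt d / real d) * (2 * B * real d / real x) = 2 * B / real x * mangoldt d" using d by simp
      ultimately show "norm (c d * (harm (x div d) - L)) \<le> 2 * B / real x * mangoldt d" by (simp only: norm_mult)
    qed
    also have "\<dots> = 2 * B / real x * (\<Sum>d\<in>{1..x}. mangoldt d)" by (simp only: sum_distrib_left)
    also have "\<dots> \<le> 2 * B / real x * (C2 * real x)" using C2[of x] B0 by (intro mult_left_mono) auto
    also have "\<dots> = 2 * B * C2" using x by simp
    finally have bd: "norm ((\<Sum>d\<in>{1..x}. c d * harm (x div d)) - (\<Sum>d\<in>{1..x}. c d * L)) \<le> 2 * B * C2" .
    have "(\<Sum>d\<in>{1..x}. c d * L) = lam x * L" by (simp add: lam_def c_def sum_distrib_right)
    then have "norm (lam x * L) \<le> norm (\<Sum>d\<in>{1..x}. c d * harm (x div d)) + 2 * B * C2"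
      using bd norm_triangle_ineq3[of "lam x * L" "\<Sum>d\<in>{1..x}. c d * harm (x div d)"] by (simp add: norm_minus_commute)
    also have "norm (\<Sum>d\<in>{1..x}. c d * harm (x div d)) \<le> C1" using C1[of x] eq by simp
    finally show ?thesis using L0 by (simp add: norm_mult pos_le_divide_eq)
  qed
  then show ?thesis by blast
qed

text \<open>
  Instead of \<open>ln n\<close>, the weights \<open>moebius d ln (x / d)\<close> are summed over \<open>d dvd n\<close>; they give \<open>mangoldt n\<close>, and an extra \<open>ln x\<close> at
  \<open>n = 1\<close>.  When \<open>harm\<close> tends to 0, the sum on the other side is bounded because \<open>ln (x / d)\<close> has bounded average.
\<close>
lemma lam_of_zero:
  assumes L: "harm \<longlonglongrightarrow> 0"
  shows "\<exists>C. \<forall>x\<ge>1. norm (lam x + of_real (ln (real x))) \<le> C"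
proof -
  have S: "norm (harm n) \<le> 2 * B / real (n + 1)" for n
  proof -
    obtain L' where "harm \<longlonglongrightarrow> L'" "\<And>n. norm (harm n - L') \<le> 2 * B / real (n + 1)" using harm_limit by blast
    then show ?thesis using LIMSEQ_unique[OF L] by fastforce
  qed
  have "norm (lam x + of_real (ln (real x))) \<le> 2 * B" if x: "x \<ge> 1" for x
  proof -
    define c where "c d = \<chi> d * of_real (moebius d * ln (real x / real d) / real d)" for d
    have "lam x + of_real (ln (real x)) = (\<Sum>n\<in>{1..x}. \<chi> n * of_real (mangoldt n / real n) + (if n = 1 then of_real (ln (real x)) else 0))"
      unfolding lam_def sum.distrib using x by (subst sum.delta) auto
    also have "\<dots> = (\<Sum>n\<in>{1..x}. \<Sum>d | d dvd n. c d * (\<chi> (n div d) / of_nat (n div d)))"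
    proof (rule sum.cong[OF refl])
      fix n assume n: "n \<in> {1..x}"
      have "(\<Sum>d | d dvd n. moebius d * ln (real x / real d)) = (\<Sum>d | d dvd n. ln (real x / real n) * moebius d + moebius d * ln (real (n div d)))"
      proof (rule sum.cong[OF refl])
        fix d assume "d \<in> {d. d dvd n}"
        then obtain m where m: "n = d * m" by blast
        have "d > 0" "m > 0" using n m by (auto intro!: Nat.gr0I)
        then show "moebius d * ln (real x / real d) = ln (real x / real n) * moebius d + moebius d * ln (real (n div d))"
          using x by (simp add: m ln_div ln_mult algebra_simps)
      qed
      also have "\<dots> = ln (real x / real n) * (\<Sum>d | d dvd n. moebius d) + (\<Sum>d | d dvd n. moebius d * ln (real (n div d)))"
        by (simp add: sum.distrib sum_distrib_left)
      also have "\<dots> = (if n = 1 then ln (real x) else 0) + mangoldt n"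
        using n by (subst sum_moebius_divisors, simp, subst sum_moebius_ln) simp_all
      finally have id: "(\<Sum>d | d dvd n. moebius d * ln (real x / real d)) = (if n = 1 then ln (real x) else 0) + mangoldt n" .
      have "(\<Sum>d | d dvd n. c d * (\<chi> (n div d) / of_nat (n div d))) = (\<Sum>d | d dvd n. \<chi> n / of_nat n * of_real (moebius d * ln (real x / real d)))"
      proof (rule sum.cong[OF refl])
        fix d assume "d \<in> {d. d dvd n}"
        then obtain m where m: "n = d * m" by blast
        have "d > 0" "m > 0" using n m by (auto intro!: Nat.gr0I)
        then show "c d * (\<chi> (n div d) / of_nat (n div d)) = \<chi> n / of_nat n * of_real (moebius d * ln (real x / real d))"
          by (simp add: m mult c_def field_simps)
      qed
      also have "\<dots> = \<chi> n / of_nat n * of_real (\<Sum>d | d dvd n. moebius d * ln (real x / real d))"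
        by (simp only: sum_distrib_left of_real_sum)
      also have "\<dots> = \<chi> n * of_real (mangoldt n / real n) + (if n = 1 then of_real (ln (real x)) else 0)"
        unfolding id using one by simp
      finally show "\<chi> n * of_real (mangoldt n / real n) + (if n = 1 then of_real (ln (real x)) else 0) = (\<Sum>d | d dvd n. c d * (\<chi> (n div d) / of_nat (n div d)))" by simp
    qed
    also have "\<dots> = (\<Sum>d\<in>{1..x}. \<Sum>m\<in>{1..x div d}. c d * (\<chi> m / of_nat m))"
      by (rule sum_divisors_swap[of "\<lambda>d m. c d * (\<chi> m / of_nat m)"])
    also have "\<dots> = (\<Sum>d\<in>{1..x}. c d * harm (x div d))" by (simp add: harm_def sum_distrib_left)
    also have "norm \<dots> \<le> (\<Sum>d\<in>{1..x}. 2 * B / real x * (ln (real x) - ln (real d)))"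
    proof (rule sum_norm_le)
      fix d assume d: "d \<in> {1..x}"
      then have l: "ln (real x / real d) = ln (real x) - ln (real d)" "ln (real x / real d) \<ge> 0" by (simp_all add: ln_div)
      have "norm (c d) = norm (\<chi> d) * (\<bar>moebius d\<bar> * (ln (real x / real d) / real d))"
        unfolding c_def norm_mult norm_of_real using l(2) by (simp add: abs_mult)
      also have "\<dots> \<le> 1 * (1 * (ln (real x / real d) / real d))"
        using l(2) by (intro mult_mono norm_le abs_moebius_le) auto
      finally have "norm (c d) \<le> ln (real x / real d) / real d" by simp
      moreover have "norm (harm (x div d)) \<le> 2 * B * real d / real x" using S[of "x div d"] div_bound[OF d] by linarith
      ultimately have "norm (c d) * norm (harm (x div d)) \<le> (ln (real x / real d) / real d) * (2 * B * real d / real x)"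
        using l(2) by (intro mult_mono) auto
      then show "norm (c d * harm (x div d)) \<le> 2 * B / real x * (ln (real x) - ln (real d))"
        unfolding l(1) using d x by (simp add: norm_mult mult_ac)
    qed
    also have "\<dots> = 2 * B / real x * (real x * ln (real x) - (\<Sum>d\<in>{1..x}. ln (real d)))"
      by (simp only: sum_distrib_left[symmetric] sum_subtractf) simp
    also have "\<dots> \<le> 2 * B / real x * real x"
      using sum_ln_ge[of x] B0 by (intro mult_left_mono) auto
    also have "\<dots> = 2 * B" using x by simp
    finally show ?thesis .
  qed
  then show ?thesis by blast
qed

end

lemma sum_sign_powers:
  fixes e :: real assumes "e \<in> {-1, 0, 1}"
  shows "(\<Sum>i\<le>a. e ^ i) \<ge> (if even a then 1 else 0)"
proof -
  have "(\<Sum>i\<le>a. (-1::real) ^ i) = (if even a then 1 else 0)" by (induction a) auto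
  moreover have "(\<Sum>i\<le>a. (0::real) ^ i) = 1" by (induction a) auto
  ultimately show ?thesis using assms by auto
qed

locale real_char =
  fixes r :: "nat \<Rightarrow> real"
  assumes rmult: "r (a * b) = r a * r b" and rone: "r 1 = 1" and rval: "r n \<in> {-1, 0, 1}"
begin

definition dsum where "dsum n = (\<Sum>d | d dvd n. r d)"

text \<open>
  A divisor of \<open>p\<^sup>a\<^sup>+\<^sup>1 m\<close> either divides \<open>m\<close> or is \<open>p\<close> times a divisor of \<open>p\<^sup>a m\<close>.
\<close>
lemma dsum_prime_power:
  assumes p: "prime p" and m: "\<not> p dvd m" "m > 0"
  shows "dsum (p ^ a * m) = (\<Sum>i\<le>a. r p ^ i) * dsum m"
proof (induction a)
  case (Suc a)
  have p0: "p > 0" by (rule prime_gt_0_nat[OF p])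
  have pos: "p ^ a * m > 0" using p0 m by simp
  have eq: "{d. d dvd p ^ Suc a * m} = {d. d dvd m} \<union> (\<lambda>d. p * d) ` {d. d dvd p ^ a * m}"
  proof (intro equalityI subsetI)
    fix d assume "d \<in> {d. d dvd p ^ Suc a * m}"
    then have d: "d dvd p ^ Suc a * m" by simp
    show "d \<in> {d. d dvd m} \<union> (\<lambda>d. p * d) ` {d. d dvd p ^ a * m}"
    proof (cases "p dvd d")
      case True
      then obtain e where e: "d = p * e" by blast
      then have "p * e dvd p * (p ^ a * m)" using d by (simp add: mult_ac)
      then have "e dvd p ^ a * m" using p0 by simp
      then show ?thesis using e by blast
    next
      case False
      then have "coprime d p" using prime_imp_coprime[OF p, of d] by (simp add: coprime_commute)
      then have "coprime d (p ^ Suc a)" by simp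
      then show ?thesis using d coprime_dvd_mult_right_iff by blast
    qed
  next
    fix d assume "d \<in> {d. d dvd m} \<union> (\<lambda>d. p * d) ` {d. d dvd p ^ a * m}"
    then show "d \<in> {d. d dvd p ^ Suc a * m}" by (auto simp: mult.assoc)
  qed
  have fin: "finite {d. d dvd m}" "finite {d. d dvd p ^ a * m}" using m pos by simp_all
  have disj: "{d. d dvd m} \<inter> (\<lambda>d. p * d) ` {d. d dvd p ^ a * m} = {}"
    using m(1) dvd_mult_left by blast
  have "dsum (p ^ Suc a * m) = dsum m + (\<Sum>d\<in>(\<lambda>d. p * d) ` {d. d dvd p ^ a * m}. r d)"
    unfolding dsum_def eq by (rule sum.union_disjoint[OF fin(1) finite_imageI[OF fin(2)] disj])
  also have "(\<Sum>d\<in>(\<lambda>d. p * d) ` {d. d dvd p ^ a * m}. r d) = (\<Sum>d | d dvd p ^ a * m. r (p * d))"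
    using p0 by (subst sum.reindex) (simp_all add: inj_on_def)
  also have "\<dots> = r p * dsum (p ^ a * m)" by (simp add: rmult dsum_def sum_distrib_left)
  also have "\<dots> = r p * (\<Sum>i\<le>a. r p ^ i) * dsum m" by (simp add: Suc.IH)
  also have "r p * (\<Sum>i\<le>a. r p ^ i) = (\<Sum>i\<le>a. r p ^ Suc i)" by (simp add: sum_distrib_left)
  finally show ?case by (simp add: sum.atMost_Suc_shift algebra_simps del: sum.atMost_Suc)
qed simp

lemma dsum_one: "dsum 1 = 1" using rone by (simp add: dsum_def)

lemma dsum_nonneg: assumes "n > 0" shows "dsum n \<ge> 0"
  using assms
proof (induction n rule: less_induct)
  case (less n)
  show ?case
  proof (cases "n = 1")
    case True then show ?thesis by (simp only: dsum_one)
  next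
    case False
    then obtain p where p: "prime p" "p dvd n" using prime_factor_nat by blast
    obtain m where m: "n = p ^ multiplicity p n * m" "\<not> p dvd m"
      using multiplicity_decompose'[of n p] less.prems p(1) by (metis not_prime_unit neq0_conv)
    define a where "a = multiplicity p n"
    have m0: "m > 0" using less.prems m(1) by (intro Nat.gr0I) auto
    have a0: "a > 0" using p less.prems by (simp add: a_def prime_multiplicity_gt_zero_iff)
    have "1 < p ^ a" by (rule one_less_power[OF prime_gt_1_nat[OF p(1)] a0])
    then have "m < n" using m0 by (subst m(1)) (simp add: a_def)
    then have "dsum m \<ge> 0" using less.IH m0 by blast
    moreover have "dsum n = (\<Sum>i\<le>a. r p ^ i) * dsum m" using dsum_prime_power[OF p(1) m(2) m0, of a] m(1) by (simp add: a_def)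
    moreover have "(\<Sum>i\<le>a. r p ^ i) \<ge> 0" using sum_sign_powers[OF rval[of p], of a] by (auto split: if_splits)
    ultimately show ?thesis by simp
  qed
qed

lemma dsum_square: assumes "k > 0" shows "dsum (k\<^sup>2) \<ge> 1"
  using assms
proof (induction k rule: less_induct)
  case (less k)
  show ?case
  proof (cases "k = 1")
    case True then show ?thesis using dsum_one by simp
  next
    case False
    then obtain p where p: "prime p" "p dvd k" using prime_factor_nat by blast
    obtain m where m: "k = p ^ multiplicity p k * m" "\<not> p dvd m"
      using multiplicity_decompose'[of k p] less.prems p(1) by (metis not_prime_unit neq0_conv)
    define a where "a = multiplicity p k"
    have m0: "m > 0" using less.prems m(1) by (intro Nat.gr0I) auto
    have a0: "a > 0" using p less.prems by (simp add: a_def prime_multiplicity_gt_zero_iff)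
    have "1 < p ^ a" by (rule one_less_power[OF prime_gt_1_nat[OF p(1)] a0])
    then have "m < k" using m0 by (subst m(1)) (simp add: a_def)
    then have IH: "dsum (m\<^sup>2) \<ge> 1" using less.IH m0 by blast
    have np: "\<not> p dvd m\<^sup>2" using m(2) p(1) prime_dvd_power by blast
    have "k\<^sup>2 = p ^ (2 * a) * m\<^sup>2" by (subst m(1)) (simp add: a_def power_mult_distrib power_mult[symmetric] mult.commute)
    then have "dsum (k\<^sup>2) = (\<Sum>i\<le>2*a. r p ^ i) * dsum (m\<^sup>2)" using dsum_prime_power[OF p(1) np, of "2 * a"] m0 by simp
    moreover have "(\<Sum>i\<le>2*a. r p ^ i) \<ge> 1" using sum_sign_powers[OF rval[of p], of "2 * a"] by simp
    ultimately show ?thesis using IH mult_mono[of 1 "\<Sum>i\<le>2*a. r p ^ i" 1 "dsum (m\<^sup>2)"] by simp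
  qed
qed

end

section \<open>Non-vanishing for real characters\<close>

definition geo :: "real \<Rightarrow> nat \<Rightarrow> real" where "geo x n = (\<Sum>i<n. x ^ i)"

lemma geo_Suc: "geo x (Suc n) = geo x n + x ^ n" "geo x (Suc n) = 1 + x * geo x n"
  by (simp add: geo_def, simp add: geo_def sum.lessThan_Suc_shift sum_distrib_left del: sum.lessThan_Suc)

lemma geo_eq: "1 - x ^ n = (1 - x) * geo x n" by (simp add: geo_def one_diff_power_eq)

text \<open>
  The inequality of the arithmetic and geometric means for the powers of \<open>t\<^sup>2\<close>, by pairing the outermost terms.
\<close>
lemma geo_ge: assumes "t \<ge> 0" shows "geo (t\<^sup>2) (Suc n) \<ge> real (Suc n) * t ^ n"
proof (induction n rule: induct_nat_012)
  case 0 then show ?case by (simp add: geo_def)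
next
  case 1
  have "0 \<le> (1 - t)\<^sup>2" by simp
  then show ?case by (simp add: geo_def power2_eq_square algebra_simps)
next
  case (ge2 n)
  have "geo (t\<^sup>2) (Suc (Suc (Suc n))) = 1 + t\<^sup>2 * geo (t\<^sup>2) (Suc n) + (t\<^sup>2) ^ Suc (Suc n)"
    by (simp only: geo_Suc(1)[of _ "Suc (Suc n)"] geo_Suc(2)[of _ "Suc n"])
  also have "\<dots> \<ge> 1 + t\<^sup>2 * (real (Suc n) * t ^ n) + (t\<^sup>2) ^ Suc (Suc n)"
    using ge2(1) by (intro add_mono mult_left_mono) auto
  moreover have "1 + t\<^sup>2 * (real (Suc n) * t ^ n) + (t\<^sup>2) ^ Suc (Suc n) = real (Suc n) * t ^ Suc (Suc n) + (1 + (t ^ Suc (Suc n))\<^sup>2)"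
    by (simp add: power2_eq_square power_mult_distrib algebra_simps)
  moreover have "0 \<le> (1 - t ^ Suc (Suc n))\<^sup>2" by simp
  then have "2 * t ^ Suc (Suc n) \<le> 1 + (t ^ Suc (Suc n))\<^sup>2" by (simp add: power2_diff)
  moreover have "real (Suc (Suc (Suc n))) * t ^ Suc (Suc n) = real (Suc n) * t ^ Suc (Suc n) + 2 * t ^ Suc (Suc n)"
    by (simp add: algebra_simps)
  ultimately show ?case by linarith
qed

text \<open>
  The difference of two sequences with the same leading behaviour as \<open>x\<close> tends to 1; unlike each of them, it is bounded there.
\<close>
definition lambert_weight :: "real \<Rightarrow> nat \<Rightarrow> real" where
  "lambert_weight x n = 1 / (real n * (1 - x)) - x ^ n / (1 - x ^ n)"

text \<open>
  Monotonicity reduces to \<open>geo x n * geo x (n + 1) \<ge> n (n + 1) x\<^sup>n\<close>.  Writing \<open>x = t\<^sup>2\<close> avoids square roots.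
\<close>
lemma lambert_weight_props:
  assumes t: "0 < t" "t < 1" and x: "x = t\<^sup>2"
  shows "n \<ge> 1 \<Longrightarrow> lambert_weight x (Suc n) \<le> lambert_weight x n"
    and "n \<ge> 1 \<Longrightarrow> lambert_weight x n \<ge> 0" and "lambert_weight x 1 = 1"
proof -
  have x01: "0 < x" "x < 1" using t by (simp_all add: x power_less_one_iff)
  have alt: "lambert_weight x (Suc k) = (1 / real (Suc k) - x ^ Suc k / geo x (Suc k)) / (1 - x)" for k
    unfolding lambert_weight_def geo_eq using x01 by (simp add: diff_divide_distrib mult.commute)
  have gpos: "geo x (Suc k) > 0" for k
  proof -
    have "0 < real (Suc k) * t ^ k" using t by (intro mult_pos_pos) auto
    also have "\<dots> \<le> geo x (Suc k)" unfolding x using t by (intro geo_ge) simp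
    finally show ?thesis .
  qed
  have ge1: "geo x (Suc k) \<ge> real (Suc k) * x ^ Suc k" for k
  proof -
    have "x ^ Suc k = t ^ (2 * Suc k)" unfolding x by (simp only: power_mult)
    also have "\<dots> \<le> t ^ k" using t by (intro power_decreasing) auto
    finally have "real (Suc k) * x ^ Suc k \<le> real (Suc k) * t ^ k" by (intro mult_left_mono) auto
    also have "\<dots> \<le> geo x (Suc k)" unfolding x using t by (intro geo_ge) simp
    finally show ?thesis .
  qed
  have ge2: "geo x (Suc k) * geo x (Suc (Suc k)) \<ge> real (Suc k) * real (Suc (Suc k)) * x ^ Suc k" for k
  proof -
    have "x ^ Suc k = t ^ (2 * Suc k)" unfolding x by (simp only: power_mult)
    also have "\<dots> \<le> t ^ (k + Suc k)" using t by (intro power_decreasing) auto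
    finally have "real (Suc k) * real (Suc (Suc k)) * x ^ Suc k \<le> real (Suc k) * real (Suc (Suc k)) * t ^ (k + Suc k)"
      by (intro mult_left_mono) auto
    also have "\<dots> = (real (Suc k) * t ^ k) * (real (Suc (Suc k)) * t ^ Suc k)" by (simp only: power_add mult_ac)
    also have "\<dots> \<le> geo x (Suc k) * geo x (Suc (Suc k))"
      unfolding x using t gpos[of k] by (intro mult_mono geo_ge) (auto simp: x)
    finally show ?thesis .
  qed
  show "lambert_weight x n \<ge> 0" if "n \<ge> 1"
  proof -
    define k where "k = n - 1"
    then have k: "n = Suc k" using that by simp
    have "x ^ Suc k / geo x (Suc k) \<le> 1 / real (Suc k)" using ge1[of k] gpos[of k] by (simp add: pos_divide_le_eq mult.commute field_simps)
    then show ?thesis unfolding k alt using x01 by simp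
  qed
  show "lambert_weight x (Suc n) \<le> lambert_weight x n" if "n \<ge> 1"
  proof -
    define k where "k = n - 1"
    then have k: "n = Suc k" using that by simp
    define G G' where "G = geo x (Suc k)" and "G' = geo x (Suc (Suc k))"
    have G: "G > 0" "G' > 0" "G' = 1 + x * G" using gpos[of k] gpos[of "Suc k"] geo_Suc(2)[of x "Suc k"] by (simp_all add: G_def G'_def)
    have "x ^ Suc k / G - x ^ Suc (Suc k) / G' = x ^ Suc k * (G' - x * G) / (G * G')" using G(1,2) by (simp add: field_simps)
    also have "\<dots> = x ^ Suc k / (G * G')" by (simp add: G(3))
    also have "\<dots> \<le> 1 / (real (Suc k) * real (Suc (Suc k)))"
      using ge2[of k] G(1,2) unfolding G_def[symmetric] G'_def[symmetric] by (subst frac_le_eq) (simp_all add: divide_simps mult_ac)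
    also have "\<dots> = 1 / real (Suc k) - 1 / real (Suc (Suc k))" by (simp add: field_simps)
    finally have "1 / real (Suc (Suc k)) - x ^ Suc (Suc k) / G' \<le> 1 / real (Suc k) - x ^ Suc k / G" by linarith
    then show ?thesis unfolding k alt G_def[symmetric] G'_def[symmetric] using x01 by (intro divide_right_mono) auto
  qed
  show "lambert_weight x 1 = 1" using x01 by (simp add: lambert_weight_def field_simps)
qed

lemma geometric_from_1: assumes "(y::real) \<noteq> 1" shows "(\<Sum>m\<in>{1..K}. y ^ m) = y / (1 - y) - y ^ (K + 1) / (1 - y)"
proof -
  have "(1 - y) * (\<Sum>m\<in>{1..K}. y ^ m) = y - y ^ (K + 1)"   proof (induction K)
    case (Suc K)
    have "(1 - y) * (\<Sum>m\<in>{1..Suc K}. y ^ m) = (1 - y) * (\<Sum>m\<in>{1..K}. y ^ m) + (1 - y) * y ^ Suc K"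
      by (simp add: distrib_left)
    also have "\<dots> = y - y ^ (Suc K + 1)" unfolding Suc.IH by (simp add: algebra_simps)
    finally show ?case .
  qed simp
  then show ?thesis using assms by (simp only: diff_divide_distrib[symmetric]) (simp add: eq_divide_eq mult.commute)
qed

text \<open>
  Monsky's argument with Lambert series.  If the sum of \<open>\<chi>(n) / n\<close> is zero, then the series of \<open>\<chi>(n) x\<^sup>n / (1 - x\<^sup>n)\<close> equals
  the negative of that of \<open>\<chi>(n)\<close> times a decreasing weight that is 1 at \<open>n = 1\<close>, so it is bounded uniformly in \<open>x < 1\<close>.
  But its coefficients \<open>dsum n\<close> are non-negative and at least 1 at squares, so it is unbounded as \<open>x\<close> tends
  to 1.  All series are truncated at a large \<open>M\<close>, which leaves a bounded error.
\<close>
theorem real_char_harm_nonzero: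
  assumes osc: "oscillating_char \<chi> B" and val: "\<And>n. \<chi> n \<in> {-1, 0, 1}"
  shows "\<not> (\<lambda>x. \<Sum>m\<in>{1..x}. \<chi> m / of_nat m) \<longlonglongrightarrow> 0"
proof
  interpret oscillating_char \<chi> B by (rule osc)
  assume "(\<lambda>x. \<Sum>m\<in>{1..x}. \<chi> m / of_nat m) \<longlonglongrightarrow> 0"
  then have L: "harm \<longlonglongrightarrow> 0" by (simp add: harm_def[abs_def])
  have S: "norm (harm n) \<le> 2 * B / real (n + 1)" for n
  proof -
    obtain L' where "harm \<longlonglongrightarrow> L'" "\<And>n. norm (harm n - L') \<le> 2 * B / real (n + 1)" using harm_limit by blast
    then show ?thesis using LIMSEQ_unique[OF L] by fastforce
  qed
  define r where "r n = Re (\<chi> n)" for n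
  have \<chi>r: "\<chi> n = of_real (r n)" for n using val[of n] by (auto simp: r_def)
  interpret R: real_char r
  proof
    fix a b n
    have "complex_of_real (r (a * b)) = of_real (r a * r b)" using mult[of a b] by (simp add: \<chi>r)
    then show "r (a * b) = r a * r b" by (simp only: of_real_eq_iff)
    show "r 1 = 1" unfolding r_def one by simp
    show "r n \<in> {-1, 0, 1}" using val[of n] by (auto simp: r_def)
  qed
  obtain k0 :: nat where k0: "4 * B + 4 < real k0" using reals_Archimedean2 by blast
  have k00: "k0 > 0" using k0 B0 by (intro Nat.gr0I) auto
  define e where "e = 2 * k0\<^sup>2"
  have e0: "e > 0" using k00 by (simp add: e_def)
  define t where "t = root e (1/2)"
  have t: "0 < t" "t < 1" "t ^ e = 1/2" using e0 by (simp_all add: t_def real_root_pow_pos2)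
  define x where "x = t\<^sup>2"
  have x01: "0 < x" "x < 1" using t by (simp_all add: x_def power_less_one_iff)
  have xk: "x ^ k0\<^sup>2 = 1/2" using t(3) by (simp add: x_def e_def power_mult)
  have lim: "(\<lambda>M. real M * x ^ M / (1 - x)) \<longlonglongrightarrow> 0 / (1 - x)"
    using powser_times_n_limit_0[of x] x01 by (intro tendsto_divide) auto
  then have ev: "eventually (\<lambda>M. real M * x ^ M / (1 - x) < 1) sequentially" by (rule order_tendstoD) simp
  then obtain M1 where M1: "\<And>M. M \<ge> M1 \<Longrightarrow> real M * x ^ M / (1 - x) < 1" by (auto simp: eventually_sequentially)
  obtain M2 :: nat where M2: "2 * B / (1 - x) < real M2" using reals_Archimedean2 by blast
  define M where "M = max M1 (max M2 (k0\<^sup>2))"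
  have Mk: "k0\<^sup>2 \<le> M" and "M1 \<le> M" "M2 \<le> M" by (simp_all add: M_def)
  let ?w = "lambert_weight x"
  note w = lambert_weight_props[OF t(1,2) x_def]
  have "(\<Sum>n\<in>{1..M}. R.dsum n * x ^ n) = (\<Sum>n\<in>{1..M}. \<Sum>d | d dvd n. r d * x ^ (d * (n div d)))"
    unfolding R.dsum_def sum_distrib_right by (intro sum.cong refl) simp
  also have "\<dots> = (\<Sum>d\<in>{1..M}. \<Sum>m\<in>{1..M div d}. r d * x ^ (d * m))"
    by (rule sum_divisors_swap[of "\<lambda>d m. r d * x ^ (d * m)"])
  also have "\<dots> = (\<Sum>d\<in>{1..M}. r d / real d / (1 - x) - r d * ?w d - r d * (x ^ (d * (M div d + 1)) / (1 - x ^ d)))"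
  proof (rule sum.cong[OF refl])
    fix d assume d: "d \<in> {1..M}"
    have "x ^ d \<le> x ^ 1" using x01 d by (intro power_decreasing) auto
    then have y: "x ^ d \<noteq> 1" using x01 by simp
    have "(\<Sum>m\<in>{1..M div d}. r d * x ^ (d * m)) = r d * (\<Sum>m\<in>{1..M div d}. (x ^ d) ^ m)"
      by (simp add: sum_distrib_left power_mult)
    also have "\<dots> = r d * (x ^ d / (1 - x ^ d) - x ^ (d * (M div d + 1)) / (1 - x ^ d))"
      unfolding geometric_from_1[OF y] power_mult ..
    also have "x ^ d / (1 - x ^ d) = 1 / (real d * (1 - x)) - ?w d" by (simp add: lambert_weight_def)
    finally show "(\<Sum>m\<in>{1..M div d}. r d * x ^ (d * m)) = r d / real d / (1 - x) - r d * ?w d - r d * (x ^ (d * (M div d + 1)) / (1 - x ^ d))"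
      by (simp add: algebra_simps)
  qed
  also have "\<dots> = (\<Sum>d\<in>{1..M}. r d / real d) / (1 - x) - (\<Sum>d\<in>{1..M}. r d * ?w d) - (\<Sum>d\<in>{1..M}. r d * (x ^ (d * (M div d + 1)) / (1 - x ^ d)))"
    by (simp add: sum_subtractf sum_divide_distrib)
  finally have main: "(\<Sum>n\<in>{1..M}. R.dsum n * x ^ n) = (\<Sum>d\<in>{1..M}. r d / real d) / (1 - x) - (\<Sum>d\<in>{1..M}. r d * ?w d)
      - (\<Sum>d\<in>{1..M}. r d * (x ^ (d * (M div d + 1)) / (1 - x ^ d)))" .
  have r1: "\<bar>r d\<bar> \<le> 1" for d using val[of d] by (auto simp: r_def)
  have first: "(\<Sum>d\<in>{1..M}. r d / real d) / (1 - x) \<le> 1"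
  proof -
    have "harm M = of_real (\<Sum>d\<in>{1..M}. r d / real d)" by (simp add: harm_def \<chi>r)
    then have "\<bar>\<Sum>d\<in>{1..M}. r d / real d\<bar> \<le> 2 * B / real (M + 1)" using S[of M] by (simp only: norm_of_real)
    also have "\<dots> \<le> 1 - x"
    proof -
      have "2 * B < (1 - x) * real M2" using M2 x01 by (simp add: pos_divide_less_eq mult.commute)
      also have "\<dots> \<le> (1 - x) * real (M + 1)" using \<open>M2 \<le> M\<close> x01 by (intro mult_left_mono) auto
      finally show ?thesis by (simp add: pos_divide_le_eq)
    qed
    finally show ?thesis using x01 by (simp add: divide_le_eq_1)
  qed
  have second: "- (\<Sum>d\<in>{1..M}. r d * ?w d) \<le> 2 * B"
  proof -
    have "norm (\<Sum>d\<in>{1..<M+1}. of_real (?w d) * \<chi> d) \<le> 2 * B * ?w 1"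
      by (rule abel_bound[OF partial]) (use w in auto)
    moreover have "(\<Sum>d\<in>{1..<M+1}. of_real (?w d) * \<chi> d) = of_real (\<Sum>d\<in>{1..M}. r d * ?w d)"
      by (simp add: \<chi>r atLeastLessThanSuc_atLeastAtMost mult.commute)
    ultimately have "\<bar>\<Sum>d\<in>{1..M}. r d * ?w d\<bar> \<le> 2 * B" unfolding w(3) by (simp only: norm_of_real mult_1_right)
    then show ?thesis by linarith
  qed
  have third: "- (\<Sum>d\<in>{1..M}. r d * (x ^ (d * (M div d + 1)) / (1 - x ^ d))) \<le> 1"
  proof -
    have "\<bar>\<Sum>d\<in>{1..M}. r d * (x ^ (d * (M div d + 1)) / (1 - x ^ d))\<bar> \<le> (\<Sum>d\<in>{1..M}. x ^ M / (1 - x))"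
    proof (rule order.trans[OF sum_abs sum_mono])
      fix d assume d: "d \<in> {1..M}"
      have "x ^ d \<le> x ^ 1" using x01 d by (intro power_decreasing) auto
      then have den: "1 - x ^ d \<ge> 1 - x" by simp
      have "M < d * (M div d + 1)" using d by (simp add: dividend_less_times_div)
      then have num: "x ^ (d * (M div d + 1)) \<le> x ^ M" using x01 by (intro power_decreasing) auto
      have q0: "x ^ (d * (M div d + 1)) / (1 - x ^ d) \<ge> 0" using den x01 by simp
      have "\<bar>r d * (x ^ (d * (M div d + 1)) / (1 - x ^ d))\<bar> = \<bar>r d\<bar> * (x ^ (d * (M div d + 1)) / (1 - x ^ d))"
        by (simp only: abs_mult abs_of_nonneg[OF q0])
      also have "\<dots> \<le> 1 * (x ^ M / (1 - x))" using r1[of d] num den q0 x01 by (intro mult_mono frac_le) auto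
      finally show "\<bar>r d * (x ^ (d * (M div d + 1)) / (1 - x ^ d))\<bar> \<le> x ^ M / (1 - x)" by simp
    qed
    also have "\<dots> < 1" using M1[OF \<open>M1 \<le> M\<close>] by simp
    finally show ?thesis by linarith
  qed
  have "real k0 / 2 = (\<Sum>k\<in>{1..k0}. 1/2)" by simp
  also have "\<dots> \<le> (\<Sum>k\<in>{1..k0}. R.dsum (k\<^sup>2) * x ^ k\<^sup>2)"
  proof (rule sum_mono)
    fix k assume k: "k \<in> {1..k0}"
    have "x ^ k0\<^sup>2 \<le> x ^ k\<^sup>2" using x01 k by (intro power_decreasing power_mono) auto
    then have "1/2 \<le> x ^ k\<^sup>2" by (simp only: xk)
    then have "1 * (1/2) \<le> R.dsum (k\<^sup>2) * x ^ k\<^sup>2" using R.dsum_square[of k] k by (intro mult_mono) auto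
    then show "1/2 \<le> R.dsum (k\<^sup>2) * x ^ k\<^sup>2" by simp
  qed
  also have "\<dots> = (\<Sum>n\<in>(\<lambda>k. k\<^sup>2) ` {1..k0}. R.dsum n * x ^ n)" by (subst sum.reindex) (auto simp: inj_on_def)
  also have "\<dots> \<le> (\<Sum>n\<in>{1..M}. R.dsum n * x ^ n)"
  proof (rule sum_mono2)
    show "(\<lambda>k. k\<^sup>2) ` {1..k0} \<subseteq> {1..M}"
    proof (rule image_subsetI)
      fix k assume k: "k \<in> {1..k0}"
      then have "k\<^sup>2 \<le> k0\<^sup>2" by (intro power_mono) auto
      then have "k\<^sup>2 \<le> M" using Mk by (rule order.trans)
      then show "k\<^sup>2 \<in> {1..M}" using k by simp
    qed
    show "\<And>b. b \<in> {1..M} - (\<lambda>k. k\<^sup>2) ` {1..k0} \<Longrightarrow> 0 \<le> R.dsum b * x ^ b" using R.dsum_nonneg x01 by simp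
  qed simp
  finally have "real k0 / 2 \<le> (\<Sum>n\<in>{1..M}. R.dsum n * x ^ n)" .
  then show False using main first second third k0 by linarith
qed

section \<open>Primes congruent to 1\<close>

lemma oscillating_nonprincipal:
  assumes \<chi>: "dirichlet_char q \<chi>" "\<chi> \<noteq> principal_char q" and q: "q > 0"
  shows "oscillating_char \<chi> (real q)"
proof
  fix a b n M
  show "\<chi> (a * b) = \<chi> a * \<chi> b" by (rule dirichlet_charD(1)[OF \<chi>(1)])
  show "\<chi> 1 = 1" by (rule dirichlet_char_one[OF \<chi>(1)])
  show "norm (\<chi> n) \<le> 1" by (rule dirichlet_char_norm_le[OF \<chi>(1) q])
  show "norm (\<Sum>n<M. \<chi> n) \<le> real q"
  proof (induction M rule: less_induct)
    case (less M)
    show ?case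
    proof (cases "M < q")
      case True
      have "norm (\<Sum>n<M. \<chi> n) \<le> (\<Sum>n<M. 1)" by (rule sum_norm_le) (rule dirichlet_char_norm_le[OF \<chi>(1) q])
      then show ?thesis using True by simp
    next
      case False
      have "{..<M} = {..<q} \<union> {q..<M}" using False by auto
      then have "(\<Sum>n<M. \<chi> n) = (\<Sum>n<q. \<chi> n) + (\<Sum>n\<in>{q..<M}. \<chi> n)" by (simp add: sum.union_disjoint ivl_disj_int)
      also have "(\<Sum>n<q. \<chi> n) = 0" by (rule sum_nonprincipal_char[OF \<chi> q])
      also have "(\<Sum>n\<in>{q..<M}. \<chi> n) = (\<Sum>n\<in>{0..<M - q}. \<chi> (n + q))"
        using False sum.shift_bounds_nat_ivl[of \<chi> 0 q "M - q"] by simp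
      also have "\<dots> = (\<Sum>n<M - q. \<chi> n)"
      proof (rule sum.cong)
        show "{0..<M - q} = {..<M - q}" by auto
        show "\<chi> (n + q) = \<chi> n" for n by (rule dirichlet_charD(2)[OF \<chi>(1)]) (simp add: Cong.cong_def)
      qed
      finally show ?thesis using less.IH[of "M - q"] q False by simp
    qed
  qed
qed

lemma principal_mangoldt_sum:
  assumes q: "q > 0"
  shows "\<exists>E. \<forall>x\<ge>1. norm ((\<Sum>n\<in>{1..x}. principal_char q n * of_real (mangoldt n / real n)) + of_real (- ln (real x))) \<le> E"
proof -
  obtain C where C: "\<And>y. y \<ge> 2 \<Longrightarrow> (\<Sum>p | prime p \<and> p \<le> y. ln (real p) / real p) \<le> ln (real y) + C" using mertens_prime_upper by blast
  define W where "W = (\<Sum>p\<in>prime_factors q. ln (real p) / real p)"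
  have W0: "W \<ge> 0" unfolding W_def by (intro sum_nonneg divide_nonneg_nonneg ln_ge_zero) (auto dest!: in_prime_factors_imp_prime prime_gt_0_nat)
  have "norm ((\<Sum>n\<in>{1..x}. principal_char q n * of_real (mangoldt n / real n)) + of_real (- ln (real x))) \<le> \<bar>C\<bar> + 21 + W" if x: "x \<ge> 1" for x
  proof -
    define U V where "U = (\<Sum>n\<in>{1..x}. mangoldt n / real n)" and "V = (\<Sum>n\<in>{1..x}. if coprime n q then 0 else mangoldt n / real n)"
    have "(\<Sum>n\<in>{1..x}. principal_char q n * of_real (mangoldt n / real n)) = of_real (\<Sum>n\<in>{1..x}. if coprime n q then mangoldt n / real n else 0)"
      unfolding of_real_sum by (intro sum.cong refl) (simp add: principal_char_def)
    also have "(\<Sum>n\<in>{1..x}. if coprime n q then mangoldt n / real n else 0) = U - V"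
      unfolding U_def V_def sum_subtractf[symmetric] by (intro sum.cong refl) simp
    finally have eq: "(\<Sum>n\<in>{1..x}. principal_char q n * of_real (mangoldt n / real n)) = of_real (U - V)" .
    have U1: "U \<ge> ln (real x) - 1" unfolding U_def by (rule mertens_mangoldt_lower[OF x])
    have U2: "U \<le> ln (real x) + \<bar>C\<bar> + 20"
    proof (cases "x = 1")
      case True
      then show ?thesis by (simp add: U_def)
    next
      case False
      have "U = (\<Sum>p | prime p \<and> p \<le> x. mangoldt p / real p) + (\<Sum>n | n \<in> {1..x} \<and> \<not> prime n. mangoldt n / real n)"
        unfolding U_def by (rule sum_split_prime)
      also have "(\<Sum>p | prime p \<and> p \<le> x. mangoldt p / real p) = (\<Sum>p | prime p \<and> p \<le> x. ln (real p) / real p)"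
        by (intro sum.cong) auto
      finally show ?thesis using C[of x] sum_mangoldt_nonprime_le[of x] x False by simp
    qed
    have V1: "V \<ge> 0" unfolding V_def by (intro sum_nonneg) (simp add: mangoldt_nonneg)
    have V2: "V \<le> W + 20"
    proof -
      have "V = (\<Sum>p | prime p \<and> p \<le> x. if coprime p q then 0 else mangoldt p / real p)
          + (\<Sum>n | n \<in> {1..x} \<and> \<not> prime n. if coprime n q then 0 else mangoldt n / real n)"
        unfolding V_def by (rule sum_split_prime)
      also have "(\<Sum>n | n \<in> {1..x} \<and> \<not> prime n. if coprime n q then 0 else mangoldt n / real n) \<le> (\<Sum>n | n \<in> {1..x} \<and> \<not> prime n. mangoldt n / real n)"
        by (rule sum_mono) (simp add: mangoldt_nonneg)
      also have "\<dots> \<le> 20" by (rule sum_mangoldt_nonprime_le)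
      also have "(\<Sum>p | prime p \<and> p \<le> x. if coprime p q then 0 else mangoldt p / real p) = (\<Sum>p | prime p \<and> p \<le> x \<and> \<not> coprime p q. ln (real p) / real p)"
        by (rule sum.mono_neutral_cong_right) (auto intro: finite_subset[of _ "{..x}"])
      also have "\<dots> \<le> W" unfolding W_def
      proof (rule sum_mono2)
        show "{p. prime p \<and> p \<le> x \<and> \<not> coprime p q} \<subseteq> prime_factors q"
        proof
          fix p assume "p \<in> {p. prime p \<and> p \<le> x \<and> \<not> coprime p q}"
          then have "prime p" "p dvd q" using prime_imp_coprime by blast+
          then show "p \<in> prime_factors q" using q by (simp add: prime_factors_dvd)
        qed
        show "0 \<le> ln (real p) / real p" if "p \<in> prime_factors q - {p. prime p \<and> p \<le> x \<and> \<not> coprime p q}" for p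
        proof -
          have "p > 0" using that in_prime_factors_imp_prime prime_gt_0_nat by blast
          then show ?thesis by (intro divide_nonneg_nonneg ln_ge_zero) auto
        qed
      qed simp
      finally show ?thesis by simp
    qed
    have "\<bar>U - V - ln (real x)\<bar> \<le> \<bar>C\<bar> + 21 + W" using U1 U2 V1 V2 W0 by linarith
    then show ?thesis unfolding eq of_real_add[symmetric] norm_of_real by simp
  qed
  then show ?thesis by blast
qed

text \<open>
  The twisted sums of \<open>mangoldt n / n\<close> are \<open>w ln x + O(1)\<close> with \<open>w = 1\<close> for the principal character, \<open>w = -1\<close> for the
  characters whose sum of \<open>\<chi>(n) / n\<close> is zero, and \<open>w = 0\<close> otherwise.  Their total is a sum of non-negative terms, so at most one
  character has \<open>w = -1\<close>.  It would equal its complex conjugate, and the real case is excluded.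
\<close>
theorem primes_cong_1_lower:
  assumes q: "q \<ge> 2"
  shows "\<exists>C. \<forall>y\<ge>1. (\<Sum>p | prime p \<and> [p = 1] (mod q) \<and> p \<le> y. ln (real p) / real p) \<ge> ln (real y) / real (totient q) - C"
proof -
  have q0: "q > 0" using q by simp
  define D where "D = {\<chi>. dirichlet_char q \<chi>}"
  have finD: "finite D" and cardD: "card D = totient q" unfolding D_def using finite_dirichlet_chars[OF q0] card_dirichlet_chars[OF q] by auto
  define har where "har \<chi> x = (\<Sum>m\<in>{1..x}. \<chi> m / of_nat m)" for \<chi> :: "nat \<Rightarrow> complex" and x :: nat
  define lm where "lm \<chi> x = (\<Sum>n\<in>{1..x}. \<chi> n * of_real (mangoldt n / real n))" for \<chi> :: "nat \<Rightarrow> complex" and x :: nat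
  define Z where "Z = {\<chi>\<in>D. \<chi> \<noteq> principal_char q \<and> har \<chi> \<longlonglongrightarrow> 0}"
  define wt :: "(nat \<Rightarrow> complex) \<Rightarrow> real" where "wt \<chi> = (if \<chi> = principal_char q then -1 else if \<chi> \<in> Z then 1 else 0)" for \<chi>
  have "\<exists>E. \<forall>x\<ge>1. norm (lm \<chi> x + of_real (wt \<chi> * ln (real x))) \<le> E" if \<chi>: "\<chi> \<in> D" for \<chi>
  proof -
    have dc: "dirichlet_char q \<chi>" using \<chi> by (simp add: D_def)
    consider "\<chi> = principal_char q" | "\<chi> \<noteq> principal_char q" "har \<chi> \<longlonglongrightarrow> 0" | "\<chi> \<noteq> principal_char q" "\<not> har \<chi> \<longlonglongrightarrow> 0" by blast
    then show ?thesis
    proof cases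
      case 1
      then show ?thesis using principal_mangoldt_sum[OF q0] by (simp add: wt_def lm_def)
    next
      case 2
      interpret oscillating_char \<chi> "real q" by (rule oscillating_nonprincipal[OF dc 2(1) q0])
      have "harm \<longlonglongrightarrow> 0" using 2(2) by (simp add: harm_def[abs_def] har_def[abs_def])
      from lam_of_zero[OF this] show ?thesis using 2 \<chi> by (simp add: wt_def Z_def lm_def lam_def)
    next
      case 3
      interpret oscillating_char \<chi> "real q" by (rule oscillating_nonprincipal[OF dc 3(1) q0])
      have "\<not> harm \<longlonglongrightarrow> 0" using 3(2) by (simp add: harm_def[abs_def] har_def[abs_def])
      from lam_bounded_of_nonzero[OF this] show ?thesis using 3 \<chi> by (simp add: wt_def Z_def lm_def lam_def)
    qed
  qed
  then obtain E where E: "\<And>\<chi> x. \<chi> \<in> D \<Longrightarrow> x \<ge> 1 \<Longrightarrow> norm (lm \<chi> x + of_real (wt \<chi> * ln (real x))) \<le> E \<chi>"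
    using bchoice[of D "\<lambda>\<chi> E. \<forall>x\<ge>1. norm (lm \<chi> x + of_real (wt \<chi> * ln (real x))) \<le> E"] by blast
  define U where "U x = (\<Sum>n\<in>{1..x}. if [n = 1] (mod q) then mangoldt n / real n else 0)" for x
  have U0: "U x \<ge> 0" for x unfolding U_def by (intro sum_nonneg) (simp add: mangoldt_nonneg)
  have sumlam: "(\<Sum>\<chi>\<in>D. lm \<chi> x) = of_real (real (totient q) * U x)" for x
  proof -
    have "(\<Sum>\<chi>\<in>D. lm \<chi> x) = (\<Sum>n\<in>{1..x}. \<Sum>\<chi>\<in>D. \<chi> n * of_real (mangoldt n / real n))" unfolding lm_def by (rule sum.swap)
    also have "\<dots> = (\<Sum>n\<in>{1..x}. (\<Sum>\<chi>\<in>D. \<chi> n) * of_real (mangoldt n / real n))" by (simp only: sum_distrib_right)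
    also have "\<dots> = (\<Sum>n\<in>{1..x}. of_real (real (totient q) * (if [n = 1] (mod q) then mangoldt n / real n else 0)))"
      by (intro sum.cong refl) (simp add: D_def sum_over_dirichlet_chars[OF q0] cardD[unfolded D_def])
    also have "\<dots> = of_real (real (totient q) * U x)" unfolding U_def by (simp only: of_real_sum sum_distrib_left)
    finally show ?thesis .
  qed
  have bound: "\<bar>real (totient q) * U x + (\<Sum>\<chi>\<in>D. wt \<chi>) * ln (real x)\<bar> \<le> (\<Sum>\<chi>\<in>D. E \<chi>)" if x: "x \<ge> 1" for x
  proof -
    have "norm (\<Sum>\<chi>\<in>D. lm \<chi> x + of_real (wt \<chi> * ln (real x))) \<le> (\<Sum>\<chi>\<in>D. E \<chi>)" by (rule sum_norm_le) (rule E[OF _ x])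
    also have "(\<Sum>\<chi>\<in>D. lm \<chi> x + of_real (wt \<chi> * ln (real x))) = of_real (real (totient q) * U x + (\<Sum>\<chi>\<in>D. wt \<chi>) * ln (real x))"
      by (simp only: sum.distrib sumlam of_real_add of_real_sum sum_distrib_right)
    finally show ?thesis by (simp only: norm_of_real)
  qed
  have Zsub: "Z \<subseteq> D" and finZ: "finite Z" using finD by (auto simp: Z_def)
  have prD: "principal_char q \<in> D" by (simp add: D_def dirichlet_char_principal)
  have sumwt: "(\<Sum>\<chi>\<in>D. wt \<chi>) = real (card Z) - 1"
  proof -
    have "(\<Sum>\<chi>\<in>D. wt \<chi>) = (\<Sum>\<chi>\<in>D. (if \<chi> \<in> Z then 1 else 0) - (if \<chi> = principal_char q then 1 else 0))"
      by (intro sum.cong refl) (simp add: wt_def Z_def)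
    also have "\<dots> = (\<Sum>\<chi>\<in>D. if \<chi> \<in> Z then 1 else 0) - 1" unfolding sum_subtractf using finD prD by simp
    also have "(\<Sum>\<chi>\<in>D. if \<chi> \<in> Z then 1 else (0::real)) = real (card (D \<inter> Z))"
      by (subst sum.inter_restrict[OF finD, symmetric]) simp
    also have "D \<inter> Z = Z" using Zsub by blast
    finally show ?thesis .
  qed
  have cardZ: "card Z \<le> 1"
  proof (rule ccontr)
    assume "\<not> card Z \<le> 1"
    then have c: "real (card Z) - 1 \<ge> 1" by simp
    obtain x :: nat where x: "exp ((\<Sum>\<chi>\<in>D. E \<chi>) + 1) < real x" using reals_Archimedean2 by blast
    then have x0: "0 < real x" using exp_gt_zero order.strict_trans by blast
    then have x1: "x \<ge> 1" by simp
    have "exp ((\<Sum>\<chi>\<in>D. E \<chi>) + 1) < exp (ln (real x))" using x x0 by (simp only: exp_ln)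
    then have "(\<Sum>\<chi>\<in>D. E \<chi>) + 1 < ln (real x)" by (simp only: exp_less_cancel_iff)
    moreover have "1 * ln (real x) \<le> (real (card Z) - 1) * ln (real x)" using c x1 by (intro mult_right_mono) auto
    moreover have "real (totient q) * U x \<ge> 0" using U0 by simp
    ultimately show False using bound[OF x1] unfolding sumwt by linarith
  qed
  have "Z = {}"
  proof (rule ccontr)
    assume "Z \<noteq> {}"
    then obtain \<chi> where \<chi>: "\<chi> \<in> Z" by blast
    then have dc: "dirichlet_char q \<chi>" "\<chi> \<noteq> principal_char q" and lim: "har \<chi> \<longlonglongrightarrow> 0" by (simp_all add: Z_def D_def)
    define \<psi> where "\<psi> n = cnj (\<chi> n)" for n
    have "dirichlet_char q \<psi>" unfolding dirichlet_char_def \<psi>_def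
      using dirichlet_charD[OF dc(1)] by auto
    moreover have "\<psi> \<noteq> principal_char q"
    proof
      assume eq: "\<psi> = principal_char q"
      have "\<chi> n = principal_char q n" for n
      proof -
        have "cnj (\<chi> n) = principal_char q n" using fun_cong[OF eq, of n] by (simp add: \<psi>_def)
        then have "cnj (cnj (\<chi> n)) = cnj (principal_char q n)" by simp
        then show ?thesis by (simp add: principal_char_def split: if_splits)
      qed
      then show False using dc(2) by blast
    qed
    moreover have "har \<psi> \<longlonglongrightarrow> 0"
    proof -
      have "har \<psi> = (\<lambda>x. cnj (har \<chi> x))" by (simp add: har_def[abs_def] \<psi>_def fun_eq_iff)
      moreover have "(\<lambda>x. cnj (har \<chi> x)) \<longlonglongrightarrow> cnj 0" by (rule tendsto_cnj[OF lim])
      ultimately show ?thesis by simp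
    qed
    ultimately have "\<psi> \<in> Z" by (simp add: Z_def D_def)
    then have eq: "\<psi> = \<chi>" using \<chi> cardZ finZ card_le_Suc0_iff_eq[OF finZ] by auto
    have val: "\<chi> n \<in> {-1, 0, 1}" for n
    proof (cases "coprime n q")
      case True
      have "cnj (\<chi> n) = \<chi> n" using fun_cong[OF eq, of n] by (simp add: \<psi>_def)
      then obtain s where s: "\<chi> n = of_real s" using Reals_cnj_iff Reals_cases by metis
      have "\<bar>s\<bar> = 1" using dirichlet_char_norm_eq_1[OF dc(1) q0 True] by (simp add: s)
      then show ?thesis by (auto simp: s abs_if split: if_splits)
    next
      case False
      then show ?thesis using dirichlet_charD(3)[OF dc(1), of n] by simp
    qed
    show False using real_char_harm_nonzero[OF oscillating_nonprincipal[OF dc q0] val] lim by (simp add: har_def[abs_def])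
  qed
  then have wt1: "(\<Sum>\<chi>\<in>D. wt \<chi>) = -1" using sumwt by simp
  show ?thesis
  proof (intro exI allI impI)
    fix y :: nat assume y: "y \<ge> 1"
    have tot: "real (totient q) > 0" using q0 by simp
    have "ln (real y) - (\<Sum>\<chi>\<in>D. E \<chi>) \<le> real (totient q) * U y" using bound[OF y] unfolding wt1 by linarith
    then have 1: "ln (real y) / real (totient q) - (\<Sum>\<chi>\<in>D. E \<chi>) / real (totient q) \<le> U y"
      using tot by (simp only: diff_divide_distrib[symmetric] pos_divide_le_eq mult.commute)
    have "U y = (\<Sum>p | prime p \<and> p \<le> y. if [p = 1] (mod q) then mangoldt p / real p else 0)
          + (\<Sum>n | n \<in> {1..y} \<and> \<not> prime n. if [n = 1] (mod q) then mangoldt n / real n else 0)"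
      unfolding U_def by (rule sum_split_prime)
    also have "(\<Sum>n | n \<in> {1..y} \<and> \<not> prime n. if [n = 1] (mod q) then mangoldt n / real n else 0) \<le> (\<Sum>n | n \<in> {1..y} \<and> \<not> prime n. mangoldt n / real n)"
      by (rule sum_mono) (simp add: mangoldt_nonneg)
    also have "\<dots> \<le> 20" by (rule sum_mangoldt_nonprime_le)
    also have "(\<Sum>p | prime p \<and> p \<le> y. if [p = 1] (mod q) then mangoldt p / real p else 0) = (\<Sum>p | prime p \<and> [p = 1] (mod q) \<and> p \<le> y. ln (real p) / real p)"
      by (rule sum.mono_neutral_cong_right) (auto intro: finite_subset[of _ "{..y}"])
    finally show "ln (real y) / real (totient q) - ((\<Sum>\<chi>\<in>D. E \<chi>) / real (totient q) + 20) \<le> (\<Sum>p | prime p \<and> [p = 1] (mod q) \<and> p \<le> y. ln (real p) / real p)"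
      using 1 by linarith
  qed
qed

section \<open>Evaluation of formal sums\<close>

text \<open>
  The additive extension of \<open>\<Phi>\<close> from generators to formal integer combinations.
\<close>
definition frag_eval :: "('a \<Rightarrow> 'b::comm_ring_1) \<Rightarrow> ('a \<Rightarrow>\<^sub>0 int) \<Rightarrow> 'b" where
  "frag_eval \<Phi> c = (\<Sum>x\<in>Poly_Mapping.keys c. of_int (Poly_Mapping.lookup c x) * \<Phi> x)"

lemma frag_eval_superset:
  assumes "finite A" "Poly_Mapping.keys c \<subseteq> A"
  shows "frag_eval \<Phi> c = (\<Sum>x\<in>A. of_int (Poly_Mapping.lookup c x) * \<Phi> x)"
  unfolding frag_eval_def by (rule sum.mono_neutral_left) (use assms in \<open>auto simp: in_keys_iff\<close>)

lemma frag_eval_of [simp]: "frag_eval \<Phi> (frag_of x) = \<Phi> x"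
  by (simp add: frag_eval_def)

lemma frag_eval_0 [simp]: "frag_eval \<Phi> 0 = 0"
  by (simp add: frag_eval_def)

lemma frag_eval_diff [simp]: "frag_eval \<Phi> (a - b) = frag_eval \<Phi> a - frag_eval \<Phi> b"
proof -
  let ?A = "Poly_Mapping.keys a \<union> Poly_Mapping.keys b"
  have *: "finite ?A" "Poly_Mapping.keys (a - b) \<subseteq> ?A" by (auto simp: keys_diff)
  show ?thesis
    by (simp add: frag_eval_superset[OF *] frag_eval_superset[OF *(1), of a] frag_eval_superset[OF *(1), of b]
        lookup_minus algebra_simps sum_subtractf)
qed

lemma frag_eval_uminus [simp]: "frag_eval \<Phi> (- a) = - frag_eval \<Phi> a"
  using frag_eval_diff[of \<Phi> 0 a] by simp

lemma frag_eval_add [simp]: "frag_eval \<Phi> (a + b) = frag_eval \<Phi> a + frag_eval \<Phi> b"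
  using frag_eval_diff[of \<Phi> a "- b"] by simp

lemma frag_eval_cmul [simp]: "frag_eval \<Phi> (frag_cmul k a) = of_int k * frag_eval \<Phi> a"
proof (cases "k = 0")
  case False
  then have "Poly_Mapping.keys (frag_cmul k a) = Poly_Mapping.keys a" by auto
  then show ?thesis by (simp add: frag_eval_def sum_distrib_left mult_ac)
qed simp

lemma frag_eval_extend: "frag_eval \<Phi> (frag_extend f c) = frag_eval (\<lambda>x. frag_eval \<Phi> (f x)) c"
  using subset_UNIV by (induction c rule: frag_induction) (auto simp: frag_extend_diff)

lemma frag_extend_fun_diff: "frag_extend (\<lambda>x. f x - g x) c = frag_extend f c - frag_extend g c"
  by (rule poly_mapping_eqI)
     (simp add: frag_extend_def lookup_sum lookup_minus algebra_simps sum_subtractf)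

lemma abelian_group_a_minus_eqI:
  assumes "abelian_group G" "x \<in> carrier G" "y \<in> carrier G" "z \<in> carrier G" "x = z \<oplus>\<^bsub>G\<^esub> y"
  shows "x \<ominus>\<^bsub>G\<^esub> y = z"
proof -
  interpret abelian_group G by fact
  show ?thesis using assms(2-5) by (simp add: a_minus_def a_assoc r_neg)
qed

section \<open>The ring of l-adic integers\<close>

lemma padic_int_ring_cring:
  assumes "l > 0"
  shows "cring (padic_int_ring l)"
proof -
  have dvd: "int l ^ k dvd int l ^ Suc k" for k by simp
  have pos: "int l ^ k > 0" for k using assms by simp
  show ?thesis
  proof (intro cringI abelian_groupI comm_monoidI)
    fix x y z assume *: "x \<in> carrier (padic_int_ring l)" "y \<in> carrier (padic_int_ring l)" "z \<in> carrier (padic_int_ring l)"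
    show "x \<otimes>\<^bsub>padic_int_ring l\<^esub> y \<otimes>\<^bsub>padic_int_ring l\<^esub> z = x \<otimes>\<^bsub>padic_int_ring l\<^esub> (y \<otimes>\<^bsub>padic_int_ring l\<^esub> z)"
      "x \<oplus>\<^bsub>padic_int_ring l\<^esub> y \<oplus>\<^bsub>padic_int_ring l\<^esub> z = x \<oplus>\<^bsub>padic_int_ring l\<^esub> (y \<oplus>\<^bsub>padic_int_ring l\<^esub> z)"
      "(x \<oplus>\<^bsub>padic_int_ring l\<^esub> y) \<otimes>\<^bsub>padic_int_ring l\<^esub> z = x \<otimes>\<^bsub>padic_int_ring l\<^esub> z \<oplus>\<^bsub>padic_int_ring l\<^esub> y \<otimes>\<^bsub>padic_int_ring l\<^esub> z"
      by (simp_all add: padic_int_ring_def fun_eq_iff mod_simps algebra_simps)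
  next
    fix x y assume *: "x \<in> carrier (padic_int_ring l)" "y \<in> carrier (padic_int_ring l)"
    then have **: "x (Suc k) mod int l ^ k = x k" "y (Suc k) mod int l ^ k = y k" for k by (auto simp: padic_int_ring_def)
    have "(x (Suc k) + y (Suc k)) mod int l ^ Suc k mod int l ^ k = (x k + y k) mod int l ^ k"
         "(x (Suc k) * y (Suc k)) mod int l ^ Suc k mod int l ^ k = (x k * y k) mod int l ^ k" for k
      unfolding mod_mod_cancel[OF dvd] by (metis ** mod_add_eq) (metis ** mod_mult_eq)
    then show "x \<oplus>\<^bsub>padic_int_ring l\<^esub> y \<in> carrier (padic_int_ring l)" "x \<otimes>\<^bsub>padic_int_ring l\<^esub> y \<in> carrier (padic_int_ring l)"
      using pos by (auto simp: padic_int_ring_def simp del: power_Suc)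
    show "x \<oplus>\<^bsub>padic_int_ring l\<^esub> y = y \<oplus>\<^bsub>padic_int_ring l\<^esub> x" "x \<otimes>\<^bsub>padic_int_ring l\<^esub> y = y \<otimes>\<^bsub>padic_int_ring l\<^esub> x"
      by (simp_all add: padic_int_ring_def add.commute mult.commute)
  next
    fix x assume *: "x \<in> carrier (padic_int_ring l)"
    then have **: "x (Suc k) mod int l ^ k = x k" "x k mod int l ^ k = x k" for k by (auto simp: padic_int_ring_def)
    show "\<zero>\<^bsub>padic_int_ring l\<^esub> \<oplus>\<^bsub>padic_int_ring l\<^esub> x = x" "\<one>\<^bsub>padic_int_ring l\<^esub> \<otimes>\<^bsub>padic_int_ring l\<^esub> x = x"
      using ** by (simp_all add: padic_int_ring_def fun_eq_iff mod_simps)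
    let ?y = "\<lambda>k. (- x k) mod int l ^ k"
    have "(- x (Suc k)) mod int l ^ Suc k mod int l ^ k = (- x k) mod int l ^ k" for k
      unfolding mod_mod_cancel[OF dvd] by (metis ** mod_minus_eq)
    then have "?y \<in> carrier (padic_int_ring l)" using pos by (auto simp: padic_int_ring_def simp del: power_Suc)
    moreover have "?y \<oplus>\<^bsub>padic_int_ring l\<^esub> x = \<zero>\<^bsub>padic_int_ring l\<^esub>"
      by (simp add: padic_int_ring_def fun_eq_iff mod_simps)
    ultimately show "\<exists>y\<in>carrier (padic_int_ring l). y \<oplus>\<^bsub>padic_int_ring l\<^esub> x = \<zero>\<^bsub>padic_int_ring l\<^esub>" by blast
  next
    have "1 mod int l ^ Suc k mod int l ^ k = 1 mod int l ^ k" for k by (rule mod_mod_cancel[OF dvd])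
    then show "\<one>\<^bsub>padic_int_ring l\<^esub> \<in> carrier (padic_int_ring l)" using pos by (auto simp: padic_int_ring_def simp del: power_Suc)
  qed (use pos in \<open>auto simp: padic_int_ring_def\<close>)
qed

lemma int_ring_cring: "cring \<Z>"
proof (intro cringI abelian_groupI comm_monoidI)
  fix x :: int
  show "\<exists>y\<in>carrier \<Z>. y \<oplus>\<^bsub>\<Z>\<^esub> x = \<zero>\<^bsub>\<Z>\<^esub>" by (auto intro: exI[of _ "- x"])
qed (auto simp: algebra_simps)

section \<open>Rings of integers\<close>

lemma integer_algebra_simps [simp]:
  "x \<in> carrier (integer_algebra F) \<longleftrightarrow> x \<in> F \<and> algebraic_int x"
  "x \<otimes>\<^bsub>integer_algebra F\<^esub> y = x * y" "x \<oplus>\<^bsub>integer_algebra F\<^esub> y = x + y"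
  "\<one>\<^bsub>integer_algebra F\<^esub> = 1" "\<zero>\<^bsub>integer_algebra F\<^esub> = 0" "k \<odot>\<^bsub>integer_algebra F\<^esub> x = of_int k * x"
  by (simp_all add: integer_algebra_def)

lemma integer_algebra_cring: "cring (integer_algebra (adjoin S))"
proof (intro cringI abelian_groupI comm_monoidI)
  fix x assume "x \<in> carrier (integer_algebra (adjoin S))"
  then show "\<exists>y\<in>carrier (integer_algebra (adjoin S)). y \<oplus>\<^bsub>integer_algebra (adjoin S)\<^esub> x = \<zero>\<^bsub>integer_algebra (adjoin S)\<^esub>"
    by (intro bexI[of _ "- x"]) (auto intro: adjoin_closed)
qed (auto simp: algebra_simps intro: adjoin_closed algebraic_int_plus_times)

lemma integer_algebra_module: "module \<Z> (integer_algebra (adjoin S))"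
proof (rule moduleI)
  show "abelian_group (integer_algebra (adjoin S))"
    using integer_algebra_cring by (simp add: cring_def ring_def)
qed (auto simp: int_ring_cring algebra_simps intro: adjoin_closed(5)[OF _ adjoin_of_int] algebraic_int_plus_times int_imp_algebraic_int)

section \<open>Tensor products\<close>

locale cring_pair = A?: cring A + B?: cring B for A :: "('a, 'c) ring_scheme" and B :: "('b, 'd) ring_scheme"
begin

abbreviation "PR \<equiv> pair_ring A B"

lemma pair_ring_simps [simp]:
  "c \<in> carrier PR \<longleftrightarrow> Poly_Mapping.keys c \<subseteq> carrier A \<times> carrier B"
  "c \<oplus>\<^bsub>PR\<^esub> d = c + d" "\<zero>\<^bsub>PR\<^esub> = 0" "\<one>\<^bsub>PR\<^esub> = frag_of (\<one>\<^bsub>A\<^esub>, \<one>\<^bsub>B\<^esub>)"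
  by (simp_all add: pair_ring_def)

lemma pair_mult_of [simp]: "frag_of (a, b) \<otimes>\<^bsub>PR\<^esub> frag_of (a', b') = frag_of (a \<otimes>\<^bsub>A\<^esub> a', b \<otimes>\<^bsub>B\<^esub> b')"
  by (simp add: pair_ring_def)

lemma pair_mult_diff_left: "(c - c') \<otimes>\<^bsub>PR\<^esub> d = c \<otimes>\<^bsub>PR\<^esub> d - c' \<otimes>\<^bsub>PR\<^esub> d"
  by (simp add: pair_ring_def frag_extend_diff)

lemma pair_mult_diff_right: "c \<otimes>\<^bsub>PR\<^esub> (d - d') = c \<otimes>\<^bsub>PR\<^esub> d - c \<otimes>\<^bsub>PR\<^esub> d'"
  by (simp add: pair_ring_def frag_extend_diff case_prod_unfold frag_extend_fun_diff)

lemma pair_mult_0 [simp]: "0 \<otimes>\<^bsub>PR\<^esub> d = 0" "c \<otimes>\<^bsub>PR\<^esub> 0 = 0"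
  using pair_mult_diff_left[of 0 0 d] pair_mult_diff_right[of c 0 0] by simp_all

lemma pair_mult_add_left: "(c + c') \<otimes>\<^bsub>PR\<^esub> d = c \<otimes>\<^bsub>PR\<^esub> d + c' \<otimes>\<^bsub>PR\<^esub> d"
  using pair_mult_diff_left[of c "0 - c'" d] pair_mult_diff_left[of 0 c' d] by simp

lemma pair_mult_closed:
  assumes "Poly_Mapping.keys c \<subseteq> carrier A \<times> carrier B" "Poly_Mapping.keys d \<subseteq> carrier A \<times> carrier B"
  shows "Poly_Mapping.keys (c \<otimes>\<^bsub>PR\<^esub> d) \<subseteq> carrier A \<times> carrier B"
  using assms(1)
proof (induction c rule: frag_induction)
  case (one x)
  obtain a b where x: "x = (a, b)" by (cases x)
  from assms(2) show ?case
  proof (induction d rule: frag_induction)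
    case (one y)
    then show ?case using \<open>x \<in> carrier A \<times> carrier B\<close> by (cases y) (auto simp: x)
  next
    case (diff u v)
    then show ?case using keys_diff[of "frag_of x \<otimes>\<^bsub>PR\<^esub> u" "frag_of x \<otimes>\<^bsub>PR\<^esub> v"] by (auto simp: pair_mult_diff_right)
  qed simp
next
  case (diff u v)
  then show ?case using keys_diff[of "u \<otimes>\<^bsub>PR\<^esub> d" "v \<otimes>\<^bsub>PR\<^esub> d"] by (auto simp: pair_mult_diff_left)
qed simp

lemma pair_ring_cring: "cring PR"
proof (intro cringI abelian_groupI comm_monoidI)
  fix x y z assume x: "x \<in> carrier PR" and y: "y \<in> carrier PR" and z: "z \<in> carrier PR"
  note x = x[unfolded pair_ring_simps] and y = y[unfolded pair_ring_simps] and z = z[unfolded pair_ring_simps]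
  from x show "x \<otimes>\<^bsub>PR\<^esub> y \<otimes>\<^bsub>PR\<^esub> z = x \<otimes>\<^bsub>PR\<^esub> (y \<otimes>\<^bsub>PR\<^esub> z)"
  proof (induction x rule: frag_induction)
    case (one p)
    from y show ?case
    proof (induction y rule: frag_induction)
      case (one q)
      from z show ?case
      proof (induction z rule: frag_induction)
        case (one r)
        then show ?case using \<open>p \<in> _\<close> \<open>q \<in> _\<close> by (cases p; cases q; cases r) (auto simp: A.m_assoc B.m_assoc)
      qed (auto simp: pair_mult_diff_right)
    qed (auto simp: pair_mult_diff_right pair_mult_diff_left)
  qed (auto simp: pair_mult_diff_left)
next
  fix x y assume x: "x \<in> carrier PR" and y: "y \<in> carrier PR"
  note x = x[unfolded pair_ring_simps] and y = y[unfolded pair_ring_simps]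
  from x y show "x \<otimes>\<^bsub>PR\<^esub> y \<in> carrier PR" by (simp add: pair_mult_closed)
  from x y show "x \<oplus>\<^bsub>PR\<^esub> y \<in> carrier PR" using keys_add[of x y] by auto
  from x show "x \<otimes>\<^bsub>PR\<^esub> y = y \<otimes>\<^bsub>PR\<^esub> x"
  proof (induction x rule: frag_induction)
    case (one p)
    from y show ?case
    proof (induction y rule: frag_induction)
      case (one q)
      then show ?case using \<open>p \<in> _\<close> by (cases p; cases q) (auto simp: A.m_comm B.m_comm)
    qed (auto simp: pair_mult_diff_right pair_mult_diff_left)
  qed (auto simp: pair_mult_diff_left pair_mult_diff_right)
next
  fix x assume x: "x \<in> carrier PR"
  then show "\<exists>y\<in>carrier PR. y \<oplus>\<^bsub>PR\<^esub> x = \<zero>\<^bsub>PR\<^esub>"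
    by (intro bexI[of _ "- x"]) auto
  note x = x[unfolded pair_ring_simps]
  from x show "\<one>\<^bsub>PR\<^esub> \<otimes>\<^bsub>PR\<^esub> x = x"
  proof (induction x rule: frag_induction)
    case (one p)
    then show ?case by (cases p) auto
  qed (auto simp: pair_mult_diff_right)
qed (auto simp: pair_mult_add_left)

abbreviation "TI \<equiv> tensor_ideal A B"
abbreviation "BC \<equiv> base_change A B"
abbreviation "pure \<equiv> pure_tensor A B"

sublocale PR: cring PR by (rule pair_ring_cring)

lemma pair_ring_a_inv [simp]: "x \<in> carrier PR \<Longrightarrow> \<ominus>\<^bsub>PR\<^esub> x = - x"
  by (rule PR.minus_equality) auto

lemma tensor_relations_carrier: "tensor_relations A B \<subseteq> carrier PR"
proof
  fix r assume "r \<in> tensor_relations A B"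
  then obtain u v w where r: "r = frag_of u - frag_of v - frag_of w" "{u, v, w} \<subseteq> carrier A \<times> carrier B"
    unfolding tensor_relations_def by fastforce
  have "Poly_Mapping.keys r \<subseteq> {u, v, w}"
    unfolding r(1) using keys_diff[of "frag_of u - frag_of v" "frag_of w"] keys_diff[of "frag_of u" "frag_of v"] by auto
  then show "r \<in> carrier PR" using r(2) by auto
qed

sublocale TI: ideal TI PR
  unfolding tensor_ideal_def by (rule PR.genideal_ideal[OF tensor_relations_carrier])

lemma BC_simps:
  "carrier BC = carrier (PR Quot TI)" "monoid.mult BC = monoid.mult (PR Quot TI)" "\<one>\<^bsub>BC\<^esub> = \<one>\<^bsub>PR Quot TI\<^esub>"
  "\<zero>\<^bsub>BC\<^esub> = \<zero>\<^bsub>PR Quot TI\<^esub>" "ring.add BC = ring.add (PR Quot TI)"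
  "b \<odot>\<^bsub>BC\<^esub> t = pure \<one>\<^bsub>A\<^esub> b \<otimes>\<^bsub>BC\<^esub> t"
  by (simp_all add: base_change_def Let_def)

lemma cring_cong:
  assumes "cring U" "carrier Y = carrier U" "monoid.mult Y = monoid.mult U" "\<one>\<^bsub>Y\<^esub> = \<one>\<^bsub>U\<^esub>" "\<zero>\<^bsub>Y\<^esub> = \<zero>\<^bsub>U\<^esub>" "ring.add Y = ring.add U"
  shows "cring Y"
proof -
  interpret U: cring U by fact
  show ?thesis
  proof (intro cringI abelian_groupI comm_monoidI)
    fix x assume "x \<in> carrier Y"
    then show "\<exists>y\<in>carrier Y. y \<oplus>\<^bsub>Y\<^esub> x = \<zero>\<^bsub>Y\<^esub>"
      using assms U.l_neg U.a_inv_closed by metis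
  qed (simp_all add: assms(2-) U.m_assoc U.a_assoc U.l_distr, simp_all add: U.m_comm U.a_comm)
qed

lemma BC_cring: "cring BC"
  by (rule cring_cong[OF TI.quotient_is_cring[OF PR.is_cring]]) (simp_all add: BC_simps)

sublocale BC: cring BC by (rule BC_cring)

definition "proj x = TI +>\<^bsub>PR\<^esub> x"

lemma proj_add: "x \<in> carrier PR \<Longrightarrow> y \<in> carrier PR \<Longrightarrow> proj (x + y) = proj x \<oplus>\<^bsub>BC\<^esub> proj y"
  and proj_mult: "x \<in> carrier PR \<Longrightarrow> y \<in> carrier PR \<Longrightarrow> proj (x \<otimes>\<^bsub>PR\<^esub> y) = proj x \<otimes>\<^bsub>BC\<^esub> proj y"
  and proj_one: "proj (frag_of (\<one>\<^bsub>A\<^esub>, \<one>\<^bsub>B\<^esub>)) = \<one>\<^bsub>BC\<^esub>"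
  and proj_closed: "x \<in> carrier PR \<Longrightarrow> proj x \<in> carrier BC"
  using ring_hom_add[OF TI.rcos_ring_hom] ring_hom_mult[OF TI.rcos_ring_hom] ring_hom_one[OF TI.rcos_ring_hom]
    ring_hom_closed[OF TI.rcos_ring_hom]
  unfolding proj_def BC_simps by simp_all

lemma proj_surj: assumes "t \<in> carrier BC" obtains x where "x \<in> carrier PR" "t = proj x"
  using assms unfolding BC_simps FactRing_simps proj_def by auto

lemma proj_zero: "proj 0 = \<zero>\<^bsub>BC\<^esub>"
proof -
  have "proj 0 = proj 0 \<oplus>\<^bsub>BC\<^esub> proj 0" using proj_add[of 0 0] by simp
  moreover have "proj 0 \<in> carrier BC" by (rule proj_closed) simp
  ultimately show ?thesis by (metis BC.add.r_cancel_one')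
qed

lemma proj_diff:
  assumes "x \<in> carrier PR" "y \<in> carrier PR" shows "proj (x - y) = proj x \<ominus>\<^bsub>BC\<^esub> proj y"
proof -
  have xy: "x - y \<in> carrier PR" using assms keys_diff[of x y] by auto
  have "proj x = proj (x - y) \<oplus>\<^bsub>BC\<^esub> proj y" using proj_add[OF xy assms(2)] by simp
  then show ?thesis using abelian_group_a_minus_eqI[OF BC.is_abelian_group] proj_closed assms xy by metis
qed

lemma proj_eq_iff:
  assumes "x \<in> carrier PR" "y \<in> carrier PR" shows "proj x = proj y \<longleftrightarrow> x - y \<in> TI"
proof -
  have "x \<ominus>\<^bsub>PR\<^esub> y = x - y" using assms by (simp add: a_minus_def)
  then show ?thesis using PR.quotient_eq_iff_same_a_r_cos[OF TI.ideal_axioms assms(1) assms(2)] by (simp add: proj_def)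
qed

lemma pure_eq: "pure a b = proj (frag_of (a, b))"
  by (simp add: pure_tensor_def proj_def)

lemma pure_closed [simp]: "a \<in> carrier A \<Longrightarrow> b \<in> carrier B \<Longrightarrow> pure a b \<in> carrier BC"
  unfolding pure_eq by (rule proj_closed) auto

lemma pure_mult: "a \<in> carrier A \<Longrightarrow> b \<in> carrier B \<Longrightarrow> a' \<in> carrier A \<Longrightarrow> b' \<in> carrier B \<Longrightarrow>
  pure a b \<otimes>\<^bsub>BC\<^esub> pure a' b' = pure (a \<otimes>\<^bsub>A\<^esub> a') (b \<otimes>\<^bsub>B\<^esub> b')"
  unfolding pure_eq by (subst proj_mult[symmetric]) auto

lemma pure_one: "pure \<one>\<^bsub>A\<^esub> \<one>\<^bsub>B\<^esub> = \<one>\<^bsub>BC\<^esub>"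
  unfolding pure_eq by (rule proj_one)

lemma pure_add_left:
  assumes "a \<in> carrier A" "a' \<in> carrier A" "b \<in> carrier B"
  shows "pure (a \<oplus>\<^bsub>A\<^esub> a') b = pure a b \<oplus>\<^bsub>BC\<^esub> pure a' b"
proof -
  have "frag_of (a \<oplus>\<^bsub>A\<^esub> a', b) - frag_of (a, b) - frag_of (a', b) \<in> tensor_relations A B"
    using assms by (auto simp: tensor_relations_def)
  then have "frag_of (a \<oplus>\<^bsub>A\<^esub> a', b) - (frag_of (a, b) + frag_of (a', b)) \<in> TI"
    unfolding tensor_ideal_def using PR.genideal_self[OF tensor_relations_carrier] by (auto simp: diff_diff_eq)
  moreover have "frag_of (a, b) + frag_of (a', b) \<in> carrier PR"
    using assms keys_add[of "frag_of (a, b)" "frag_of (a', b)"] by auto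
  ultimately have "proj (frag_of (a \<oplus>\<^bsub>A\<^esub> a', b)) = proj (frag_of (a, b) + frag_of (a', b))"
    using assms by (subst proj_eq_iff) auto
  then show ?thesis using assms unfolding pure_eq by (simp add: proj_add)
qed

lemma pure_add_right:
  assumes "a \<in> carrier A" "b \<in> carrier B" "b' \<in> carrier B"
  shows "pure a (b \<oplus>\<^bsub>B\<^esub> b') = pure a b \<oplus>\<^bsub>BC\<^esub> pure a b'"
proof -
  have "frag_of (a, b \<oplus>\<^bsub>B\<^esub> b') - frag_of (a, b) - frag_of (a, b') \<in> tensor_relations A B"
    using assms by (auto simp: tensor_relations_def)
  then have "frag_of (a, b \<oplus>\<^bsub>B\<^esub> b') - (frag_of (a, b) + frag_of (a, b')) \<in> TI"
    unfolding tensor_ideal_def using PR.genideal_self[OF tensor_relations_carrier] by (auto simp: diff_diff_eq)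
  moreover have "frag_of (a, b) + frag_of (a, b') \<in> carrier PR"
    using assms keys_add[of "frag_of (a, b)" "frag_of (a, b')"] by auto
  ultimately have "proj (frag_of (a, b \<oplus>\<^bsub>B\<^esub> b')) = proj (frag_of (a, b) + frag_of (a, b'))"
    using assms by (subst proj_eq_iff) auto
  then show ?thesis using assms unfolding pure_eq by (simp add: proj_add)
qed

lemma BC_module: "module B BC"
proof (rule moduleI)
  fix a b x y assume "a \<in> carrier B" "b \<in> carrier B" "x \<in> carrier BC" "y \<in> carrier BC"
  then show "(a \<oplus>\<^bsub>B\<^esub> b) \<odot>\<^bsub>BC\<^esub> x = a \<odot>\<^bsub>BC\<^esub> x \<oplus>\<^bsub>BC\<^esub> b \<odot>\<^bsub>BC\<^esub> x"
    by (simp add: BC_simps(6) pure_add_right BC.l_distr)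
  show "(a \<otimes>\<^bsub>B\<^esub> b) \<odot>\<^bsub>BC\<^esub> x = a \<odot>\<^bsub>BC\<^esub> (b \<odot>\<^bsub>BC\<^esub> x)"
    using \<open>a \<in> _\<close> \<open>b \<in> _\<close> \<open>x \<in> _\<close> by (simp add: BC_simps(6) BC.m_assoc[symmetric] pure_mult)
qed (auto simp: B.is_cring BC.is_abelian_group BC_simps(6) BC.r_distr pure_one)

lemma smult_pure: "a \<in> carrier A \<Longrightarrow> b \<in> carrier B \<Longrightarrow> c \<in> carrier B \<Longrightarrow> c \<odot>\<^bsub>BC\<^esub> pure a b = pure a (c \<otimes>\<^bsub>B\<^esub> b)"
  by (simp add: BC_simps(6) pure_mult)

text \<open>
  The pure tensors generate the base change as an additive group.
\<close>
lemma BC_induct [consumes 1, case_names zero diff pure]: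
  assumes "t \<in> carrier BC" "P \<zero>\<^bsub>BC\<^esub>" "\<And>x y. x \<in> carrier BC \<Longrightarrow> y \<in> carrier BC \<Longrightarrow> P x \<Longrightarrow> P y \<Longrightarrow> P (x \<ominus>\<^bsub>BC\<^esub> y)"
    "\<And>a b. a \<in> carrier A \<Longrightarrow> b \<in> carrier B \<Longrightarrow> P (pure a b)"
  shows "P t"
proof -
  obtain x where x: "x \<in> carrier PR" "t = proj x" using proj_surj[OF assms(1)] .
  have "P (proj x)"
  proof (rule free_Abelian_group_induct[where P = "\<lambda>x. P (proj x)", OF x(1)[unfolded pair_ring_simps]])
    show "P (proj 0)" using assms(2) proj_zero by metis
    show "P (proj (x - y))" if "Poly_Mapping.keys x \<subseteq> carrier A \<times> carrier B" "Poly_Mapping.keys y \<subseteq> carrier A \<times> carrier B" "P (proj x)" "P (proj y)" for x y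
      using that assms(3) by (simp add: proj_diff proj_closed)
    show "P (proj (frag_of a))" if "a \<in> carrier A \<times> carrier B" for a
      using that assms(4) by (cases a) (auto simp: pure_eq)
  qed
  then show ?thesis using x by simp
qed

end

section \<open>Exterior powers\<close>

locale exterior = module R M for R :: "('r, 'd) ring_scheme" and M :: "('r, 'm, 'c) module_scheme" +
  fixes n :: nat
  assumes n_pos: "n > 0"
begin

abbreviation "TU \<equiv> tuples n M"
abbreviation "FA \<equiv> free_Abelian_group TU"
abbreviation "NU \<equiv> exterior_null n R M"

lemma tuples_update: "xs \<in> TU \<Longrightarrow> x \<in> carrier M \<Longrightarrow> xs[i := x] \<in> TU"
  using set_update_subset_insert[of xs i x] by (auto simp: tuples_def)

lemma tuples_nth: "xs \<in> TU \<Longrightarrow> i < n \<Longrightarrow> xs ! i \<in> carrier M"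
  by (auto simp: tuples_def)

lemma tuples_length: "xs \<in> TU \<Longrightarrow> length xs = n"
  by (auto simp: tuples_def)

lemma exterior_relations_subset: "exterior_relations n R M \<subseteq> carrier FA"
proof
  fix r assume "r \<in> exterior_relations n R M"
  then consider
     (1) xs i x y where "r = frag_of (xs[i := x \<oplus>\<^bsub>M\<^esub> y]) - frag_of (xs[i := x]) - frag_of (xs[i := y])"
        "xs \<in> TU" "x \<in> carrier M" "y \<in> carrier M"
   | (2) xs i j c where "r = frag_of (xs[i := c \<odot>\<^bsub>M\<^esub> xs ! i]) - frag_of (xs[j := c \<odot>\<^bsub>M\<^esub> xs ! j])"
        "xs \<in> TU" "i < n" "j < n" "c \<in> carrier R"
   | (3) xs where "r = frag_of xs" "xs \<in> TU"
    unfolding exterior_relations_def by fast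
  then show "r \<in> carrier FA"
  proof cases
    case 1
    then have "{xs[i := x \<oplus>\<^bsub>M\<^esub> y], xs[i := x], xs[i := y]} \<subseteq> TU" by (simp add: tuples_update)
    then show ?thesis unfolding 1(1)
      using keys_diff[of "frag_of (xs[i := x \<oplus>\<^bsub>M\<^esub> y]) - frag_of (xs[i := x])" "frag_of (xs[i := y])"]
        keys_diff[of "frag_of (xs[i := x \<oplus>\<^bsub>M\<^esub> y])" "frag_of (xs[i := x])"] by auto
  next
    case 2
    then have "{xs[i := c \<odot>\<^bsub>M\<^esub> xs ! i], xs[j := c \<odot>\<^bsub>M\<^esub> xs ! j]} \<subseteq> TU" by (simp add: tuples_update tuples_nth)
    then show ?thesis unfolding 2(1)
      using keys_diff[of "frag_of (xs[i := c \<odot>\<^bsub>M\<^esub> xs ! i])" "frag_of (xs[j := c \<odot>\<^bsub>M\<^esub> xs ! j])"] by auto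
  qed simp
qed

lemma null_subgroup: "subgroup NU FA"
  unfolding exterior_null_def by (rule group.generate_is_subgroup[OF group_free_Abelian_group exterior_relations_subset])

lemma null_normal: "NU \<lhd> FA"
  by (rule comm_group.subgroup_imp_normal[OF abelian_free_Abelian_group null_subgroup])

lemma FA_mult [simp]: "x \<otimes>\<^bsub>FA\<^esub> y = x + y" by (simp add: free_Abelian_group_def)

lemma null_carrier: "z \<in> NU \<Longrightarrow> Poly_Mapping.keys z \<subseteq> TU"
  using subsetD[OF subgroup.subset[OF null_subgroup], of z] by simp

lemma null_zero [simp]: "0 \<in> NU" using subgroup.one_closed[OF null_subgroup] by simp

lemma null_add: "x \<in> NU \<Longrightarrow> y \<in> NU \<Longrightarrow> x + y \<in> NU"
  using subgroup.m_closed[OF null_subgroup, of x y] by simp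

lemma null_uminus: "x \<in> NU \<Longrightarrow> - x \<in> NU"
  using subgroup.m_inv_closed[OF null_subgroup, of x] null_carrier[of x] by simp

lemma null_diff: "x \<in> NU \<Longrightarrow> y \<in> NU \<Longrightarrow> x - y \<in> NU"
  using null_add[of x "- y"] null_uminus[of y] by simp

lemma null_relation: "r \<in> exterior_relations n R M \<Longrightarrow> r \<in> NU"
  unfolding exterior_null_def by (rule generate.incl)

lemma null_induct [consumes 1, case_names zero relation diff]:
  assumes "z \<in> NU" "P 0" "\<And>r. r \<in> exterior_relations n R M \<Longrightarrow> P r" "\<And>x y. P x \<Longrightarrow> P y \<Longrightarrow> P (x - y)"
  shows "P z"
proof -
  have neg: "P (- x)" if "P x" for x using assms(4)[OF assms(2) that] by simp
  have add: "P (x + y)" if "P x" "P y" for x y using assms(4)[OF that(1) neg[OF that(2)]] by simp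
  have "z \<in> generate FA (exterior_relations n R M)" using assms(1) by (simp add: exterior_null_def)
  then show ?thesis
  proof induction
    case (inv h)
    then have "Poly_Mapping.keys h \<subseteq> TU" using subsetD[OF exterior_relations_subset, of h] by simp
    then show ?case using neg assms(3)[OF inv] by simp
  qed (use assms(2,3) add in auto)
qed

lemma relation_add:
  "xs \<in> TU \<Longrightarrow> i < n \<Longrightarrow> x \<in> carrier M \<Longrightarrow> y \<in> carrier M \<Longrightarrow>
    frag_of (xs[i := x \<oplus>\<^bsub>M\<^esub> y]) - frag_of (xs[i := x]) - frag_of (xs[i := y]) \<in> NU"
  by (rule null_relation) (unfold exterior_relations_def, blast)

lemma relation_smult:
  "xs \<in> TU \<Longrightarrow> i < n \<Longrightarrow> j < n \<Longrightarrow> c \<in> carrier R \<Longrightarrow>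
    frag_of (xs[i := c \<odot>\<^bsub>M\<^esub> xs ! i]) - frag_of (xs[j := c \<odot>\<^bsub>M\<^esub> xs ! j]) \<in> NU"
  by (rule null_relation) (unfold exterior_relations_def, blast)

lemma relation_alt:
  "xs \<in> TU \<Longrightarrow> i < j \<Longrightarrow> j < n \<Longrightarrow> xs ! i = xs ! j \<Longrightarrow> frag_of xs \<in> NU"
  by (rule null_relation) (unfold exterior_relations_def, blast)

lemma relations_cases [consumes 1, case_names add smult alt]:
  assumes "r \<in> exterior_relations n R M"
  obtains xs i x y where "r = frag_of (xs[i := x \<oplus>\<^bsub>M\<^esub> y]) - frag_of (xs[i := x]) - frag_of (xs[i := y])"
        "xs \<in> TU" "i < n" "x \<in> carrier M" "y \<in> carrier M"
   | xs i j c where "r = frag_of (xs[i := c \<odot>\<^bsub>M\<^esub> xs ! i]) - frag_of (xs[j := c \<odot>\<^bsub>M\<^esub> xs ! j])"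
        "xs \<in> TU" "i < n" "j < n" "c \<in> carrier R"
   | xs i j where "r = frag_of xs" "xs \<in> TU" "i < j" "j < n" "xs ! i = xs ! j"
  using assms unfolding exterior_relations_def by fast

lemma coset_eq: "NU #>\<^bsub>FA\<^esub> x = {h + x | h. h \<in> NU}"
  by (auto simp: r_coset_def)

lemma coset_eq_iff: "NU #>\<^bsub>FA\<^esub> x = NU #>\<^bsub>FA\<^esub> y \<longleftrightarrow> x - y \<in> NU"
proof
  assume "NU #>\<^bsub>FA\<^esub> x = NU #>\<^bsub>FA\<^esub> y"
  moreover have "x \<in> NU #>\<^bsub>FA\<^esub> x" unfolding coset_eq by (auto intro: exI[of _ 0])
  ultimately obtain h where "h \<in> NU" "x = h + y" unfolding coset_eq by blast
  then show "x - y \<in> NU" by simp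
next
  assume *: "x - y \<in> NU"
  show "NU #>\<^bsub>FA\<^esub> x = NU #>\<^bsub>FA\<^esub> y"
    unfolding coset_eq
  proof (intro equalityI subsetI; elim CollectE exE conjE)
    fix z h assume "z = h + x" "h \<in> NU"
    then show "z \<in> {h + y |h. h \<in> NU}" using null_add[OF _ *, of h] by (intro CollectI exI[of _ "h + (x - y)"]) simp
  next
    fix z h assume "z = h + y" "h \<in> NU"
    then show "z \<in> {h + x |h. h \<in> NU}" using null_diff[OF _ *, of h] by (intro CollectI exI[of _ "h - (x - y)"]) simp
  qed
qed

lemma wedge_eq: "length xs = n \<Longrightarrow> wedge R M xs = NU #>\<^bsub>FA\<^esub> frag_of xs"
  by (simp add: wedge_def)

lemma exterior_lift_coset:
  assumes "0 \<in> N'" "\<And>z. z \<in> N' \<Longrightarrow> frag_extend (\<lambda>xs. frag_of (f xs)) z \<in> NU"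
  shows "exterior_lift n R M f {h + w | h. h \<in> N'} = NU #>\<^bsub>FA\<^esub> frag_extend (\<lambda>xs. frag_of (f xs)) w"
proof -
  let ?f = "frag_extend (\<lambda>xs. frag_of (f xs))"
  have "exterior_lift n R M f {h + w | h. h \<in> N'} = {a + ?f (h + w) | a h. a \<in> NU \<and> h \<in> N'}"
    unfolding exterior_lift_def set_mult_def by auto
  also have "\<dots> = {a + ?f w | a. a \<in> NU}"
  proof (intro equalityI subsetI; elim CollectE exE conjE)
    fix z a h assume "z = a + ?f (h + w)" "a \<in> NU" "h \<in> N'"
    then show "z \<in> {a + ?f w | a. a \<in> NU}"
      using null_add[OF _ assms(2), of a h] by (intro CollectI exI[of _ "a + ?f h"]) (simp add: frag_extend_add)
  next
    fix z a assume "z = a + ?f w" "a \<in> NU"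
    then show "z \<in> {a + ?f (h + w) | a h. a \<in> NU \<and> h \<in> N'}"
      using assms(1) by (intro CollectI exI[of _ a] exI[of _ 0]) simp
  qed
  finally show ?thesis by (simp add: coset_eq)
qed

definition sc where "sc c xs = xs[0 := c \<odot>\<^bsub>M\<^esub> xs ! 0]"

abbreviation "SC c \<equiv> frag_extend (\<lambda>xs. frag_of (sc c xs))"

lemma sc_tuples: "c \<in> carrier R \<Longrightarrow> xs \<in> TU \<Longrightarrow> sc c xs \<in> TU"
  unfolding sc_def using tuples_nth[of xs 0] n_pos by (intro tuples_update) auto

lemma SC_carrier: "c \<in> carrier R \<Longrightarrow> Poly_Mapping.keys z \<subseteq> TU \<Longrightarrow> Poly_Mapping.keys (SC c z) \<subseteq> TU"
  by (rule order.trans[OF keys_frag_extend], rule UN_least) (use sc_tuples in \<open>simp add: subset_iff\<close>)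

text \<open>
  Expanding the tuple with \<open>x + y\<close> in both places.
\<close>
lemma antisymmetric:
  assumes "xs \<in> TU" "i < j" "j < n" "x \<in> carrier M" "y \<in> carrier M"
  shows "frag_of (xs[i := x, j := y]) + frag_of (xs[i := y, j := x]) \<in> NU"
proof -
  define t where "t u v = frag_of (xs[i := u, j := v])" for u v
  have len: "length xs = n" using assms(1) by (rule tuples_length)
  have 1: "t u (v \<oplus>\<^bsub>M\<^esub> w) - t u v - t u w \<in> NU" if "u \<in> carrier M" "v \<in> carrier M" "w \<in> carrier M" for u v w
    unfolding t_def using that assms by (intro relation_add tuples_update) auto
  have 2: "t (v \<oplus>\<^bsub>M\<^esub> w) u - t v u - t w u \<in> NU" if "u \<in> carrier M" "v \<in> carrier M" "w \<in> carrier M" for u v w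
    using relation_add[OF tuples_update[OF assms(1) that(1), of j] _ that(2,3), of i] assms
    by (simp add: t_def list_update_swap)
  have 3: "t u u \<in> NU" if "u \<in> carrier M" for u
    unfolding t_def using that assms len by (intro relation_alt[where i = i and j = j] tuples_update) auto
  let ?s = "x \<oplus>\<^bsub>M\<^esub> y"
  have "t ?s ?s - (t ?s ?s - t x ?s - t y ?s) - (t x ?s - t x x - t x y) - (t y ?s - t y x - t y y) - t x x - t y y \<in> NU"
    using assms(4,5) by (intro null_diff 1 2 3) auto
  moreover have "t ?s ?s - (t ?s ?s - t x ?s - t y ?s) - (t x ?s - t x x - t x y) - (t y ?s - t y x - t y y) - t x x - t y y = t x y + t y x"
    by simp
  ultimately show ?thesis by (simp add: t_def)
qed

text \<open>
  The scalar acts on the first argument only, and an alternating tuple may have its repeated entry there.  Halving the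
  scalar \<open>c = d + d\<close> and moving one half to the other copy makes the two copies cancel by antisymmetry.
\<close>
lemma SC_null:
  assumes half: "\<And>c. c \<in> carrier R \<Longrightarrow> \<exists>d\<in>carrier R. c = d \<oplus>\<^bsub>R\<^esub> d" and c: "c \<in> carrier R" and z: "z \<in> NU"
  shows "SC c z \<in> NU"
  using z
proof (induction rule: null_induct)
  case (diff x y)
  then show ?case by (simp add: frag_extend_diff null_diff)
next
  case (relation r)
  then show ?case
  proof (cases rule: relations_cases)
    case (add xs i x y)
    show ?thesis
    proof (cases "i = 0")
      case True
      have len: "length xs = n" using add(2) by (rule tuples_length)
      have "frag_of (xs[0 := c \<odot>\<^bsub>M\<^esub> x \<oplus>\<^bsub>M\<^esub> c \<odot>\<^bsub>M\<^esub> y]) - frag_of (xs[0 := c \<odot>\<^bsub>M\<^esub> x]) - frag_of (xs[0 := c \<odot>\<^bsub>M\<^esub> y]) \<in> NU"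
        using add c n_pos by (intro relation_add) auto
      then show ?thesis using True add c n_pos len by (simp add: frag_extend_diff sc_def smult_r_distr)
    next
      case False
      have "frag_of ((sc c xs)[i := x \<oplus>\<^bsub>M\<^esub> y]) - frag_of ((sc c xs)[i := x]) - frag_of ((sc c xs)[i := y]) \<in> NU"
        using add c by (intro relation_add sc_tuples) auto
      then show ?thesis using False add by (simp add: frag_extend_diff sc_def list_update_swap)
    qed
  next
    case (smult xs i j d)
    have len: "length xs = n" using smult(2) by (rule tuples_length)
    have "sc c (xs[i := d \<odot>\<^bsub>M\<^esub> xs ! i]) = (sc c xs)[i := d \<odot>\<^bsub>M\<^esub> sc c xs ! i]" if "i < n" for i
    proof (cases "i = 0")
      case True
      have "c \<odot>\<^bsub>M\<^esub> (d \<odot>\<^bsub>M\<^esub> xs ! 0) = d \<odot>\<^bsub>M\<^esub> (c \<odot>\<^bsub>M\<^esub> xs ! 0)"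
        using c smult(5) tuples_nth[OF smult(2) n_pos] by (simp add: smult_assoc1[symmetric] R.m_comm)
      then show ?thesis using True len n_pos by (simp add: sc_def)
    next
      case False
      then show ?thesis using len that by (simp add: sc_def list_update_swap)
    qed
    then show ?thesis using relation_smult[OF sc_tuples[OF c smult(2)] smult(3,4,5)] smult
      by (simp add: frag_extend_diff)
  next
    case (alt xs i j)
    have len: "length xs = n" using alt(2) by (rule tuples_length)
    show ?thesis
    proof (cases "i = 0")
      case False
      then have "frag_of (sc c xs) \<in> NU"
        using alt c by (intro relation_alt[where i = i and j = j] sc_tuples) (auto simp: sc_def)
      then show ?thesis by (simp add: alt(1))
    next
      case True
      obtain d where d: "d \<in> carrier R" "c = d \<oplus>\<^bsub>R\<^esub> d" using half[OF c] by blast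
      define x where "x = xs ! 0"
      have x: "x \<in> carrier M" "xs ! j = x" using alt tuples_nth[OF alt(2) n_pos] True by (auto simp: x_def)
      have j: "0 < j" "j < n" using alt True by auto
      define y where "y = d \<odot>\<^bsub>M\<^esub> x"
      have y: "y \<in> carrier M" using d x by (simp add: y_def)
      have cx: "c \<odot>\<^bsub>M\<^esub> x = y \<oplus>\<^bsub>M\<^esub> y" using d x by (simp add: smult_l_distr y_def)
      have a: "frag_of (sc c xs) - frag_of (xs[0 := y]) - frag_of (xs[0 := y]) \<in> NU"
        using relation_add[OF alt(2) n_pos y y] by (simp add: sc_def cx flip: x_def)
      have b: "frag_of (xs[0 := y]) - frag_of (xs[j := y]) \<in> NU"
        using relation_smult[OF alt(2) n_pos j(2) d(1)] x by (simp add: y_def flip: x_def)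
      have "xs[0 := y, j := x] = xs[0 := y]" "xs[0 := x, j := y] = xs[j := y]"
        using x(2) j x_def by (metis list_update_id nth_list_update_neq less_not_refl, metis list_update_id)
      then have e: "frag_of (xs[0 := y]) + frag_of (xs[j := y]) \<in> NU"
        using antisymmetric[OF alt(2) j y x(1)] by simp
      have "(frag_of (sc c xs) - frag_of (xs[0 := y]) - frag_of (xs[0 := y])) + (frag_of (xs[0 := y]) - frag_of (xs[j := y]))
          + (frag_of (xs[0 := y]) + frag_of (xs[j := y])) \<in> NU"
        by (intro null_add a b e)
      then show ?thesis by (simp add: alt(1))
    qed
  qed
qed simp

lemma exterior_smult_coset:
  assumes half: "\<And>c. c \<in> carrier R \<Longrightarrow> \<exists>d\<in>carrier R. c = d \<oplus>\<^bsub>R\<^esub> d" and c: "c \<in> carrier R"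
  shows "exterior_smult n R M c (NU #>\<^bsub>FA\<^esub> w) = NU #>\<^bsub>FA\<^esub> SC c w"
  unfolding exterior_smult_def coset_eq[of w] sc_def[symmetric]
  by (rule exterior_lift_coset) (use SC_null[OF half c] in auto)

lemma frag_eval_null:
  fixes \<Phi> :: "'m list \<Rightarrow> int" and q :: int
  assumes add: "\<And>xs i x y. xs \<in> TU \<Longrightarrow> i < n \<Longrightarrow> x \<in> carrier M \<Longrightarrow> y \<in> carrier M \<Longrightarrow>
       [\<Phi> (xs[i := x \<oplus>\<^bsub>M\<^esub> y]) = \<Phi> (xs[i := x]) + \<Phi> (xs[i := y])] (mod q)"
    and smult: "\<And>xs i j c. xs \<in> TU \<Longrightarrow> i < n \<Longrightarrow> j < n \<Longrightarrow> c \<in> carrier R \<Longrightarrow>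
       [\<Phi> (xs[i := c \<odot>\<^bsub>M\<^esub> xs ! i]) = \<Phi> (xs[j := c \<odot>\<^bsub>M\<^esub> xs ! j])] (mod q)"
    and alt: "\<And>xs i j. xs \<in> TU \<Longrightarrow> i < j \<Longrightarrow> j < n \<Longrightarrow> xs ! i = xs ! j \<Longrightarrow> [\<Phi> xs = 0] (mod q)"
    and z: "z \<in> NU"
  shows "q dvd frag_eval \<Phi> z"
  using z
proof (induction rule: null_induct)
  case (relation r)
  then show ?case
  proof (cases rule: relations_cases)
    case (add xs i x y)
    then show ?thesis using assms(1)[of xs i x y] by (simp add: cong_iff_dvd_diff diff_diff_eq)
  next
    case (smult xs i j c)
    then show ?thesis using assms(2)[of xs i j c] by (simp add: cong_iff_dvd_diff)
  next
    case (alt xs i j)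
    then show ?thesis using assms(3)[of xs i j] by (simp add: cong_iff_dvd_diff)
  qed
qed auto

lemma exterior_power_cyclic:
  assumes \<omega>: "\<omega> \<in> carrier (exterior_power n R M)" "generate (exterior_power n R M) {\<omega>} = carrier (exterior_power n R M)"
  obtains w where "Poly_Mapping.keys w \<subseteq> TU" "\<omega> = NU #>\<^bsub>FA\<^esub> w"
    "\<And>xs. xs \<in> TU \<Longrightarrow> \<exists>k. frag_of xs - frag_cmul k w \<in> NU"
proof -
  let ?E = "exterior_power n R M"
  interpret NU: normal NU FA by (rule null_normal)
  obtain w where w: "w \<in> carrier FA" "\<omega> = NU #>\<^bsub>FA\<^esub> w"
    using \<omega>(1) unfolding exterior_power_def FactGroup_def RCOSETS_def by auto
  have gen: "\<exists>k. t = NU #>\<^bsub>FA\<^esub> frag_cmul k w" if "t \<in> generate ?E {\<omega>}" for t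
    using that
  proof induction
    case one
    have "\<one>\<^bsub>?E\<^esub> = NU #>\<^bsub>FA\<^esub> 0" by (simp add: exterior_power_def FactGroup_def coset_eq)
    then show ?case by (intro exI[of _ 0]) simp
  next
    case (incl h)
    then show ?case using w by (intro exI[of _ 1]) simp
  next
    case (inv h)
    then have "inv\<^bsub>?E\<^esub> h = NU #>\<^bsub>FA\<^esub> (- w)"
      using NU.inv_FactGroup[of \<omega>] \<omega>(1) NU.rcos_inv[OF w(1)] w by (simp add: exterior_power_def)
    then show ?case by (intro exI[of _ "-1"]) simp
  next
    case (eng h1 h2)
    then obtain k1 k2 where k: "h1 = NU #>\<^bsub>FA\<^esub> frag_cmul k1 w" "h2 = NU #>\<^bsub>FA\<^esub> frag_cmul k2 w" by blast
    have kc: "frag_cmul k w \<in> carrier FA" for k using w(1) keys_cmul[of k w] by auto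
    have "h1 \<otimes>\<^bsub>?E\<^esub> h2 = NU #>\<^bsub>FA\<^esub> frag_cmul (k1 + k2) w"
      using NU.rcos_sum[OF kc kc, of k1 k2] k by (simp add: exterior_power_def FactGroup_def frag_cmul_distrib)
    then show ?case by blast
  qed
  show ?thesis
  proof (rule that[of w])
    show "Poly_Mapping.keys w \<subseteq> TU" "\<omega> = NU #>\<^bsub>FA\<^esub> w" using w by auto
    fix xs assume "xs \<in> TU"
    then have "frag_of xs \<in> carrier FA" by simp
    then have "NU #>\<^bsub>FA\<^esub> frag_of xs \<in> carrier ?E"
      unfolding exterior_power_def FactGroup_def RCOSETS_def by auto
    then obtain k where "NU #>\<^bsub>FA\<^esub> frag_of xs = NU #>\<^bsub>FA\<^esub> frag_cmul k w" using gen \<omega>(2) by blast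
    then show "\<exists>k. frag_of xs - frag_cmul k w \<in> NU" unfolding coset_eq_iff by blast
  qed
qed

end

section \<open>Determinants as functionals on exterior powers\<close>

definition leibniz_form :: "nat \<Rightarrow> (nat \<Rightarrow> 'm \<Rightarrow> int) \<Rightarrow> 'm list \<Rightarrow> int" where
  "leibniz_form n E xs = (\<Sum>p | p permutes {0..<n}. signof p * (\<Prod>k\<in>{0..<n}. E (p k) (xs ! k)))"

lemma leibniz_form_det: "leibniz_form n E xs = det (mat n n (\<lambda>(k,i). E i (xs ! k)))"
proof -
  have *: "(\<Prod>i = 0..<n. mat n n (\<lambda>(k, i). E i (xs ! k)) $$ (i, p i)) = (\<Prod>k\<in>{0..<n}. E (p k) (xs ! k))"
    if "p permutes {0..<n}" for p
    using permutes_in_image[OF that] by (intro prod.cong) auto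
  show ?thesis by (auto simp: leibniz_form_def det_def * intro!: sum.cong)
qed

lemma leibniz_form_cong:
  assumes "\<And>i k. i < n \<Longrightarrow> k < n \<Longrightarrow> [E i (xs ! k) = E' i (ys ! k)] (mod q)"
  shows "[leibniz_form n E xs = leibniz_form n E' ys] (mod q)"
  unfolding leibniz_form_def
proof (intro cong_sum cong_mult cong_prod cong_refl)
  fix p k assume "p \<in> {p. p permutes {0..<n}}" "k \<in> {0..<n}"
  then show "[E (p k) (xs ! k) = E' (p k) (ys ! k)] (mod q)"
    using permutes_in_image[of p "{0..<n}" k] by (intro assms) auto
qed

lemma leibniz_form_update:
  assumes "length xs = n" "i < n"
  shows "leibniz_form n E (xs[i := x]) =
    (\<Sum>p | p permutes {0..<n}. signof p * (E (p i) x * (\<Prod>k\<in>{0..<n} - {i}. E (p k) (xs ! k))))"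
proof -
  have "(\<Prod>k\<in>{0..<n}. E (p k) (xs[i := x] ! k)) = E (p i) x * (\<Prod>k\<in>{0..<n} - {i}. E (p k) (xs ! k))" for p
    using assms by (subst prod.remove[of _ i]) (auto intro!: prod.cong)
  then show ?thesis by (simp add: leibniz_form_def)
qed

lemma leibniz_form_add:
  assumes "length xs = n" "i < n" "\<And>j. j < n \<Longrightarrow> [E j z = E j x + E j y] (mod q)"
  shows "[leibniz_form n E (xs[i := z]) = leibniz_form n E (xs[i := x]) + leibniz_form n E (xs[i := y])] (mod q)"
proof -
  have "leibniz_form n E (xs[i := x]) + leibniz_form n E (xs[i := y]) =
    (\<Sum>p | p permutes {0..<n}. signof p * ((E (p i) x + E (p i) y) * (\<Prod>k\<in>{0..<n} - {i}. E (p k) (xs ! k))))"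
    unfolding leibniz_form_update[OF assms(1,2)] by (simp add: sum.distrib algebra_simps)
  also have "[leibniz_form n E (xs[i := z]) = \<dots>] (mod q)"
    unfolding leibniz_form_update[OF assms(1,2)]
  proof (intro cong_sum cong_mult cong_refl)
    fix p assume "p \<in> {p. p permutes {0..<n}}"
    then show "[E (p i) z = E (p i) x + E (p i) y] (mod q)"
      using permutes_in_image[of p "{0..<n}" i] assms(2) by (intro assms(3)) auto
  qed
  finally show ?thesis .
qed

lemma leibniz_form_smult:
  assumes "length xs = n" "i < n" "\<And>j. j < n \<Longrightarrow> [E j z = c * E j (xs ! i)] (mod q)"
  shows "[leibniz_form n E (xs[i := z]) = c * leibniz_form n E xs] (mod q)"
proof -
  have "c * leibniz_form n E xs = c * leibniz_form n E (xs[i := xs ! i])" by simp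
  also have "\<dots> = (\<Sum>p | p permutes {0..<n}. signof p * ((c * E (p i) (xs ! i)) * (\<Prod>k\<in>{0..<n} - {i}. E (p k) (xs ! k))))"
    unfolding leibniz_form_update[OF assms(1,2)] by (simp add: sum_distrib_left algebra_simps)
  also have "[leibniz_form n E (xs[i := z]) = \<dots>] (mod q)"
    unfolding leibniz_form_update[OF assms(1,2)]
  proof (intro cong_sum cong_mult cong_refl)
    fix p assume "p \<in> {p. p permutes {0..<n}}"
    then show "[E (p i) z = c * E (p i) (xs ! i)] (mod q)"
      using permutes_in_image[of p "{0..<n}" i] assms(2) by (intro assms(3)) auto
  qed
  finally show ?thesis .
qed

text \<open>
  A determinant with two equal rows vanishes.
\<close>
lemma leibniz_form_alt:
  assumes "length xs = n" "i < j" "j < n" "xs ! i = xs ! j"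
  shows "leibniz_form n E xs = 0"
  unfolding leibniz_form_det
  by (rule det_identical_rows[of _ n i j]) (use assms in \<open>auto intro!: eq_vecI\<close>)

context exterior
begin

text \<open>
  A determinant of additive coordinates respects the defining relations of the exterior power, here up to the
  modulus to which the coordinates are linear.
\<close>
lemma frag_eval_leibniz_null:
  assumes add: "\<And>i x y. i < n \<Longrightarrow> x \<in> carrier M \<Longrightarrow> y \<in> carrier M \<Longrightarrow> [E i (x \<oplus>\<^bsub>M\<^esub> y) = E i x + E i y] (mod q)"
    and smult: "\<And>i c x. i < n \<Longrightarrow> c \<in> carrier R \<Longrightarrow> x \<in> carrier M \<Longrightarrow> [E i (c \<odot>\<^bsub>M\<^esub> x) = \<phi> c * E i x] (mod q)"
    and z: "z \<in> NU"
  shows "q dvd frag_eval (leibniz_form n E) z"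
proof (rule frag_eval_null[OF _ _ _ z])
  fix xs i j c assume *: "xs \<in> TU" "i < n" "j < n" "c \<in> carrier R"
  have "[leibniz_form n E (xs[i := c \<odot>\<^bsub>M\<^esub> xs ! i]) = \<phi> c * leibniz_form n E xs] (mod q)"
    using * by (intro leibniz_form_smult tuples_length smult tuples_nth) auto
  moreover have "[leibniz_form n E (xs[j := c \<odot>\<^bsub>M\<^esub> xs ! j]) = \<phi> c * leibniz_form n E xs] (mod q)"
    using * by (intro leibniz_form_smult tuples_length smult tuples_nth) auto
  ultimately show "[leibniz_form n E (xs[i := c \<odot>\<^bsub>M\<^esub> xs ! i]) = leibniz_form n E (xs[j := c \<odot>\<^bsub>M\<^esub> xs ! j])] (mod q)"
    using cong_trans cong_sym by blast
qed (auto intro!: leibniz_form_add add tuples_length simp: leibniz_form_alt tuples_length)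

lemma frag_eval_leibniz_SC:
  assumes smult: "\<And>i c x. i < n \<Longrightarrow> c \<in> carrier R \<Longrightarrow> x \<in> carrier M \<Longrightarrow> [E i (c \<odot>\<^bsub>M\<^esub> x) = \<phi> c * E i x] (mod q)"
    and c: "c \<in> carrier R" and z: "Poly_Mapping.keys z \<subseteq> TU"
  shows "[frag_eval (leibniz_form n E) (SC c z) = \<phi> c * frag_eval (leibniz_form n E) z] (mod q)"
  using z
proof (induction z rule: frag_induction)
  case (one xs)
  have "[leibniz_form n E (xs[0 := c \<odot>\<^bsub>M\<^esub> xs ! 0]) = \<phi> c * leibniz_form n E xs] (mod q)"
    using one c n_pos by (intro leibniz_form_smult tuples_length smult tuples_nth) auto
  then show ?case by (simp add: sc_def)
next
  case (diff a b)
  then show ?case by (simp add: frag_extend_diff right_diff_distrib cong_diff)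
qed simp

lemma SC_one: "Poly_Mapping.keys z \<subseteq> TU \<Longrightarrow> SC \<one>\<^bsub>R\<^esub> z = z"
proof (induction z rule: frag_induction)
  case (one xs)
  then show ?case using tuples_nth[of xs 0] n_pos by (simp add: sc_def)
qed (auto simp: frag_extend_diff)

lemma SC_SC:
  assumes "c \<in> carrier R" "d \<in> carrier R"
  shows "Poly_Mapping.keys z \<subseteq> TU \<Longrightarrow> SC c (SC d z) = SC (c \<otimes>\<^bsub>R\<^esub> d) z"
proof (induction z rule: frag_induction)
  case (one xs)
  then show ?case using tuples_nth[of xs 0] n_pos assms tuples_length[of xs] by (simp add: sc_def smult_assoc1)
qed (auto simp: frag_extend_diff)

lemma SC_add:
  assumes "c \<in> carrier R" "d \<in> carrier R"
  shows "Poly_Mapping.keys z \<subseteq> TU \<Longrightarrow> SC (c \<oplus>\<^bsub>R\<^esub> d) z - SC c z - SC d z \<in> NU"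
proof (induction z rule: frag_induction)
  case (one xs)
  have "(c \<oplus>\<^bsub>R\<^esub> d) \<odot>\<^bsub>M\<^esub> xs ! 0 = c \<odot>\<^bsub>M\<^esub> xs ! 0 \<oplus>\<^bsub>M\<^esub> d \<odot>\<^bsub>M\<^esub> xs ! 0"
    using assms tuples_nth[OF one n_pos] by (rule smult_l_distr)
  then show ?case
    using relation_add[OF one n_pos, of "c \<odot>\<^bsub>M\<^esub> xs ! 0" "d \<odot>\<^bsub>M\<^esub> xs ! 0"] assms tuples_nth[OF one n_pos] by (simp add: sc_def)
next
  case (diff a b)
  have "(SC (c \<oplus>\<^bsub>R\<^esub> d) a - SC c a - SC d a) - (SC (c \<oplus>\<^bsub>R\<^esub> d) b - SC c b - SC d b) \<in> NU"
    by (rule null_diff[OF diff])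
  then show ?case by (simp add: frag_extend_diff algebra_simps)
qed simp

lemma SC_minus:
  assumes "c \<in> carrier R" "d \<in> carrier R" "Poly_Mapping.keys z \<subseteq> TU"
  shows "SC (c \<ominus>\<^bsub>R\<^esub> d) z - (SC c z - SC d z) \<in> NU"
proof -
  have "(c \<ominus>\<^bsub>R\<^esub> d) \<oplus>\<^bsub>R\<^esub> d = c" using assms by (simp add: R.minus_eq R.a_assoc R.l_neg)
  then have "SC c z - SC (c \<ominus>\<^bsub>R\<^esub> d) z - SC d z \<in> NU"
    using SC_add[of "c \<ominus>\<^bsub>R\<^esub> d" d z] assms by simp
  from null_uminus[OF this] show ?thesis by (simp add: algebra_simps)
qed

lemma SC_of_int:
  assumes z: "Poly_Mapping.keys z \<subseteq> TU"
  shows "\<exists>c\<in>carrier R. frag_cmul k z - SC c z \<in> NU"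
proof (induction k rule: int_induct[of _ 0])
  case base
  have "SC (\<zero>\<^bsub>R\<^esub> \<oplus>\<^bsub>R\<^esub> \<zero>\<^bsub>R\<^esub>) z - SC \<zero>\<^bsub>R\<^esub> z - SC \<zero>\<^bsub>R\<^esub> z \<in> NU" using z by (intro SC_add) auto
  then show ?case by (intro bexI[of _ "\<zero>\<^bsub>R\<^esub>"]) auto
next
  case (step1 i)
  then obtain c where c: "c \<in> carrier R" "frag_cmul i z - SC c z \<in> NU" by blast
  have "SC (c \<oplus>\<^bsub>R\<^esub> \<one>\<^bsub>R\<^esub>) z - SC c z - SC \<one>\<^bsub>R\<^esub> z \<in> NU" using z c by (intro SC_add) auto
  from null_diff[OF c(2) this] have "frag_cmul (i + 1) z - SC (c \<oplus>\<^bsub>R\<^esub> \<one>\<^bsub>R\<^esub>) z \<in> NU"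
    using z by (simp add: SC_one frag_cmul_distrib algebra_simps)
  then show ?case using c by (intro bexI[of _ "c \<oplus>\<^bsub>R\<^esub> \<one>\<^bsub>R\<^esub>"]) auto
next
  case (step2 i)
  then obtain c where c: "c \<in> carrier R" "frag_cmul i z - SC c z \<in> NU" by blast
  have "SC (c \<ominus>\<^bsub>R\<^esub> \<one>\<^bsub>R\<^esub>) z - (SC c z - SC \<one>\<^bsub>R\<^esub> z) \<in> NU" using z c by (intro SC_minus) auto
  from null_diff[OF c(2) this] have "frag_cmul (i - 1) z - SC (c \<ominus>\<^bsub>R\<^esub> \<one>\<^bsub>R\<^esub>) z \<in> NU"
    using z by (simp add: SC_one frag_cmul_diff_distrib algebra_simps)
  then show ?case using c by (intro bexI[of _ "c \<ominus>\<^bsub>R\<^esub> \<one>\<^bsub>R\<^esub>"]) auto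
qed

text \<open>
  By multilinearity it suffices to treat tuples of entries from a generating set; a scalar in any place can be moved to
  the first one, where the scalar action is defined.
\<close>
lemma multiples_of_generator:
  assumes half: "\<And>c. c \<in> carrier R \<Longrightarrow> \<exists>d\<in>carrier R. c = d \<oplus>\<^bsub>R\<^esub> d"
    and w: "Poly_Mapping.keys w \<subseteq> TU"
    and Gs: "Gs \<subseteq> carrier M" "Gs \<noteq> {}"
    and induct: "\<And>P t. t \<in> carrier M \<Longrightarrow> P \<zero>\<^bsub>M\<^esub> \<Longrightarrow>
        (\<And>x y. x \<in> carrier M \<Longrightarrow> y \<in> carrier M \<Longrightarrow> P x \<Longrightarrow> P y \<Longrightarrow> P (x \<ominus>\<^bsub>M\<^esub> y)) \<Longrightarrow>
        (\<And>c s. c \<in> carrier R \<Longrightarrow> s \<in> Gs \<Longrightarrow> P (c \<odot>\<^bsub>M\<^esub> s)) \<Longrightarrow> P t"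
    and gen: "\<And>xs. xs \<in> TU \<Longrightarrow> set xs \<subseteq> Gs \<Longrightarrow> \<exists>c\<in>carrier R. frag_of xs - SC c w \<in> NU"
  shows "xs \<in> TU \<Longrightarrow> \<exists>c\<in>carrier R. frag_of xs - SC c w \<in> NU"
proof -
  define Good where "Good xs \<longleftrightarrow> (\<exists>c\<in>carrier R. frag_of xs - SC c w \<in> NU)" for xs
  have diff: "Good (xs[i := x \<ominus>\<^bsub>M\<^esub> y])" if "xs \<in> TU" "i < n" "x \<in> carrier M" "y \<in> carrier M" "Good (xs[i := x])" "Good (xs[i := y])" for xs i x y
  proof -
    from that obtain c d where cd: "c \<in> carrier R" "frag_of (xs[i := x]) - SC c w \<in> NU" "d \<in> carrier R" "frag_of (xs[i := y]) - SC d w \<in> NU"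
      unfolding Good_def by blast
    have "(x \<ominus>\<^bsub>M\<^esub> y) \<oplus>\<^bsub>M\<^esub> y = x" using that by (simp add: M.minus_eq M.a_assoc M.l_neg)
    then have 1: "frag_of (xs[i := x]) - frag_of (xs[i := x \<ominus>\<^bsub>M\<^esub> y]) - frag_of (xs[i := y]) \<in> NU"
      using relation_add[OF that(1,2), of "x \<ominus>\<^bsub>M\<^esub> y" y] that by simp
    have 2: "SC (c \<ominus>\<^bsub>R\<^esub> d) w - (SC c w - SC d w) \<in> NU" using cd w by (intro SC_minus)
    have "(frag_of (xs[i := x]) - SC c w) - (frag_of (xs[i := y]) - SC d w)
       - (frag_of (xs[i := x]) - frag_of (xs[i := x \<ominus>\<^bsub>M\<^esub> y]) - frag_of (xs[i := y])) - (SC (c \<ominus>\<^bsub>R\<^esub> d) w - (SC c w - SC d w)) \<in> NU"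
      by (intro null_diff cd 1 2)
    then have "frag_of (xs[i := x \<ominus>\<^bsub>M\<^esub> y]) - SC (c \<ominus>\<^bsub>R\<^esub> d) w \<in> NU" by (simp add: algebra_simps)
    then show ?thesis unfolding Good_def using cd by (intro bexI[of _ "c \<ominus>\<^bsub>R\<^esub> d"]) auto
  qed
  have smult: "Good (xs[i := c \<odot>\<^bsub>M\<^esub> s])" if "xs \<in> TU" "i < n" "c \<in> carrier R" "s \<in> carrier M" "Good (xs[i := s])" for xs i c s
  proof -
    let ?ys = "xs[i := s]"
    have ys: "?ys \<in> TU" using that by (simp add: tuples_update)
    from that obtain d where d: "d \<in> carrier R" "frag_of ?ys - SC d w \<in> NU" unfolding Good_def by blast
    have "frag_of (?ys[i := c \<odot>\<^bsub>M\<^esub> ?ys ! i]) - frag_of (?ys[0 := c \<odot>\<^bsub>M\<^esub> ?ys ! 0]) \<in> NU"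
      by (rule relation_smult[OF ys that(2) n_pos that(3)])
    then have 1: "frag_of (xs[i := c \<odot>\<^bsub>M\<^esub> s]) - SC c (frag_of ?ys) \<in> NU"
      using that tuples_length[OF that(1)] by (simp add: sc_def)
    have "SC c (frag_of ?ys - SC d w) \<in> NU" by (rule SC_null[OF half that(3) d(2)])
    then have 2: "SC c (frag_of ?ys) - SC (c \<otimes>\<^bsub>R\<^esub> d) w \<in> NU"
      by (simp only: frag_extend_diff SC_SC[OF that(3) d(1) w])
    from null_add[OF 1 2] have "frag_of (xs[i := c \<odot>\<^bsub>M\<^esub> s]) - SC (c \<otimes>\<^bsub>R\<^esub> d) w \<in> NU" by simp
    then show ?thesis unfolding Good_def using d that by (intro bexI[of _ "c \<otimes>\<^bsub>R\<^esub> d"]) auto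
  qed
  have fill: "Good xs" if "xs \<in> TU" "k \<le> n" "\<forall>i. k \<le> i \<and> i < n \<longrightarrow> xs ! i \<in> Gs" for k xs
    using that
  proof (induction k arbitrary: xs)
    case 0
    then have "set xs \<subseteq> Gs" using tuples_length[OF 0(1)] by (auto simp: set_conv_nth)
    then show ?case using gen[OF 0(1)] by (simp add: Good_def)
  next
    case (Suc k)
    have k: "k < n" using Suc by simp
    have len: "length xs = n" using Suc tuples_length by blast
    have s: "Good (xs[k := s])" if "s \<in> Gs" for s
    proof (rule Suc.IH)
      show "xs[k := s] \<in> TU" using Suc(2) that Gs by (intro tuples_update) auto
      show "\<forall>i. k \<le> i \<and> i < n \<longrightarrow> xs[k := s] ! i \<in> Gs"
        using Suc(4) that len by (auto simp: nth_list_update)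
    qed (use k in simp)
    obtain s0 where s0: "s0 \<in> Gs" using Gs by blast
    have "Good (xs[k := xs ! k])"
    proof (rule induct[of "xs ! k" "\<lambda>t. Good (xs[k := t])"])
      show "Good (xs[k := \<zero>\<^bsub>M\<^esub>])"
        using smult[OF Suc(2) k R.zero_closed _ s[OF s0]] s0 Gs by (auto simp: smult_l_null)
      show "Good (xs[k := c \<odot>\<^bsub>M\<^esub> t])" if "c \<in> carrier R" "t \<in> Gs" for c t
        using smult[OF Suc(2) k that(1) _ s[OF that(2)]] that Gs by auto
    qed (use diff Suc(2) k tuples_nth in auto)
    then show ?case by simp
  qed
  assume "xs \<in> TU"
  then have "Good xs" by (rule fill[of xs n]) auto
  then show "\<exists>c\<in>carrier R. frag_of xs - SC c w \<in> NU" unfolding Good_def .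
qed

end

lemma exterior_null_map:
  assumes 1: "exterior R1 M1 n" and 2: "exterior R2 M2 n"
    and closed: "\<And>x. x \<in> carrier M1 \<Longrightarrow> h x \<in> carrier M2"
    and add: "\<And>x y. x \<in> carrier M1 \<Longrightarrow> y \<in> carrier M1 \<Longrightarrow> h (x \<oplus>\<^bsub>M1\<^esub> y) = h x \<oplus>\<^bsub>M2\<^esub> h y"
    and smult: "\<And>c x. c \<in> carrier R1 \<Longrightarrow> x \<in> carrier M1 \<Longrightarrow> h (c \<odot>\<^bsub>M1\<^esub> x) = \<phi> c \<odot>\<^bsub>M2\<^esub> h x"
    and \<phi>: "\<And>c. c \<in> carrier R1 \<Longrightarrow> \<phi> c \<in> carrier R2"
    and z: "z \<in> exterior_null n R1 M1"
  shows "frag_extend (\<lambda>xs. frag_of (map h xs)) z \<in> exterior_null n R2 M2"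
proof -
  interpret E1: exterior R1 M1 n by fact
  interpret E2: exterior R2 M2 n by fact
  have mapT: "map h xs \<in> tuples n M2" if "xs \<in> tuples n M1" for xs
    using that closed by (auto simp: tuples_def)
  show ?thesis using z
  proof (induction rule: E1.null_induct)
    case (relation r)
    then show ?case
    proof (cases rule: E1.relations_cases)
      case (add xs i x y)
      then show ?thesis using E2.relation_add[OF mapT[OF add(2)] add(3) closed closed, of x y]
        by (simp add: frag_extend_diff map_update assms(4))
    next
      case (smult xs i j c)
      then show ?thesis using E2.relation_smult[OF mapT[OF smult(2)] smult(3,4) \<phi>[OF smult(5)]]
          E1.tuples_length[OF smult(2)] E1.tuples_nth[OF smult(2)]
        by (simp add: frag_extend_diff map_update assms(5))
    next
      case (alt xs i j)
      then show ?thesis using E2.relation_alt[OF mapT[OF alt(2)] alt(3,4)] E1.tuples_length[OF alt(2)] by simp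
    qed
  qed (auto simp: frag_extend_diff E2.null_diff)
qed

section \<open>Coordinates on the ring of integers\<close>

lemma generate_ring_singleton: "generate_ring complex_ring {x} = range (\<lambda>f. ipoly f x)"
proof (intro equalityI subsetI)
  fix y assume "y \<in> generate_ring complex_ring {x}"
  then show "y \<in> range (\<lambda>f. ipoly f x)"
  proof induction
    case one
    show ?case by (intro range_eqI[of _ _ 1]) simp
  next
    case (incl h)
    then show ?case by (intro range_eqI[of _ _ "[:0,1:]"]) simp
  next
    case (a_inv h)
    then obtain f where "h = ipoly f x" by auto
    then show ?case by (intro range_eqI[of _ _ "- f"]) simp
  next
    case (eng_add h1 h2)
    then obtain f g where "h1 = ipoly f x" "h2 = ipoly g x" by auto
    then show ?case by (intro range_eqI[of _ _ "f + g"]) simp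
  next
    case (eng_mult h1 h2)
    then obtain f g where "h1 = ipoly f x" "h2 = ipoly g x" by auto
    then show ?case by (intro range_eqI[of _ _ "f * g"]) simp
  qed
next
  note gen = generate_ring.intros[where R = complex_ring and H = "{x}", simplified]
  have int: "of_int k \<in> generate_ring complex_ring {x}" for k
  proof (induction k rule: int_induct[of _ 0])
    case base
    show ?case using cx.zero_in_generate[of "{x}"] by simp
  next
    case (step1 i)
    then show ?case using gen(4)[OF step1(2) gen(1)] by simp
  next
    case (step2 i)
    then show ?case using gen(4)[OF step2(2) gen(3)[OF gen(1)]] by simp
  qed
  fix y assume "y \<in> range (\<lambda>f. ipoly f x)"
  then obtain f where y: "y = ipoly f x" by blast
  have "ipoly f x \<in> generate_ring complex_ring {x}"
    by (induction f) (use int[of 0] in \<open>auto simp: of_int_hom.map_poly_pCons_hom intro!: gen(4,5) int gen(2)[OF refl]\<close>)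
  then show "y \<in> generate_ring complex_ring {x}" using y by simp
qed

locale monogenic_order =
  fixes H :: "int poly" and \<alpha> :: complex and n g :: nat
  assumes H: "min_int_poly_of H \<alpha>" and n: "degree H = n" and idx: "power_order_index \<alpha> = g" and g: "g > 0"
begin

abbreviation "F \<equiv> adjoin {\<alpha>}"
abbreviation "OF \<equiv> integer_algebra F"
abbreviation "Z\<alpha> \<equiv> generate_ring complex_ring {\<alpha>}"
abbreviation "AG \<equiv> add_monoid OF"

lemma n_pos: "n > 0" using min_int_poly_of_degree_pos[OF H] n by simp

lemma ipoly_in_OF: "ipoly f \<alpha> \<in> carrier OF"
  using algebraic_int_ipoly[OF min_int_poly_of_algebraic_int[OF H]] by (simp add: adjoin_ipoly adjoin_closed)

lemma OF_closed:
  "x \<in> carrier OF \<Longrightarrow> y \<in> carrier OF \<Longrightarrow> x + y \<in> carrier OF"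
  "x \<in> carrier OF \<Longrightarrow> y \<in> carrier OF \<Longrightarrow> x * y \<in> carrier OF"
  "x \<in> carrier OF \<Longrightarrow> - x \<in> carrier OF"
  "of_int k \<in> carrier OF" "0 \<in> carrier OF" "1 \<in> carrier OF" "\<alpha> \<in> carrier OF"
  using min_int_poly_of_algebraic_int[OF H]
  by (auto intro: adjoin_closed adjoin_of_int algebraic_int_plus_times int_imp_algebraic_int)

lemma OF_diff: "x \<in> carrier OF \<Longrightarrow> y \<in> carrier OF \<Longrightarrow> x - y \<in> carrier OF"
  using OF_closed(1)[of x "- y"] OF_closed(3)[of y] by simp

lemma OF_sum: "(\<And>a. a \<in> A \<Longrightarrow> f a \<in> carrier OF) \<Longrightarrow> sum f A \<in> carrier OF"
  by (induction A rule: infinite_finite_induct) (use OF_closed in auto)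

lemma OF_int_mult: "x \<in> carrier OF \<Longrightarrow> of_int k * x \<in> carrier OF"
  by (rule OF_closed(2)[OF OF_closed(4)])

lemma OF_power: "x \<in> carrier OF \<Longrightarrow> x ^ k \<in> carrier OF"
  by (induction k) (use OF_closed in auto)

lemma AG_comm_group: "comm_group AG"
proof -
  interpret cring OF by (rule integer_algebra_cring)
  show ?thesis by (rule a_comm_group)
qed

lemma Za_subgroup: "subgroup Z\<alpha> AG"
proof -
  interpret comm_group AG by (rule AG_comm_group)
  have inv: "inv\<^bsub>AG\<^esub> x = - x" if "x \<in> carrier OF" for x
    using that OF_closed(3)[OF that] by (intro inv_equality) auto
  show ?thesis
  proof (rule subgroupI)
    show "Z\<alpha> \<subseteq> carrier AG" unfolding generate_ring_singleton using ipoly_in_OF by auto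
    show "Z\<alpha> \<noteq> {}" unfolding generate_ring_singleton by blast
  next
    fix a assume "a \<in> Z\<alpha>"
    then obtain f where f: "a = ipoly f \<alpha>" unfolding generate_ring_singleton by blast
    show "inv\<^bsub>AG\<^esub> a \<in> Z\<alpha>" unfolding f inv[OF ipoly_in_OF] generate_ring_singleton
      by (intro range_eqI[of _ _ "- f"]) simp
  next
    fix a b assume "a \<in> Z\<alpha>" "b \<in> Z\<alpha>"
    then obtain f h where f: "a = ipoly f \<alpha>" "b = ipoly h \<alpha>" unfolding generate_ring_singleton by blast
    show "a \<otimes>\<^bsub>AG\<^esub> b \<in> Z\<alpha>" unfolding f generate_ring_singleton
      by (intro range_eqI[of _ _ "f + h"]) simp
  qed
qed

lemma card_cosets: "card (rcosets\<^bsub>AG\<^esub> Z\<alpha>) = g"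
  using idx by (simp add: power_order_index_def A_RCOSETS_def)

lemma coset_def': "Z\<alpha> #>\<^bsub>AG\<^esub> x = {z + x | z. z \<in> Z\<alpha>}"
  by (auto simp: r_coset_def)

lemma coset_eq_iff: "Z\<alpha> #>\<^bsub>AG\<^esub> x = Z\<alpha> #>\<^bsub>AG\<^esub> y \<longleftrightarrow> x - y \<in> Z\<alpha>"
proof
  assume "Z\<alpha> #>\<^bsub>AG\<^esub> x = Z\<alpha> #>\<^bsub>AG\<^esub> y"
  moreover have "0 \<in> Z\<alpha>" unfolding generate_ring_singleton by (intro range_eqI[of _ _ 0]) simp
  then have "x \<in> Z\<alpha> #>\<^bsub>AG\<^esub> x" unfolding coset_def' by (intro CollectI exI[of _ 0]) auto
  ultimately obtain h where "h \<in> Z\<alpha>" "x = h + y" unfolding coset_def' by blast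
  then show "x - y \<in> Z\<alpha>" by simp
next
  assume "x - y \<in> Z\<alpha>"
  then obtain d where d: "x - y = ipoly d \<alpha>" unfolding generate_ring_singleton by blast
  show "Z\<alpha> #>\<^bsub>AG\<^esub> x = Z\<alpha> #>\<^bsub>AG\<^esub> y"
    unfolding coset_def' unfolding generate_ring_singleton
  proof (intro equalityI subsetI; elim CollectE exE conjE rangeE)
    fix z h f assume "z = h + x" "h = ipoly f \<alpha>"
    then have "z = ipoly (f + d) \<alpha> + y" using d by (simp add: algebra_simps)
    then show "z \<in> {h + y |h. h \<in> range (\<lambda>f. ipoly f \<alpha>)}" by blast
  next
    fix z h f assume "z = h + y" "h = ipoly f \<alpha>"
    then have "z = ipoly (f - d) \<alpha> + x" using d by (simp add: algebra_simps)
    then show "z \<in> {h + x |h. h \<in> range (\<lambda>f. ipoly f \<alpha>)}" by blast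
  qed
qed

text \<open>
  A group of order \<open>g\<close> is annihilated by \<open>g\<close>; here the group is the ring of integers modulo \<open>\<int>[\<alpha>]\<close>.
\<close>
lemma index_multiple:
  assumes x: "x \<in> carrier OF"
  shows "\<exists>f. degree f < n \<and> ipoly f \<alpha> = of_nat g * x"
proof -
  interpret G: comm_group AG by (rule AG_comm_group)
  interpret N: normal Z\<alpha> AG by (rule G.subgroup_imp_normal[OF Za_subgroup])
  let ?Q = "AG Mod Z\<alpha>"
  interpret Q: group ?Q by (rule N.factorgroup_is_group)
  have ord: "Coset.order ?Q = g" using card_cosets by (simp add: Coset.order_def FactGroup_def)
  have xc: "Z\<alpha> #>\<^bsub>AG\<^esub> x \<in> carrier ?Q" using x by (auto simp: FactGroup_def RCOSETS_def)
  have pw: "(Z\<alpha> #>\<^bsub>AG\<^esub> x) [^]\<^bsub>?Q\<^esub> k = Z\<alpha> #>\<^bsub>AG\<^esub> (of_nat k * x)" for k :: nat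
  proof (induction k)
    case 0
    have "0 \<in> Z\<alpha>" unfolding generate_ring_singleton by (intro range_eqI[of _ _ 0]) simp
    then have "Z\<alpha> #>\<^bsub>AG\<^esub> 0 = Z\<alpha>" using OF_closed(5) by (intro G.coset_join2[OF _ Za_subgroup]) auto
    then have e: "Z\<alpha> = Z\<alpha> #>\<^bsub>AG\<^esub> (of_nat 0 * x)" by (simp only: of_nat_0 mult_zero_left)
    have "(Z\<alpha> #>\<^bsub>AG\<^esub> x) [^]\<^bsub>?Q\<^esub> (0::nat) = Z\<alpha>" by (simp add: FactGroup_def)
    also note e
    finally show ?case .
  next
    case (Suc k)
    have "of_nat k * x \<in> carrier AG" using OF_int_mult[OF x, of "int k"] by simp
    then have 1: "(Z\<alpha> #>\<^bsub>AG\<^esub> (of_nat k * x)) <#>\<^bsub>AG\<^esub> (Z\<alpha> #>\<^bsub>AG\<^esub> x) = Z\<alpha> #>\<^bsub>AG\<^esub> (of_nat k * x \<otimes>\<^bsub>AG\<^esub> x)"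
      using x by (intro N.rcos_sum) simp_all
    have 2: "of_nat k * x \<otimes>\<^bsub>AG\<^esub> x = of_nat (Suc k) * x" by (simp add: algebra_simps)
    show ?case by (simp only: Q.nat_pow_Suc Suc mult_FactGroup 1 2)
  qed
  have "Z\<alpha> #>\<^bsub>AG\<^esub> (of_nat g * x) = \<one>\<^bsub>?Q\<^esub>"
    using Q.pow_order_eq_1[OF xc, unfolded ord pw] .
  also have "\<dots> = Z\<alpha> #>\<^bsub>AG\<^esub> 0"
    using pw[of 0] by (simp only: Q.nat_pow_0 of_nat_0 mult_zero_left)
  finally have "of_nat g * x - 0 \<in> Z\<alpha>" unfolding coset_eq_iff .
  then obtain f where "of_nat g * x = ipoly f \<alpha>" unfolding generate_ring_singleton by auto
  then show ?thesis using min_int_poly_of_reduce[OF H, of f] n by metis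
qed

definition cf :: "complex \<Rightarrow> int poly" where
  "cf x = (THE f. degree f < n \<and> ipoly f \<alpha> = of_nat g * x)"

lemma cf_unique: "degree f < n \<Longrightarrow> ipoly f \<alpha> = of_nat g * x \<Longrightarrow> cf x = f"
  unfolding cf_def
proof (rule the_equality)
  fix f' assume *: "degree f < n" "ipoly f \<alpha> = of_nat g * x" "degree f' < n \<and> ipoly f' \<alpha> = of_nat g * x"
  have "degree (f' - f) < n" using * degree_diff_less by blast
  then have "f' - f = 0" using * n by (intro min_int_poly_of_eq_0[OF H]) auto
  then show "f' = f" by simp
qed auto

lemma cf: "x \<in> carrier OF \<Longrightarrow> degree (cf x) < n" "x \<in> carrier OF \<Longrightarrow> ipoly (cf x) \<alpha> = of_nat g * x"
  using index_multiple[of x] cf_unique by blast+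

text \<open>
  The \<open>i\<close>-th coordinate of \<open>g x\<close> with respect to the powers of \<open>\<alpha>\<close>; multiplying by \<open>g\<close> makes the coordinates integers.
\<close>
definition ec :: "nat \<Rightarrow> complex \<Rightarrow> int" where "ec i x = coeff (cf x) i"

lemma ec_add: "x \<in> carrier OF \<Longrightarrow> y \<in> carrier OF \<Longrightarrow> ec i (x + y) = ec i x + ec i y"
proof -
  assume *: "x \<in> carrier OF" "y \<in> carrier OF"
  have "cf (x + y) = cf x + cf y" using * cf by (intro cf_unique degree_add_less) (auto simp: algebra_simps)
  then show ?thesis by (simp add: ec_def)
qed

lemma ec_int_mult: "x \<in> carrier OF \<Longrightarrow> ec i (of_int k * x) = k * ec i x"
proof -
  assume *: "x \<in> carrier OF"
  have "cf (of_int k * x) = smult k (cf x)"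
    using * cf n_pos by (intro cf_unique) (auto intro: order.strict_trans1[OF degree_smult_le])
  then show ?thesis by (simp add: ec_def)
qed

lemma ec_diff: "x \<in> carrier OF \<Longrightarrow> y \<in> carrier OF \<Longrightarrow> ec i (x - y) = ec i x - ec i y"
  using ec_add[of x "of_int (-1) * y" i] ec_int_mult[of y i "-1"] OF_int_mult[of y "-1"] by simp

lemma ec_0: "ec i 0 = 0"
  using ec_int_mult[OF OF_closed(5), of i 0] by simp

lemma ec_sum:
  assumes "\<And>a. a \<in> A \<Longrightarrow> f a \<in> carrier OF"
  shows "ec i (sum f A) = (\<Sum>a\<in>A. ec i (f a))"
  using assms
proof (induction A rule: infinite_finite_induct)
  case (insert a A)
  have "f a \<in> carrier OF" "sum f A \<in> carrier OF" by (rule insert(4), simp) (rule OF_sum, rule insert(4), simp)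
  then have "ec i (f a + sum f A) = ec i (f a) + ec i (sum f A)" by (rule ec_add)
  moreover have "ec i (sum f A) = (\<Sum>a\<in>A. ec i (f a))" by (rule insert.IH, rule insert(4), simp)
  ultimately show ?case using insert(1,2) by simp
qed (simp_all add: ec_0)

lemma ec_ipoly: "degree f < n \<Longrightarrow> ec i (ipoly f \<alpha>) = int g * coeff f i"
proof -
  assume "degree f < n"
  then have "cf (ipoly f \<alpha>) = smult (int g) f"
    by (intro cf_unique) (auto intro: order.strict_trans1[OF degree_smult_le])
  then show ?thesis by (simp add: ec_def)
qed

lemma ec_Za: "y \<in> Z\<alpha> \<Longrightarrow> int g dvd ec i y"
proof -
  assume "y \<in> Z\<alpha>"
  then obtain f where "y = ipoly f \<alpha>" unfolding generate_ring_singleton by blast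
  with min_int_poly_of_reduce[OF H, of f] n obtain r where "degree r < n" "y = ipoly r \<alpha>" by metis
  then show ?thesis by (simp add: ec_ipoly)
qed

lemma ec_power: "j < n \<Longrightarrow> ec i (\<alpha> ^ j) = (if i = j then int g else 0)"
  using ec_ipoly[of "Polynomial.monom 1 j" i] by (simp add: degree_monom_eq)

lemma ec_eq_0_imp: "x \<in> carrier OF \<Longrightarrow> (\<And>i. i < n \<Longrightarrow> ec i x = 0) \<Longrightarrow> x = 0"
proof -
  assume x: "x \<in> carrier OF" and "\<And>i. i < n \<Longrightarrow> ec i x = 0"
  then have "coeff (cf x) i = 0" for i
    using cf(1)[OF x] by (cases "i < n") (auto simp: ec_def coeff_eq_0)
  then have "cf x = 0" by (simp add: poly_eq_iff)
  then show ?thesis using cf(2)[OF x] g by simp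
qed

section \<open>A triangular basis\<close>

text \<open>
  The algebraic integers that are combinations of \<open>1, \<alpha>, \<dots>, \<alpha>\<^sup>i\<close> with rational coefficients.
\<close>
definition lead_vals :: "nat \<Rightarrow> complex set" where
  "lead_vals i = {x \<in> carrier OF. \<forall>j. i < j \<and> j < n \<longrightarrow> ec j x = 0}"

text \<open>
  Among the integers of degree at most \<open>i\<close> in \<open>\<alpha>\<close>, one whose leading coordinate is least and positive; Euclidean division makes
  this coordinate divide all others.
\<close>
lemma triangular_basis:
  assumes "i < n"
  shows "\<exists>b s. b \<in> lead_vals i \<and> s > 0 \<and> ec i b = s \<and> (\<forall>x\<in>lead_vals i. s dvd ec i x) \<and> s dvd int g"
proof -
  define P where "P s \<longleftrightarrow> s > 0 \<and> (\<exists>b\<in>lead_vals i. ec i b = int s)" for s :: nat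
  have "\<alpha> ^ i \<in> lead_vals i" using assms OF_power[OF OF_closed(7)] by (auto simp: lead_vals_def ec_power)
  then have "P g" using g assms unfolding P_def by (intro conjI bexI[of _ "\<alpha> ^ i"]) (auto simp: ec_power)
  define s where "s = (LEAST s. P s)"
  have s: "P s" unfolding s_def by (rule LeastI[of P g, OF \<open>P g\<close>])
  have least: "\<not> P t" if "t < s" for t using that not_less_Least unfolding s_def by blast
  from s obtain b where b: "s > 0" "b \<in> lead_vals i" "ec i b = int s" by (auto simp: P_def)
  have dvd: "int s dvd ec i x" if x: "x \<in> lead_vals i" for x
  proof (rule ccontr)
    assume nd: "\<not> int s dvd ec i x"
    define q where "q = ec i x div int s"
    have xb: "x \<in> carrier OF" "b \<in> carrier OF" using x b by (simp_all add: lead_vals_def)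
    let ?y = "x - of_int q * b"
    have y: "?y \<in> lead_vals i" using x b xb OF_diff[OF xb(1) OF_int_mult[OF xb(2)], of q] OF_int_mult[OF xb(2), of q]
      by (simp add: lead_vals_def ec_diff ec_int_mult del: integer_algebra_simps)
    have ey: "ec i ?y = ec i x mod int s"
      using OF_int_mult[OF xb(2), of q] xb b(3)
      by (simp add: ec_diff ec_int_mult q_def minus_div_mult_eq_mod del: integer_algebra_simps)
    have "nat (ec i x mod int s) < s" using b(1) by (simp add: nat_less_iff)
    moreover have "P (nat (ec i x mod int s))"
    proof -
      have "ec i x mod int s \<noteq> 0" using nd by (simp add: dvd_eq_mod_eq_0)
      moreover have "ec i x mod int s \<ge> 0" using b(1) by simp
      ultimately have pos: "ec i x mod int s > 0" by linarith
      then have "ec i ?y = int (nat (ec i x mod int s))" using ey by simp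
      then show ?thesis unfolding P_def using pos y by (metis zero_less_nat_eq)
    qed
    ultimately show False using least by blast
  qed
  show ?thesis
  proof (intro exI conjI ballI)
    show "b \<in> lead_vals i" "int s > 0" "ec i b = int s" "\<And>x. x \<in> lead_vals i \<Longrightarrow> int s dvd ec i x" using b dvd by auto
    show "int s dvd int g" using dvd[OF \<open>\<alpha> ^ i \<in> lead_vals i\<close>] assms by (simp add: ec_power)
  qed
qed

text \<open>
  The \<open>i\<close>-th element of the triangular basis, together with its leading coordinate.
\<close>
definition bs :: "nat \<Rightarrow> complex \<times> int" where
  "bs i = (SOME p. fst p \<in> lead_vals i \<and> snd p > 0 \<and> ec i (fst p) = snd p \<and> (\<forall>x\<in>lead_vals i. snd p dvd ec i x) \<and> snd p dvd int g)"

definition "bb i = fst (bs i)"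
definition "ss i = snd (bs i)"
definition "gg i = int g div ss i"

lemma bs:
  assumes "i < n"
  shows "bb i \<in> lead_vals i" "ss i > 0" "ec i (bb i) = ss i" "\<And>x. x \<in> lead_vals i \<Longrightarrow> ss i dvd ec i x" "ss i dvd int g"
    "ss i * gg i = int g" "gg i > 0" "bb i \<in> carrier OF"
proof -
  have "\<exists>p. fst p \<in> lead_vals i \<and> snd p > 0 \<and> ec i (fst p) = snd p \<and> (\<forall>x\<in>lead_vals i. snd p dvd ec i x) \<and> snd p dvd int g"
    using triangular_basis[OF assms] by auto
  from someI_ex[OF this] have *: "bb i \<in> lead_vals i" "ss i > 0" "ec i (bb i) = ss i" "(\<forall>x\<in>lead_vals i. ss i dvd ec i x)" "ss i dvd int g"
    by (simp_all add: bs_def bb_def ss_def)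
  then show "bb i \<in> lead_vals i" "ss i > 0" "ec i (bb i) = ss i" "\<And>x. x \<in> lead_vals i \<Longrightarrow> ss i dvd ec i x" "ss i dvd int g" by auto
  show "ss i * gg i = int g" using * by (simp add: gg_def)
  then show "gg i > 0" using g * by (metis of_nat_0_less_iff zero_less_mult_pos)
  show "bb i \<in> carrier OF" using * by (simp add: lead_vals_def)
qed

lemma ec_bb: "i < n \<Longrightarrow> j < n \<Longrightarrow> i < j \<Longrightarrow> ec j (bb i) = 0"
  using bs(1)[of i] by (simp add: lead_vals_def)

lemma ec_lincomb: "ec i (\<Sum>j<n. of_int (c j) * bb j) = (\<Sum>j<n. c j * ec i (bb j))"
proof -
  have "ec i (\<Sum>j<n. of_int (c j) * bb j) = (\<Sum>j<n. ec i (of_int (c j) * bb j))"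
    by (rule ec_sum, rule OF_int_mult, rule bs(8)) simp
  also have "\<dots> = (\<Sum>j<n. c j * ec i (bb j))"
    by (rule sum.cong) (simp_all add: ec_int_mult bs(8) del: integer_algebra_simps)
  finally show ?thesis .
qed

lemma expand_basis:
  assumes "x \<in> carrier OF" "k \<le> n" "\<And>j. k \<le> j \<Longrightarrow> j < n \<Longrightarrow> ec j x = 0"
  shows "\<exists>c. x = (\<Sum>i<k. of_int (c i) * bb i)"
  using assms
proof (induction k arbitrary: x)
  case 0
  then have "x = 0" by (intro ec_eq_0_imp) auto
  then show ?case by simp
next
  case (Suc k)
  then have k: "k < n" by simp
  have "x \<in> lead_vals k" using Suc by (auto simp: lead_vals_def)
  then obtain t where t: "ec k x = ss k * t" using bs(4)[OF k] by blast
  note bk = bs(8)[OF k] OF_int_mult[OF bs(8)[OF k], of t]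
  define x' where "x' = x - of_int t * bb k"
  have x': "x' \<in> carrier OF" unfolding x'_def by (rule OF_diff[OF Suc(2) bk(2)])
  have "ec j x' = 0" if "k \<le> j" "j < n" for j
    using that Suc(4)[of j] t bs(3)[OF k] ec_bb[OF k, of j]
    by (cases "j = k") (auto simp: x'_def ec_diff[OF Suc(2) bk(2)] ec_int_mult[OF bk(1)])
  from Suc.IH[OF x' _ this] k obtain c where c: "x' = (\<Sum>i<k. of_int (c i) * bb i)" by auto
  have "x = (\<Sum>i<Suc k. of_int ((c(k := t)) i) * bb i)"
    using c by (simp add: x'_def algebra_simps)
  then show ?case by blast
qed

lemma expand_basis_mod:
  assumes "x \<in> carrier OF" "k \<le> n" "\<And>j. k \<le> j \<Longrightarrow> j < n \<Longrightarrow> ec j x = 0"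
  shows "\<exists>c y. y \<in> Z\<alpha> \<and> (\<forall>i<k. c i \<in> {0..<gg i}) \<and> x = (\<Sum>i<k. of_int (c i) * bb i) + y"
  using assms
proof (induction k arbitrary: x)
  case 0
  then have "x = 0" by (intro ec_eq_0_imp) auto
  moreover have "0 \<in> Z\<alpha>" unfolding generate_ring_singleton by (intro range_eqI[of _ _ 0]) simp
  ultimately show ?case by auto
next
  case (Suc k)
  then have k: "k < n" by simp
  have "x \<in> lead_vals k" using Suc by (auto simp: lead_vals_def)
  then obtain t where t: "ec k x = ss k * t" using bs(4)[OF k] by blast
  define d where "d = t mod gg k"
  define q where "q = t div gg k"
  have d: "d \<in> {0..<gg k}" using bs(7)[OF k] by (simp add: d_def)
  have tq: "t = gg k * q + d" by (simp add: d_def q_def)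
  note bk = bs(8)[OF k] OF_int_mult[OF bs(8)[OF k], of d]
  note ak = OF_power[OF OF_closed(7), of k] OF_int_mult[OF OF_power[OF OF_closed(7), of k], of q]
  define x' where "x' = x - of_int d * bb k - of_int q * \<alpha> ^ k"
  note xd = OF_diff[OF Suc(2) bk(2)]
  have x': "x' \<in> carrier OF" unfolding x'_def by (rule OF_diff[OF xd ak(2)])
  have ex: "ec j x' = ec j x - d * ec j (bb k) - q * ec j (\<alpha> ^ k)" for j
    unfolding x'_def ec_diff[OF xd ak(2)] ec_diff[OF Suc(2) bk(2)] ec_int_mult[OF bk(1)] ec_int_mult[OF ak(1)] ..
  have top: "ec k x' = 0"
  proof -
    have "ec k x' = ss k * (gg k * q + d) - d * ss k - q * int g"
      using ex[of k] t tq bs(3)[OF k] k by (simp add: ec_power)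
    also have "\<dots> = q * (ss k * gg k - int g)" by (simp add: algebra_simps)
    finally show ?thesis by (simp add: bs(6)[OF k])
  qed
  have "ec j x' = 0" if "k \<le> j" "j < n" for j
  proof (cases "j = k")
    case False
    then show ?thesis using that Suc(4)[of j] ec_bb[OF k, of j] k by (simp add: ex ec_power)
  qed (simp add: top)
  from Suc.IH[OF x' _ this] k obtain c y where c: "y \<in> Z\<alpha>" "\<forall>i<k. c i \<in> {0..<gg i}" "x' = (\<Sum>i<k. of_int (c i) * bb i) + y" by auto
  from c(1) obtain f where f: "y = ipoly f \<alpha>" unfolding generate_ring_singleton by blast
  have "y + of_int q * \<alpha> ^ k \<in> Z\<alpha>" unfolding f generate_ring_singleton
    by (intro range_eqI[of _ _ "f + Polynomial.monom q k"]) simp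
  moreover have "\<forall>i<Suc k. (c(k := d)) i \<in> {0..<gg i}" using c(2) d by (auto simp: less_Suc_eq)
  moreover have "x = (\<Sum>i<Suc k. of_int ((c(k := d)) i) * bb i) + (y + of_int q * \<alpha> ^ k)"
    using c(3) by (simp add: x'_def algebra_simps)
  ultimately show ?case by blast
qed

text \<open>
  The expansions with digits below \<open>gg i\<close> represent each coset of \<open>\<int>[\<alpha>]\<close> once, and there are \<open>g\<close> cosets.
\<close>
lemma prod_gg: "(\<Prod>i<n. gg i) = int g"
proof -
  let ?C = "Pi\<^sub>E {..<n} (\<lambda>i. {0..<gg i})"
  let ?h = "\<lambda>c. Z\<alpha> #>\<^bsub>AG\<^esub> (\<Sum>i<n. of_int (c i) * bb i)"
  have sumOF: "(\<Sum>i<n. of_int (c i) * bb i) \<in> carrier OF" for c :: "nat \<Rightarrow> int"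
    by (intro OF_sum OF_int_mult bs(8)) auto
  have "bij_betw ?h ?C (rcosets\<^bsub>AG\<^esub> Z\<alpha>)"
    unfolding bij_betw_def
  proof
    show "inj_on ?h ?C"
    proof (rule inj_onI, rule ccontr)
      fix c d assume c: "c \<in> ?C" and d: "d \<in> ?C" and eq: "?h c = ?h d" and ne: "c \<noteq> d"
      then have "{i. i < n \<and> c i \<noteq> d i} \<noteq> {}" using PiE_ext[OF c d] by blast
      define k where "k = Max {i. i < n \<and> c i \<noteq> d i}"
      have "k \<in> {i. i < n \<and> c i \<noteq> d i}" unfolding k_def using \<open>_ \<noteq> {}\<close> by (intro Max_in) auto
      then have k: "k < n" "c k \<noteq> d k" by auto
      have above: "c i = d i" if "k < i" "i < n" for i
        using Max_ge[of "{i. i < n \<and> c i \<noteq> d i}" i] that by (fastforce simp flip: k_def)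
      have "(\<Sum>i<n. of_int (c i) * bb i) - (\<Sum>i<n. of_int (d i) * bb i) \<in> Z\<alpha>" using eq unfolding coset_eq_iff .
      then have "int g dvd ec k ((\<Sum>i<n. of_int (c i) * bb i) - (\<Sum>i<n. of_int (d i) * bb i))" by (rule ec_Za)
      also have "ec k ((\<Sum>i<n. of_int (c i) * bb i) - (\<Sum>i<n. of_int (d i) * bb i)) = (\<Sum>i<n. (c i - d i) * ec k (bb i))"
        by (simp add: ec_diff[OF sumOF sumOF] ec_lincomb left_diff_distrib sum_subtractf del: integer_algebra_simps)
      also have "\<dots> = (\<Sum>i\<in>{k}. (c i - d i) * ec k (bb i))"
      proof (rule sum.mono_neutral_right)
        show "\<forall>i\<in>{..<n} - {k}. (c i - d i) * ec k (bb i) = 0"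
          using above ec_bb[OF _ k(1)] by (auto simp: nat_neq_iff)
      qed (use k in auto)
      also have "\<dots> = ss k * (c k - d k)" using bs(3)[OF k(1)] by simp
      finally have "ss k * gg k dvd ss k * (c k - d k)" by (simp only: bs(6)[OF k(1)])
      then have "gg k dvd c k - d k" using bs(2)[OF k(1)] by simp
      then have "c k mod gg k = d k mod gg k" by (simp add: mod_eq_dvd_iff)
      moreover have "c k \<in> {0..<gg k}" "d k \<in> {0..<gg k}" using PiE_mem[OF c, of k] PiE_mem[OF d, of k] k(1) by simp_all
      ultimately have "c k = d k" by simp
      then show False using k by simp
    qed
    show "?h ` ?C = rcosets\<^bsub>AG\<^esub> Z\<alpha>"
    proof
      show "?h ` ?C \<subseteq> rcosets\<^bsub>AG\<^esub> Z\<alpha>"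
      proof (intro image_subsetI)
        fix c
        have "(\<Sum>i<n. of_int (c i) * bb i) \<in> carrier AG" using sumOF[of c] by simp
        then show "?h c \<in> rcosets\<^bsub>AG\<^esub> Z\<alpha>" unfolding RCOSETS_def by (rule UN_I) (rule singletonI)
      qed
      show "rcosets\<^bsub>AG\<^esub> Z\<alpha> \<subseteq> ?h ` ?C"
      proof
        fix t assume "t \<in> rcosets\<^bsub>AG\<^esub> Z\<alpha>"
        then obtain x where x: "x \<in> carrier OF" "t = Z\<alpha> #>\<^bsub>AG\<^esub> x" by (auto simp: RCOSETS_def)
        from expand_basis_mod[OF x(1) order.refl] obtain c y where
          c: "y \<in> Z\<alpha>" "\<forall>i<n. c i \<in> {0..<gg i}" "x = (\<Sum>i<n. of_int (c i) * bb i) + y" by auto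
        have "(\<Sum>i<n. of_int (restrict c {..<n} i) * bb i) = (\<Sum>i<n. of_int (c i) * bb i)" by simp
        then have "t = ?h (restrict c {..<n})" unfolding x(2) coset_eq_iff using c by simp
        moreover have "restrict c {..<n} \<in> ?C" using c(2) by auto
        ultimately show "t \<in> ?h ` ?C" by blast
      qed
    qed
  qed
  from trans[OF bij_betw_same_card[OF this] card_cosets] have "card ?C = g" .
  moreover have "card ?C = (\<Prod>i<n. nat (gg i))" by (simp add: card_PiE)
  ultimately have "int g = int (\<Prod>i<n. nat (gg i))" by simp
  also have "\<dots> = (\<Prod>i<n. int (nat (gg i)))" by (rule of_nat_prod)
  also have "\<dots> = (\<Prod>i<n. gg i)" using bs(7) by (intro prod.cong) (auto simp: less_imp_le)
  finally show ?thesis ..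
qed

lemma prod_ss: "(\<Prod>i<n. ss i) = int g ^ (n - 1)"
proof -
  have "(\<Prod>i<n. ss i) * (\<Prod>i<n. gg i) = (\<Prod>i<n. int g)"
    unfolding prod.distrib[symmetric] by (intro prod.cong) (auto simp: bs(6))
  then have "(\<Prod>i<n. ss i) * int g = int g ^ (n - 1) * int g"
    using n_pos by (simp add: prod_gg power_eq_if)
  then show ?thesis using g by simp
qed

abbreviation "\<Delta> \<equiv> leibniz_form n ec"

lemma leibniz_basis: "\<Delta> (map bb [0..<n]) = int g ^ (n - 1)"
proof -
  let ?M = "mat n n (\<lambda>(k,i). ec i (map bb [0..<n] ! k))"
  have "det ?M = prod_list (diag_mat ?M)"
    by (rule det_lower_triangular[of n]) (auto simp: ec_bb)
  also have "\<dots> = (\<Prod>i<n. ss i)"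
    by (simp add: prod_list_diag_prod bs(3) atLeast0LessThan cong: prod.cong_simp)
  finally show ?thesis by (simp add: leibniz_form_det prod_ss)
qed

lemma leibniz_dvd:
  assumes "xs \<in> tuples n OF"
  shows "int g ^ (n - 1) dvd \<Delta> xs"
proof -
  have len: "length xs = n" and xs: "\<And>k. k < n \<Longrightarrow> xs ! k \<in> carrier OF" using assms by (auto simp: tuples_def simp del: integer_algebra_simps)
  have "\<exists>c. xs ! k = (\<Sum>i<n. of_int (c i) * bb i)" if "k < n" for k
    using xs[OF that] by (intro expand_basis) auto
  then obtain c where c: "\<And>k. k < n \<Longrightarrow> xs ! k = (\<Sum>i<n. of_int (c k i) * bb i)" by metis
  let ?C = "mat n n (\<lambda>(k,j). c k j)" and ?B = "mat n n (\<lambda>(k,i). ec i (map bb [0..<n] ! k))"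
  have "mat n n (\<lambda>(k,i). ec i (xs ! k)) = ?C * ?B"
  proof (rule eq_matI)
    fix k i assume "k < dim_row (?C * ?B)" "i < dim_col (?C * ?B)"
    then have k: "k < n" "i < n" by auto
    have "ec i (xs ! k) = (\<Sum>j<n. c k j * ec i (bb j))"
      by (simp add: c[OF k(1)] ec_lincomb del: integer_algebra_simps)
    then show "mat n n (\<lambda>(k,i). ec i (xs ! k)) $$ (k, i) = (?C * ?B) $$ (k, i)"
      using k by (simp add: scalar_prod_def atLeast0LessThan)
  qed auto
  then have "\<Delta> xs = det ?C * \<Delta> (map bb [0..<n])"
    unfolding leibniz_form_det by (simp add: det_mult[of _ n])
  then show ?thesis by (simp add: leibniz_basis)
qed

lemma OF_exterior: "exterior \<Z> OF n"
  unfolding exterior_def exterior_axioms_def using integer_algebra_module n_pos by blast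

text \<open>
  The determinant of coordinates takes the value \<open>g\<^sup>n\<^sup>-\<^sup>1\<close> at the triangular basis and is divisible by \<open>g\<^sup>n\<^sup>-\<^sup>1\<close>
  at every tuple, so its value at a generator of the exterior power is \<open>g\<^sup>n\<^sup>-\<^sup>1\<close> up to sign.  The coordinates are those
  of \<open>g x\<close> with respect to the powers of \<open>\<alpha>\<close>, which explains the power of \<open>g\<close>.
\<close>
lemma orientation_value:
  assumes w: "Poly_Mapping.keys w \<subseteq> tuples n OF"
    and gen: "\<And>xs. xs \<in> tuples n OF \<Longrightarrow> \<exists>k. frag_of xs - frag_cmul k w \<in> exterior_null n \<Z> OF"
  shows "\<bar>frag_eval \<Delta> w\<bar> = int g ^ (n - 1)"
proof -
  interpret E: exterior \<Z> OF n by (rule OF_exterior)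
  let ?W = "frag_eval \<Delta> w"
  have null: "frag_eval \<Delta> z = 0" if "z \<in> E.NU" for z
  proof -
    have "0 dvd frag_eval \<Delta> z"
      by (rule E.frag_eval_leibniz_null[where \<phi> = id, OF _ _ that])
         (auto simp del: integer_algebra_simps(1) simp: ec_add ec_int_mult)
    then show ?thesis by simp
  qed
  have dvd1: "?W dvd \<Delta> xs" if "xs \<in> tuples n OF" for xs
  proof -
    from gen[OF that] obtain k where "frag_of xs - frag_cmul k w \<in> E.NU" by blast
    from null[OF this] show ?thesis by simp
  qed
  have dvd2: "int g ^ (n - 1) dvd ?W"
    unfolding frag_eval_def using w leibniz_dvd by (intro dvd_sum dvd_mult) auto
  have "map bb [0..<n] \<in> tuples n OF" using bs(8) by (auto simp: tuples_def simp del: integer_algebra_simps)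
  from dvd1[OF this] have "?W dvd int g ^ (n - 1)" unfolding leibniz_basis .
  from zdvd_antisym_abs[OF this dvd2] show ?thesis by simp
qed

end

section \<open>The local algebra modulo prime powers\<close>

text \<open>
  For odd \<open>l\<close> the residue of 1/2 modulo \<open>l\<^sup>k\<close> is that of \<open>(l\<^sup>k + 1) / 2\<close>.
\<close>
lemma padic_half:
  assumes "odd l" and c: "c \<in> carrier (padic_int_ring l)"
  shows "\<exists>d\<in>carrier (padic_int_ring l). c = d \<oplus>\<^bsub>padic_int_ring l\<^esub> d"
proof -
  have l: "l > 0" using assms(1) by (cases l) auto
  interpret cring "padic_int_ring l" by (rule padic_int_ring_cring[OF l])
  define h :: "nat \<Rightarrow> int" where "h k = ((int l ^ k + 1) div 2) mod int l ^ k" for k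
  have odd: "odd (int l ^ k)" for k using assms(1) by simp
  have h2: "2 * ((int l ^ k + 1) div 2) = int l ^ k + 1" for k
    by (rule dvd_mult_div_cancel) (use odd[of k] in \<open>simp only: even_plus_one_iff not_False_eq_True\<close>)
  have hs: "h (Suc k) mod int l ^ k = h k" for k
  proof -
    define e where "e = (int l - 1) div 2"
    have "int l = 2 * e + 1" using assms(1) by (simp add: e_def)
    then have "int l ^ Suc k = (2 * e + 1) * int l ^ k" by (metis power_Suc)
    then have "int l ^ Suc k = int l ^ k + 2 * (int l ^ k * e)" by (simp only: algebra_simps mult_1)
    then have "(int l ^ Suc k + 1) div 2 = (int l ^ k + 1) div 2 + int l ^ k * e"
      using h2[of k] h2[of "Suc k"] by linarith
    then show ?thesis unfolding h_def by (subst mod_mod_cancel) auto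
  qed
  have hc: "h \<in> carrier (padic_int_ring l)"
    using hs l by (simp add: padic_int_ring_def h_def)
  have "h \<oplus>\<^bsub>padic_int_ring l\<^esub> h = \<one>\<^bsub>padic_int_ring l\<^esub>"
  proof -
    have "(h k + h k) mod int l ^ k = 1 mod int l ^ k" for k
    proof -
      have "(h k + h k) mod int l ^ k = (2 * ((int l ^ k + 1) div 2)) mod int l ^ k"
        unfolding h_def by (simp add: mod_simps)
      also have "\<dots> = 1 mod int l ^ k" unfolding h2 by simp
      finally show ?thesis .
    qed
    then show ?thesis by (simp add: padic_int_ring_def)
  qed
  then have "c = c \<otimes>\<^bsub>padic_int_ring l\<^esub> h \<oplus>\<^bsub>padic_int_ring l\<^esub> c \<otimes>\<^bsub>padic_int_ring l\<^esub> h"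
    using c hc by (metis r_distr r_one)
  then show ?thesis using c hc by blast
qed

locale monogenic_order_at = monogenic_order +
  fixes l :: nat
  assumes l_prime: "Factorial_Ring.prime l" and l_odd: "odd l" and l_g: "\<not> l dvd g"
begin

abbreviation "Zl \<equiv> padic_int_ring l"

lemma l_pos: "l > 0" using l_prime prime_gt_0_nat by blast

sublocale cring_pair OF Zl
  by (intro cring_pair.intro integer_algebra_cring padic_int_ring_cring l_pos)

lemma local_algebra_eq: "local_algebra F l = BC" by (simp add: local_algebra_def)

text \<open>
  The map \<open>a \<otimes> b \<mapsto> b a\<close> with \<open>b\<close> replaced by its residue modulo \<open>l\<^sup>j\<close>; it is well defined modulo \<open>l\<^sup>j\<close>.
\<close>
definition "Tj j r = frag_eval (\<lambda>(a, b). of_int (b j) * a :: complex) r" for j :: nat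

definition "mrel j x y \<longleftrightarrow> (\<exists>z\<in>carrier OF. x - y = of_int (int l ^ j) * z)" for j :: nat and x y :: complex

lemma mrelI: "z \<in> carrier OF \<Longrightarrow> x - y = of_int (int l ^ j) * z \<Longrightarrow> mrel j x y"
  unfolding mrel_def by blast

lemma mrel_refl: "mrel j x x"
  by (rule mrelI[OF OF_closed(5)]) simp

lemma mrel_add: "mrel j x y \<Longrightarrow> mrel j x' y' \<Longrightarrow> mrel j (x + x') (y + y')"
proof -
  assume "mrel j x y" "mrel j x' y'"
  then obtain z z' where "z \<in> carrier OF" "x - y = of_int (int l ^ j) * z" "z' \<in> carrier OF" "x' - y' = of_int (int l ^ j) * z'"
    unfolding mrel_def by blast
  then show ?thesis by (intro mrelI[OF OF_closed(1), of z z']) (simp_all add: algebra_simps del: integer_algebra_simps)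
qed

lemma mrel_mult_left: "mrel j x y \<Longrightarrow> c \<in> carrier OF \<Longrightarrow> mrel j (c * x) (c * y)"
proof -
  assume c: "c \<in> carrier OF" and "mrel j x y"
  then obtain z where z: "z \<in> carrier OF" "x - y = of_int (int l ^ j) * z" unfolding mrel_def by blast
  have "c * x - c * y = c * (x - y)" by (simp add: algebra_simps)
  also have "\<dots> = of_int (int l ^ j) * (c * z)" unfolding z(2) by simp
  finally show ?thesis by (rule mrelI[OF OF_closed(2)[OF c z(1)]])
qed

lemma mrel_diff: "mrel j x y \<Longrightarrow> mrel j x' y' \<Longrightarrow> mrel j (x - x') (y - y')"
  using mrel_add[of j x y "- x'" "- y'"] mrel_mult_left[of j x' y' "-1"] OF_closed(4)[of "-1"] by simp

lemma mrel_trans: "mrel j x y \<Longrightarrow> mrel j y z \<Longrightarrow> mrel j x z"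
  using mrel_add[of j x y y z] mrel_diff[of j "x + y" "y + z" y y] mrel_refl by simp

lemma mrel_mult: "mrel j x y \<Longrightarrow> mrel j x' y' \<Longrightarrow> y \<in> carrier OF \<Longrightarrow> x' \<in> carrier OF \<Longrightarrow> mrel j (x * x') (y * y')"
  using mrel_mult_left[of j x y x'] mrel_mult_left[of j x' y' y] mrel_trans by (metis mult.commute)

lemma mrel_mod: "a \<in> carrier OF \<Longrightarrow> mrel j (of_int (k mod int l ^ j) * a) (of_int k * a)"
proof -
  assume a: "a \<in> carrier OF"
  have k: "complex_of_int k = of_int (int l ^ j) * of_int (k div int l ^ j) + of_int (k mod int l ^ j)"
    by (metis mult_div_mod_eq of_int_add of_int_mult)
  have "of_int (k mod int l ^ j) * a - of_int k * a = of_int (int l ^ j) * (of_int (- (k div int l ^ j)) * a)"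
    by (simp only: k) (simp add: algebra_simps)
  then show ?thesis by (rule mrelI[OF OF_int_mult[OF a]])
qed

lemma ec_mrel: "mrel j x y \<Longrightarrow> x \<in> carrier OF \<Longrightarrow> y \<in> carrier OF \<Longrightarrow> [ec i x = ec i y] (mod int l ^ j)"
proof -
  assume xy: "x \<in> carrier OF" "y \<in> carrier OF" and "mrel j x y"
  then obtain z where z: "z \<in> carrier OF" "x - y = of_int (int l ^ j) * z" unfolding mrel_def by blast
  have "ec i x - ec i y = int l ^ j * ec i z"
    using ec_diff[OF xy, of i] ec_int_mult[OF z(1), of i "int l ^ j"] by (simp add: z(2))
  then show ?thesis by (simp add: cong_iff_dvd_diff)
qed

lemma Tj_of [simp]: "Tj j (frag_of (a, b)) = of_int (b j) * a" by (simp add: Tj_def)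
lemma Tj_diff [simp]: "Tj j (r - s) = Tj j r - Tj j s" by (simp add: Tj_def)
lemma Tj_add [simp]: "Tj j (r + s) = Tj j r + Tj j s" by (simp add: Tj_def)
lemma Tj_uminus [simp]: "Tj j (- r) = - Tj j r" by (simp add: Tj_def)
lemma Tj_0 [simp]: "Tj j 0 = 0" by (simp add: Tj_def)

lemma Tj_OF: "r \<in> carrier PR \<Longrightarrow> Tj j r \<in> carrier OF"
proof -
  assume "r \<in> carrier PR"
  then have "Poly_Mapping.keys r \<subseteq> carrier OF \<times> carrier Zl" by (simp only: pair_ring_simps)
  then show ?thesis
  proof (induction r rule: frag_induction)
    case zero
    show ?case using OF_closed(5) by simp
  next
    case (one p)
    then obtain a b where "p = (a, b)" "a \<in> carrier OF" by auto
    then show ?case using OF_int_mult[of a "b j"] by simp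
  next
    case (diff r s)
    then show ?case using OF_diff by simp
  qed
qed

lemma Tj_mult:
  assumes "r \<in> carrier PR" "s \<in> carrier PR"
  shows "mrel j (Tj j (r \<otimes>\<^bsub>PR\<^esub> s)) (Tj j r * Tj j s)"
proof -
  have r: "Poly_Mapping.keys r \<subseteq> carrier OF \<times> carrier Zl" and s: "Poly_Mapping.keys s \<subseteq> carrier OF \<times> carrier Zl"
    using assms by (simp_all only: pair_ring_simps)
  show ?thesis using r
  proof (induction r rule: frag_induction)
    case (one p)
    then obtain a b where p: "p = (a, b)" "a \<in> carrier OF" by auto
    show ?case using s
    proof (induction s rule: frag_induction)
      case (one q)
      then obtain a' b' where q: "q = (a', b')" "a' \<in> carrier OF" by auto
      have "mrel j (of_int ((b j * b' j) mod int l ^ j) * (a * a')) (of_int (b j * b' j) * (a * a'))"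
        by (rule mrel_mod[OF OF_closed(2)[OF p(2) q(2)]])
      moreover have "(b \<otimes>\<^bsub>Zl\<^esub> b') j = (b j * b' j) mod int l ^ j" by (simp add: padic_int_ring_def)
      ultimately show ?case by (simp add: p q mult_ac)
    next
      case (diff u v)
      then show ?case using mrel_diff[OF diff] by (simp add: pair_mult_diff_right algebra_simps)
    qed (simp add: mrel_refl)
  next
    case (diff u v)
    then show ?case using mrel_diff[OF diff] by (simp add: pair_mult_diff_left algebra_simps)
  qed (simp add: mrel_refl)
qed

text \<open>
  Replacing an \<open>l\<close>-adic integer by its \<open>j\<close>-th component makes the tensor relations hold modulo \<open>l\<^sup>j\<close>.
\<close>
lemma Tj_ideal: "r \<in> TI \<Longrightarrow> mrel j (Tj j r) 0"
proof -
  define I where "I = {r \<in> carrier PR. mrel j (Tj j r) 0}"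
  have PRm: "r - s \<in> carrier PR" if "r \<in> carrier PR" "s \<in> carrier PR" for r s
    using PR.minus_closed[OF that] that by (simp add: a_minus_def del: pair_ring_simps(1))
  have "ideal I PR"
  proof (rule idealI)
    show "ring PR" by (rule PR.ring_axioms)
    show "subgroup I (add_monoid PR)"
    proof (rule group.subgroupI[OF PR.a_group])
      show "I \<subseteq> carrier (add_monoid PR)" by (auto simp: I_def)
      have "0 \<in> I" using PR.zero_closed mrel_refl by (simp add: I_def)
      then show "I \<noteq> {}" by blast
      fix a assume a: "a \<in> I"
      then have "inv\<^bsub>add_monoid PR\<^esub> a = 0 - a"
        using pair_ring_a_inv[of a] by (simp add: a_inv_def I_def)
      then show "inv\<^bsub>add_monoid PR\<^esub> a \<in> I" using a PRm[of 0 a] PR.zero_closed mrel_diff[OF mrel_refl[of j 0], of "Tj j a" 0]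
        by (simp add: I_def)
      fix b assume b: "b \<in> I"
      then show "a \<otimes>\<^bsub>add_monoid PR\<^esub> b \<in> I" using a PR.a_closed[of a b] mrel_add[of j "Tj j a" 0 "Tj j b" 0]
        by (simp add: I_def)
    qed
  next
    fix a x assume a: "a \<in> I" and x: "x \<in> carrier PR"
    then have ac: "a \<in> carrier PR" "mrel j (Tj j a) 0" by (simp_all add: I_def)
    have "mrel j (Tj j (x \<otimes>\<^bsub>PR\<^esub> a)) (Tj j x * Tj j a)" by (rule Tj_mult[OF x ac(1)])
    moreover have "mrel j (Tj j x * Tj j a) (Tj j x * 0)" by (rule mrel_mult_left[OF ac(2) Tj_OF[OF x]])
    ultimately have "mrel j (Tj j (x \<otimes>\<^bsub>PR\<^esub> a)) 0" using mrel_trans by fastforce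
    then show 1: "x \<otimes>\<^bsub>PR\<^esub> a \<in> I" using PR.m_closed[OF x ac(1)] unfolding I_def by blast
    then show "a \<otimes>\<^bsub>PR\<^esub> x \<in> I" using PR.m_comm[OF x ac(1)] by simp
  qed
  moreover have "tensor_relations OF Zl \<subseteq> I"
  proof
    fix r assume r: "r \<in> tensor_relations OF Zl"
    have rc: "r \<in> carrier PR" using r tensor_relations_carrier by blast
    from r consider (1) a a' b where "r = frag_of (a \<oplus>\<^bsub>OF\<^esub> a', b) - frag_of (a, b) - frag_of (a', b)"
      | (2) a b b' where "r = frag_of (a, b \<oplus>\<^bsub>Zl\<^esub> b') - frag_of (a, b) - frag_of (a, b')" "a \<in> carrier OF"
      unfolding tensor_relations_def by blast
    then have "mrel j (Tj j r) 0"
    proof cases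
      case 1
      have "Tj j r = 0" unfolding 1 by (simp add: algebra_simps)
      then show ?thesis by (simp add: mrel_refl)
    next
      case 2
      have "mrel j (of_int ((b j + b' j) mod int l ^ j) * a - of_int (b j + b' j) * a) (of_int (b j + b' j) * a - of_int (b j + b' j) * a)"
        by (rule mrel_diff[OF mrel_mod[OF 2(2)] mrel_refl])
      then show ?thesis unfolding 2(1) by (simp add: padic_int_ring_def algebra_simps)
    qed
    then show "r \<in> I" using rc by (simp add: I_def)
  qed
  ultimately have "TI \<subseteq> I" unfolding tensor_ideal_def by (rule PR.genideal_minimal)
  then show "r \<in> TI \<Longrightarrow> mrel j (Tj j r) 0" by (auto simp: I_def)
qed

definition "rep t = (SOME r. r \<in> carrier PR \<and> t = proj r)"
text \<open>
  Reduction of the base change to the ring of integers modulo \<open>l\<^sup>j\<close>.  It is a function through the choice of a preimage, and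
  additive and multiplicative only up to the congruence \<open>mrel j\<close>.
\<close>
definition "red j t = Tj j (rep t)" for j :: nat

lemma rep: "t \<in> carrier BC \<Longrightarrow> rep t \<in> carrier PR" "t \<in> carrier BC \<Longrightarrow> proj (rep t) = t"
proof -
  assume "t \<in> carrier BC"
  then have "\<exists>r. r \<in> carrier PR \<and> t = proj r" using proj_surj by metis
  from someI_ex[OF this] show "rep t \<in> carrier PR" "proj (rep t) = t" unfolding rep_def by simp_all
qed

lemma red_OF: "t \<in> carrier BC \<Longrightarrow> red j t \<in> carrier OF"
  unfolding red_def by (intro Tj_OF rep)

lemma red_proj: "r \<in> carrier PR \<Longrightarrow> mrel j (red j (proj r)) (Tj j r)"
proof -
  assume r: "r \<in> carrier PR"
  have "proj (rep (proj r)) = proj r" by (rule rep(2)[OF proj_closed[OF r]])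
  then have "rep (proj r) - r \<in> TI" using proj_eq_iff[OF rep(1)[OF proj_closed[OF r]] r] by blast
  from mrel_add[OF Tj_ideal[OF this, of j] mrel_refl[of j "Tj j r"]] show ?thesis by (simp add: red_def)
qed

lemma red_add: "s \<in> carrier BC \<Longrightarrow> t \<in> carrier BC \<Longrightarrow> mrel j (red j (s \<oplus>\<^bsub>BC\<^esub> t)) (red j s + red j t)"
  using red_proj[OF PR.a_closed[OF rep(1) rep(1)], of s t j] proj_add[OF rep(1) rep(1), of s t] by (simp add: rep(2) red_def)

lemma red_mult: "s \<in> carrier BC \<Longrightarrow> t \<in> carrier BC \<Longrightarrow> mrel j (red j (s \<otimes>\<^bsub>BC\<^esub> t)) (red j s * red j t)"
  using red_proj[OF PR.m_closed[OF rep(1) rep(1)], of s t j] proj_mult[OF rep(1) rep(1), of s t]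
    Tj_mult[OF rep(1) rep(1), of s t j] mrel_trans by (simp add: rep(2) red_def)

lemma red_pure: "a \<in> carrier OF \<Longrightarrow> b \<in> carrier Zl \<Longrightarrow> mrel j (red j (pure a b)) (of_int (b j) * a)"
  using red_proj[of "frag_of (a, b)" j] unfolding pure_eq by simp

lemma red_smult: "c \<in> carrier Zl \<Longrightarrow> t \<in> carrier BC \<Longrightarrow> mrel j (red j (c \<odot>\<^bsub>BC\<^esub> t)) (of_int (c j) * red j t)"
proof -
  assume c: "c \<in> carrier Zl" and t: "t \<in> carrier BC"
  have p: "pure \<one>\<^bsub>OF\<^esub> c \<in> carrier BC" using c OF_closed(6) by (intro pure_closed) auto
  have "mrel j (red j (c \<odot>\<^bsub>BC\<^esub> t)) (red j (pure \<one>\<^bsub>OF\<^esub> c) * red j t)"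
    unfolding BC_simps(6) by (rule red_mult[OF p t])
  moreover have "mrel j (red j (pure \<one>\<^bsub>OF\<^esub> c) * red j t) (of_int (c j) * red j t)"
  proof -
    have "mrel j (red j (pure 1 c)) (of_int (c j))" using red_pure[OF OF_closed(6) c, of j] by simp
    from mrel_mult[OF this mrel_refl OF_closed(4) red_OF[OF t]] show ?thesis by simp
  qed
  ultimately show ?thesis by (rule mrel_trans)
qed

lemma red_one: "mrel j (red j \<one>\<^bsub>BC\<^esub>) 1"
proof -
  have "mrel j (red j (pure \<one>\<^bsub>OF\<^esub> \<one>\<^bsub>Zl\<^esub>)) (of_int (\<one>\<^bsub>Zl\<^esub> j) * \<one>\<^bsub>OF\<^esub>)"
    using OF_closed(6) by (intro red_pure B.one_closed) simp
  moreover have "mrel j (of_int (\<one>\<^bsub>Zl\<^esub> j) * \<one>\<^bsub>OF\<^esub>) (of_int 1 * \<one>\<^bsub>OF\<^esub>)"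
    using mrel_mod[of "\<one>\<^bsub>OF\<^esub>" j 1] OF_closed(6) by (simp add: padic_int_ring_def)
  ultimately show ?thesis using mrel_trans unfolding pure_one by simp
qed

lemma red_power: "t \<in> carrier BC \<Longrightarrow> mrel j (red j (t [^]\<^bsub>BC\<^esub> (k::nat))) (red j t ^ k)"
proof (induction k)
  case 0
  show ?case using red_one by simp
next
  case (Suc k)
  have tk: "t [^]\<^bsub>BC\<^esub> k \<in> carrier BC" using Suc by simp
  have "mrel j (red j (t [^]\<^bsub>BC\<^esub> k \<otimes>\<^bsub>BC\<^esub> t)) (red j (t [^]\<^bsub>BC\<^esub> k) * red j t)" by (rule red_mult[OF tk Suc(2)])
  moreover have "mrel j (red j (t [^]\<^bsub>BC\<^esub> k) * red j t) (red j t ^ k * red j t)"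
    by (rule mrel_mult[OF Suc.IH[OF Suc(2)] mrel_refl OF_power[OF red_OF[OF Suc(2)]] red_OF[OF Suc(2)]])
  ultimately show ?case using mrel_trans by (simp add: mult.commute)
qed

sublocale LX: exterior Zl BC n
  unfolding exterior_def exterior_axioms_def using BC_module n_pos by blast

sublocale GX: exterior \<Z> OF n by (rule OF_exterior)

lemma pure_zero: "a \<in> carrier OF \<Longrightarrow> pure a \<zero>\<^bsub>Zl\<^esub> = \<zero>\<^bsub>BC\<^esub>" "b \<in> carrier Zl \<Longrightarrow> pure 0 b = \<zero>\<^bsub>BC\<^esub>"
proof -
  assume a: "a \<in> carrier OF"
  have "pure a \<zero>\<^bsub>Zl\<^esub> = pure a \<zero>\<^bsub>Zl\<^esub> \<oplus>\<^bsub>BC\<^esub> pure a \<zero>\<^bsub>Zl\<^esub>" using pure_add_right[OF a B.zero_closed B.zero_closed] by simp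
  then show "pure a \<zero>\<^bsub>Zl\<^esub> = \<zero>\<^bsub>BC\<^esub>" using pure_closed[OF a B.zero_closed] by (metis BC.add.r_cancel_one')
next
  assume b: "b \<in> carrier Zl"
  have "pure 0 b = pure 0 b \<oplus>\<^bsub>BC\<^esub> pure 0 b" using pure_add_left[OF OF_closed(5) OF_closed(5) b] by simp
  then show "pure 0 b = \<zero>\<^bsub>BC\<^esub>" using pure_closed[OF OF_closed(5) b] by (metis BC.add.r_cancel_one')
qed

lemma pure_int_mult:
  "\<exists>c\<in>carrier Zl. \<forall>x\<in>carrier OF. pure (of_int k * x) \<one>\<^bsub>Zl\<^esub> = c \<odot>\<^bsub>BC\<^esub> pure x \<one>\<^bsub>Zl\<^esub>"
proof -
  have "\<exists>c\<in>carrier Zl. \<forall>x\<in>carrier OF. pure (of_int k * x) \<one>\<^bsub>Zl\<^esub> = pure x c"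
  proof (induction k rule: int_induct[of _ 0])
    case base
    show ?case by (intro bexI[of _ "\<zero>\<^bsub>Zl\<^esub>"] ballI) (simp_all add: pure_zero del: integer_algebra_simps)
  next
    case (step1 i)
    then obtain c where c: "c \<in> carrier Zl" "\<And>x. x \<in> carrier OF \<Longrightarrow> pure (of_int i * x) \<one>\<^bsub>Zl\<^esub> = pure x c" by blast
    have "pure (of_int (i + 1) * x) \<one>\<^bsub>Zl\<^esub> = pure x (c \<oplus>\<^bsub>Zl\<^esub> \<one>\<^bsub>Zl\<^esub>)" if x: "x \<in> carrier OF" for x
      using pure_add_left[OF OF_int_mult[OF x, of i] x B.one_closed] pure_add_right[OF x c(1) B.one_closed] c(2)[OF x]
      by (simp add: algebra_simps)
    then show ?case using c by (intro bexI[of _ "c \<oplus>\<^bsub>Zl\<^esub> \<one>\<^bsub>Zl\<^esub>"]) auto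
  next
    case (step2 i)
    then obtain c where c: "c \<in> carrier Zl" "\<And>x. x \<in> carrier OF \<Longrightarrow> pure (of_int i * x) \<one>\<^bsub>Zl\<^esub> = pure x c" by blast
    have cm: "c \<ominus>\<^bsub>Zl\<^esub> \<one>\<^bsub>Zl\<^esub> \<in> carrier Zl" using c by simp
    have cc: "(c \<ominus>\<^bsub>Zl\<^esub> \<one>\<^bsub>Zl\<^esub>) \<oplus>\<^bsub>Zl\<^esub> \<one>\<^bsub>Zl\<^esub> = c" using c by (simp add: B.minus_eq B.a_assoc B.l_neg)
    have "pure (of_int (i - 1) * x) \<one>\<^bsub>Zl\<^esub> = pure x (c \<ominus>\<^bsub>Zl\<^esub> \<one>\<^bsub>Zl\<^esub>)" if x: "x \<in> carrier OF" for x
    proof -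
      have "pure (of_int (i - 1) * x) \<one>\<^bsub>Zl\<^esub> \<oplus>\<^bsub>BC\<^esub> pure x \<one>\<^bsub>Zl\<^esub> = pure (of_int i * x) \<one>\<^bsub>Zl\<^esub>"
        using pure_add_left[OF OF_int_mult[OF x, of "i - 1"] x B.one_closed] by (simp add: algebra_simps)
      also have "\<dots> = pure x (c \<ominus>\<^bsub>Zl\<^esub> \<one>\<^bsub>Zl\<^esub>) \<oplus>\<^bsub>BC\<^esub> pure x \<one>\<^bsub>Zl\<^esub>"
        using pure_add_right[OF x cm B.one_closed] c(2)[OF x] cc by simp
      finally show ?thesis
        using BC.add.r_cancel[OF _ pure_closed[OF OF_int_mult[OF x] B.one_closed] pure_closed[OF x cm] pure_closed[OF x B.one_closed]] by blast
    qed
    then show ?case using cm by blast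
  qed
  then show ?thesis using smult_pure[OF _ B.one_closed] by (metis B.r_one)
qed

abbreviation "hp \<equiv> (\<lambda>a. pure a \<one>\<^bsub>Zl\<^esub>)"
abbreviation "EJ \<equiv> (\<lambda>j i t. ec i (red j t))"

lemma EJ_add:
  assumes "x \<in> carrier BC" "y \<in> carrier BC"
  shows "[EJ j i (x \<oplus>\<^bsub>BC\<^esub> y) = EJ j i x + EJ j i y] (mod int l ^ j)"
proof -
  note xy = red_OF[OF assms(1), of j] red_OF[OF assms(2), of j]
  have "[EJ j i (x \<oplus>\<^bsub>BC\<^esub> y) = ec i (red j x + red j y)] (mod int l ^ j)"
    by (rule ec_mrel[OF red_add[OF assms] red_OF[OF BC.a_closed[OF assms]] OF_closed(1)[OF xy]])
  then show ?thesis by (simp only: ec_add[OF xy])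
qed

lemma EJ_smult:
  assumes "c \<in> carrier Zl" "x \<in> carrier BC"
  shows "[EJ j i (c \<odot>\<^bsub>BC\<^esub> x) = c j * EJ j i x] (mod int l ^ j)"
proof -
  note x = red_OF[OF assms(2), of j]
  have "[EJ j i (c \<odot>\<^bsub>BC\<^esub> x) = ec i (of_int (c j) * red j x)] (mod int l ^ j)"
    by (rule ec_mrel[OF red_smult[OF assms] red_OF[OF LX.smult_closed[OF assms]] OF_int_mult[OF x]])
  then show ?thesis by (simp only: ec_int_mult[OF x])
qed

lemma local_wedge_value:
  assumes w: "Poly_Mapping.keys w \<subseteq> tuples n OF"
    and c: "c \<in> carrier Zl" "frag_of ys - LX.SC c (frag_extend (\<lambda>xs. frag_of (map hp xs)) w) \<in> LX.NU"
  shows "[leibniz_form n (EJ j) ys = c j * frag_eval \<Delta> w] (mod int l ^ j)"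
proof -
  let ?w = "frag_extend (\<lambda>xs. frag_of (map hp xs)) w"
  have hpT: "map hp xs \<in> LX.TU" if "xs \<in> tuples n OF" for xs
    using that pure_closed[OF _ B.one_closed] by (auto simp: tuples_def simp del: integer_algebra_simps)
  have wT: "Poly_Mapping.keys ?w \<subseteq> LX.TU"
    by (rule order.trans[OF keys_frag_extend], rule UN_least) (use w hpT in \<open>simp add: subset_iff\<close>)
  have "int l ^ j dvd frag_eval (leibniz_form n (EJ j)) (frag_of ys - LX.SC c ?w)"
    by (rule LX.frag_eval_leibniz_null[where \<phi> = "\<lambda>c. c j", OF EJ_add EJ_smult c(2)])
  then have "[leibniz_form n (EJ j) ys = frag_eval (leibniz_form n (EJ j)) (LX.SC c ?w)] (mod int l ^ j)"
    by (simp add: cong_iff_dvd_diff)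
  also have "[frag_eval (leibniz_form n (EJ j)) (LX.SC c ?w) = c j * frag_eval (leibniz_form n (EJ j)) ?w] (mod int l ^ j)"
    by (rule LX.frag_eval_leibniz_SC[where \<phi> = "\<lambda>c. c j", OF EJ_smult c(1) wT])
  also have "[c j * frag_eval (leibniz_form n (EJ j)) ?w = c j * frag_eval \<Delta> w] (mod int l ^ j)"
  proof (rule cong_mult[OF cong_refl])
    have "frag_eval (leibniz_form n (EJ j)) ?w = frag_eval (\<lambda>xs. leibniz_form n (EJ j) (map hp xs)) w"
      by (simp add: frag_eval_extend)
    also have "[\<dots> = frag_eval \<Delta> w] (mod int l ^ j)"
      unfolding frag_eval_def
    proof (intro cong_sum cong_mult cong_refl leibniz_form_cong)
      fix xs i k assume "xs \<in> Poly_Mapping.keys w" "i < n" "k < n"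
      then have xs: "xs \<in> tuples n OF" "xs ! k \<in> carrier OF" "k < length xs" using w GX.tuples_nth GX.tuples_length by blast+
      have p: "hp (xs ! k) \<in> carrier BC" by (rule pure_closed[OF xs(2) B.one_closed])
      have "mrel j (red j (hp (xs ! k))) (of_int (\<one>\<^bsub>Zl\<^esub> j) * xs ! k)" by (rule red_pure[OF xs(2) B.one_closed])
      moreover have "mrel j (of_int (\<one>\<^bsub>Zl\<^esub> j) * xs ! k) (of_int 1 * xs ! k)"
        using mrel_mod[OF xs(2), of j 1] by (simp add: padic_int_ring_def)
      ultimately have "mrel j (red j (hp (xs ! k))) (of_int 1 * xs ! k)" by (rule mrel_trans)
      then have "mrel j (red j (hp (xs ! k))) (xs ! k)" by simp
      from ec_mrel[OF this red_OF[OF p] xs(2)] show "[EJ j i (map hp xs ! k) = ec i (xs ! k)] (mod int l ^ j)"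
        using xs(3) by simp
    qed
    finally show "[frag_eval (leibniz_form n (EJ j)) ?w = frag_eval \<Delta> w] (mod int l ^ j)" .
  qed
  finally show ?thesis .
qed

text \<open>
  The solution \<open>x\<close> of the local equation is reduced to an algebraic integer \<open>\<xi>\<close> modulo \<open>l\<close>, and both sides of the
  defining equation of the index form are evaluated by the determinant of coordinates.
\<close>
theorem local_index_form_unit:
  assumes or: "orientation F \<omega>" and \<epsilon>: "\<epsilon> = 1 \<or> \<epsilon> = (-1 :: int)" and x: "x \<in> carrier (local_algebra F l)"
    and eq: "local_index_form F l \<omega> x = [\<epsilon>] \<cdot>\<^bsub>Zl\<^esub> \<one>\<^bsub>Zl\<^esub>"
  shows "\<exists>\<xi>\<in>carrier OF. \<exists>s. (s = 1 \<or> s = -1) \<and> [\<Delta> (map (\<lambda>k. \<xi> ^ k) [0..<n]) = s * int g ^ (n - 1)] (mod int l)"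
proof -
  have deg: "ext_degree \<rat> F = n" using ext_degree_adjoin[OF H] n by simp
  have half: "\<exists>d\<in>carrier Zl. c = d \<oplus>\<^bsub>Zl\<^esub> d" if "c \<in> carrier Zl" for c by (rule padic_half[OF l_odd that])
  obtain w where w: "Poly_Mapping.keys w \<subseteq> GX.TU" "\<omega> = GX.NU #>\<^bsub>GX.FA\<^esub> w"
    "\<And>xs. xs \<in> GX.TU \<Longrightarrow> \<exists>k. frag_of xs - frag_cmul k w \<in> GX.NU"
    using or GX.exterior_power_cyclic[of \<omega>] unfolding orientation_def Let_def deg by metis
  define L where "L = frag_extend (\<lambda>xs. frag_of (map hp xs))"
  obtain \<phi> where \<phi>: "\<And>k. \<phi> k \<in> carrier Zl" "\<And>k x. x \<in> carrier OF \<Longrightarrow> pure (of_int k * x) \<one>\<^bsub>Zl\<^esub> = \<phi> k \<odot>\<^bsub>BC\<^esub> pure x \<one>\<^bsub>Zl\<^esub>"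
    using pure_int_mult by metis
  have Lnull: "L z \<in> LX.NU" if "z \<in> GX.NU" for z
    unfolding L_def
  proof (rule exterior_null_map[OF GX.exterior_axioms LX.exterior_axioms _ _ _ _ that])
    fix x y assume "x \<in> carrier OF" "y \<in> carrier OF"
    then show "hp (x \<oplus>\<^bsub>OF\<^esub> y) = hp x \<oplus>\<^bsub>BC\<^esub> hp y" by (rule pure_add_left[OF _ _ B.one_closed])
  next
    fix c x assume "x \<in> carrier OF"
    then show "hp (c \<odot>\<^bsub>OF\<^esub> x) = \<phi> c \<odot>\<^bsub>BC\<^esub> hp x" using \<phi>(2) by simp
  qed (rule pure_closed[OF _ B.one_closed], assumption, rule \<phi>(1))
  have hpT: "map hp xs \<in> LX.TU" if "xs \<in> GX.TU" for xs
    using that pure_closed[OF _ B.one_closed] by (auto simp: tuples_def simp del: integer_algebra_simps)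
  have wT: "Poly_Mapping.keys (L w) \<subseteq> LX.TU"
    unfolding L_def by (rule order.trans[OF keys_frag_extend], rule UN_least) (use w(1) hpT in \<open>simp add: subset_iff\<close>)
  have lor: "local_orientation F l \<omega> = LX.NU #>\<^bsub>LX.FA\<^esub> L w"
    unfolding local_orientation_def deg local_algebra_eq w(2) GX.coset_eq L_def
    by (rule LX.exterior_lift_coset) (use Lnull in \<open>auto simp: L_def\<close>)
  have ex: "\<exists>c\<in>carrier Zl. frag_of ys - LX.SC c (L w) \<in> LX.NU" if "ys \<in> LX.TU" for ys
  proof (rule LX.multiples_of_generator[OF half wT _ _ _ _ that, where Gs = "hp ` carrier OF"])
    show "hp ` carrier OF \<subseteq> carrier BC" using pure_closed[OF _ B.one_closed] by blast
    show "hp ` carrier OF \<noteq> {}" using OF_closed(5) by blast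
  next
    fix P t assume t: "t \<in> carrier BC" and P: "P \<zero>\<^bsub>BC\<^esub>" "\<And>x y. x \<in> carrier BC \<Longrightarrow> y \<in> carrier BC \<Longrightarrow> P x \<Longrightarrow> P y \<Longrightarrow> P (x \<ominus>\<^bsub>BC\<^esub> y)"
      "\<And>c s. c \<in> carrier Zl \<Longrightarrow> s \<in> hp ` carrier OF \<Longrightarrow> P (c \<odot>\<^bsub>BC\<^esub> s)"
    show "P t"
    proof (rule BC_induct[OF t P(1,2)])
      fix a b assume ab: "a \<in> carrier OF" "b \<in> carrier Zl"
      then have "P (b \<odot>\<^bsub>BC\<^esub> hp a)" by (intro P(3)) auto
      then show "P (pure a b)" using smult_pure[OF ab(1) B.one_closed ab(2)] ab by simp
    qed
  next
    fix ys assume ys: "ys \<in> LX.TU" "set ys \<subseteq> hp ` carrier OF"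
    then have "\<forall>y\<in>set ys. \<exists>a. a \<in> carrier OF \<and> y = hp a" by blast
    then obtain f where f: "\<And>y. y \<in> set ys \<Longrightarrow> f y \<in> carrier OF \<and> y = hp (f y)" by metis
    have T: "map f ys \<in> GX.TU" using f LX.tuples_length[OF ys(1)] by (auto simp: tuples_def simp del: integer_algebra_simps)
    have m: "map hp (map f ys) = ys" using f by (simp add: map_idI)
    from w(3)[OF T] obtain k where "frag_of (map f ys) - frag_cmul k w \<in> GX.NU" by blast
    from Lnull[OF this] have 1: "frag_of ys - frag_cmul k (L w) \<in> LX.NU"
      unfolding L_def by (simp only: frag_extend_diff frag_extend_of frag_extend_cmul m)
    obtain c where c: "c \<in> carrier Zl" "frag_cmul k (L w) - LX.SC c (L w) \<in> LX.NU" using LX.SC_of_int[OF wT] by blast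
    from LX.null_add[OF 1 c(2)] show "\<exists>c\<in>carrier Zl. frag_of ys - LX.SC c (L w) \<in> LX.NU" using c(1) by auto
  qed
  define ys where "ys = map (\<lambda>i. x [^]\<^bsub>BC\<^esub> i) [0..<n]"
  have xB: "x \<in> carrier BC" using x by (simp only: local_algebra_eq)
  have ysT: "ys \<in> LX.TU" using xB by (auto simp: ys_def tuples_def)
  obtain c where c: "c \<in> carrier Zl" "frag_of ys - LX.SC c (L w) \<in> LX.NU" using ex[OF ysT] by blast
  let ?W = "frag_eval \<Delta> w"
  have W: "\<bar>?W\<bar> = int g ^ (n - 1)" by (rule orientation_value[OF w(1,3)])
  have cop: "coprime ?W (int l ^ j)" for j
  proof -
    have "coprime l g" using l_prime l_g by (rule prime_imp_coprime)
    then have "coprime (int g ^ (n - 1)) (int l ^ j)" by (simp add: coprime_commute)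
    then show ?thesis using W by (metis coprime_abs_left_iff)
  qed
  have val: "[leibniz_form n (EJ j) ys = d j * ?W] (mod int l ^ j)" if "d \<in> carrier Zl" "frag_of ys - LX.SC d (L w) \<in> LX.NU" for d j
    using local_wedge_value[OF w(1) that[unfolded L_def]] .
  have uniq: "d = c" if d: "d \<in> carrier Zl" "frag_of ys - LX.SC d (L w) \<in> LX.NU" for d
  proof
    fix j
    have "[d j * ?W = c j * ?W] (mod int l ^ j)" using val[OF d, of j] val[OF c, of j] cong_sym cong_trans by blast
    then have "[d j = c j] (mod int l ^ j)" using cong_mult_rcancel[OF cop] by blast
    moreover have "d j \<in> {0..<int l ^ j}" "c j \<in> {0..<int l ^ j}" using d(1) c(1) by (auto simp: padic_int_ring_def)
    ultimately show "d j = c j" by (auto intro: cong_less_imp_eq_int)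
  qed
  have "local_index_form F l \<omega> x = (THE d. d \<in> carrier Zl \<and> wedge Zl BC ys = exterior_smult n Zl BC d (LX.NU #>\<^bsub>LX.FA\<^esub> L w))"
    unfolding local_index_form_def index_form_def deg local_algebra_eq lor ys_def ..
  also have "\<dots> = (THE d. d \<in> carrier Zl \<and> frag_of ys - LX.SC d (L w) \<in> LX.NU)"
  proof -
    have "length ys = n" by (simp add: ys_def)
    then have *: "wedge Zl BC ys = exterior_smult n Zl BC d (LX.NU #>\<^bsub>LX.FA\<^esub> L w) \<longleftrightarrow> frag_of ys - LX.SC d (L w) \<in> LX.NU"
      if "d \<in> carrier Zl" for d
      using LX.exterior_smult_coset[OF half that, of "L w"] LX.wedge_eq[of ys] LX.coset_eq_iff by simp
    have "(\<lambda>d. d \<in> carrier Zl \<and> wedge Zl BC ys = exterior_smult n Zl BC d (LX.NU #>\<^bsub>LX.FA\<^esub> L w))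
       = (\<lambda>d. d \<in> carrier Zl \<and> frag_of ys - LX.SC d (L w) \<in> LX.NU)"
      by (intro ext conj_cong refl *)
    then show ?thesis by (rule arg_cong[where f = The])
  qed
  also have "\<dots> = c"
  proof (rule the_equality)
    show "c \<in> carrier Zl \<and> frag_of ys - LX.SC c (L w) \<in> LX.NU" by (intro conjI c)
    show "d = c" if "d \<in> carrier Zl \<and> frag_of ys - LX.SC d (L w) \<in> LX.NU" for d
      by (rule uniq[OF conjunct1[OF that] conjunct2[OF that]])
  qed
  finally have ceq: "c = [\<epsilon>] \<cdot>\<^bsub>Zl\<^esub> \<one>\<^bsub>Zl\<^esub>" using eq by simp
  have c1: "[c 1 = \<epsilon>] (mod int l)"
  proof (cases "\<epsilon> = 1")
    case True
    then have "c = \<one>\<^bsub>Zl\<^esub>" using ceq B.add.int_pow_1[OF B.one_closed] by simp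
    then show ?thesis using True by (simp add: padic_int_ring_def cong_def)
  next
    case False
    then have "\<epsilon> = - 1" using \<epsilon> by simp
    then have "c = \<ominus>\<^bsub>Zl\<^esub> \<one>\<^bsub>Zl\<^esub>" using ceq B.add.int_pow_neg[OF B.one_closed, of 1] B.add.int_pow_1[OF B.one_closed] by simp
    then have "c \<oplus>\<^bsub>Zl\<^esub> \<one>\<^bsub>Zl\<^esub> = \<zero>\<^bsub>Zl\<^esub>" using B.l_neg[OF B.one_closed] by simp
    then have "(c \<oplus>\<^bsub>Zl\<^esub> \<one>\<^bsub>Zl\<^esub>) 1 = \<zero>\<^bsub>Zl\<^esub> 1" by simp
    then have "(c 1 + 1) mod int l = 0" by (simp add: padic_int_ring_def mod_simps)
    then show ?thesis using \<open>\<epsilon> = - 1\<close> by (simp add: cong_iff_dvd_diff dvd_eq_mod_eq_0)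
  qed
  let ?\<xi> = "red 1 x"
  have \<xi>: "?\<xi> \<in> carrier OF" by (rule red_OF[OF xB])
  have "[\<Delta> (map (\<lambda>k. ?\<xi> ^ k) [0..<n]) = leibniz_form n (EJ 1) ys] (mod int l ^ 1)"
  proof (rule cong_sym, rule leibniz_form_cong)
    fix i k assume "i < n" "k < n"
    have "x [^]\<^bsub>BC\<^esub> k \<in> carrier BC" using xB by simp
    from ec_mrel[OF red_power[OF xB, of 1 k] red_OF[OF this] OF_power[OF \<xi>]]
    show "[EJ 1 i (ys ! k) = ec i (map (\<lambda>k. ?\<xi> ^ k) [0..<n] ! k)] (mod int l ^ 1)"
      using \<open>k < n\<close> by (simp add: ys_def)
  qed
  also have "[leibniz_form n (EJ 1) ys = c 1 * ?W] (mod int l ^ 1)" by (rule val[OF c])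
  also have "[c 1 * ?W = \<epsilon> * ?W] (mod int l ^ 1)" using c1 by (intro cong_mult cong_refl) simp
  finally have fin: "[\<Delta> (map (\<lambda>k. ?\<xi> ^ k) [0..<n]) = \<epsilon> * ?W] (mod int l)" by simp
  have "?W = int g ^ (n - 1) \<or> ?W = - (int g ^ (n - 1))" using W by linarith
  then have "\<exists>s. (s = 1 \<or> s = -1) \<and> \<epsilon> * ?W = s * int g ^ (n - 1)"
  proof
    assume "?W = int g ^ (n - 1)"
    then show ?thesis using \<epsilon> by (intro exI[of _ \<epsilon>]) simp
  next
    assume "?W = - (int g ^ (n - 1))"
    then show ?thesis using \<epsilon> by (intro exI[of _ "- \<epsilon>"]) auto
  qed
  then obtain s where "s = 1 \<or> s = -1" "\<epsilon> * ?W = s * int g ^ (n - 1)" by blast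
  with fin show ?thesis by (intro bexI[OF _ \<xi>] exI[of _ s]) simp
qed

end

section \<open>The index form at a totally ramified prime\<close>

definition ldet :: "nat \<Rightarrow> (nat \<Rightarrow> nat \<Rightarrow> int) \<Rightarrow> int" where
  "ldet n f = leibniz_form n (\<lambda>i k. f k i) [0..<n]"

lemma ldet_det: "ldet n f = det (mat n n (\<lambda>(k,i). f k i))"
  unfolding ldet_def leibniz_form_det by (rule arg_cong[where f = det]) (auto intro!: eq_matI)

lemma leibniz_form_ldet: "leibniz_form n E (map h [0..<n]) = ldet n (\<lambda>k i. E i (h k))"
  unfolding ldet_det leibniz_form_det by (rule arg_cong[where f = det]) (auto intro!: eq_matI)

lemma ldet_scale_rows: "ldet n (\<lambda>k i. c k * f k i) = (\<Prod>k<n. c k) * ldet n f"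
proof -
  have "ldet n (\<lambda>k i. c k * f k i) = (\<Sum>p | p permutes {0..<n}. signof p * (\<Prod>k\<in>{0..<n}. c k * f k (p k)))"
    by (auto simp: ldet_def leibniz_form_def intro!: sum.cong prod.cong)
  also have "\<dots> = (\<Sum>p | p permutes {0..<n}. (\<Prod>k<n. c k) * (signof p * (\<Prod>k\<in>{0..<n}. f k (p k))))"
    by (intro sum.cong refl) (simp only: prod.distrib lessThan_atLeast0 mult_ac)
  also have "\<dots> = (\<Prod>k<n. c k) * ldet n f"
    unfolding sum_distrib_left[symmetric] by (rule arg_cong[where f = "(*) _"]) (auto simp: ldet_def leibniz_form_def intro!: sum.cong prod.cong)
  finally show ?thesis .
qed

lemma ldet_cong:
  assumes "\<And>i k. i < n \<Longrightarrow> k < n \<Longrightarrow> [f k i = f' k i] (mod q)"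
  shows "[ldet n f = ldet n f'] (mod q)"
  unfolding ldet_def by (rule leibniz_form_cong) (use assms in simp)

lemma sum_lessThan_id: "(\<Sum>k<n. k) = n * (n - 1) div (2::nat)"
proof -
  have "(\<Sum>k<n. k) = (\<Sum>k = 0..n - 1. k)" if "n > 0"
    using that by (intro sum.cong) auto
  then show ?thesis by (cases "n = 0") (auto simp: gauss_sum_nat mult.commute)
qed

lemma coeff_power_X_times:
  fixes v :: "int poly"
  assumes "coeff v 0 = 0"
  shows "i < k \<Longrightarrow> coeff (v ^ k) i = 0" "coeff (v ^ k) k = coeff v 1 ^ k"
proof -
  obtain c u where u: "v = pCons c u" by (cases v)
  then have u: "v = [:0, 1:] * u" using assms by simp
  have "v ^ k = Polynomial.monom 1 k * u ^ k"
    unfolding u power_mult_distrib by (simp add: monom_altdef)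
  then have c: "coeff (v ^ k) i = (if i < k then 0 else coeff (u ^ k) (i - k))" for i
    by (simp add: coeff_monom_mult)
  show "i < k \<Longrightarrow> coeff (v ^ k) i = 0" by (simp add: c)
  have "coeff (u ^ k) 0 = coeff u 0 ^ k" by (simp add: coeff_0_power)
  moreover have "coeff v 1 = coeff u 0" by (simp add: u)
  ultimately show "coeff (v ^ k) k = coeff v 1 ^ k" by (simp add: c)
qed

text \<open>
  Subtracting the constant term from \<open>u\<close> amounts to a unipotent change of rows, given by binomial coefficients, after which
  the matrix is triangular.
\<close>
lemma ldet_powers: "ldet n (\<lambda>k i. coeff (u ^ k) i) = coeff u 1 ^ (n * (n - 1) div 2)"
proof -
  define c where "c = coeff u 0"
  define v where "v = u - [:c:]"
  have v: "coeff v 0 = 0" "coeff v 1 = coeff u 1" by (simp_all add: v_def c_def)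
  have uv: "u = v + [:c:]" by (simp add: v_def)
  let ?P = "mat n n (\<lambda>(k,j). int (k choose j) * c ^ (k - j))" and ?V = "mat n n (\<lambda>(j,i). coeff (v ^ j) i)"
  have "mat n n (\<lambda>(k,i). coeff (u ^ k) i) = ?P * ?V"
  proof (rule eq_matI)
    fix k i assume "k < dim_row (?P * ?V)" "i < dim_col (?P * ?V)"
    then have k: "k < n" "i < n" by auto
    have "u ^ k = (\<Sum>j\<le>k. of_nat (k choose j) * v ^ j * [:c:] ^ (k - j))"
      unfolding uv by (rule binomial_ring)
    also have "\<dots> = (\<Sum>j\<le>k. smult (int (k choose j) * c ^ (k - j)) (v ^ j))"
      by (intro sum.cong) (simp_all add: poly_const_pow of_nat_poly mult_ac)
    finally have "coeff (u ^ k) i = (\<Sum>j\<le>k. int (k choose j) * c ^ (k - j) * coeff (v ^ j) i)"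
      by (simp add: coeff_sum)
    also have "\<dots> = (\<Sum>j<n. int (k choose j) * c ^ (k - j) * coeff (v ^ j) i)"
      using k by (intro sum.mono_neutral_left) (auto simp: binomial_eq_0)
    finally show "mat n n (\<lambda>(k,i). coeff (u ^ k) i) $$ (k, i) = (?P * ?V) $$ (k, i)"
      using k by (simp add: scalar_prod_def atLeast0LessThan)
  qed auto
  then have "ldet n (\<lambda>k i. coeff (u ^ k) i) = det ?P * det ?V"
    by (simp add: ldet_det det_mult[of _ n])
  also have "det ?P = 1"
  proof -
    have "det ?P = prod_list (diag_mat ?P)" by (rule det_lower_triangular[of n]) (auto simp: binomial_eq_0)
    also have "\<dots> = 1" by (simp add: prod_list_diag_prod)
    finally show ?thesis .
  qed
  also have "det ?V = prod_list (diag_mat ?V)"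
    by (rule det_upper_triangular[of _ n]) (auto simp: coeff_power_X_times(1)[OF v(1)])
  also have "\<dots> = (\<Prod>k<n. coeff u 1 ^ k)"
    by (simp add: prod_list_diag_prod coeff_power_X_times(2)[OF v(1)] v(2)[simplified] atLeast0LessThan)
  also have "\<dots> = coeff u 1 ^ (n * (n - 1) div 2)" by (simp add: power_sum[symmetric] sum_lessThan_id)
  finally show ?thesis by simp
qed

context monogenic_order_at
begin

text \<open>
  Modulo \<open>l\<close> the minimal polynomial is \<open>X\<^sup>n\<close>, so the coordinates of \<open>\<xi>\<^sup>k\<close> are, up to powers of \<open>g\<close>, the low coefficients
  of \<open>u\<^sup>k\<close>, whose determinant is a power of the linear coefficient of \<open>u\<close>.  Since \<open>g\<close> is invertible modulo \<open>l\<close>, its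
  powers can be absorbed into \<open>a\<close>, except for one factor.
\<close>
lemma totally_ramified_power_residue:
  assumes Hm: "H = Polynomial.monom 1 n - [:m:]" and lm: "int l dvd m"
    and \<xi>: "\<xi> \<in> carrier OF" and s: "s = 1 \<or> s = (-1::int)"
    and eq: "[\<Delta> (map (\<lambda>k. \<xi> ^ k) [0..<n]) = s * int g ^ (n - 1)] (mod int l)"
  shows "\<exists>a. [int g * a ^ (n * (n - 1) div 2) = s] (mod int l)"
proof -
  define N where "N = n * (n - 1) div 2"
  define u where "u = cf \<xi>"
  have u: "ipoly u \<alpha> = of_nat g * \<xi>" using cf[OF \<xi>] by (simp add: u_def)
  have key: "[int g ^ k * ec i (\<xi> ^ k) = int g * poly.coeff (u ^ k) i] (mod int l)" if "i < n" for i k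
  proof -
    have \<xi>k: "\<xi> ^ k \<in> carrier OF" by (rule OF_power[OF \<xi>])
    obtain r where r: "Polynomial.degree r < Polynomial.degree H" "ipoly (u ^ k) \<alpha> = ipoly r \<alpha>" "H dvd u ^ k - r"
      using min_int_poly_of_reduce[OF H] by blast
    have "ec i (ipoly r \<alpha>) = int g * poly.coeff r i" using r(1) n by (intro ec_ipoly) simp
    moreover have "ipoly r \<alpha> = of_int (int g ^ k) * \<xi> ^ k" using r(2) u by (simp add: power_mult_distrib)
    ultimately have 1: "int g ^ k * ec i (\<xi> ^ k) = int g * poly.coeff r i" by (simp only: ec_int_mult[OF \<xi>k])
    from r(3) obtain q where q: "u ^ k - r = H * q" by blast
    have "H * q = Polynomial.monom 1 n * q - smult m q" unfolding Hm by (simp add: left_diff_distrib)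
    then have "poly.coeff (u ^ k - r) i = - (m * poly.coeff q i)" using that by (simp add: q coeff_monom_mult)
    then have "int l dvd poly.coeff (u ^ k) i - poly.coeff r i" using lm by simp
    then have "[poly.coeff r i = poly.coeff (u ^ k) i] (mod int l)" by (simp add: cong_iff_dvd_diff dvd_diff_commute)
    then show ?thesis unfolding 1 by (intro cong_mult cong_refl)
  qed
  have "[int g ^ N * \<Delta> (map (\<lambda>k. \<xi> ^ k) [0..<n]) = int g ^ n * poly.coeff u 1 ^ N] (mod int l)"
  proof -
    have "int g ^ N * \<Delta> (map (\<lambda>k. \<xi> ^ k) [0..<n]) = ldet n (\<lambda>k i. int g ^ k * ec i (\<xi> ^ k))"
      by (simp add: leibniz_form_ldet ldet_scale_rows power_sum[symmetric] sum_lessThan_id N_def)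
    also have "[\<dots> = ldet n (\<lambda>k i. int g * poly.coeff (u ^ k) i)] (mod int l)"
      by (rule ldet_cong) (rule key)
    also have "ldet n (\<lambda>k i. int g * poly.coeff (u ^ k) i) = int g ^ n * poly.coeff u 1 ^ N"
      by (simp add: ldet_scale_rows ldet_powers N_def)
    finally show ?thesis .
  qed
  moreover have "[int g ^ N * \<Delta> (map (\<lambda>k. \<xi> ^ k) [0..<n]) = int g ^ N * (s * int g ^ (n - 1))] (mod int l)"
    by (intro cong_mult cong_refl eq)
  ultimately have "[int g ^ n * poly.coeff u 1 ^ N = int g ^ N * (s * int g ^ (n - 1))] (mod int l)"
    using cong_sym cong_trans by blast
  then have "[int g ^ (n - 1) * (int g * poly.coeff u 1 ^ N) = int g ^ (n - 1) * (s * int g ^ N)] (mod int l)"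
    using n_pos by (simp add: power_eq_if mult_ac)
  moreover have cop: "coprime (int g) (int l)"
    using prime_imp_coprime[OF l_prime l_g] by (simp add: coprime_commute)
  then have "coprime (int g ^ (n - 1)) (int l)" by simp
  ultimately have c: "[int g * poly.coeff u 1 ^ N = s * int g ^ N] (mod int l)"
    using cong_mult_lcancel by blast
  obtain h where h: "[int g * h = 1] (mod int l)" using cong_solve_coprime_int[OF cop] by blast
  have "int g * (poly.coeff u 1 * h) ^ N = (int g * poly.coeff u 1 ^ N) * h ^ N" by (simp add: power_mult_distrib)
  also have "[\<dots> = (s * int g ^ N) * h ^ N] (mod int l)" by (intro cong_mult cong_refl c)
  also have "(s * int g ^ N) * h ^ N = s * (int g * h) ^ N" by (simp add: power_mult_distrib)
  also have "[\<dots> = s * 1 ^ N] (mod int l)" by (intro cong_mult cong_refl cong_pow h)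
  finally show ?thesis unfolding N_def[symmetric] by auto
qed

end

theorem index_form_power_residue:
  fixes m :: int
  assumes irr: "min_int_poly_of (Polynomial.monom 1 n - [:m:]) \<alpha>" and n: "n > 0"
    and idx: "power_order_index \<alpha> = g" "g > 0"
    and solv: "fixed_sign_locally_solvable (adjoin {\<alpha>})"
    and l: "Factorial_Ring.prime l" "odd l" "\<not> l dvd g" "int l dvd m"
  shows "\<exists>a s. (s = 1 \<or> s = -1) \<and> [int g * a ^ (n * (n - 1) div 2) = s] (mod int l)"
proof -
  have deg: "degree (Polynomial.monom 1 n - [:m:]) = n"
  proof -
    have "degree (Polynomial.monom 1 n + [:- m:]) = n"
      using n by (subst degree_add_eq_left) (auto simp: degree_monom_eq)
    moreover have e: "Polynomial.monom 1 n - [:m:] = Polynomial.monom 1 n + [:- m:]"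
      by (simp add: poly_eq_iff coeff_pCons split: nat.split)
    ultimately show ?thesis by (simp only: e)
  qed
  interpret monogenic_order_at "Polynomial.monom 1 n - [:m:]" \<alpha> n g l
    by unfold_locales (use assms deg in auto)
  from solv obtain \<omega> \<epsilon> x where "orientation F \<omega>" "\<epsilon> = 1 \<or> \<epsilon> = (-1::int)" "x \<in> carrier (local_algebra F l)"
    "local_index_form F l \<omega> x = [\<epsilon>] \<cdot>\<^bsub>padic_int_ring l\<^esub> \<one>\<^bsub>padic_int_ring l\<^esub>"
    unfolding fixed_sign_locally_solvable_def using l(1) by blast
  from local_index_form_unit[OF this] obtain \<xi> s where "\<xi> \<in> carrier OF" "s = 1 \<or> s = -1"
    "[\<Delta> (map (\<lambda>k. \<xi> ^ k) [0..<n]) = s * int g ^ (n - 1)] (mod int l)" by blast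
  from totally_ramified_power_residue[OF refl l(4) this] this(2) show ?thesis by blast
qed

section \<open>The primes that cannot divide the parameter\<close>

text \<open>
  With a primitive root \<open>w\<close> modulo \<open>p\<close>, the element \<open>w\<close> to the power \<open>(p - 1) / 2\<close> is \<open>-1\<close>, and \<open>(p - 1) / 2\<close> is a multiple of \<open>N\<close>.
\<close>
lemma minus_one_is_power_mod_prime:
  assumes p: "prime p" "[p = 1] (mod (2 * N))" and N: "N > 0"
  shows "\<exists>b::int. [b ^ N = -1] (mod int p)"
proof -
  have p1: "p > 1" by (rule prime_gt_1_nat[OF p(1)])
  have "2 * N dvd p - 1" using p(2) p1 by (simp add: cong_altdef_nat cong_sym_eq)
  then obtain m where m: "p - 1 = 2 * N * m" by blast
  have m0: "m > 0" using m p1 by (intro Nat.gr0I) auto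
  obtain w where w: "residue_primroot p w" using prime_primitive_root_exists[OF p1 p(1)] by blast
  have ord: "ord p w = 2 * N * m" "coprime p w" unfolding m[symmetric] using w p(1) by (simp_all add: residue_primroot_def totient_prime)
  define b where "b = w ^ m"
  have bN: "b ^ N = w ^ (N * m)" by (simp add: b_def power_mult[symmetric] mult.commute)
  have "\<not> 2 * N * m dvd N * m" using N m0 by (auto dest: dvd_imp_le)
  then have "\<not> [w ^ (N * m) = 1] (mod p)" unfolding ord_divides ord .
  then have n1: "\<not> [int (b ^ N) = int 1] (mod int p)" unfolding bN cong_int_iff .
  have "[w ^ (2 * N * m) = 1] (mod p)" unfolding ord_divides ord by simp
  then have "[int (w ^ (2 * N * m)) = int 1] (mod int p)" unfolding cong_int_iff .
  moreover have "w ^ (2 * N * m) = (b ^ N) ^ 2" by (simp add: bN power_mult[symmetric] mult_ac)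
  ultimately have "int p dvd (int (b ^ N))\<^sup>2 - 1" by (simp add: cong_iff_dvd_diff)
  then have "int p dvd (int (b ^ N) - 1) * (int (b ^ N) + 1)" by (simp add: power2_eq_square algebra_simps)
  then have "int p dvd int (b ^ N) - 1 \<or> int p dvd int (b ^ N) + 1" using p(1) by (simp only: prime_dvd_mult_iff prime_nat_int_transfer)
  moreover have "\<not> int p dvd int (b ^ N) - 1" using n1 by (simp add: cong_iff_dvd_diff)
  ultimately have "[int b ^ N = -1] (mod int p)" by (simp add: cong_iff_dvd_diff)
  then show ?thesis by blast
qed

lemma power_residue_of_signed_relation:
  assumes p: "prime p" "[p = 1] (mod (2 * N))" and N: "N > 0"
    and rel: "[g * a ^ N = s] (mod int p)" "s = 1 \<or> s = -1"
  shows "\<exists>r. [r ^ N = g] (mod int p)"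
proof -
  obtain b :: int where b: "[b ^ N = s] (mod int p)"
  proof (cases "s = 1")
    case True
    then show ?thesis using that[of 1] by simp
  next
    case False
    then show ?thesis using minus_one_is_power_mod_prime[OF p N] rel(2) that by blast
  qed
  have "\<not> int p dvd a"
  proof
    assume "int p dvd a"
    then have "int p dvd a ^ N" using N by (meson dvd_power dvd_trans)
    then have "int p dvd g * a ^ N" by (rule dvd_mult)
    then have "int p dvd s" using cong_dvd_iff[OF rel(1)] by simp
    then have "int p dvd 1" using rel(2) by auto
    then show False using prime_gt_1_nat[OF p(1)] by simp
  qed
  then have "coprime a (int p)" using prime_imp_coprime[of "int p" a] p(1) by (simp add: coprime_commute)
  then obtain a' where a': "[a * a' = 1] (mod int p)" using cong_solve_coprime_int by blast
  have "[(b * a') ^ N = s * a' ^ N] (mod int p)" unfolding power_mult_distrib by (rule cong_mult[OF b cong_refl])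
  also have "[s * a' ^ N = (g * a ^ N) * a' ^ N] (mod int p)" by (rule cong_mult[OF cong_sym[OF rel(1)] cong_refl])
  also have "(g * a ^ N) * a' ^ N = g * (a * a') ^ N" by (simp add: power_mult_distrib)
  also have "[g * (a * a') ^ N = g * 1 ^ N] (mod int p)" by (rule cong_mult[OF cong_refl cong_pow[OF a']])
  finally show ?thesis by (intro exI[of _ "b * a'"]) simp
qed

lemma radical_poly: 
  assumes "k > 0"
  shows "degree (Polynomial.monom 1 k - [:a:] :: int poly) = k" "lead_coeff (Polynomial.monom 1 k - [:a:] :: int poly) = 1"
proof -
  have eq: "Polynomial.monom (1::int) k - [:a:] = Polynomial.monom 1 k + [:-a:]" by simp
  show 1: "degree (Polynomial.monom 1 k - [:a:] :: int poly) = k"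
    unfolding eq using assms by (subst degree_add_eq_left) (simp_all add: degree_monom_eq)
  show "lead_coeff (Polynomial.monom 1 k - [:a:] :: int poly) = 1" unfolding 1 using assms by (cases k) simp_all
qed

lemma algebraic_int_radical:
  fixes z :: complex
  assumes "z ^ k = of_int a" "k > 0"
  shows "algebraic_int z"
  unfolding algebraic_int_altdef_ipoly
proof (intro exI conjI)
  show "ipoly (Polynomial.monom 1 k - [:a:]) z = 0" using assms(1) by simp
qed (rule radical_poly(2)[OF assms(2)])

text \<open>
  Irreducibility over \<open>\<rat>\<close> leaves no proper monic factor over \<open>\<int>\<close>.
\<close>
lemma min_int_poly_of_radical:
  assumes irr: "irreducible (Polynomial.monom 1 n - [:of_int m:] :: rat poly)" and n: "n > 0" and \<alpha>: "\<alpha> ^ n = of_int m"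
  shows "min_int_poly_of (Polynomial.monom 1 n - [:m:]) \<alpha>"
proof -
  define P :: "int poly" where "P = Polynomial.monom 1 n - [:m:]"
  obtain G where G: "min_int_poly_of G \<alpha>" using min_int_poly_of_exists[OF algebraic_int_radical[OF \<alpha> n]] by blast
  have "ipoly P \<alpha> = 0" using \<alpha> by (simp add: P_def)
  then obtain k where k: "P = G * k" using min_int_poly_of_dvd[OF G] by blast
  have lk: "lead_coeff k = 1"
    using radical_poly(2)[OF n, of m] min_int_poly_of_monic[OF G] unfolding P_def[symmetric] k lead_coeff_mult by simp
  have "map_poly of_int P = (Polynomial.monom 1 n - [:of_int m:] :: rat poly)"
    unfolding P_def of_int_poly_hom.hom_minus by (simp add: map_poly_monom of_int_hom.map_poly_pCons_hom)
  then have "irreducible (map_poly of_int G * map_poly of_int k :: rat poly)"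
    using irr unfolding k of_int_poly_hom.hom_mult by simp
  then have "map_poly of_int G dvd (1 :: rat poly) \<or> map_poly of_int k dvd (1 :: rat poly)"
    by (rule Factorial_Ring.irreducibleD) simp
  then have "degree (map_poly of_int G :: rat poly) \<le> 0 \<or> degree (map_poly of_int k :: rat poly) \<le> 0"
    using dvd_imp_degree_le[of _ "1 :: rat poly"] by auto
  then have "degree G = 0 \<or> degree k = 0" by (simp add: degree_map_poly)
  then have "degree k = 0" using min_int_poly_of_degree_pos[OF G] by simp
  then obtain e where "k = [:e:]" using degree_eq_zeroE by blast
  then have "k = 1" using lk by simp
  then show ?thesis using G k by (simp add: P_def)
qed

definition obstructing_primes :: "nat \<Rightarrow> nat \<Rightarrow> nat set" where
  "obstructing_primes N g = {p. prime p \<and> [p = 1] (mod (2 * N)) \<and> \<not> int p dvd int g \<and> \<not> (\<exists>r. [r ^ N = int g] (mod int p))}"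

lemma pure_field_params_sqfree_over:
  assumes m: "m \<in> pure_field_params n g x" and n: "n > 0" and N: "N = n * (n - 1) div 2" "N > 0" and g: "g > 0"
  shows "nat \<bar>m\<bar> \<in> sqfree_over (- obstructing_primes N g) (nat \<lfloor>x\<rfloor>)"
proof -
  from m obtain \<alpha> where le: "\<bar>real_of_int m\<bar> \<le> x" and sf: "squarefree m"
    and irr: "irreducible (Polynomial.monom 1 n - [:of_int m:] :: rat poly)"
    and \<alpha>: "\<alpha> ^ n = of_int m" "power_order_index \<alpha> = g" "fixed_sign_locally_solvable (adjoin {\<alpha>})"
    by (auto simp: pure_field_params_def)
  have m0: "m \<noteq> 0" using sf by auto
  have "real_of_int \<bar>m\<bar> \<le> x" using le by simp
  then have "\<bar>m\<bar> \<le> \<lfloor>x\<rfloor>" by (simp only: le_floor_iff)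
  moreover have "squarefree (nat \<bar>m\<bar>)"
  proof (rule squarefreeI)
    fix k assume "k ^ 2 dvd nat \<bar>m\<bar>"
    then have "int (k ^ 2) dvd int (nat \<bar>m\<bar>)" by (simp only: int_dvd_int_iff)
    then have "(int k) ^ 2 dvd m" by simp
    then have "is_unit (int k)" using sf squarefreeD by blast
    then show "is_unit k" by simp
  qed
  moreover have "prime_factors (nat \<bar>m\<bar>) \<subseteq> - obstructing_primes N g"
  proof
    fix p assume p: "p \<in> prime_factors (nat \<bar>m\<bar>)"
    then have pr: "prime p" "p dvd nat \<bar>m\<bar>" by (simp_all add: prime_factors_dvd m0)
    then have "int p dvd int (nat \<bar>m\<bar>)" by (simp only: int_dvd_int_iff)
    then have pm: "int p dvd m" by simp
    show "p \<in> - obstructing_primes N g"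
    proof (rule ComplI)
      assume "p \<in> obstructing_primes N g"
      then have ob: "[p = 1] (mod (2 * N))" "\<not> p dvd g" "\<not> (\<exists>r. [r ^ N = int g] (mod int p))"
        by (simp_all add: obstructing_primes_def)
      have "odd p"
      proof
        assume "even p"
        then have "p = 2" using pr(1) primes_dvd_imp_eq[of 2 p] by simp
        moreover have "2 * N dvd p - 1" using ob(1) prime_gt_1_nat[OF pr(1)] by (simp add: cong_altdef_nat cong_sym_eq)
        ultimately show False using N(2) by (auto dest: dvd_imp_le)
      qed
      obtain a s where "s = 1 \<or> s = -1" "[int g * a ^ N = s] (mod int p)"
        using index_form_power_residue[OF min_int_poly_of_radical[OF irr n \<alpha>(1)] n \<alpha>(2) g \<alpha>(3) pr(1) \<open>odd p\<close> ob(2) pm] N(1) by blast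
      then show False using power_residue_of_signed_relation[OF pr(1) ob(1) N(2)] ob(3) by blast
    qed
  qed
  ultimately show ?thesis using m0 by (simp add: sqfree_over_def nat_mono)
qed

lemma card_pure_field_params_le:
  assumes n: "n > 0" and N: "N = n * (n - 1) div 2" "N > 0" and g: "g > 0"
  shows "card (pure_field_params n g x) \<le> 2 * card (sqfree_over (- obstructing_primes N g) (nat \<lfloor>x\<rfloor>))"
proof -
  let ?S = "sqfree_over (- obstructing_primes N g) (nat \<lfloor>x\<rfloor>)"
  have "pure_field_params n g x \<subseteq> int ` ?S \<union> (\<lambda>k. - int k) ` ?S"
  proof
    fix m assume "m \<in> pure_field_params n g x"
    then have "nat \<bar>m\<bar> \<in> ?S" by (rule pure_field_params_sqfree_over[OF _ n N g])
    moreover have "m = int (nat \<bar>m\<bar>) \<or> m = - int (nat \<bar>m\<bar>)" by auto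
    ultimately show "m \<in> int ` ?S \<union> (\<lambda>k. - int k) ` ?S" by blast
  qed
  then have "card (pure_field_params n g x) \<le> card (int ` ?S \<union> (\<lambda>k. - int k) ` ?S)" by (intro card_mono) auto
  also have "\<dots> \<le> card (int ` ?S) + card ((\<lambda>k. - int k) ` ?S)" by (rule card_Un_le)
  also have "\<dots> \<le> card ?S + card ?S" by (intro add_mono card_image_le) auto
  finally show ?thesis by simp
qed

text \<open>
  The roots \<open>\<zeta>\<^sup>j\<close> with \<open>j\<close> prime to \<open>q\<close> give one inequality.  For the other, every prime congruent to 1 splits completely in
  \<open>\<rat>(\<zeta>)\<close>, so that the upper bound for split primes contradicts Dirichlet's theorem if the degree is larger.
\<close>
lemma degree_cyclotomic:
  assumes q: "q \<ge> 2" and h: "min_int_poly_of h (cis (2 * pi / real q))"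
  shows "degree h = totient q"
proof (rule antisym)
  define \<zeta> where "\<zeta> = cis (2 * pi / real q)"
  have h': "min_int_poly_of h \<zeta>" using h by (simp add: \<zeta>_def)
  have q0: "q > 0" using q by simp
  have \<zeta>q: "\<zeta> ^ q = 1" using q0 by (simp add: \<zeta>_def DeMoivre)
  have pow: "\<zeta> ^ j = cis (2 * pi * real j / real q)" for j by (simp add: \<zeta>_def DeMoivre mult_ac)
  have hd: "h dvd Polynomial.monom 1 q - [:1:]" by (rule min_int_poly_of_dvd[OF h']) (simp add: \<zeta>q)
  have h0: "map_poly of_int h \<noteq> (0 :: complex poly)" using min_int_poly_of_monic[OF h'] by auto
  have sub: "(\<lambda>j. \<zeta> ^ j) ` totatives q \<subseteq> {z. ipoly h z = 0}"
  proof (rule image_subsetI)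
    fix j assume "j \<in> totatives q"
    then have "coprime j q" "j > 0" by (auto simp: totatives_def)
    then show "\<zeta> ^ j \<in> {z. ipoly h z = 0}" using cyclotomic_roots[OF hd min_int_poly_of_root[OF h'] q0] by simp
  qed
  have "totatives q \<subseteq> {..<q}"
  proof
    fix j assume "j \<in> totatives q"
    then have j: "j \<le> q" "coprime j q" by (simp_all add: totatives_def)
    have "j \<noteq> q" using j(2) q by (intro notI) simp
    then show "j \<in> {..<q}" using j(1) by simp
  qed
  then have "inj_on (\<lambda>j. \<zeta> ^ j) (totatives q)"
    unfolding pow using bij_betw_imp_inj_on[OF bij_betw_roots_unity[OF q0]] inj_on_subset by blast
  then have "totient q = card ((\<lambda>j. \<zeta> ^ j) ` totatives q)" by (simp only: card_image totient_def)
  also have "\<dots> \<le> card {z. ipoly h z = 0}" by (rule card_mono[OF poly_roots_finite[OF h0] sub])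
  also have "\<dots> \<le> degree (map_poly of_int h :: complex poly)" by (rule card_poly_roots_bound[OF h0])
  also have "\<dots> = degree h" by (simp add: degree_map_poly)
  finally show "totient q \<le> degree h" .
  obtain C1 where C1: "\<And>y. y \<ge> 1 \<Longrightarrow> ln (real y) / real (totient q) - C1 \<le> (\<Sum>p | prime p \<and> [p = 1] (mod q) \<and> p \<le> y. ln (real p) / real p)"
    using primes_cong_1_lower[OF q] by blast
  have "\<exists>C. \<forall>y\<ge>2. (\<Sum>p | p \<in> {p. prime p \<and> [p = 1] (mod q)} \<and> p \<le> y. ln (real p) / real p) \<le> ln (real y) / real (degree h) + C"
  proof (rule frobenius_fixed_primes_upper[OF h'])
    fix p assume p: "p \<in> {p. prime p \<and> [p = 1] (mod q)}"
    then have pr: "prime p" "[p = 1] (mod q)" by simp_all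
    have p1: "p > 1" by (rule prime_gt_1_nat[OF pr(1)])
    have "q dvd p - 1" using pr(2) p1 by (simp add: cong_altdef_nat cong_sym_eq)
    then have "\<zeta> ^ (p - 1) = 1" using \<zeta>q by (auto simp: power_mult elim!: dvdE)
    then have "\<zeta> ^ p = \<zeta>" using power_minus_mult[of p \<zeta>] p1 by simp
    then have "of_int 1 * (\<zeta> ^ p - \<zeta>) = of_nat p * ipoly 0 \<zeta>" by simp
    moreover have "\<not> int p dvd 1" using p1 by simp
    ultimately show "prime p \<and> (p > 0 \<longrightarrow> (\<exists>D f. \<not> int p dvd D \<and> of_int D * (\<zeta> ^ p - \<zeta>) = of_nat p * ipoly f \<zeta>))"
      using pr(1) by blast
  qed
  then obtain C2 where C2: "\<And>y. y \<ge> 2 \<Longrightarrow> (\<Sum>p | prime p \<and> [p = 1] (mod q) \<and> p \<le> y. ln (real p) / real p) \<le> ln (real y) / real (degree h) + C2"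
    by (auto simp: conj_assoc)
  show "degree h \<le> totient q"
  proof (rule ccontr)
    assume "\<not> degree h \<le> totient q"
    moreover have "totient q > 0" using q0 by simp
    ultimately have "1 / real (degree h) < 1 / real (totient q)" by (intro divide_strict_left_mono) auto
    define e where "e = 1 / real (totient q) - 1 / real (degree h)"
    have e: "e > 0" using \<open>1 / real (degree h) < 1 / real (totient q)\<close> by (simp add: e_def)
    obtain y :: nat where y: "max 2 (exp ((C1 + C2) / e)) < real y" using reals_Archimedean2 by blast
    then have y2: "y \<ge> 2" "exp ((C1 + C2) / e) < exp (ln (real y))" by simp_all
    then have "(C1 + C2) / e < ln (real y)" by (simp only: exp_less_cancel_iff)
    then have "C1 + C2 < ln (real y) * e" using e by (simp only: pos_divide_less_eq)
    also have "\<dots> = ln (real y) / real (totient q) - ln (real y) / real (degree h)" by (simp add: e_def right_diff_distrib)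
    finally show False using C1[of y] C2[of y] y2(1) by simp
  qed
qed

section \<open>The counting bound\<close>

text \<open>
  A prime that is not obstructing and congruent to 1 modulo \<open>2 N\<close> divides \<open>g\<close> or has \<open>g\<close> as an \<open>N\<close>-th power residue;
  only the latter contribute to the main term.
\<close>
lemma nonobstructing_primes_upper:
  assumes N: "N > 0" and g: "g > 0" and dK: "dK = totient (2 * N)"
    and HL: "min_int_poly_of HL (\<zeta> + of_int c * \<gamma>)" and L: "adjoin {\<zeta>, \<gamma>} = adjoin {\<zeta> + of_int c * \<gamma>}"
    and \<zeta>: "\<zeta> ^ (2 * N) = 1" and \<gamma>: "\<gamma> ^ N = of_int (int g)"
  shows "\<exists>C. \<forall>y\<ge>2. (\<Sum>p | prime p \<and> p \<in> - obstructing_primes N g \<and> p \<le> y. ln (real p) / real p)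
    \<le> (1 - (1 / real dK - 1 / real (degree HL))) * ln (real y) + C"
proof -
  define f :: "nat \<Rightarrow> real" where "f p = ln (real p) / real p" for p
  obtain C0 where C0: "\<And>y. y \<ge> 2 \<Longrightarrow> (\<Sum>p | prime p \<and> p \<le> y. f p) \<le> ln (real y) + C0"
    unfolding f_def using mertens_prime_upper by blast
  have q2: "2 * N \<ge> 2" using N by simp
  obtain C1 where C1: "\<And>y. y \<ge> 1 \<Longrightarrow> ln (real y) / real dK - C1 \<le> (\<Sum>p | prime p \<and> [p = 1] (mod (2 * N)) \<and> p \<le> y. f p)"
    unfolding f_def dK using primes_cong_1_lower[OF q2] by blast
  define S where "S = {p. prime p \<and> [p = 1] (mod (2 * N)) \<and> \<not> int p dvd int g \<and> (\<exists>r. [r ^ N = int g] (mod int p))}"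
  obtain B where B: "\<And>p r. prime p \<Longrightarrow> p > B \<Longrightarrow> [p = 1] (mod (2 * N)) \<Longrightarrow> \<not> int p dvd int g \<Longrightarrow> [r ^ N = int g] (mod int p) \<Longrightarrow>
    (\<exists>D f. \<not> int p dvd D \<and> of_int D * ((\<zeta> + of_int c * \<gamma>) ^ p - (\<zeta> + of_int c * \<gamma>)) = of_nat p * ipoly f (\<zeta> + of_int c * \<gamma>))"
    using frobenius_fixes_radical_sum[OF HL L \<zeta> \<gamma> dvd_triv_right] by blast
  have "\<exists>C. \<forall>y\<ge>2. (\<Sum>p | p \<in> S \<and> p \<le> y. ln (real p) / real p) \<le> ln (real y) / real (degree HL) + C"
  proof (rule frobenius_fixed_primes_upper[OF HL, of S B], intro conjI impI)
    fix p assume "p \<in> S"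
    then obtain r where p: "prime p" "[p = 1] (mod (2 * N))" "\<not> int p dvd int g" "[r ^ N = int g] (mod int p)"
      unfolding S_def by blast
    show "prime p" by (rule p(1))
    assume "p > B"
    then show "\<exists>D f. \<not> int p dvd D \<and> of_int D * ((\<zeta> + of_int c * \<gamma>) ^ p - (\<zeta> + of_int c * \<gamma>)) = of_nat p * ipoly f (\<zeta> + of_int c * \<gamma>)"
      by (rule B[OF p(1) _ p(2-4)])
  qed
  then obtain C2 where C2: "\<And>y. y \<ge> 2 \<Longrightarrow> (\<Sum>p | p \<in> S \<and> p \<le> y. f p) \<le> ln (real y) / real (degree HL) + C2"
    unfolding f_def by blast
  define W where "W = (\<Sum>p\<in>{1..g}. f p)"
  show ?thesis
  proof (intro exI allI impI)
    fix y :: nat assume y: "y \<ge> 2"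
    define F where "F = {p. prime p \<and> p \<le> y}"
    have finF: "finite F" unfolding F_def by (rule finite_subset[of _ "{..y}"]) auto
    have f0: "f p \<ge> 0" for p unfolding f_def by (cases "p = 0") simp_all
    have filt: "(\<Sum>p\<in>{p\<in>F. R p}. f p) = (\<Sum>p\<in>F. if R p then f p else 0)" for R by (rule sum.inter_filter[OF finF])
    let ?P = "obstructing_primes N g"
    have main: "(\<Sum>p\<in>F. if p \<in> - ?P then f p else 0) + (\<Sum>p\<in>F. if [p = 1] (mod (2 * N)) then f p else 0)
        \<le> (\<Sum>p\<in>F. f p) + (\<Sum>p\<in>F. if p \<in> S then f p else 0) + (\<Sum>p\<in>F. if int p dvd int g then f p else 0)"
      unfolding sum.distrib[symmetric]
    proof (rule sum_mono)
      fix p assume "p \<in> F"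
      then have pr: "prime p" by (simp add: F_def)
      show "(if p \<in> - ?P then f p else 0) + (if [p = 1] (mod (2 * N)) then f p else 0)
        \<le> f p + (if p \<in> S then f p else 0) + (if int p dvd int g then f p else 0)"
        using pr f0[of p] by (simp add: obstructing_primes_def S_def)
    qed
    have eqs: "{p\<in>F. p \<in> - ?P} = {p. prime p \<and> p \<in> - ?P \<and> p \<le> y}" "{p\<in>F. [p = 1] (mod (2 * N))} = {p. prime p \<and> [p = 1] (mod (2 * N)) \<and> p \<le> y}"
      "{p\<in>F. p \<in> S} = {p. p \<in> S \<and> p \<le> y}" by (auto simp: F_def S_def)
    have W: "(\<Sum>p\<in>{p\<in>F. int p dvd int g}. f p) \<le> W" unfolding W_def
    proof (rule sum_mono2)
      show "{p\<in>F. int p dvd int g} \<subseteq> {1..g}"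
      proof
        fix p assume "p \<in> {p\<in>F. int p dvd int g}"
        then have "prime p" "p dvd g" by (simp_all add: F_def)
        then show "p \<in> {1..g}" using g dvd_imp_le[of p g] prime_gt_0_nat[of p] by simp
      qed
    qed (simp_all add: f0)
    have "(\<Sum>p | prime p \<and> p \<in> - ?P \<and> p \<le> y. f p) + (\<Sum>p | prime p \<and> [p = 1] (mod (2 * N)) \<and> p \<le> y. f p)
        \<le> (\<Sum>p | prime p \<and> p \<le> y. f p) + (\<Sum>p | p \<in> S \<and> p \<le> y. f p) + W"
      using main W unfolding filt[symmetric] unfolding eqs unfolding F_def[symmetric] by linarith
    then have "(\<Sum>p | prime p \<and> p \<in> - ?P \<and> p \<le> y. f p) \<le> ln (real y) + C0 + (ln (real y) / real (degree HL) + C2) + W - (ln (real y) / real dK - C1)"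
      using C0[OF y] C1[of y] C2[OF y] y by linarith
    also have "\<dots> = (1 - (1 / real dK - 1 / real (degree HL))) * ln (real y) + (C0 + C1 + C2 + W)"
      by (simp add: algebra_simps)
    finally show "(\<Sum>p | prime p \<and> p \<in> - ?P \<and> p \<le> y. ln (real p) / real p)
      \<le> (1 - (1 / real dK - 1 / real (degree HL))) * ln (real y) + (C0 + C1 + C2 + W)" unfolding f_def .
  qed
qed

text \<open>
  For \<open>x \<ge> 4\<close> the integer part of \<open>x\<close> is at least the square root of \<open>x\<close>, so its logarithm is at least half of \<open>ln x\<close>.
\<close>
lemma bigo_of_sqfree_over_bound:
  assumes le: "\<And>x. h x \<le> 2 * card (sqfree_over Q (nat \<lfloor>x\<rfloor>))"
    and B: "\<And>n. n \<ge> 2 \<Longrightarrow> real (card (sqfree_over Q n)) \<le> B * real n * ln (real n) powr (- \<delta>)" and \<delta>: "\<delta> \<ge> 0"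
  shows "(\<lambda>x :: real. real (h x)) \<in> O[at_top](\<lambda>x. x / ln x powr \<delta>)"
proof (rule bigoI)
  show "eventually (\<lambda>x. norm (real (h x)) \<le> (2 * \<bar>B\<bar> * 2 powr \<delta>) * norm (x / ln x powr \<delta>)) at_top"
  proof (rule eventually_at_top_linorderI[of 4])
    fix x :: real assume x: "x \<ge> 4"
    define n where "n = nat \<lfloor>x\<rfloor>"
    have n: "real n \<le> x" "real n \<ge> x - 1" using x by (simp_all add: n_def)
    have n2: "n \<ge> 2" using n x by linarith
    have "4 * x \<le> x * x" using x by (intro mult_right_mono) auto
    moreover have "(x - 1)\<^sup>2 = x * x - 2 * x + 1" by (simp add: power2_eq_square algebra_simps)
    ultimately have "x \<le> (x - 1)\<^sup>2" using x by linarith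
    also have "\<dots> \<le> (real n)\<^sup>2" using n x by (intro power_mono) auto
    finally have "ln x \<le> ln ((real n)\<^sup>2)" using x n2 by (subst ln_le_cancel_iff) auto
    then have lnn: "ln x / 2 \<le> ln (real n)" using n2 by (simp add: ln_realpow)
    have lx: "ln x > 0" using x by simp
    have "ln (real n) powr (- \<delta>) \<le> (ln x / 2) powr (- \<delta>)" using lnn lx \<delta> by (intro powr_mono2') auto
    also have "(ln x / 2) powr (- \<delta>) = inverse ((ln x / 2) powr \<delta>)" by (rule powr_minus)
    also have "(ln x / 2) powr \<delta> = ln x powr \<delta> / 2 powr \<delta>" by (rule powr_divide)
    also have "inverse (ln x powr \<delta> / 2 powr \<delta>) = 2 powr \<delta> / ln x powr \<delta>" by (rule inverse_divide)
    finally have pw: "ln (real n) powr (- \<delta>) \<le> 2 powr \<delta> / ln x powr \<delta>" .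
    have "real (h x) \<le> real (2 * card (sqfree_over Q n))" using le[of x] unfolding n_def by (simp only: of_nat_le_iff)
    also have "\<dots> = 2 * real (card (sqfree_over Q n))" by simp
    also have "\<dots> \<le> 2 * (B * real n * ln (real n) powr (- \<delta>))" using B[OF n2] by simp
    also have "\<dots> \<le> 2 * (\<bar>B\<bar> * x * (2 powr \<delta> / ln x powr \<delta>))"
    proof -
      have le1: "B * real n \<le> \<bar>B\<bar> * x" using n by (intro mult_mono) auto
      have nn: "0 \<le> \<bar>B\<bar> * x" using x by simp
      have "B * real n * ln (real n) powr (- \<delta>) \<le> \<bar>B\<bar> * x * (2 powr \<delta> / ln x powr \<delta>)"
        by (rule mult_mono[OF le1 pw nn powr_ge_zero])
      then show ?thesis by simp
    qed
    also have "\<dots> = (2 * \<bar>B\<bar> * 2 powr \<delta>) * (x / ln x powr \<delta>)" by simp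
    finally show "norm (real (h x)) \<le> (2 * \<bar>B\<bar> * 2 powr \<delta>) * norm (x / ln x powr \<delta>)" using x by simp
  qed
qed

lemma bigo_weaken_exponent:
  fixes h :: "real \<Rightarrow> real"
  assumes h: "h \<in> O[at_top](\<lambda>x. x / ln x powr \<delta>)" and le: "\<delta>' \<le> \<delta>"
  shows "h \<in> O[at_top](\<lambda>x. x / ln x powr \<delta>')"
proof (rule landau_o.big_trans[OF h bigoI[where c = 1]])
  show "eventually (\<lambda>x :: real. norm (x / ln x powr \<delta>) \<le> 1 * norm (x / ln x powr \<delta>')) at_top"
  proof (rule eventually_at_top_linorderI[of "exp 1"])
    fix x :: real assume x: "x \<ge> exp 1"
    then have x0: "x > 0" using exp_gt_zero less_le_trans by blast
    then have "ln x \<ge> 1" using x by (simp add: ln_ge_iff)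
    then have "ln x powr \<delta>' \<le> ln x powr \<delta>" using le by (intro powr_mono) auto
    moreover have "ln x powr \<delta>' > 0" using \<open>ln x \<ge> 1\<close> by simp
    ultimately have "x / ln x powr \<delta> \<le> x / ln x powr \<delta>'" using x0 by (intro divide_left_mono) auto
    then show "norm (x / ln x powr \<delta>) \<le> 1 * norm (x / ln x powr \<delta>')" using x0 by simp
  qed
qed

theorem proposition6p1:
  fixes n g N :: nat and K L :: "complex set" and \<delta> :: real
  assumes "n \<ge> 4"
    and "N = n * (n - 1) div 2"
    and "g \<ge> 2"
    and "K = adjoin {cis (2 * pi / real (2 * N))}"
    and "L = adjoin {cis (2 * pi / real (2 * N)), complex_of_real (root N (real g))}"
    and "K \<subset> L"
    and "\<delta> = 1 / real (ext_degree \<rat> K) - 1 / real (ext_degree \<rat> L)"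
  shows "\<delta> > 0 \<and>
    (\<lambda>x :: real. real (card (pure_field_params n g x))) \<in> O[at_top](\<lambda>x. x / ln x powr \<delta>) \<and>
    \<delta> = (real (ext_degree K L) - 1) / (real (ext_degree K L) * real (ext_degree \<rat> K)) \<and>
    \<delta> \<ge> 1 / (2 * real (totient (2 * N))) \<and>
    (\<lambda>x :: real. real (card (pure_field_params n g x)))
      \<in> O[at_top](\<lambda>x. x / ln x powr (1 / (2 * real (totient (2 * N)))))"
proof -
  have "4 * 3 \<le> n * (n - 1)" using assms(1) by (intro mult_le_mono) auto
  then have N: "N > 0" unfolding assms(2) by simp
  have n0: "n > 0" and g0: "g > 0" using assms(1,3) by simp_all
  define \<zeta> where "\<zeta> = cis (2 * pi / real (2 * N))"
  define \<gamma> where "\<gamma> = complex_of_real (root N (real g))"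
  have \<zeta>: "\<zeta> ^ (2 * N) = 1" using N by (simp only: \<zeta>_def DeMoivre) simp
  have "\<gamma> ^ N = complex_of_real (root N (real g) ^ N)" by (simp add: \<gamma>_def)
  also have "root N (real g) ^ N = real g" using N by (simp add: real_root_pow_pos2)
  finally have \<gamma>: "\<gamma> ^ N = of_int (int g)" by simp
  have \<gamma>0: "\<gamma> \<noteq> 0" using N g0 by (simp add: \<gamma>_def)
  have q0: "2 * N > 0" using N by simp
  obtain c :: int where c: "adjoin {\<zeta>, \<gamma>} = adjoin {\<zeta> + of_int c * \<gamma>}"
    using primitive_element_radical[OF \<zeta> \<gamma> \<gamma>0 N q0] by blast
  have a\<zeta>: "algebraic_int \<zeta>" by (rule algebraic_int_radical[of _ "2 * N" 1]) (use \<zeta> N in simp_all)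
  have a\<gamma>: "algebraic_int \<gamma>" by (rule algebraic_int_radical[OF \<gamma> N])
  have "algebraic_int (\<zeta> + of_int c * \<gamma>)"
    by (intro algebraic_int_plus_times a\<zeta> a\<gamma> int_imp_algebraic_int) simp
  then obtain HL where HL: "min_int_poly_of HL (\<zeta> + of_int c * \<gamma>)" using min_int_poly_of_exists by blast
  obtain HK where HK: "min_int_poly_of HK \<zeta>" using min_int_poly_of_exists[OF a\<zeta>] by blast
  have K: "K = adjoin {\<zeta>}" and L: "L = adjoin {\<zeta> + of_int c * \<gamma>}" using assms(4,5) c by (simp_all add: \<zeta>_def \<gamma>_def)
  define dK dL e where "dK = ext_degree \<rat> K" and "dL = ext_degree \<rat> L" and "e = ext_degree K L"
  have dK: "dK = degree HK" and dL: "dL = degree HL" unfolding dK_def dL_def K L by (rule ext_degree_adjoin[OF HK], rule ext_degree_adjoin[OF HL])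
  have "2 * N \<ge> 2" using N by simp
  then have dKt: "dK = totient (2 * N)" unfolding dK using degree_cyclotomic[of "2 * N" HK] HK by (simp only: \<zeta>_def)
  have dK0: "dK > 0" unfolding dK by (rule min_int_poly_of_degree_pos[OF HK])
  have sub: "adjoin {\<zeta>} \<subset> adjoin {\<zeta> + of_int c * \<gamma>}" using assms(6) by (simp only: K L)
  have tower: "dL = dK * e" "e \<ge> 2" unfolding dL_def dK_def e_def K L
    by (rule ext_degree_tower[OF dimension_adjoin[OF HL] dimension_adjoin[OF HK] sub])+
  have \<delta>: "\<delta> = 1 / real dK - 1 / real dL" using assms(7) by (simp only: dK_def dL_def)
  have \<delta>e: "\<delta> = (real e - 1) / (real e * real dK)" unfolding \<delta> tower(1) using dK0 tower(2) by (simp add: field_simps)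
  have \<delta>0: "\<delta> > 0" unfolding \<delta>e using tower(2) dK0 by simp
  have "(real e - 1) / (real e * real dK) - 1 / (2 * real dK) = (real e - 2) / (2 * real e * real dK)"
    using tower(2) dK0 by (simp add: field_simps)
  moreover have "(real e - 2) / (2 * real e * real dK) \<ge> 0" using tower(2) by simp
  ultimately have \<delta>ge: "\<delta> \<ge> 1 / (2 * real (totient (2 * N)))" unfolding \<delta>e dKt[symmetric] by linarith
  have "1 / real dK \<le> 1" "1 / real dL \<ge> 0" using dK0 by (simp_all add: divide_le_eq_1)
  then have "\<delta> \<le> 1" unfolding \<delta> by linarith
  obtain C where C: "\<And>y. y \<ge> 2 \<Longrightarrow> (\<Sum>p | prime p \<and> p \<in> - obstructing_primes N g \<and> p \<le> y. ln (real p) / real p) \<le> (1 - \<delta>) * ln (real y) + C"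
    using nonobstructing_primes_upper[OF N g0 dKt HL c \<zeta> \<gamma>] unfolding \<delta> dL by blast
  have "1 - \<delta> \<ge> 0" using \<open>\<delta> \<le> 1\<close> by simp
  then obtain B where B: "\<And>k. k \<ge> 2 \<Longrightarrow> real (card (sqfree_over (- obstructing_primes N g) k)) \<le> B * real k * ln (real k) powr (1 - \<delta> - 1)"
    using card_sqfree_over_upper_bound[OF _ C] by blast
  have big: "(\<lambda>x :: real. real (card (pure_field_params n g x))) \<in> O[at_top](\<lambda>x. x / ln x powr \<delta>)"
  proof (rule bigo_of_sqfree_over_bound[where Q = "- obstructing_primes N g" and B = B])
    show "card (pure_field_params n g x) \<le> 2 * card (sqfree_over (- obstructing_primes N g) (nat \<lfloor>x\<rfloor>))" for x
      by (rule card_pure_field_params_le[OF n0 assms(2) N g0])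
    show "real (card (sqfree_over (- obstructing_primes N g) k)) \<le> B * real k * ln (real k) powr (- \<delta>)" if "k \<ge> 2" for k
      using B[OF that] by simp
    show "\<delta> \<ge> 0" using \<delta>0 by simp
  qed
  show ?thesis
    using \<delta>0 big \<delta>e \<delta>ge bigo_weaken_exponent[OF big \<delta>ge] by (simp only: dK_def e_def)
qed

end
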